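(* Let $m\ge 2$, let $(S,\mathcal S)$ be a measurable space, let $h\colon S^m\to\mathbb R$ be a symmetric (measurable) kernel and let $(X_i)_{i\in\mathbb Z}$ be a strictly stationary sequence of $S$-valued random variables. Let $h_1\colon S\to\mathbb R$ be defined by $$h_1(x)=\int h(x,y_1,\dots,y_{m-1})\,d\mathbb P_{X_0}(y_1)\cdots d\mathbb P_{X_0}(y_{m-1}),\quad x\in S.$$ Suppose that the following three conditions hold: $$\sum_{k=1}^{\infty}\int_0^{\alpha(\sigma(X_i,\,i\le 0),\,\sigma(X_k))}Q^2_{h_1(X_0)}(u)\,du<\infty;$$ the family $\{H_{\boldsymbol i,k}^2 : k\in\{1,\dots,m\},\ \boldsymbol i\in\operatorname{Inc}^k\}$ is uniformly integrable; and $$\sum_{k=1}^{+\infty}k\,\beta(k)<+\infty.$$ Then, as $n\to+\infty$, the following convergence in distribution takes place: $$\frac{\sqrt n}{\binom nm}\bigl(U_{m,n}(h)-\mathbb E[U_{m,n}(h)]\bigr)\to m\sigma\mathcal N,$$ where $\mathcal N$ has a standard normal distribution and $\sigma\geq 0$ is given by $\sigma^2=\sum_{i\in\mathbb Z}\operatorname{Cov}(h_1(X_0),h_1(X_i))$.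
   Context: For integers $k,n\ge1$, $\operatorname{Inc}^k_n=\{\boldsymbol i=(i_1,\dots,i_k): 1\le i_1<\dots<i_k\le n\}$ and $\operatorname{Inc}^k=\bigcup_{n\ge k}\operatorname{Inc}^k_n$ (integer tuples). For $\boldsymbol i=(i_1,\dots,i_m)$, $X_{\boldsymbol i}=(X_{i_1},\dots,X_{i_m})$, and the $U$-statistic is $U_{m,n}(h)=\sum_{\boldsymbol i\in\operatorname{Inc}^m_n}h(X_{\boldsymbol i})$. A kernel $h$ is symmetric if $h(x_{\tau(1)},\dots,x_{\tau(m)})=h(x_1,\dots,x_m)$ for every permutation $\tau$ of $\{1,\dots,m\}$ and all $x_1,\dots,x_m\in S$. $\mathbb P_{X_0}$ is the law of $X_0$. For a real random variable $Y$, $Q_Y(u)=\inf\{t>0:\mathbb P(|Y|>t)\le u\}$. Let $(X_1^*,\dots,X_{m-1}^* )$ be a vector independent of $(X_i)_{i\in\mathbb Z}$ consisting of i.i.d. random variables with the same distribution as $X_0$. For $k\in\{1,\dots,m-1\}$ and $\boldsymbol i\in\operatorname{Inc}^k$, $H_{\boldsymbol i,k}:=h(X_{i_1},\dots,X_{i_k},X_1^*,\dots,X_{m-k}^* )$; for $\boldsymbol i\in\operatorname{Inc}^m$, $H_{\boldsymbol i,m}:=h(X_{i_1},\dots,X_{i_m})$. For sub-$\sigma$-algebras $\mathcal A,\mathcal B$ of the underlying probability space $(\Omega,\mathcal F,\mathbb P)$, $\alpha(\mathcal A,\mathcal B)=\sup\{|\mathbb P(A\cap B)-\mathbb P(A)\mathbb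 P(B)|:A\in\mathcal A,B\in\mathcal B\}$ and $\beta(\mathcal A,\mathcal B)=\frac12\sup\sum_{i=1}^I\sum_{j=1}^J|\mathbb P(A_i\cap B_j)-\mathbb P(A_i)\mathbb P(B_j)|$, the supremum being over all finite partitions $(A_i)_{i=1}^I$ and $(B_j)_{j=1}^J$ of $\Omega$ into elements of $\mathcal A$ and $\mathcal B$ respectively. For $k\ge1$, $\beta(k)=\sup_{\ell\ge1}\beta(\mathcal F_1^\ell,\mathcal F_{\ell+k}^\infty)$, where $\mathcal F_u^v$ is the $\sigma$-algebra generated by $X_i$, $u\le i\le v$ ($i\ge u$ when $v=\infty$). *)

theory Defs
  imports "HOL-Probability.Probability"
begin

text \<open>
  A tuple indexed by \<open>{1..k}\<close> is a function that is \<open>undefined\<close> outside \<open>{1..k}\<close>; accordingly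
  \<open>S\<^sup>m\<close> is the product measurable space \<open>\<Pi>\<^sub>M j\<in>{1..m}. S\<close>, and a kernel is a function on such tuples.
\<close>

definition Inc_upto :: "nat \<Rightarrow> nat \<Rightarrow> (nat \<Rightarrow> int) set" where
  "Inc_upto k n = {i \<in> {1..k} \<rightarrow>\<^sub>E {1..int n}. strict_mono_on {1..k} i}"

definition Inc :: "nat \<Rightarrow> (nat \<Rightarrow> int) set" where
  "Inc k = (\<Union>n\<in>{k..}. Inc_upto k n)"

definition symmetric_kernel :: "'s measure \<Rightarrow> nat \<Rightarrow> ((nat \<Rightarrow> 's) \<Rightarrow> real) \<Rightarrow> bool" where
  "symmetric_kernel S m h \<longleftrightarrow>
     (\<forall>\<tau>. \<tau> permutes {1..m} \<longrightarrow>
        (\<forall>x \<in> space (\<Pi>\<^sub>M j\<in>{1..m}. S). h (\<lambda>j\<in>{1..m}. x (\<tau> j)) = h x))"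

definition strictly_stationary :: "'a measure \<Rightarrow> 's measure \<Rightarrow> (int \<Rightarrow> 'a \<Rightarrow> 's) \<Rightarrow> bool" where
  "strictly_stationary M S X \<longleftrightarrow>
     (\<forall>i. X i \<in> measurable M S) \<and>
     (\<forall>t::int. distr M (\<Pi>\<^sub>M i\<in>(UNIV :: int set). S) (\<lambda>\<omega> i. X (i + t) \<omega>) =
               distr M (\<Pi>\<^sub>M i\<in>(UNIV :: int set). S) (\<lambda>\<omega> i. X i \<omega>))"

definition U_stat :: "nat \<Rightarrow> nat \<Rightarrow> ((nat \<Rightarrow> 's) \<Rightarrow> real) \<Rightarrow> (int \<Rightarrow> 'a \<Rightarrow> 's) \<Rightarrow> 'a \<Rightarrow> real" where
  "U_stat m n h X \<omega> = (\<Sum>i\<in>Inc_upto m n. h (\<lambda>j\<in>{1..m}. X (i j) \<omega>))"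

text \<open>
  The function \<open>h\<^sub>1\<close>, for \<open>\<mu>\<close> the law of \<open>X\<^sub>0\<close>. Being a Bochner integral, it takes the value 0 at
  those \<open>x\<close> for which the integral does not exist.
\<close>

definition first_projection :: "'s measure \<Rightarrow> nat \<Rightarrow> ((nat \<Rightarrow> 's) \<Rightarrow> real) \<Rightarrow> 's \<Rightarrow> real" where
  "first_projection \<mu> m h x =
     (\<integral>y. h (\<lambda>j\<in>{1..m}. if j = 1 then x else y (j - 1)) \<partial>(\<Pi>\<^sub>M j\<in>{1..m-1}. \<mu>))"

text \<open>
  The random variable \<open>H\<^bsub>i,k\<^esub>\<close>, with \<open>Xs\<close> the independent vector \<open>X\<^sup>*\<close>. For \<open>k = m\<close> the vector \<open>Xs\<close>
  does not occur.
\<close>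

definition H_var :: "nat \<Rightarrow> ((nat \<Rightarrow> 's) \<Rightarrow> real) \<Rightarrow> (int \<Rightarrow> 'a \<Rightarrow> 's) \<Rightarrow> (nat \<Rightarrow> 'a \<Rightarrow> 's) \<Rightarrow>
    nat \<Rightarrow> (nat \<Rightarrow> int) \<Rightarrow> 'a \<Rightarrow> real" where
  "H_var m h X Xs k i \<omega> = h (\<lambda>j\<in>{1..m}. if j \<le> k then X (i j) \<omega> else Xs (j - k) \<omega>)"

text \<open>
  The infimum is taken in \<^typ>\<open>ennreal\<close>, so that it is \<open>\<infinity>\<close> when no \<open>t\<close> qualifies (possible only at
  \<open>u = 0\<close>, for essentially unbounded \<open>Y\<close>).
\<close>

definition upper_quantile :: "'a measure \<Rightarrow> ('a \<Rightarrow> real) \<Rightarrow> real \<Rightarrow> ennreal" where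
  "upper_quantile M Y u = (INF t\<in>{t. 0 < t \<and> measure M {\<omega>\<in>space M. \<bar>Y \<omega>\<bar> > t} \<le> u}. ennreal t)"

definition uniformly_integrable :: "'a measure \<Rightarrow> 'i set \<Rightarrow> ('i \<Rightarrow> 'a \<Rightarrow> real) \<Rightarrow> bool" where
  "uniformly_integrable M I Y \<longleftrightarrow>
     (\<forall>i\<in>I. Y i \<in> borel_measurable M) \<and>
     ((\<lambda>R::real. SUP i\<in>I. \<integral>\<^sup>+\<omega>\<in>{\<omega>. \<bar>Y i \<omega>\<bar> > R}. ennreal \<bar>Y i \<omega>\<bar> \<partial>M) \<longlongrightarrow> 0) at_top"

definition generated_algebra :: "'a measure \<Rightarrow> 's measure \<Rightarrow> (int \<Rightarrow> 'a \<Rightarrow> 's) \<Rightarrow> int set \<Rightarrow> 'a set set" where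
  "generated_algebra M S X I = sigma_sets (space M) (\<Union>i\<in>I. {X i -` A \<inter> space M |A. A \<in> sets S})"

definition alpha_coeff :: "'a measure \<Rightarrow> 'a set set \<Rightarrow> 'a set set \<Rightarrow> real" where
  "alpha_coeff M \<A> \<B> =
     (SUP (A, B)\<in>\<A> \<times> \<B>. \<bar>measure M (A \<inter> B) - measure M A * measure M B\<bar>)"

text \<open>
  Here \<^const>\<open>partition_on\<close> excludes empty blocks, which would contribute 0 to the sum.
\<close>

definition beta_coeff :: "'a measure \<Rightarrow> 'a set set \<Rightarrow> 'a set set \<Rightarrow> real" where
  "beta_coeff M \<A> \<B> = 1 / 2 *
     (SUP (P, Q)\<in>{P. finite P \<and> P \<subseteq> \<A> \<and> partition_on (space M) P} \<times>
                 {Q. finite Q \<and> Q \<subseteq> \<B> \<and> partition_on (space M) Q}.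
        \<Sum>A\<in>P. \<Sum>B\<in>Q. \<bar>measure M (A \<inter> B) - measure M A * measure M B\<bar>)"

definition beta_mixing :: "'a measure \<Rightarrow> 's measure \<Rightarrow> (int \<Rightarrow> 'a \<Rightarrow> 's) \<Rightarrow> nat \<Rightarrow> real" where
  "beta_mixing M S X k =
     (SUP l\<in>{1..}. beta_coeff M (generated_algebra M S X {1..l}) (generated_algebra M S X {l + int k..}))"

definition covariance :: "'a measure \<Rightarrow> ('a \<Rightarrow> real) \<Rightarrow> ('a \<Rightarrow> real) \<Rightarrow> real" where
  "covariance M Y Z =
     (\<integral>\<omega>. (Y \<omega> - (\<integral>\<omega>'. Y \<omega>' \<partial>M)) * (Z \<omega> - (\<integral>\<omega>'. Z \<omega>' \<partial>M)) \<partial>M)"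

end

theory Submission
  imports Defs "HOL-Real_Asymp.Real_Asymp"
begin

text \<open>
  Write the Hoeffding decomposition \<open>h(x) = \<theta> + \<Sum>\<^sub>l (h\<^sub>1(x\<^sub>l) - \<theta>) + r(x)\<close>, whose remainder \<open>r\<close> integrates to 0
  in each coordinate. Absolute regularity allows one to read the variables \<open>X\<^sub>i\<close> from independent
  copies of the process, a fresh copy for each cluster of indices, at a cost of order \<open>\<beta>(k)\<close> if
  distinct clusters are \<open>k\<close> apart. The second moment of the sum of \<open>r\<close> over all
  tuples is a sum over pairs of tuples, that is over \<open>2m\<close> indices. Order the pairs of
  indices by their distance and let \<open>k\<close> be the second smallest distance: cutting at distance \<open>k\<close>
  leaves at most one pair of indices together, and then degeneracy makes the decoupled expectation
  vanish. If the kernel is first truncated at \<open>\<surd>n\<close>, which by uniform integrability costs little in \<open>L\<^sup>1\<close>,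
  such a term is therefore \<open>O(n \<beta>(k))\<close>, and also \<open>O(1)\<close>, as used for small \<open>k\<close>. There are \<open>O(k n\<^sup>2\<^sup>m\<^sup>-\<^sup>2)\<close> of them,
  so that summability of \<open>k \<beta>(k)\<close> yields \<open>o(n\<^sup>2\<^sup>m\<^sup>-\<^sup>1)\<close> in total.

  This leaves the linear part \<open>m n\<^sup>-\<^sup>1\<^sup>/\<^sup>2 \<Sum>\<^sub>i (h\<^sub>1(X\<^sub>i) - \<theta>)\<close>. For bounded functions in place of \<open>h\<^sub>1\<close> the central limit
  theorem follows from Bernstein's blocks. In general \<open>h\<^sub>1\<close> is truncated: Rio's
  covariance inequality bounds the covariances at lag \<open>k\<close> of all truncations by one summable sequence, so the limit
  variances converge and the discarded parts have uniformly small variance.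
\<close>

section \<open>Decoupling under absolute regularity\<close>

text \<open>The level sqrt n is forced from both sides. Decoupling costs the squared sup norm of the
  kernel times \<beta>(k), so sqrt n is the largest order of a sup norm for which the far pairs stay
  within n^(2m-1). Conversely, the part of h that is cut off is at most h^2 / sqrt n; its mean is
  o(1 / sqrt n), which is just enough for n^m tuples under the normalization sqrt n / n^m. In L^2
  the same part would be multiplied by n. Truncation destroys degeneracy, so each truncated kernel
  is decomposed anew, with its own mean and projection. Cutting at the smallest distance would be
  too crude: about n^(2m-1) index choices have a given smallest distance, one power of n too many.
  One merged pair is harmless, because degeneracy is used in this form: with one coordinate frozen,
  the integral of the remainder over all the others vanishes. Wherever the merged pair lies, one of
  the two tuples keeps at least m-1 coordinates on copies that nothing else reads.\<close>

text \<open>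
  \<open>f\<close> is within \<open>1 / n\<close> of the average of the indicators of \<open>{f > j / n}\<close>, \<open>j < n\<close>.
\<close>

lemma functional_le_on_unit_functions:
  fixes L :: "('a \<Rightarrow> real) \<Rightarrow> real"
  assumes add: "\<And>f g b c. \<lbrakk>f \<in> borel_measurable N; g \<in> borel_measurable N;
        \<forall>x\<in>space N. \<bar>f x\<bar> \<le> b; \<forall>x\<in>space N. \<bar>g x\<bar> \<le> c\<rbrakk> \<Longrightarrow> L (\<lambda>x. f x + g x) = L f + L g"
    and scale: "\<And>f b c. \<lbrakk>f \<in> borel_measurable N; \<forall>x\<in>space N. \<bar>f x\<bar> \<le> b\<rbrakk> \<Longrightarrow> L (\<lambda>x. c * f x) = c * L f"
    and bound: "\<And>f b. \<lbrakk>f \<in> borel_measurable N; \<forall>x\<in>space N. \<bar>f x\<bar> \<le> b\<rbrakk> \<Longrightarrow> \<bar>L f\<bar> \<le> K * b"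
    and sets: "\<And>A. A \<in> sets N \<Longrightarrow> \<bar>L (indicator A)\<bar> \<le> a"
    and f: "f \<in> borel_measurable N" "\<And>x. x \<in> space N \<Longrightarrow> 0 \<le> f x \<and> f x \<le> 1"
  shows "\<bar>L f\<bar> \<le> a"
proof -
  note [measurable] = f(1)
  have main: "\<bar>L f\<bar> \<le> a + K * (1 / real n)" if n: "n > 0" for n
  proof -
    define A where "A j = {x\<in>space N. real j / real n \<le> f x}" for j
    have [measurable]: "A j \<in> sets N" for j
      unfolding A_def by measurable
    define s where "s J x = (\<Sum>j\<in>J. indicator (A j) x :: real)" for J x
    have s_meas: "s J \<in> borel_measurable N" for J
      unfolding s_def by measurable
    have s_bd: "\<bar>s J x\<bar> \<le> real (card J)" if "finite J" for J x
    proof -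
      have "\<bar>s J x\<bar> \<le> (\<Sum>j\<in>J. \<bar>indicator (A j) x :: real\<bar>)"
        unfolding s_def by (rule sum_abs)
      also have "\<dots> \<le> (\<Sum>j\<in>J. 1)" by (intro sum_mono) (auto simp: indicator_def)
      finally show ?thesis by simp
    qed
    have Ls: "\<bar>L (s J)\<bar> \<le> real (card J) * a" if "finite J" for J
      using that
    proof induction
      case empty
      have "\<bar>L (s {})\<bar> \<le> K * 0" by (rule bound[OF s_meas]) (auto simp: s_def)
      then show ?case by simp
    next
      case (insert j J)
      have "L (s (insert j J)) = L (\<lambda>x. indicator (A j) x + s J x)"
        using insert by (intro arg_cong[where f=L]) (auto simp: s_def)
      also have "\<dots> = L (indicator (A j)) + L (s J)"
        using s_meas s_bd insert by (intro add[where b=1 and c="real (card J)"]) (auto simp: indicator_def)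
      finally have "\<bar>L (s (insert j J))\<bar> \<le> a + real (card J) * a"
        using sets[of "A j"] insert(3) by simp
      then show ?case using insert by (simp add: algebra_simps)
    qed
    define g where "g x = (1 / real n) * s {1..n} x" for x
    \<comment> \<open>For fixed \<open>x\<close> the condition \<open>x \<in> A j\<close> reads
      \<open>j \<le> n * f x\<close>, so the sum counts the integers from 1 to the floor of
      \<open>n * f x\<close>.\<close>
    have s_floor: "s {1..n} x = of_int \<lfloor>real n * f x\<rfloor>" if x: "x \<in> space N" for x
    proof -
      have "s {1..n} x = real (card {j\<in>{1..n}. real j / real n \<le> f x})"
        using x unfolding s_def A_def by (simp add: indicator_def Int_def flip: sum.inter_filter)
      also have "{j\<in>{1..n}. real j / real n \<le> f x} = {1..nat \<lfloor>real n * f x\<rfloor>}"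
      proof -
        have "real j / real n \<le> f x \<longleftrightarrow> int j \<le> \<lfloor>real n * f x\<rfloor>" for j
          using n by (simp add: divide_le_eq le_floor_iff mult.commute)
        moreover have "\<lfloor>real n * f x\<rfloor> \<le> int n"
          using f(2)[OF x] n by (simp add: floor_le_iff) (smt (verit) mult_left_le of_nat_0_le_iff)
        moreover have "0 \<le> \<lfloor>real n * f x\<rfloor>" using f(2)[OF x] by simp
        ultimately show ?thesis by (intro set_eqI) (simp add: le_nat_iff, linarith?)
      qed
      finally show ?thesis using f(2)[OF x] by simp
    qed
    have diff: "\<bar>f x + (- 1) * g x\<bar> \<le> 1 / real n" if x: "x \<in> space N" for x
    proof -
      have "f x + (- 1) * g x = (real n * f x - of_int \<lfloor>real n * f x\<rfloor>) / real n"
        using n s_floor[OF x] unfolding g_def by (simp add: field_simps)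
      moreover have "\<bar>real n * f x - of_int \<lfloor>real n * f x\<rfloor>\<bar> \<le> 1" by linarith
      ultimately show ?thesis using n by (simp add: divide_right_mono abs_divide)
    qed
    have g_meas [measurable]: "g \<in> borel_measurable N"
      unfolding g_def using s_meas by measurable
    have g_bd: "\<bar>g x\<bar> \<le> 1" for x
      using s_bd[of "{1..n}" x] n unfolding g_def by (simp add: abs_mult divide_le_eq)
    have "L (\<lambda>x. (f x + (- 1) * g x) + g x) = L (\<lambda>x. f x + (- 1) * g x) + L g"
      using diff g_bd by (intro add[where b="1 / real n" and c=1]) auto
    then have "L f = L (\<lambda>x. f x + (- 1) * g x) + L g" by simp
    moreover have "\<bar>L (\<lambda>x. f x + (- 1) * g x)\<bar> \<le> K * (1 / real n)"
      using diff by (intro bound) auto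
    moreover have "L g = (1 / real n) * L (s {1..n})"
      unfolding g_def[abs_def] using s_meas s_bd[of "{1..n}"]
      by (intro scale[where b="real n"]) auto
    moreover have "\<bar>(1 / real n) * L (s {1..n})\<bar> \<le> a"
      using Ls[of "{1..n}"] n by (simp add: abs_mult divide_le_eq mult.commute)
    ultimately show ?thesis by linarith
  qed
  have "(\<lambda>n. a + K * (1 / real n)) \<longlonglongrightarrow> a + K * 0"
    by (intro tendsto_intros lim_1_over_n)
  moreover have "\<forall>\<^sub>F n in sequentially. \<bar>L f\<bar> \<le> a + K * (1 / real n)"
    using eventually_gt_at_top[of 0] by (rule eventually_mono) (rule main)
  ultimately show ?thesis
    by (intro tendsto_lowerbound[of _ "a" sequentially]) auto
qed

text \<open>Averaging over level sets transfers the bound from events to functions with values in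
  [0,1] without enlarging the constant. The factor \<open>K = 2\<close> enters only through the
  rounding error, which vanishes in the limit.\<close>

lemma integral_diff_le_of_sets:
  assumes P1: "prob_space P1" and P2: "prob_space P2" and eq: "sets P1 = sets P2"
    and diff: "\<And>A. A \<in> sets P1 \<Longrightarrow> \<bar>measure P1 A - measure P2 A\<bar> \<le> a"
    and f: "f \<in> borel_measurable P1" "\<And>x. x \<in> space P1 \<Longrightarrow> 0 \<le> f x \<and> f x \<le> 1"
  shows "\<bar>(\<integral>x. f x \<partial>P1) - (\<integral>x. f x \<partial>P2)\<bar> \<le> (a::real)"
proof -
  interpret P1: prob_space P1 by fact
  interpret P2: prob_space P2 by fact
  have sp: "space P2 = space P1" using eq by (metis sets_eq_imp_space_eq)
  have m: "g \<in> borel_measurable P1 \<longleftrightarrow> g \<in> borel_measurable P2" for g :: "_ \<Rightarrow> real"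
    using eq by (metis measurable_cong_sets)
  have i1: "integrable P1 g" if "g \<in> borel_measurable P1" "\<forall>x\<in>space P1. \<bar>g x\<bar> \<le> b" for g and b :: real
    using that by (intro P1.integrable_const_bound[where B=b]) auto
  have i2: "integrable P2 g" if "g \<in> borel_measurable P1" "\<forall>x\<in>space P1. \<bar>g x\<bar> \<le> b" for g and b :: real
    using that sp by (intro P2.integrable_const_bound[where B=b]) (auto simp: m[symmetric])
  have b1: "\<bar>\<integral>x. g x \<partial>P1\<bar> \<le> b" if "g \<in> borel_measurable P1" "\<forall>x\<in>space P1. \<bar>g x\<bar> \<le> b" for g and b :: real
  proof -
    have "\<bar>\<integral>x. g x \<partial>P1\<bar> \<le> (\<integral>x. \<bar>g x\<bar> \<partial>P1)" by (rule integral_abs_bound)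
    also have "\<dots> \<le> (\<integral>x. b \<partial>P1)"
      using that i1[OF that] by (intro integral_mono) auto
    finally show ?thesis by (simp add: P1.prob_space)
  qed
  have b2: "\<bar>\<integral>x. g x \<partial>P2\<bar> \<le> b" if "g \<in> borel_measurable P1" "\<forall>x\<in>space P1. \<bar>g x\<bar> \<le> b" for g and b :: real
  proof -
    have "\<bar>\<integral>x. g x \<partial>P2\<bar> \<le> (\<integral>x. \<bar>g x\<bar> \<partial>P2)" by (rule integral_abs_bound)
    also have "\<dots> \<le> (\<integral>x. b \<partial>P2)"
      using that i2[OF that] sp by (intro integral_mono) auto
    finally show ?thesis by (simp add: P2.prob_space)
  qed
  show ?thesis
  proof (rule functional_le_on_unit_functions[where N=P1 and K=2 and
        L="\<lambda>g. (\<integral>x. g x \<partial>P1) - (\<integral>x. g x \<partial>P2)"])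
    fix f g :: "'a \<Rightarrow> real" and b c
    assume fg: "f \<in> borel_measurable P1" "g \<in> borel_measurable P1"
      "\<forall>x\<in>space P1. \<bar>f x\<bar> \<le> b" "\<forall>x\<in>space P1. \<bar>g x\<bar> \<le> c"
    have "integrable P1 f" "integrable P1 g" "integrable P2 f" "integrable P2 g"
      by (rule i1 i2, fact, fact)+
    then show "(\<integral>x. f x + g x \<partial>P1) - (\<integral>x. f x + g x \<partial>P2) =
       (\<integral>x. f x \<partial>P1) - (\<integral>x. f x \<partial>P2) + ((\<integral>x. g x \<partial>P1) - (\<integral>x. g x \<partial>P2))"
      by simp
  next
    fix f :: "'a \<Rightarrow> real" and b assume "f \<in> borel_measurable P1" "\<forall>x\<in>space P1. \<bar>f x\<bar> \<le> b"
    then show "\<bar>(\<integral>x. f x \<partial>P1) - (\<integral>x. f x \<partial>P2)\<bar> \<le> 2 * b"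
      using b1 b2 by (smt (verit, best))
  next
    fix A assume A: "A \<in> sets P1"
    then have "A \<in> sets P2" using eq by auto
    moreover have "A \<inter> space P1 = A" using A sets.sets_into_space by blast
    ultimately show "\<bar>(\<integral>x. indicator A x \<partial>P1) - (\<integral>x. indicator A x \<partial>P2)\<bar> \<le> a"
      using diff[OF A] A sp by simp
  qed (use f in \<open>auto simp: right_diff_distrib\<close>)
qed

text \<open>One \<open>D\<close> has to approximate \<open>C\<close> under both measures at once,
  because it serves to compare them. The class of approximable sets is closed under complements,
  which leave the symmetric difference unchanged, and under disjoint countable unions.\<close>

lemma algebra_approximation:
  assumes "finite_measure P1" "finite_measure P2"
    and s1: "sets P1 = sigma_sets \<Omega> G" and s2: "sets P2 = sigma_sets \<Omega> G"
    and alg: "algebra \<Omega> G"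
    and C: "C \<in> sigma_sets \<Omega> G" and e: "0 < (e::real)"
  shows "\<exists>D\<in>G. measure P1 ((C - D) \<union> (D - C)) < e \<and> measure P2 ((C - D) \<union> (D - C)) < e"
proof -
  interpret P1: finite_measure P1 by fact
  interpret P2: finite_measure P2 by fact
  interpret algebra \<Omega> G by fact
  have sub: "G \<subseteq> Pow \<Omega>" by (rule space_closed)
  have Gs: "D \<in> sigma_sets \<Omega> G" if "D \<in> G" for D using that by auto
  have diffs: "(A - B) \<union> (B - A) \<in> sigma_sets \<Omega> G"
    if "A \<in> sigma_sets \<Omega> G" "B \<in> sigma_sets \<Omega> G" for A B
    using that s1 by (metis sets.Diff sets.Un)
  have "Int_stable G" by (auto simp: Int_stable_def)
  show ?thesis
    using \<open>Int_stable G\<close> sub C e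
  proof (induction arbitrary: e rule: sigma_sets_induct_disjoint)
    case (basic A)
    then show ?case by (intro bexI[of _ A]) auto
  next
    case empty
    then show ?case by (intro bexI[of _ "{}"]) auto
  next
    case (compl A)
    then obtain D where D: "D \<in> G" "measure P1 ((A - D) \<union> (D - A)) < e" "measure P2 ((A - D) \<union> (D - A)) < e"
      by blast
    have "A \<subseteq> \<Omega>" using compl sigma_sets_into_sp[OF sub] by blast
    moreover have "D \<subseteq> \<Omega>" using D sub by auto
    ultimately have eq: "((\<Omega> - A) - (\<Omega> - D)) \<union> ((\<Omega> - D) - (\<Omega> - A)) = (A - D) \<union> (D - A)" by blast
    show ?case using D by (intro bexI[of _ "\<Omega> - D"]) (auto simp: eq)
  next
    case (union A)
    note AS = union(2)[THEN subsetD, OF rangeI]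
    \<comment> \<open>The union is cut off at an \<open>n\<close> where the rest \<open>T n\<close>
      has mass below \<open>e / 2\<close> for both measures; the approximations of the first
      \<open>n\<close> sets share the other half of \<open>e\<close>.\<close>
    define T where "T n = (\<Union>i. A i) - (\<Union>i<n. A i)" for n
    have AU: "(\<Union>i. A i) \<in> sigma_sets \<Omega> G" using AS by (intro sigma_sets.Union) auto
    have "(\<Union>i<n. A i) \<in> sets P1" for n :: nat
      using AS s1 by (intro sets.finite_UN) auto
    then have AF: "(\<Union>i<n. A i) \<in> sigma_sets \<Omega> G" for n :: nat using s1 by simp
    have T_sets: "T n \<in> sigma_sets \<Omega> G" for n
      unfolding T_def using AU AF[of n] s1 by (metis sets.Diff)
    have T0: "(\<Inter>n. T n) = {}"
    proof -
      have False if "x \<in> A i" and "\<forall>n. x \<in> T n" for x i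
        using that(1) that(2)[rule_format, of "Suc i"] unfolding T_def by auto
      then show ?thesis unfolding T_def by blast
    qed
    have Tdec: "decseq T" unfolding decseq_def T_def by (force)
    have T1: "(\<lambda>n. measure P1 (T n)) \<longlonglongrightarrow> 0"
      using P1.finite_Lim_measure_decseq[of T] T_sets Tdec T0 s1 by (simp add: image_subset_iff)
    have T2: "(\<lambda>n. measure P2 (T n)) \<longlonglongrightarrow> 0"
      using P2.finite_Lim_measure_decseq[of T] T_sets Tdec T0 s2 by (simp add: image_subset_iff)
    have "\<forall>\<^sub>F n in sequentially. measure P1 (T n) < e / 2 \<and> measure P2 (T n) < e / 2"
      using order_tendstoD(2)[OF T1, of "e/2"] order_tendstoD(2)[OF T2, of "e/2"] union.prems
      by (auto simp: eventually_conj_iff)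
    then obtain n where n: "measure P1 (T n) < e / 2" "measure P2 (T n) < e / 2"
      by (auto simp: eventually_sequentially)
    \<comment> \<open>\<open>Suc n\<close> keeps the denominator positive for \<open>n = 0\<close>
      and makes \<open>n * d < e / 2\<close> strict.\<close>
    define d where "d = e / (2 * real (Suc n))"
    have d: "d > 0" using union.prems by (simp add: d_def)
    have "\<forall>i. \<exists>D\<in>G. measure P1 ((A i - D) \<union> (D - A i)) < d \<and> measure P2 ((A i - D) \<union> (D - A i)) < d"
      using union.IH[OF d] by blast
    then obtain D where D: "\<And>i. D i \<in> G" "\<And>i. measure P1 ((A i - D i) \<union> (D i - A i)) < d"
      "\<And>i. measure P2 ((A i - D i) \<union> (D i - A i)) < d" by metis
    define E where "E = (\<Union>i<n. D i)"
    have E: "E \<in> G" unfolding E_def using D(1) by (intro finite_UN) auto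
    define B where "B i = (A i - D i) \<union> (D i - A i)" for i
    have B: "B i \<in> sigma_sets \<Omega> G" for i
      unfolding B_def using AS Gs[OF D(1)] by (intro diffs) auto
    have sub2: "((\<Union>i. A i) - E) \<union> (E - (\<Union>i. A i)) \<subseteq> (\<Union>i<n. B i) \<union> T n"
      unfolding E_def B_def T_def by blast
    have "(\<Union>i<n. B i) \<in> sets P1"
      using B s1 by (intro sets.finite_UN) auto
    then have BU: "(\<Union>i<n. B i) \<in> sigma_sets \<Omega> G" using s1 by simp
    have BT: "(\<Union>i<n. B i) \<union> T n \<in> sets P1" "(\<Union>i<n. B i) \<union> T n \<in> sets P2"
      using BU T_sets[of n] s1 s2 by (metis sets.Un)+
    have nd: "real n * d < e / 2"
      using union.prems by (simp add: d_def field_simps)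
    have "measure P1 (((\<Union>i. A i) - E) \<union> (E - (\<Union>i. A i))) \<le> measure P1 ((\<Union>i<n. B i) \<union> T n)"
      using sub2 BT by (intro P1.finite_measure_mono)
    also have "\<dots> \<le> measure P1 (\<Union>i<n. B i) + measure P1 (T n)"
      using BU T_sets s1 by (intro measure_Un_le) auto
    also have "measure P1 (\<Union>i<n. B i) \<le> (\<Sum>i<n. measure P1 (B i))"
      using B s1 by (intro measure_UNION_le) auto
    also have "\<dots> \<le> (\<Sum>i<n. d)" using D by (intro sum_mono) (auto simp: B_def less_imp_le)
    finally have 1: "measure P1 (((\<Union>i. A i) - E) \<union> (E - (\<Union>i. A i))) < e" using n nd by simp
    have "measure P2 (((\<Union>i. A i) - E) \<union> (E - (\<Union>i. A i))) \<le> measure P2 ((\<Union>i<n. B i) \<union> T n)"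
      using sub2 BT by (intro P2.finite_measure_mono)
    also have "\<dots> \<le> measure P2 (\<Union>i<n. B i) + measure P2 (T n)"
      using BU T_sets s2 by (intro measure_Un_le) auto
    also have "measure P2 (\<Union>i<n. B i) \<le> (\<Sum>i<n. measure P2 (B i))"
      using B s2 by (intro measure_UNION_le) auto
    also have "\<dots> \<le> (\<Sum>i<n. d)" using D by (intro sum_mono) (auto simp: B_def less_imp_le)
    finally have 2: "measure P2 (((\<Union>i. A i) - E) \<union> (E - (\<Union>i. A i))) < e" using n nd by simp
    show ?case using E 1 2 by blast
  qed
qed

text \<open>The sigma-algebra of a product is reached in this way from finite unions of rectangles,
  the sets about which finite partitions give direct information.\<close>

lemma measure_diff_le_of_algebra:
  assumes P1: "finite_measure P1" and P2: "finite_measure P2"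
    and s1: "sets P1 = sigma_sets \<Omega> G" and s2: "sets P2 = sigma_sets \<Omega> G"
    and alg: "algebra \<Omega> G"
    and diff: "\<And>D. D \<in> G \<Longrightarrow> \<bar>measure P1 D - measure P2 D\<bar> \<le> a"
    and C: "C \<in> sets P1"
  shows "\<bar>measure P1 C - measure P2 C\<bar> \<le> a"
proof (rule field_le_epsilon)
  interpret P1: finite_measure P1 by fact
  interpret P2: finite_measure P2 by fact
  fix e :: real assume "0 < e"
  then have "0 < e / 2" by simp
  from algebra_approximation[OF P1 P2 s1 s2 alg C[unfolded s1] this] obtain D where
    D: "D \<in> G" "measure P1 ((C - D) \<union> (D - C)) < e / 2" "measure P2 ((C - D) \<union> (D - C)) < e / 2" by blast
  have DS: "D \<in> sets P1" "D \<in> sets P2" using D s1 s2 by auto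
  have CS: "C \<in> sets P2" using C s1 s2 by auto
  have "\<bar>measure P1 C - measure P1 D\<bar> \<le> measure P1 ((C - D) \<union> (D - C))"
  proof -
    have "measure P1 C \<le> measure P1 (D \<union> ((C - D) \<union> (D - C)))"
      using C DS by (intro P1.finite_measure_mono) auto
    also have "\<dots> \<le> measure P1 D + measure P1 ((C - D) \<union> (D - C))"
      using C DS by (intro measure_Un_le) auto
    finally have 1: "measure P1 C \<le> measure P1 D + measure P1 ((C - D) \<union> (D - C))" .
    have "measure P1 D \<le> measure P1 (C \<union> ((C - D) \<union> (D - C)))"
      using C DS by (intro P1.finite_measure_mono) auto
    also have "\<dots> \<le> measure P1 C + measure P1 ((C - D) \<union> (D - C))"
      using C DS by (intro measure_Un_le) auto
    finally show ?thesis using 1 by linarith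
  qed
  moreover have "\<bar>measure P2 C - measure P2 D\<bar> \<le> measure P2 ((C - D) \<union> (D - C))"
  proof -
    have "measure P2 C \<le> measure P2 (D \<union> ((C - D) \<union> (D - C)))"
      using CS DS by (intro P2.finite_measure_mono) auto
    also have "\<dots> \<le> measure P2 D + measure P2 ((C - D) \<union> (D - C))"
      using CS DS by (intro measure_Un_le) auto
    finally have 1: "measure P2 C \<le> measure P2 D + measure P2 ((C - D) \<union> (D - C))" .
    have "measure P2 D \<le> measure P2 (C \<union> ((C - D) \<union> (D - C)))"
      using CS DS by (intro P2.finite_measure_mono) auto
    also have "\<dots> \<le> measure P2 C + measure P2 ((C - D) \<union> (D - C))"
      using CS DS by (intro measure_Un_le) auto
    finally show ?thesis using 1 by linarith
  qed
  ultimately show "\<bar>measure P1 C - measure P2 C\<bar> \<le> a + e"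
    using diff[OF D(1)] D by linarith
qed

text \<open>\<open>d\<close> bounds the sums over pairs of finite partitions that define the \<beta>
  coefficient, without its factor 1/2. A set that depends on finitely many values of each argument
  is a union of cells of such a pair, so on it the joint law and the product of the marginals differ
  by at most \<open>d\<close>. Approximation extends this to all measurable sets.\<close>

lemma (in prob_space) decoupling_pair:
  fixes U :: "'a \<Rightarrow> 'b" and V :: "'a \<Rightarrow> 'c"
  assumes U [measurable]: "U \<in> measurable M A" and V [measurable]: "V \<in> measurable M B"
    and part: "\<And>P Q. \<lbrakk>finite P; finite Q; partition_on (space M) P; partition_on (space M) Q;
        P \<subseteq> {U -` E \<inter> space M |E. E \<in> sets A}; Q \<subseteq> {V -` E \<inter> space M |E. E \<in> sets B}\<rbrakk>
        \<Longrightarrow> (\<Sum>a\<in>P. \<Sum>b\<in>Q. \<bar>measure M (a \<inter> b) - measure M a * measure M b\<bar>) \<le> d"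
    and \<Phi> [measurable]: "\<Phi> \<in> borel_measurable (A \<Otimes>\<^sub>M B)"
    and \<Phi>01: "\<And>z. z \<in> space (A \<Otimes>\<^sub>M B) \<Longrightarrow> 0 \<le> \<Phi> z \<and> \<Phi> z \<le> 1"
  shows "\<bar>(\<integral>\<omega>. \<Phi> (U \<omega>, V \<omega>) \<partial>M) - (\<integral>\<omega>'. (\<integral>\<omega>. \<Phi> (U \<omega>, V \<omega>') \<partial>M) \<partial>M)\<bar> \<le> (d::real)"
proof -
  define P1 where "P1 = distr M (A \<Otimes>\<^sub>M B) (\<lambda>\<omega>. (U \<omega>, V \<omega>))"
  interpret MU: prob_space "distr M A U" by (rule prob_space_distr) fact
  interpret MV: prob_space "distr M B V" by (rule prob_space_distr) fact
  interpret UV: pair_prob_space "distr M A U" "distr M B V" by unfold_locales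
  define P2 where "P2 = distr M A U \<Otimes>\<^sub>M distr M B V"
  have ps1: "prob_space P1" unfolding P1_def by (rule prob_space_distr) measurable
  have ps2: "prob_space P2" unfolding P2_def by unfold_locales
  interpret P1: prob_space P1 by fact
  interpret P2: prob_space P2 by fact
  have s1: "sets P1 = sets (A \<Otimes>\<^sub>M B)" by (simp add: P1_def)
  have s2: "sets P2 = sets (A \<Otimes>\<^sub>M B)" unfolding P2_def by (intro sets_pair_measure_cong) auto
  define \<Omega> where "\<Omega> = space A \<times> space B"
  have sp: "space (A \<Otimes>\<^sub>M B) = \<Omega>" by (simp add: \<Omega>_def space_pair_measure)
  \<comment> \<open>This is the algebra of finite unions of measurable rectangles. Encoding a member
    by two finitely valued labellings and a relation \<open>R\<close> makes complements immediate
    (complement \<open>R\<close>) and reduces unions to a common refinement by pairing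
    labels.\<close>
  define G where "G = {C. \<exists>(f::'b \<Rightarrow> nat) (g::'c \<Rightarrow> nat) R. f \<in> measurable A (count_space UNIV) \<and>
      g \<in> measurable B (count_space UNIV) \<and> finite (f ` space A) \<and> finite (g ` space B) \<and>
      C = {z\<in>\<Omega>. (f (fst z), g (snd z)) \<in> R}}"
  have GI: "{z\<in>\<Omega>. (f (fst z), g (snd z)) \<in> R} \<in> G"
    if "f \<in> measurable A (count_space UNIV)" "g \<in> measurable B (count_space UNIV)"
      "finite (f ` space A)" "finite (g ` space B)" for f :: "'b \<Rightarrow> nat" and g :: "'c \<Rightarrow> nat" and R
    unfolding G_def using that by blast
  have const: "(\<lambda>x::'b. 0::nat) \<in> measurable A (count_space UNIV)" "(\<lambda>x::'c. 0::nat) \<in> measurable B (count_space UNIV)"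
    by measurable
  have alg: "algebra \<Omega> G"
    unfolding algebra_iff_Un
  proof (intro conjI ballI)
    show "G \<subseteq> Pow \<Omega>" unfolding G_def by blast
    show "{} \<in> G" using GI[OF const, of "{}"] by (simp add: image_constant_conv)
  next
    fix C assume "C \<in> G"
    then obtain f :: "'b \<Rightarrow> nat" and g :: "'c \<Rightarrow> nat" and R where C: "f \<in> measurable A (count_space UNIV)" "g \<in> measurable B (count_space UNIV)"
      "finite (f ` space A)" "finite (g ` space B)" "C = {z\<in>\<Omega>. (f (fst z), g (snd z)) \<in> R}"
      unfolding G_def by blast
    have "\<Omega> - C = {z\<in>\<Omega>. (f (fst z), g (snd z)) \<in> - R}" unfolding C by auto
    then show "\<Omega> - C \<in> G" using GI[OF C(1-4), of "- R"] by simp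
  next
    fix C D assume "C \<in> G" "D \<in> G"
    from \<open>C \<in> G\<close> obtain f :: "'b \<Rightarrow> nat" and g :: "'c \<Rightarrow> nat" and R where C: "f \<in> measurable A (count_space UNIV)" "g \<in> measurable B (count_space UNIV)"
      "finite (f ` space A)" "finite (g ` space B)" "C = {z\<in>\<Omega>. (f (fst z), g (snd z)) \<in> R}"
      unfolding G_def by blast
    from \<open>D \<in> G\<close> obtain f' :: "'b \<Rightarrow> nat" and g' :: "'c \<Rightarrow> nat" and R' where D: "f' \<in> measurable A (count_space UNIV)" "g' \<in> measurable B (count_space UNIV)"
      "finite (f' ` space A)" "finite (g' ` space B)" "D = {z\<in>\<Omega>. (f' (fst z), g' (snd z)) \<in> R'}"
      unfolding G_def by blast
    define F where "F x = prod_encode (f x, f' x)" for x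
    define H where "H x = prod_encode (g x, g' x)" for x
    define T where "T = {(n, k). (fst (prod_decode n), fst (prod_decode k)) \<in> R \<or> (snd (prod_decode n), snd (prod_decode k)) \<in> R'}"
    have [measurable]: "f \<in> measurable A (count_space UNIV)" "f' \<in> measurable A (count_space UNIV)"
      "g \<in> measurable B (count_space UNIV)" "g' \<in> measurable B (count_space UNIV)" by fact+
    have F: "F \<in> measurable A (count_space UNIV)" unfolding F_def by measurable
    have H: "H \<in> measurable B (count_space UNIV)" unfolding H_def by measurable
    have "F ` space A \<subseteq> prod_encode ` (f ` space A \<times> f' ` space A)" unfolding F_def by auto
    then have Ff: "finite (F ` space A)" using C D by (meson finite_SigmaI finite_imageI finite_subset)
    have "H ` space B \<subseteq> prod_encode ` (g ` space B \<times> g' ` space B)" unfolding H_def by auto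
    then have Hf: "finite (H ` space B)" using C D by (meson finite_SigmaI finite_imageI finite_subset)
    have "C \<union> D = {z\<in>\<Omega>. (F (fst z), H (snd z)) \<in> T}"
      unfolding C D F_def H_def T_def by auto
    then show "C \<union> D \<in> G" using GI[OF F H Ff Hf, of T] by simp
  qed
  have G_sets: "C \<in> sets (A \<Otimes>\<^sub>M B)" if "C \<in> G" for C
  proof -
    obtain f :: "'b \<Rightarrow> nat" and g :: "'c \<Rightarrow> nat" and R where C: "f \<in> measurable A (count_space UNIV)" "g \<in> measurable B (count_space UNIV)"
      "C = {z\<in>\<Omega>. (f (fst z), g (snd z)) \<in> R}"
      using \<open>C \<in> G\<close> unfolding G_def by blast
    note [measurable] = C(1,2)
    have "C = {z\<in>space (A \<Otimes>\<^sub>M B). (f (fst z), g (snd z)) \<in> R}" using C sp by simp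
    also have "\<dots> \<in> sets (A \<Otimes>\<^sub>M B)" by measurable
    finally show ?thesis .
  qed
  have GS: "sets (A \<Otimes>\<^sub>M B) = sigma_sets \<Omega> G"
  proof
    show "sigma_sets \<Omega> G \<subseteq> sets (A \<Otimes>\<^sub>M B)"
      using sets.sigma_sets_subset[of G "A \<Otimes>\<^sub>M B"] G_sets sp by auto
    have "{a \<times> b |a b. a \<in> sets A \<and> b \<in> sets B} \<subseteq> G"
    proof safe
      fix a b assume ab: "a \<in> sets A" "b \<in> sets B"
      note [measurable] = ab
      have "a \<times> b = {z\<in>\<Omega>. ((if fst z \<in> a then 1 else 0::nat), (if snd z \<in> b then 1 else 0::nat)) \<in> {(1,1)}}"
        using sets.sets_into_space[OF ab(1)] sets.sets_into_space[OF ab(2)] unfolding \<Omega>_def by (auto split: if_splits)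
      also have "\<dots> \<in> G"
      proof (rule GI)
        show "finite ((\<lambda>x. if x \<in> a then 1 else 0::nat) ` space A)"
          by (rule finite_subset[of _ "{0,1}"]) auto
        show "finite ((\<lambda>x. if x \<in> b then 1 else 0::nat) ` space B)"
          by (rule finite_subset[of _ "{0,1}"]) auto
      qed measurable
      finally show "a \<times> b \<in> G" .
    qed
    then have "sigma_sets \<Omega> {a \<times> b |a b. a \<in> sets A \<and> b \<in> sets B} \<subseteq> sigma_sets \<Omega> G"
      by (rule sigma_sets_mono')
    then show "sets (A \<Otimes>\<^sub>M B) \<subseteq> sigma_sets \<Omega> G"
      by (simp add: sets_pair_measure \<Omega>_def)
  qed
  have diff: "\<bar>measure P1 C - measure P2 C\<bar> \<le> d" if "C \<in> G" for C
  proof -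
    obtain f :: "'b \<Rightarrow> nat" and g :: "'c \<Rightarrow> nat" and R where C: "f \<in> measurable A (count_space UNIV)" "g \<in> measurable B (count_space UNIV)"
      "finite (f ` space A)" "finite (g ` space B)" "C = {z\<in>\<Omega>. (f (fst z), g (snd z)) \<in> R}"
      using \<open>C \<in> G\<close> unfolding G_def by blast
    note [measurable] = C(1,2)
    define Fa where "Fa n = f -` {n} \<inter> space A" for n
    define Gb where "Gb n = g -` {n} \<inter> space B" for n
    have [measurable]: "Fa n \<in> sets A" "Gb n \<in> sets B" for n unfolding Fa_def Gb_def by measurable
    define W where "W = (f ` space A \<times> g ` space B)"
    define W' where "W' = W \<inter> R"
    have fW: "finite W" "finite W'" using C by (auto simp: W_def W'_def)
    have Ceq: "C = (\<Union>w\<in>W'. Fa (fst w) \<times> Gb (snd w))"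
      unfolding C(5) W'_def W_def Fa_def Gb_def \<Omega>_def by force
    have disj: "disjoint_family_on (\<lambda>w. Fa (fst w) \<times> Gb (snd w)) W'"
      unfolding disjoint_family_on_def Fa_def Gb_def by auto
    define Ua where "Ua n = U -` Fa n \<inter> space M" for n
    define Vb where "Vb n = V -` Gb n \<inter> space M" for n
    have m1: "measure P1 (Fa n \<times> Gb k) = measure M (Ua n \<inter> Vb k)" for n k
    proof -
      have "measure P1 (Fa n \<times> Gb k) = measure M ((\<lambda>\<omega>. (U \<omega>, V \<omega>)) -` (Fa n \<times> Gb k) \<inter> space M)"
        unfolding P1_def by (rule measure_distr) measurable
      also have "(\<lambda>\<omega>. (U \<omega>, V \<omega>)) -` (Fa n \<times> Gb k) \<inter> space M = Ua n \<inter> Vb k"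
        unfolding Ua_def Vb_def by auto
      finally show ?thesis .
    qed
    have m2: "measure P2 (Fa n \<times> Gb k) = measure M (Ua n) * measure M (Vb k)" for n k
    proof -
      have "emeasure P2 (Fa n \<times> Gb k) = emeasure (distr M A U) (Fa n) * emeasure (distr M B V) (Gb k)"
        unfolding P2_def by (rule MV.emeasure_pair_measure_Times) auto
      then have "measure P2 (Fa n \<times> Gb k) = measure (distr M A U) (Fa n) * measure (distr M B V) (Gb k)"
        by (simp add: measure_def enn2real_mult)
      then show ?thesis by (simp add: measure_distr Ua_def Vb_def)
    qed
    have im: "(\<lambda>w. Fa (fst w) \<times> Gb (snd w)) ` W' \<subseteq> sets P1" "(\<lambda>w. Fa (fst w) \<times> Gb (snd w)) ` W' \<subseteq> sets P2"
      unfolding s1 s2 by auto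
    have c1: "measure P1 C = (\<Sum>w\<in>W'. measure M (Ua (fst w) \<inter> Vb (snd w)))"
      unfolding Ceq m1[symmetric] by (rule P1.finite_measure_finite_Union[OF fW(2) im(1) disj])
    have c2: "measure P2 C = (\<Sum>w\<in>W'. measure M (Ua (fst w)) * measure M (Vb (snd w)))"
      unfolding Ceq m2[symmetric] by (rule P2.finite_measure_finite_Union[OF fW(2) im(2) disj])
    define D where "D a b = \<bar>measure M (a \<inter> b) - measure M a * measure M b\<bar>" for a b
    have D0: "D {} b = 0" "D a {} = 0" for a b unfolding D_def by auto
    \<comment> \<open>Blocks of \<open>partition_on\<close> are non-empty, so values without
      preimage are dropped. On the remaining values \<open>Ua\<close> and \<open>Vb\<close> are
      injective, and summing over values equals summing over blocks.\<close>
    define N where "N = {n \<in> f ` space A. Ua n \<noteq> {}}"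
    define K where "K = {n \<in> g ` space B. Vb n \<noteq> {}}"
    have "\<bar>measure P1 C - measure P2 C\<bar> \<le> (\<Sum>w\<in>W'. D (Ua (fst w)) (Vb (snd w)))"
      unfolding c1 c2 D_def sum_subtractf[symmetric] by (rule sum_abs)
    also have "\<dots> \<le> (\<Sum>w\<in>W. D (Ua (fst w)) (Vb (snd w)))"
      using fW by (intro sum_mono2) (auto simp: W'_def D_def)
    also have "\<dots> = (\<Sum>w\<in>N \<times> K. D (Ua (fst w)) (Vb (snd w)))"
      using fW by (intro sum.mono_neutral_right) (auto simp: N_def K_def W_def D0)
    also have "\<dots> = (\<Sum>n\<in>N. \<Sum>k\<in>K. D (Ua n) (Vb k))"
      by (simp add: sum.cartesian_product case_prod_unfold)
    also have "\<dots> = (\<Sum>a\<in>Ua ` N. \<Sum>b\<in>Vb ` K. D a b)"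
    proof -
      have i1: "inj_on Ua N"
      proof (rule inj_onI)
        fix n k assume n: "n \<in> N" and eq: "Ua n = Ua k"
        then obtain \<omega> where "\<omega> \<in> Ua n" by (auto simp: N_def)
        with eq have "\<omega> \<in> Ua n" "\<omega> \<in> Ua k" by auto
        then show "n = k" by (auto simp: Ua_def Fa_def)
      qed
      have i2: "inj_on Vb K"
      proof (rule inj_onI)
        fix n k assume n: "n \<in> K" and eq: "Vb n = Vb k"
        then obtain \<omega> where "\<omega> \<in> Vb n" by (auto simp: K_def)
        with eq have "\<omega> \<in> Vb n" "\<omega> \<in> Vb k" by auto
        then show "n = k" by (auto simp: Vb_def Gb_def)
      qed
      show ?thesis using i1 i2 by (simp add: sum.reindex)
    qed
    also have "\<dots> \<le> d"
      unfolding D_def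
    proof (rule part)
      show "finite (Ua ` N)" "finite (Vb ` K)" using C by (auto simp: N_def K_def)
      show "partition_on (space M) (Ua ` N)"
      proof (rule partition_onI)
        show "\<Union> (Ua ` N) = space M"
          unfolding N_def Ua_def Fa_def using measurable_space[OF U] by auto
        show "disjnt p q" if "p \<in> Ua ` N" "q \<in> Ua ` N" "p \<noteq> q" for p q
          using that unfolding disjnt_def N_def Ua_def Fa_def by auto
        show "{} \<notin> Ua ` N" unfolding N_def by auto
      qed
      show "partition_on (space M) (Vb ` K)"
      proof (rule partition_onI)
        show "\<Union> (Vb ` K) = space M"
          unfolding K_def Vb_def Gb_def using measurable_space[OF V] by auto
        show "disjnt p q" if "p \<in> Vb ` K" "q \<in> Vb ` K" "p \<noteq> q" for p q
          using that unfolding disjnt_def K_def Vb_def Gb_def by auto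
        show "{} \<notin> Vb ` K" unfolding K_def by auto
      qed
      show "Ua ` N \<subseteq> {U -` E \<inter> space M |E. E \<in> sets A}" unfolding Ua_def by auto
      show "Vb ` K \<subseteq> {V -` E \<inter> space M |E. E \<in> sets B}" unfolding Vb_def by auto
    qed
    finally show ?thesis .
  qed
  have all: "\<bar>measure P1 C - measure P2 C\<bar> \<le> d" if "C \<in> sets P1" for C
    using P1.finite_measure_axioms P2.finite_measure_axioms s1 s2 GS that
    by (intro measure_diff_le_of_algebra[OF _ _ _ _ alg diff]) auto
  have m1: "\<Phi> \<in> borel_measurable P1" using \<Phi> s1 by (metis measurable_cong_sets)
  have m2: "\<Phi> \<in> borel_measurable P2" using \<Phi> s2 by (metis measurable_cong_sets)
  have sp1: "space P1 = space (A \<Otimes>\<^sub>M B)" "space P2 = space (A \<Otimes>\<^sub>M B)"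
    using s1 s2 sets_eq_imp_space_eq by blast+
  have "\<bar>(\<integral>z. \<Phi> z \<partial>P1) - (\<integral>z. \<Phi> z \<partial>P2)\<bar> \<le> d"
    using s1 s2 m1 \<Phi>01 sp1 by (intro integral_diff_le_of_sets[OF ps1 ps2 _ all]) auto
  moreover have "(\<integral>z. \<Phi> z \<partial>P1) = (\<integral>\<omega>. \<Phi> (U \<omega>, V \<omega>) \<partial>M)"
    unfolding P1_def by (rule integral_distr) measurable
  moreover have "(\<integral>z. \<Phi> z \<partial>P2) = (\<integral>\<omega>'. (\<integral>\<omega>. \<Phi> (U \<omega>, V \<omega>') \<partial>M) \<partial>M)"
  proof -
    have int: "integrable P2 \<Phi>"
      using m2 \<Phi>01 sp1 by (intro P2.integrable_const_bound[where B=1]) auto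
    have "(\<integral>z. \<Phi> z \<partial>P2) = (\<integral>y. (\<integral>x. \<Phi> (x, y) \<partial>distr M A U) \<partial>distr M B V)"
      using UV.integral_snd[of "\<lambda>x y. \<Phi> (x, y)"] int unfolding P2_def by simp
    also have "\<dots> = (\<integral>y. (\<integral>\<omega>. \<Phi> (U \<omega>, y) \<partial>M) \<partial>distr M B V)"
      by (intro Bochner_Integration.integral_cong refl integral_distr) auto
    also have "\<dots> = (\<integral>\<omega>'. (\<integral>\<omega>. \<Phi> (U \<omega>, V \<omega>') \<partial>M) \<partial>M)"
      by (intro integral_distr) measurable
    finally show ?thesis .
  qed
  ultimately show ?thesis by simp
qed

text \<open>A supremum of reals carries information only for a set that is bounded above; this bound
  provides that for the sums in \<open>beta_coeff\<close>.\<close>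

lemma (in prob_space) sum_partition_dependence_le_2:
  assumes P: "finite P" "partition_on (space M) P" "P \<subseteq> events"
    and Q: "finite Q" "partition_on (space M) Q" "Q \<subseteq> events"
  shows "(\<Sum>a\<in>P. \<Sum>b\<in>Q. \<bar>measure M (a \<inter> b) - measure M a * measure M b\<bar>) \<le> 2"
proof -
  have s: "(\<Sum>b\<in>R. prob (a \<inter> b)) = prob a" if "finite R" "partition_on (space M) R" "R \<subseteq> events" "a \<in> events" for a R
  proof -
    have "a = (\<Union>b\<in>R. a \<inter> b)"
      using partition_onD1[OF that(2)] sets.sets_into_space[OF that(4)] by auto
    moreover have "prob (\<Union>b\<in>R. a \<inter> b) = (\<Sum>b\<in>R. prob (a \<inter> b))"
      using that partition_onD2[OF that(2)]
      by (intro finite_measure_finite_Union) (auto simp: disjoint_family_on_def disjoint_def)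
    ultimately show ?thesis by simp
  qed
  have s1: "(\<Sum>b\<in>R. prob b) = 1" if "finite R" "partition_on (space M) R" "R \<subseteq> events" for R
  proof -
    have "(\<Sum>b\<in>R. prob b) = (\<Sum>b\<in>R. prob (space M \<inter> b))"
      using that(3) by (intro sum.cong) auto
    then show ?thesis using s[OF that sets.top] by (simp add: prob_space)
  qed
  have "(\<Sum>a\<in>P. \<Sum>b\<in>Q. \<bar>prob (a \<inter> b) - prob a * prob b\<bar>) \<le> (\<Sum>a\<in>P. \<Sum>b\<in>Q. prob (a \<inter> b) + prob a * prob b)"
    by (intro sum_mono) (smt (verit) measure_nonneg mult_nonneg_nonneg)
  also have "\<dots> = (\<Sum>a\<in>P. prob a + prob a * 1)"
    using s[OF Q] s1[OF Q] P(3) by (intro sum.cong refl) (auto simp: sum.distrib simp flip: sum_distrib_left)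
  also have "\<dots> = 2" using s1[OF P] by (simp flip: sum_distrib_left)
  finally show ?thesis .
qed

section \<open>Elementary properties of the \<beta> mixing coefficients\<close>

locale process = prob_space M for M :: "'a measure" +
  fixes S :: "'s measure" and X :: "int \<Rightarrow> 'a \<Rightarrow> 's"
  assumes X_meas [measurable]: "\<And>i. X i \<in> measurable M S"
begin

lemma generated_algebra_subset: "generated_algebra M S X I \<subseteq> events"
  unfolding generated_algebra_def by (rule sets.sigma_sets_subset) auto

lemma vimage_in_generated_algebra:
  assumes "J \<subseteq> I" "E \<in> sets (\<Pi>\<^sub>M i\<in>J. S)"
  shows "(\<lambda>\<omega>. \<lambda>i\<in>J. X i \<omega>) -` E \<inter> space M \<in> generated_algebra M S X I"
proof -
  define N where "N = sigma (space M) (\<Union>i\<in>I. {X i -` A \<inter> space M |A. A \<in> sets S})"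
  have N: "sets N = generated_algebra M S X I" "space N = space M"
    unfolding N_def generated_algebra_def by (auto intro!: sets_measure_of space_measure_of)
  have "X i \<in> measurable N S" if "i \<in> J" for i
  proof (rule measurableI)
    show "X i x \<in> space S" if "x \<in> space N" for x
      using measurable_space[OF X_meas] that N by simp
    show "X i -` A \<inter> space N \<in> sets N" if "A \<in> sets S" for A
      unfolding N generated_algebra_def using that \<open>i \<in> J\<close> assms(1) by (intro sigma_sets.Basic) auto
  qed
  then have "(\<lambda>\<omega>. \<lambda>i\<in>J. X i \<omega>) \<in> measurable N (\<Pi>\<^sub>M i\<in>J. S)"
    by (intro measurable_restrict) auto
  from measurable_sets[OF this assms(2)] show ?thesis using N by simp
qed

lemma partition_sum_bdd_above:
  assumes "\<A> \<subseteq> events" "\<B> \<subseteq> events"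
  shows "bdd_above ((\<lambda>(P, Q). \<Sum>A\<in>P. \<Sum>B\<in>Q. \<bar>prob (A \<inter> B) - prob A * prob B\<bar>) `
    ({P. finite P \<and> P \<subseteq> \<A> \<and> partition_on (space M) P} \<times>
     {Q. finite Q \<and> Q \<subseteq> \<B> \<and> partition_on (space M) Q}))"
  using assms by (intro bdd_aboveI[where M=2]) (auto intro!: sum_partition_dependence_le_2)

lemma trivial_partition:
  assumes "space M \<in> \<A>"
  shows "{space M} \<in> {P. finite P \<and> P \<subseteq> \<A> \<and> partition_on (space M) P}"
  using assms not_empty by (auto simp: partition_on_def)

lemma space_in_generated_algebra: "space M \<in> generated_algebra M S X I"
  unfolding generated_algebra_def by (rule sigma_sets_top)

lemma beta_coeff_le_1: "beta_coeff M (generated_algebra M S X I) (generated_algebra M S X J) \<le> 1"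
proof -
  have "(SUP (P, Q)\<in>{P. finite P \<and> P \<subseteq> generated_algebra M S X I \<and> partition_on (space M) P} \<times>
                 {Q. finite Q \<and> Q \<subseteq> generated_algebra M S X J \<and> partition_on (space M) Q}.
        \<Sum>A\<in>P. \<Sum>B\<in>Q. \<bar>prob (A \<inter> B) - prob A * prob B\<bar>) \<le> 2"
    using trivial_partition[OF space_in_generated_algebra] generated_algebra_subset
    by (intro cSUP_least) (fastforce intro!: sum_partition_dependence_le_2)+
  then show ?thesis by (simp add: beta_coeff_def)
qed

lemma partition_sum_le_beta_coeff:
  assumes "finite P" "P \<subseteq> generated_algebra M S X I" "partition_on (space M) P"
    and "finite Q" "Q \<subseteq> generated_algebra M S X J" "partition_on (space M) Q"
  shows "(\<Sum>A\<in>P. \<Sum>B\<in>Q. \<bar>prob (A \<inter> B) - prob A * prob B\<bar>) \<le>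
     2 * beta_coeff M (generated_algebra M S X I) (generated_algebra M S X J)"
  unfolding beta_coeff_def
  using cSUP_upper[OF _ partition_sum_bdd_above[OF generated_algebra_subset generated_algebra_subset], of "(P, Q)"] assms
  by simp

lemma beta_coeff_le_beta_mixing:
  "l \<ge> 1 \<Longrightarrow> beta_coeff M (generated_algebra M S X {1..l}) (generated_algebra M S X {l + int k..}) \<le> beta_mixing M S X k"
  unfolding beta_mixing_def by (intro cSUP_upper bdd_aboveI[where M=1]) (auto intro: beta_coeff_le_1)

lemma generated_algebra_mono: "I \<subseteq> J \<Longrightarrow> generated_algebra M S X I \<subseteq> generated_algebra M S X J"
  unfolding generated_algebra_def by (intro sigma_sets_mono') auto

lemma beta_mixing_antimono:
  assumes "k \<le> k'"
  shows "beta_mixing M S X k' \<le> beta_mixing M S X k"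
  unfolding beta_mixing_def
proof (rule cSUP_mono)
  show "bdd_above ((\<lambda>l. beta_coeff M (generated_algebra M S X {1..l}) (generated_algebra M S X {l + int k..})) ` {1..})"
    by (intro bdd_aboveI[where M=1]) (auto intro: beta_coeff_le_1)
  fix l :: int assume l: "l \<in> {1..}"
  have "beta_coeff M (generated_algebra M S X {1..l}) (generated_algebra M S X {l + int k'..})
      \<le> beta_coeff M (generated_algebra M S X {1..l}) (generated_algebra M S X {l + int k..})"
    unfolding beta_coeff_def
  proof (intro mult_left_mono cSUP_subset_mono)
    show "{P. finite P \<and> P \<subseteq> generated_algebra M S X {1..l} \<and> partition_on (space M) P} \<times>
      {Q. finite Q \<and> Q \<subseteq> generated_algebra M S X {l + int k'..} \<and> partition_on (space M) Q} \<noteq> {}"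
      using trivial_partition[OF space_in_generated_algebra] by blast
    show "{P. finite P \<and> P \<subseteq> generated_algebra M S X {1..l} \<and> partition_on (space M) P} \<times>
      {Q. finite Q \<and> Q \<subseteq> generated_algebra M S X {l + int k'..} \<and> partition_on (space M) Q} \<subseteq>
      {P. finite P \<and> P \<subseteq> generated_algebra M S X {1..l} \<and> partition_on (space M) P} \<times>
      {Q. finite Q \<and> Q \<subseteq> generated_algebra M S X {l + int k..} \<and> partition_on (space M) Q}"
      using generated_algebra_mono[of "{l + int k'..}" "{l + int k..}"] assms by auto
  qed (use partition_sum_bdd_above[OF generated_algebra_subset generated_algebra_subset] in auto)
  then show "\<exists>l'\<in>{1..}. beta_coeff M (generated_algebra M S X {1..l}) (generated_algebra M S X {l + int k'..})
      \<le> beta_coeff M (generated_algebra M S X {1..l'}) (generated_algebra M S X {l' + int k..})"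
    using l by blast
qed auto

lemma beta_mixing_nonneg: "0 \<le> beta_mixing M S X k"
proof -
  have "0 \<le> (\<Sum>A\<in>{space M}. \<Sum>B\<in>{space M}. \<bar>prob (A \<inter> B) - prob A * prob B\<bar>)"
    by (intro sum_nonneg) auto
  also have "\<dots> \<le> 2 * beta_coeff M (generated_algebra M S X {1..1}) (generated_algebra M S X {1 + int k..})"
    using trivial_partition[OF space_in_generated_algebra] by (intro partition_sum_le_beta_coeff) auto
  also have "\<dots> \<le> 2 * beta_mixing M S X k" using beta_coeff_le_beta_mixing[of 1 k] by simp
  finally show ?thesis by simp
qed

text \<open>The factor 2 undoes the 1/2 in \<open>beta_coeff\<close>. The first block has to lie in
  \<open>{1..}\<close> because \<open>beta_mixing\<close> compares pasts that start at time
  1.\<close>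

lemma beta_decoupling_pair:
  assumes I: "finite I1" "finite I2" "I1 \<subseteq> {1..}" and gap: "\<And>i j. i \<in> I1 \<Longrightarrow> j \<in> I2 \<Longrightarrow> i + int k \<le> j"
    and \<Phi> [measurable]: "\<Phi> \<in> borel_measurable ((\<Pi>\<^sub>M i\<in>I1. S) \<Otimes>\<^sub>M (\<Pi>\<^sub>M i\<in>I2. S))"
    and \<Phi>01: "\<And>z. z \<in> space ((\<Pi>\<^sub>M i\<in>I1. S) \<Otimes>\<^sub>M (\<Pi>\<^sub>M i\<in>I2. S)) \<Longrightarrow> 0 \<le> \<Phi> z \<and> \<Phi> z \<le> 1"
  shows "\<bar>(\<integral>\<omega>. \<Phi> (\<lambda>i\<in>I1. X i \<omega>, \<lambda>i\<in>I2. X i \<omega>) \<partial>M) -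
      (\<integral>\<omega>'. (\<integral>\<omega>. \<Phi> (\<lambda>i\<in>I1. X i \<omega>, \<lambda>i\<in>I2. X i \<omega>') \<partial>M) \<partial>M)\<bar> \<le> 2 * beta_mixing M S X k"
proof (cases "I1 = {}")
  case True
  then show ?thesis using beta_mixing_nonneg[of k] by (simp add: restrict_def prob_space)
next
  case False
  \<comment> \<open>The last index of the first block is the time \<open>l\<close> of the supremum
    in \<open>beta_mixing\<close>; the gap puts all of \<open>I2\<close> into
    \<open>{l + int k..}\<close>. An empty \<open>I1\<close> has no maximum and is treated
    separately.\<close>
  define l where "l = Max I1"
  have l: "l \<in> I1" "\<And>i. i \<in> I1 \<Longrightarrow> i \<le> l" unfolding l_def using False I by auto
  have sub: "I1 \<subseteq> {1..l}" "I2 \<subseteq> {l + int k..}" using l I gap by auto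
  have "l \<ge> 1" using l I by auto
  show ?thesis
  proof (rule decoupling_pair[OF _ _ _ \<Phi> \<Phi>01])
    fix P Q assume PQ: "finite P" "finite Q" "partition_on (space M) P" "partition_on (space M) Q"
      "P \<subseteq> {(\<lambda>\<omega>. \<lambda>i\<in>I1. X i \<omega>) -` E \<inter> space M |E. E \<in> sets (\<Pi>\<^sub>M i\<in>I1. S)}"
      "Q \<subseteq> {(\<lambda>\<omega>. \<lambda>i\<in>I2. X i \<omega>) -` E \<inter> space M |E. E \<in> sets (\<Pi>\<^sub>M i\<in>I2. S)}"
    have "P \<subseteq> generated_algebra M S X {1..l}" "Q \<subseteq> generated_algebra M S X {l + int k..}"
      using PQ(5,6) vimage_in_generated_algebra[OF sub(1)] vimage_in_generated_algebra[OF sub(2)] by blast+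
    then have "(\<Sum>a\<in>P. \<Sum>b\<in>Q. \<bar>prob (a \<inter> b) - prob a * prob b\<bar>) \<le>
      2 * beta_coeff M (generated_algebra M S X {1..l}) (generated_algebra M S X {l + int k..})"
      using PQ by (intro partition_sum_le_beta_coeff)
    also have "\<dots> \<le> 2 * beta_mixing M S X k" using beta_coeff_le_beta_mixing[OF \<open>l \<ge> 1\<close>] by simp
    finally show "(\<Sum>a\<in>P. \<Sum>b\<in>Q. \<bar>prob (a \<inter> b) - prob a * prob b\<bar>) \<le> 2 * beta_mixing M S X k" .
  qed measurable
qed

lemma product_decoupled_measurable [measurable]:
  assumes "g ` I \<subseteq> K"
  shows "(\<lambda>w. \<lambda>i\<in>I. X i (w (g i))) \<in> measurable (\<Pi>\<^sub>M j\<in>K. M) (\<Pi>\<^sub>M i\<in>I. S)"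
  using assms by (intro measurable_restrict measurable_compose[OF _ X_meas] measurable_component_singleton) auto

text \<open>
  The label \<open>g i\<close> names the independent copy of the whole process from which the \<open>i\<close>-th coordinate
  is read, so that variables with distinct labels are independent under the product measure while
  variables sharing a label keep their joint law.
\<close>

theorem beta_decoupling:
  fixes \<Phi> :: "(int \<Rightarrow> 's) \<Rightarrow> real"
  assumes "finite I" "I \<subseteq> {1..}" "g ` I \<subseteq> {..<J::nat}"
    and "\<And>i j. i \<in> I \<Longrightarrow> j \<in> I \<Longrightarrow> g i < g j \<Longrightarrow> i + int k \<le> j"
    and "\<Phi> \<in> borel_measurable (\<Pi>\<^sub>M i\<in>I. S)"
    and "\<And>z. z \<in> space (\<Pi>\<^sub>M i\<in>I. S) \<Longrightarrow> 0 \<le> \<Phi> z \<and> \<Phi> z \<le> 1"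
  shows "\<bar>(\<integral>\<omega>. \<Phi> (\<lambda>i\<in>I. X i \<omega>) \<partial>M) - (\<integral>w. \<Phi> (\<lambda>i\<in>I. X i (w (g i))) \<partial>(\<Pi>\<^sub>M j\<in>{..<J}. M))\<bar>
     \<le> 2 * real J * beta_mixing M S X k"
  using assms
proof (induction J arbitrary: I \<Phi>)
  case 0
  then have "I = {}" by auto
  interpret E: prob_space "\<Pi>\<^sub>M j\<in>{..<0::nat}. M" by (rule prob_space_PiM) unfold_locales
  show ?case using \<open>I = {}\<close> E.prob_space by (simp add: prob_space restrict_def)
next
  case (Suc J)
  \<comment> \<open>The block with the largest label is split off. By the gap condition it lies to
    the right of all the others, so \<open>beta_decoupling_pair\<close> applies to the two
    groups.\<close>
  define I1 where "I1 = {i\<in>I. g i < J}"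
  define I2 where "I2 = {i\<in>I. g i = J}"
  have I: "I = I1 \<union> I2" "I1 \<inter> I2 = {}" "finite I1" "finite I2" "I1 \<subseteq> {1..}"
    using Suc.prems(1-3) unfolding I1_def I2_def by (auto simp: less_Suc_eq image_subset_iff)
  note [measurable] = Suc.prems(5)
  define \<Psi> where "\<Psi> z = \<Phi> (merge I1 I2 z)" for z
  have \<Phi>m: "\<Phi> \<in> borel_measurable (\<Pi>\<^sub>M i\<in>I1 \<union> I2. S)" using Suc.prems(5) I(1) by simp
  have \<Psi> [measurable]: "\<Psi> \<in> borel_measurable ((\<Pi>\<^sub>M i\<in>I1. S) \<Otimes>\<^sub>M (\<Pi>\<^sub>M i\<in>I2. S))"
    unfolding \<Psi>_def by (rule measurable_compose[OF measurable_merge \<Phi>m])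
  have \<Psi>01: "0 \<le> \<Psi> z \<and> \<Psi> z \<le> 1" if "z \<in> space ((\<Pi>\<^sub>M i\<in>I1. S) \<Otimes>\<^sub>M (\<Pi>\<^sub>M i\<in>I2. S))" for z
    unfolding \<Psi>_def using measurable_space[OF measurable_merge that] I(1) by (intro Suc.prems(6)) simp
  interpret J: prob_space "\<Pi>\<^sub>M j\<in>{..<J}. M" by (rule prob_space_PiM) unfold_locales
  interpret J': prob_space "\<Pi>\<^sub>M j\<in>{..<Suc J}. M" by (rule prob_space_PiM) unfold_locales
  interpret PS: product_prob_space "\<lambda>_::nat. M" "{..<J}" by unfold_locales
  interpret pair2: pair_prob_space "\<Pi>\<^sub>M j\<in>{..<J}. M" M by unfold_locales
  have [measurable]: "(\<lambda>w. \<lambda>i\<in>I1. X i (w (g i))) \<in> measurable (\<Pi>\<^sub>M j\<in>{..<J}. M) (\<Pi>\<^sub>M i\<in>I1. S)"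
    by (rule product_decoupled_measurable) (auto simp: I1_def)
  have [measurable]: "(\<lambda>w. \<lambda>i\<in>I. X i (w (g i))) \<in> measurable (\<Pi>\<^sub>M j\<in>{..<Suc J}. M) (\<Pi>\<^sub>M i\<in>I. S)"
    by (rule product_decoupled_measurable) (use Suc.prems in auto)
  have [measurable]: "(\<lambda>\<omega>. \<lambda>i\<in>A. X i \<omega>) \<in> measurable M (\<Pi>\<^sub>M i\<in>A. S)" for A
    by (rule measurable_restrict) auto
  have space1: "(\<lambda>i\<in>A. X i \<omega>) \<in> space (\<Pi>\<^sub>M i\<in>A. S)" if "\<omega> \<in> space M" for A \<omega>
    using that measurable_space[OF X_meas] by (auto simp: space_PiM)
  have "(\<lambda>i\<in>I. X i \<omega>) = merge I1 I2 (\<lambda>i\<in>I1. X i \<omega>, \<lambda>i\<in>I2. X i \<omega>)" for \<omega>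
    unfolding I(1) using I(2) by (auto simp: merge_def restrict_def fun_eq_iff)
  then have e1: "(\<integral>\<omega>. \<Phi> (\<lambda>i\<in>I. X i \<omega>) \<partial>M) = (\<integral>\<omega>. \<Psi> (\<lambda>i\<in>I1. X i \<omega>, \<lambda>i\<in>I2. X i \<omega>) \<partial>M)"
    unfolding \<Psi>_def by simp
  have d1: "\<bar>(\<integral>\<omega>. \<Psi> (\<lambda>i\<in>I1. X i \<omega>, \<lambda>i\<in>I2. X i \<omega>) \<partial>M) -
      (\<integral>\<omega>'. (\<integral>\<omega>. \<Psi> (\<lambda>i\<in>I1. X i \<omega>, \<lambda>i\<in>I2. X i \<omega>') \<partial>M) \<partial>M)\<bar> \<le> 2 * beta_mixing M S X k"
  proof (rule beta_decoupling_pair[OF I(3,4,5) _ \<Psi> \<Psi>01])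
    show "i + int k \<le> j" if "i \<in> I1" "j \<in> I2" for i j
      using that Suc.prems(4)[of i j] by (auto simp: I1_def I2_def)
  qed
  define F where "F \<omega>' = (\<integral>\<omega>. \<Psi> (\<lambda>i\<in>I1. X i \<omega>, \<lambda>i\<in>I2. X i \<omega>') \<partial>M)" for \<omega>'
  \<comment> \<open>\<open>F\<close> still reads the whole first group from one copy,
    \<open>H\<close> reads it from its final copies. With the last block frozen at
    \<open>\<omega>'\<close> the induction hypothesis compares the two, uniformly in
    \<open>\<omega>'\<close>.\<close>
  define H where "H \<omega>' = (\<integral>w. \<Psi> (\<lambda>i\<in>I1. X i (w (g i)), \<lambda>i\<in>I2. X i \<omega>') \<partial>(\<Pi>\<^sub>M j\<in>{..<J}. M))" for \<omega>'
  have [measurable]: "F \<in> borel_measurable M" unfolding F_def by measurable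
  have [measurable]: "H \<in> borel_measurable M" unfolding H_def by measurable
  have FH: "\<bar>F \<omega>' - H \<omega>'\<bar> \<le> 2 * real J * beta_mixing M S X k" if w: "\<omega>' \<in> space M" for \<omega>'
    unfolding F_def H_def
  proof (rule Suc.IH)
    show "(\<lambda>z. \<Psi> (z, \<lambda>i\<in>I2. X i \<omega>')) \<in> borel_measurable (\<Pi>\<^sub>M i\<in>I1. S)"
      using space1[OF w] by measurable
    show "0 \<le> \<Psi> (z, \<lambda>i\<in>I2. X i \<omega>') \<and> \<Psi> (z, \<lambda>i\<in>I2. X i \<omega>') \<le> 1" if "z \<in> space (\<Pi>\<^sub>M i\<in>I1. S)" for z
      using that space1[OF w] by (intro \<Psi>01) (auto simp: space_pair_measure)
    show "i + int k \<le> j" if "i \<in> I1" "j \<in> I1" "g i < g j" for i j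
      using that Suc.prems(4)[of i j] by (simp add: I1_def)
    show "g ` I1 \<subseteq> {..<J}" by (auto simp: I1_def)
  qed (fact I)+
  have F01: "\<bar>F \<omega>'\<bar> \<le> 1" if w: "\<omega>' \<in> space M" for \<omega>'
  proof -
    have "0 \<le> F \<omega>'" unfolding F_def using \<Psi>01 space1 w
      by (intro Bochner_Integration.integral_nonneg) (auto simp: space_pair_measure)
    moreover have "F \<omega>' \<le> (\<integral>\<omega>. 1 \<partial>M)" unfolding F_def
      using \<Psi>01 space1 w by (intro integral_mono integrable_const_bound[where B=1]) (auto simp: space_pair_measure)
    ultimately show ?thesis by (simp add: prob_space)
  qed
  have iF: "integrable M F" using F01 by (intro integrable_const_bound[where B=1]) auto
  have iH: "integrable M H"
  proof (rule integrable_const_bound[where B="1 + 2 * real J * beta_mixing M S X k"])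
    show "AE x in M. norm (H x) \<le> 1 + 2 * real J * beta_mixing M S X k"
      using F01 FH by (intro AE_I2) (smt (verit) real_norm_def)
  qed measurable
  have d2: "\<bar>(\<integral>\<omega>'. F \<omega>' \<partial>M) - (\<integral>\<omega>'. H \<omega>' \<partial>M)\<bar> \<le> 2 * real J * beta_mixing M S X k"
  proof -
    have "\<bar>(\<integral>\<omega>'. F \<omega>' \<partial>M) - (\<integral>\<omega>'. H \<omega>' \<partial>M)\<bar> = \<bar>\<integral>\<omega>'. F \<omega>' - H \<omega>' \<partial>M\<bar>"
      using iF iH by simp
    also have "\<dots> \<le> (\<integral>\<omega>'. \<bar>F \<omega>' - H \<omega>'\<bar> \<partial>M)" by (rule integral_abs_bound)
    also have "\<dots> \<le> (\<integral>\<omega>'. 2 * real J * beta_mixing M S X k \<partial>M)"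
      using iF iH FH by (intro integral_mono) auto
    finally show ?thesis by (simp add: prob_space)
  qed
  have e2: "(\<integral>w. \<Phi> (\<lambda>i\<in>I. X i (w (g i))) \<partial>(\<Pi>\<^sub>M j\<in>{..<Suc J}. M)) = (\<integral>\<omega>'. H \<omega>' \<partial>M)"
  proof -
    have int: "integrable (\<Pi>\<^sub>M j\<in>{..<Suc J}. M) (\<lambda>w. \<Phi> (\<lambda>i\<in>I. X i (w (g i))))"
    proof (rule J'.integrable_const_bound[where B=1])
      show "AE w in \<Pi>\<^sub>M j\<in>{..<Suc J}. M. norm (\<Phi> (\<lambda>i\<in>I. X i (w (g i)))) \<le> 1"
      proof (rule AE_I2)
        fix w assume w: "w \<in> space (\<Pi>\<^sub>M j\<in>{..<Suc J}. M)"
        have "(\<lambda>i\<in>I. X i (w (g i))) \<in> space (\<Pi>\<^sub>M i\<in>I. S)"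
          by (rule measurable_space[OF product_decoupled_measurable w]) (rule Suc.prems(3))
        from Suc.prems(6)[OF this] show "norm (\<Phi> (\<lambda>i\<in>I. X i (w (g i)))) \<le> 1"
          unfolding real_norm_def by linarith
      qed
    qed measurable
    have "(\<integral>w. \<Phi> (\<lambda>i\<in>I. X i (w (g i))) \<partial>(\<Pi>\<^sub>M j\<in>{..<Suc J}. M)) =
        (\<integral>w. (\<integral>\<omega>'. \<Phi> (\<lambda>i\<in>I. X i ((w(J := \<omega>')) (g i))) \<partial>M) \<partial>(\<Pi>\<^sub>M j\<in>{..<J}. M))"
      using PS.product_integral_insert[of "{..<J}" J "\<lambda>w. \<Phi> (\<lambda>i\<in>I. X i (w (g i)))"] int
      by (simp add: lessThan_Suc)
    also have "\<dots> = (\<integral>w. (\<integral>\<omega>'. \<Psi> (\<lambda>i\<in>I1. X i (w (g i)), \<lambda>i\<in>I2. X i \<omega>') \<partial>M) \<partial>(\<Pi>\<^sub>M j\<in>{..<J}. M))"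
    proof -
      have "(\<lambda>i\<in>I. X i ((w(J := \<omega>')) (g i))) = merge I1 I2 (\<lambda>i\<in>I1. X i (w (g i)), \<lambda>i\<in>I2. X i \<omega>')" for w \<omega>'
        unfolding I(1) using I(2) by (auto simp: merge_def restrict_def fun_eq_iff I1_def I2_def)
      then show ?thesis unfolding \<Psi>_def by simp
    qed
    also have "\<dots> = (\<integral>\<omega>'. H \<omega>' \<partial>M)"
      unfolding H_def
    proof (rule pair2.Fubini_integral[symmetric])
      show "integrable ((\<Pi>\<^sub>M j\<in>{..<J}. M) \<Otimes>\<^sub>M M) (\<lambda>(w, \<omega>'). \<Psi> (\<lambda>i\<in>I1. X i (w (g i)), \<lambda>i\<in>I2. X i \<omega>'))"
      proof (rule pair2.integrable_const_bound[where B=1])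
        show "AE z in (\<Pi>\<^sub>M j\<in>{..<J}. M) \<Otimes>\<^sub>M M. norm (case z of (w, \<omega>') \<Rightarrow> \<Psi> (\<lambda>i\<in>I1. X i (w (g i)), \<lambda>i\<in>I2. X i \<omega>')) \<le> 1"
        proof (rule AE_I2, clarify)
          fix w \<omega>' assume "(w, \<omega>') \<in> space ((\<Pi>\<^sub>M j\<in>{..<J}. M) \<Otimes>\<^sub>M M)"
          then have w: "w \<in> space (\<Pi>\<^sub>M j\<in>{..<J}. M)" "\<omega>' \<in> space M" by (auto simp: space_pair_measure)
          have "(\<lambda>i\<in>I1. X i (w (g i))) \<in> space (\<Pi>\<^sub>M i\<in>I1. S)"
            by (rule measurable_space[OF product_decoupled_measurable w(1)]) (auto simp: I1_def)
          then show "norm (\<Psi> (\<lambda>i\<in>I1. X i (w (g i)), \<lambda>i\<in>I2. X i \<omega>')) \<le> 1"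
            using space1[OF w(2)] \<Psi>01[of "(\<lambda>i\<in>I1. X i (w (g i)), \<lambda>i\<in>I2. X i \<omega>')"] by (simp add: space_pair_measure)
        qed
      qed measurable
    qed
    finally show ?thesis .
  qed
  have "\<bar>(\<integral>\<omega>. \<Phi> (\<lambda>i\<in>I. X i \<omega>) \<partial>M) - (\<integral>\<omega>'. H \<omega>' \<partial>M)\<bar> \<le>
      2 * beta_mixing M S X k + 2 * real J * beta_mixing M S X k"
    using d1 d2 unfolding e1 F_def[symmetric] by linarith
  moreover have "2 * real (Suc J) * beta_mixing M S X k = 2 * beta_mixing M S X k + 2 * real J * beta_mixing M S X k"
    by (simp add: algebra_simps)
  ultimately show ?case unfolding e2 by linarith
qed

end

section \<open>Degenerate kernels\<close>

declare One_nat_def [simp del]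

text \<open>Once indices with distinct labels are decoupled they are independent, so their joint law
  is determined by the common marginal law \<open>\<mu>\<close>.\<close>

locale identically_distributed = process M S X
  for M :: "'a measure" and S :: "'s measure" and X :: "int \<Rightarrow> 'a \<Rightarrow> 's" +
  fixes \<mu> :: "'s measure"
  assumes law_X: "\<And>i. distr M S (X i) = \<mu>"
begin

lemma sets_law [measurable_cong, simp]: "sets \<mu> = sets S"
  using law_X[of 0, symmetric] by simp

lemma space_law [simp]: "space \<mu> = space S"
  using sets_law by (rule sets_eq_imp_space_eq)

lemma prob_space_law: "prob_space \<mu>"
  using law_X[of 0, symmetric] by (simp add: prob_space_distr)

sublocale law: prob_space \<mu>
  by (rule prob_space_law)

sublocale laws: product_sigma_finite "\<lambda>_::nat. \<mu>"
  by unfold_locales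

sublocale copies: product_sigma_finite "\<lambda>_::nat. M"
  by unfold_locales

lemma sets_PiM_law [measurable_cong]: "sets (\<Pi>\<^sub>M l\<in>A. \<mu>) = sets (\<Pi>\<^sub>M l\<in>A. S)"
  by (intro sets_PiM_cong) auto

lemma prob_space_copies: "prob_space (\<Pi>\<^sub>M k\<in>K. M)"
  by (rule prob_space_PiM) unfold_locales

lemma prob_space_laws: "prob_space (\<Pi>\<^sub>M l\<in>A. \<mu>)"
  by (rule prob_space_PiM) unfold_locales

lemma decoupled_tuple_measurable [measurable]:
  assumes "lab ` A \<subseteq> K"
  shows "(\<lambda>w. \<lambda>l\<in>A. X (i l) (w (lab l))) \<in> measurable (\<Pi>\<^sub>M k\<in>K. M) (\<Pi>\<^sub>M l\<in>A. S)"
  using assms by (intro measurable_restrict measurable_compose[OF _ X_meas] measurable_component_singleton) auto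

text \<open>Variables read from distinct copies are independent with law \<open>\<mu>\<close>,
  whatever the time indices \<open>i l\<close> are. \<open>K\<close> may contain further labels,
  whose factors have total mass 1.\<close>

lemma law_decoupled_tuple:
  fixes i :: "nat \<Rightarrow> int" and lab :: "nat \<Rightarrow> nat"
  assumes "finite A" "finite K" "inj_on lab A" "lab ` A \<subseteq> K"
  shows "distr (\<Pi>\<^sub>M k\<in>K. M) (\<Pi>\<^sub>M l\<in>A. S) (\<lambda>w. \<lambda>l\<in>A. X (i l) (w (lab l))) = (\<Pi>\<^sub>M l\<in>A. \<mu>)"
proof (rule laws.PiM_eqI)
  show "finite A" by fact
  show "sets (distr (\<Pi>\<^sub>M k\<in>K. M) (\<Pi>\<^sub>M l\<in>A. S) (\<lambda>w. \<lambda>l\<in>A. X (i l) (w (lab l)))) = sets (\<Pi>\<^sub>M l\<in>A. \<mu>)"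
    by (simp add: sets_PiM_law)
  fix B assume B: "\<And>l. l \<in> A \<Longrightarrow> B l \<in> sets \<mu>"
  \<comment> \<open>The condition on copy \<open>k\<close> is the one imposed by the coordinate that
    reads it, and none if no coordinate does.\<close>
  define C where "C k = (if k \<in> lab ` A then X (i (inv_into A lab k)) -` B (inv_into A lab k) \<inter> space M else space M)" for k
  have C: "C k \<in> sets M" for k
  proof (cases "k \<in> lab ` A")
    case True
    then have "inv_into A lab k \<in> A" by (rule inv_into_into)
    then show ?thesis using True B[of "inv_into A lab k"] measurable_sets[OF X_meas] unfolding C_def by simp
  qed (simp add: C_def)
  have Clab: "C (lab l) = X (i l) -` B l \<inter> space M" if "l \<in> A" for l
    using that assms(3) by (simp add: C_def)
  have BS: "Pi\<^sub>E A B \<in> sets (\<Pi>\<^sub>M l\<in>A. S)"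
    using B \<open>finite A\<close> by (intro sets_PiM_I_finite) auto
  have eq: "(\<lambda>w. \<lambda>l\<in>A. X (i l) (w (lab l))) -` Pi\<^sub>E A B \<inter> space (\<Pi>\<^sub>M k\<in>K. M) = Pi\<^sub>E K C"
  proof (intro set_eqI iffI)
    fix w assume w: "w \<in> (\<lambda>w. \<lambda>l\<in>A. X (i l) (w (lab l))) -` Pi\<^sub>E A B \<inter> space (\<Pi>\<^sub>M k\<in>K. M)"
    then have wK: "w \<in> Pi\<^sub>E K (\<lambda>_. space M)" by (simp add: space_PiM)
    have wB: "X (i l) (w (lab l)) \<in> B l" if "l \<in> A" for l
      using w that by (auto simp: PiE_iff)
    have "w k \<in> C k" if "k \<in> K" for k
    proof (cases "k \<in> lab ` A")
      case True
      then obtain l where "l \<in> A" "k = lab l" by auto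
      then show ?thesis using Clab wB wK that by (auto simp: PiE_iff)
    qed (use wK that in \<open>auto simp: C_def PiE_iff\<close>)
    then show "w \<in> Pi\<^sub>E K C" using wK by (auto simp: PiE_iff)
  next
    fix w assume w: "w \<in> Pi\<^sub>E K C"
    have "w k \<in> space M" if "k \<in> K" for k
      using w that sets.sets_into_space[OF C[of k]] by (auto simp: PiE_iff)
    then have "w \<in> space (\<Pi>\<^sub>M k\<in>K. M)" using w by (auto simp: space_PiM PiE_iff)
    moreover have "X (i l) (w (lab l)) \<in> B l" if "l \<in> A" for l
      using w that assms(4) Clab[OF that] by (auto simp: PiE_iff image_subset_iff)
    ultimately show "w \<in> (\<lambda>w. \<lambda>l\<in>A. X (i l) (w (lab l))) -` Pi\<^sub>E A B \<inter> space (\<Pi>\<^sub>M k\<in>K. M)"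
      by auto
  qed
  have "emeasure (distr (\<Pi>\<^sub>M k\<in>K. M) (\<Pi>\<^sub>M l\<in>A. S) (\<lambda>w. \<lambda>l\<in>A. X (i l) (w (lab l)))) (Pi\<^sub>E A B) =
      emeasure (\<Pi>\<^sub>M k\<in>K. M) (Pi\<^sub>E K C)"
    using BS assms(4) by (subst emeasure_distr) (auto simp: eq)
  also have "\<dots> = (\<Prod>k\<in>K. emeasure M (C k))"
    using C \<open>finite K\<close> by (intro copies.emeasure_PiM) auto
  also have "\<dots> = (\<Prod>k\<in>lab ` A. emeasure M (C k))"
    using assms by (intro prod.mono_neutral_right) (auto simp: C_def emeasure_space_1)
  also have "\<dots> = (\<Prod>l\<in>A. emeasure M (X (i l) -` B l \<inter> space M))"
    using assms(3) Clab by (simp add: prod.reindex)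
  also have "\<dots> = (\<Prod>l\<in>A. emeasure \<mu> (B l))"
  proof (intro prod.cong refl)
    fix l assume "l \<in> A"
    then have "B l \<in> sets S" using B by simp
    then show "emeasure M (X (i l) -` B l \<inter> space M) = emeasure \<mu> (B l)"
      by (subst law_X[of "i l", symmetric]) (simp add: emeasure_distr)
  qed
  finally show "emeasure (distr (\<Pi>\<^sub>M k\<in>K. M) (\<Pi>\<^sub>M l\<in>A. S) (\<lambda>w. \<lambda>l\<in>A. X (i l) (w (lab l)))) (Pi\<^sub>E A B) =
      (\<Prod>l\<in>A. emeasure \<mu> (B l))" .
qed

end

text \<open>The kernel is a parameter because the decomposition is carried out for \<open>h\<close>
  and again for each of its truncations.\<close>

locale square_integrable_kernel = identically_distributed M S X \<mu>
  for M :: "'a measure" and S :: "'s measure" and X :: "int \<Rightarrow> 'a \<Rightarrow> 's" and \<mu> :: "'s measure" +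
  fixes m :: nat and h :: "(nat \<Rightarrow> 's) \<Rightarrow> real"
  assumes m_ge_2: "m \<ge> 2"
    and h_meas [measurable]: "h \<in> borel_measurable (\<Pi>\<^sub>M j\<in>{1..m}. S)"
    and h_sym: "symmetric_kernel S m h"
    and h_square: "integrable (\<Pi>\<^sub>M j\<in>{1..m}. \<mu>) (\<lambda>x. (h x)\<^sup>2)"
begin

section \<open>Hoeffding projection and degenerate remainder\<close>

definition h1 :: "'s \<Rightarrow> real" where "h1 = first_projection \<mu> m h"

definition \<theta> :: real where "\<theta> = (\<integral>x. h x \<partial>(\<Pi>\<^sub>M j\<in>{1..m}. \<mu>))"

definition remainder :: "(nat \<Rightarrow> 's) \<Rightarrow> real" where
  "remainder x = h x - \<theta> - (\<Sum>l\<in>{1..m}. h1 (x l) - \<theta>)"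

definition cons :: "'s \<Rightarrow> (nat \<Rightarrow> 's) \<Rightarrow> nat \<Rightarrow> 's" where
  "cons x y = (\<lambda>j\<in>{1..m}. if j = 1 then x else y (j - 1))"

lemma h1_eq: "h1 x = (\<integral>y. h (cons x y) \<partial>(\<Pi>\<^sub>M j\<in>{1..m-1}. \<mu>))"
  unfolding h1_def first_projection_def cons_def ..

lemma cons_measurable [measurable]:
  "(\<lambda>(x, y). cons x y) \<in> measurable (S \<Otimes>\<^sub>M (\<Pi>\<^sub>M j\<in>{1..m-1}. S)) (\<Pi>\<^sub>M j\<in>{1..m}. S)"
  unfolding cons_def case_prod_beta
proof (rule measurable_restrict)
  fix j assume "j \<in> {1..m}"
  then have "j - 1 \<in> {1..m-1}" if "j \<noteq> 1" using that by auto
  then show "(\<lambda>z. if j = 1 then fst z else snd z (j - 1)) \<in> measurable (S \<Otimes>\<^sub>M (\<Pi>\<^sub>M j\<in>{1..m-1}. S)) S"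
    by (cases "j = 1") (auto intro!: measurable_compose[OF measurable_snd] measurable_component_singleton)
qed

lemma h1_measurable [measurable]: "h1 \<in> borel_measurable S"
proof -
  interpret L: prob_space "\<Pi>\<^sub>M j\<in>{1..m-1}. \<mu>" by (rule prob_space_laws)
  have "(\<lambda>(x, y). h (cons x y)) \<in> borel_measurable (S \<Otimes>\<^sub>M (\<Pi>\<^sub>M j\<in>{1..m-1}. \<mu>))"
    using measurable_compose[OF cons_measurable h_meas] by (simp add: case_prod_beta cong: measurable_cong_sets)
  from L.borel_measurable_lebesgue_integral[OF this] show ?thesis
    unfolding h1_eq[abs_def] .
qed

text \<open>With the first argument split off, Fubini's theorem for pairs applies; this is how
  integrals of \<open>h1\<close> become integrals of \<open>h\<close>.\<close>

lemma law_cons: "distr (\<mu> \<Otimes>\<^sub>M (\<Pi>\<^sub>M j\<in>{1..m-1}. \<mu>)) (\<Pi>\<^sub>M j\<in>{1..m}. S) (\<lambda>(x, y). cons x y) = (\<Pi>\<^sub>M j\<in>{1..m}. \<mu>)"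
proof (rule laws.PiM_eqI)
  interpret L: prob_space "\<Pi>\<^sub>M j\<in>{1..m-1}. \<mu>" by (rule prob_space_laws)
  interpret P: pair_prob_space \<mu> "\<Pi>\<^sub>M j\<in>{1..m-1}. \<mu>" by unfold_locales
  show "finite {1..m}" by simp
  show "sets (distr (\<mu> \<Otimes>\<^sub>M (\<Pi>\<^sub>M j\<in>{1..m-1}. \<mu>)) (\<Pi>\<^sub>M j\<in>{1..m}. S) (\<lambda>(x, y). cons x y)) = sets (\<Pi>\<^sub>M j\<in>{1..m}. \<mu>)"
    by (simp add: sets_PiM_law)
  fix B assume B: "\<And>l. l \<in> {1..m} \<Longrightarrow> B l \<in> sets \<mu>"
  have BS: "Pi\<^sub>E {1..m} B \<in> sets (\<Pi>\<^sub>M j\<in>{1..m}. S)" using B by (intro sets_PiM_I_finite) auto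
  have 1: "1 \<in> {1..m}" using m_ge_2 by auto
  have eq: "(\<lambda>(x, y). cons x y) -` Pi\<^sub>E {1..m} B \<inter> space (\<mu> \<Otimes>\<^sub>M (\<Pi>\<^sub>M j\<in>{1..m-1}. \<mu>)) =
      B 1 \<times> Pi\<^sub>E {1..m-1} (\<lambda>j. B (Suc j))"
  proof (intro set_eqI iffI)
    fix z assume z: "z \<in> (\<lambda>(x, y). cons x y) -` Pi\<^sub>E {1..m} B \<inter> space (\<mu> \<Otimes>\<^sub>M (\<Pi>\<^sub>M j\<in>{1..m-1}. \<mu>))"
    obtain x y where zxy: "z = (x, y)" using prod.exhaust by blast
    with z have xy: "cons x y \<in> Pi\<^sub>E {1..m} B"
      "(x, y) \<in> space (\<mu> \<Otimes>\<^sub>M (\<Pi>\<^sub>M j\<in>{1..m-1}. \<mu>))" by auto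
    then have c: "cons x y l \<in> B l" if "l \<in> {1..m}" for l using that by (auto simp: PiE_iff)
    have "x \<in> B 1" using c[OF 1] 1 by (simp add: cons_def)
    moreover have "y j \<in> B (Suc j)" if "j \<in> {1..m-1}" for j
      using c[of "Suc j"] that by (auto simp: cons_def)
    ultimately show "z \<in> B 1 \<times> Pi\<^sub>E {1..m-1} (\<lambda>j. B (Suc j))"
      using xy(2) unfolding zxy by (auto simp: space_pair_measure space_PiM PiE_iff)
  next
    fix z assume "z \<in> B 1 \<times> Pi\<^sub>E {1..m-1} (\<lambda>j. B (Suc j))"
    then obtain x y where zxy: "z = (x, y)" and xy: "x \<in> B 1" "y \<in> Pi\<^sub>E {1..m-1} (\<lambda>j. B (Suc j))" by auto
    have "cons x y l \<in> B l" if "l \<in> {1..m}" for l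
    proof (cases "l = 1")
      case False
      then have "l - 1 \<in> {1..m-1}" "Suc (l - 1) = l" using that by auto
      moreover from this(1) have "y (l - 1) \<in> B (Suc (l - 1))" by (rule PiE_mem[OF xy(2)])
      ultimately show ?thesis using False that by (simp add: cons_def)
    qed (use xy that in \<open>auto simp: cons_def\<close>)
    then have "cons x y \<in> Pi\<^sub>E {1..m} B" by (auto simp: cons_def PiE_iff)
    moreover have "x \<in> space S" using xy B[OF 1] sets.sets_into_space by (metis sets_law subsetD)
    moreover have "y j \<in> space S" if "j \<in> {1..m-1}" for j
    proof -
      have "Suc j \<in> {1..m}" using that by auto
      from B[OF this] have "B (Suc j) \<in> sets S" by simp
      then have "B (Suc j) \<subseteq> space S" by (rule sets.sets_into_space)
      then show ?thesis using PiE_mem[OF xy(2) that] by auto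
    qed
    ultimately show "z \<in> (\<lambda>(x, y). cons x y) -` Pi\<^sub>E {1..m} B \<inter> space (\<mu> \<Otimes>\<^sub>M (\<Pi>\<^sub>M j\<in>{1..m-1}. \<mu>))"
      using xy unfolding zxy by (auto simp: space_pair_measure space_PiM PiE_iff)
  qed
  have BY: "Pi\<^sub>E {1..m-1} (\<lambda>j. B (Suc j)) \<in> sets (\<Pi>\<^sub>M j\<in>{1..m-1}. \<mu>)"
  proof (rule sets_PiM_I_finite)
    show "B (Suc j) \<in> sets \<mu>" if "j \<in> {1..m-1}" for j
      using that by (intro B) auto
  qed simp
  have "emeasure (distr (\<mu> \<Otimes>\<^sub>M (\<Pi>\<^sub>M j\<in>{1..m-1}. \<mu>)) (\<Pi>\<^sub>M j\<in>{1..m}. S) (\<lambda>(x, y). cons x y)) (Pi\<^sub>E {1..m} B) =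
      emeasure (\<mu> \<Otimes>\<^sub>M (\<Pi>\<^sub>M j\<in>{1..m-1}. \<mu>)) (B 1 \<times> Pi\<^sub>E {1..m-1} (\<lambda>j. B (Suc j)))"
    using BS by (subst emeasure_distr) (auto simp only: eq, measurable)
  also have "\<dots> = emeasure \<mu> (B 1) * emeasure (\<Pi>\<^sub>M j\<in>{1..m-1}. \<mu>) (Pi\<^sub>E {1..m-1} (\<lambda>j. B (Suc j)))"
    using B[OF 1] BY by (intro L.emeasure_pair_measure_Times)
  also have "\<dots> = emeasure \<mu> (B 1) * (\<Prod>j\<in>{1..m-1}. emeasure \<mu> (B (Suc j)))"
    proof (subst laws.emeasure_PiM)
    show "B (Suc j) \<in> sets \<mu>" if "j \<in> {1..m-1}" for j
      using that by (intro B) auto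
  qed simp_all
  also have "\<dots> = (\<Prod>j\<in>{1..m}. emeasure \<mu> (B j))"
  proof -
    have "(\<Prod>j\<in>{1..m-1}. emeasure \<mu> (B (Suc j))) = (\<Prod>j\<in>Suc ` {1..m-1}. emeasure \<mu> (B j))"
      by (subst prod.reindex) auto
    also have "Suc ` {1..m-1} = {2..m}" using m_ge_2 by (simp add: numeral_2_eq_2 One_nat_def)
    finally have "(\<Prod>j\<in>{1..m-1}. emeasure \<mu> (B (Suc j))) = (\<Prod>j\<in>{2..m}. emeasure \<mu> (B j))" .
    moreover have "{1..m} = insert 1 {2..m}" using m_ge_2 by auto
    ultimately show ?thesis by simp
  qed
  finally show "emeasure (distr (\<mu> \<Otimes>\<^sub>M (\<Pi>\<^sub>M j\<in>{1..m-1}. \<mu>)) (\<Pi>\<^sub>M j\<in>{1..m}. S) (\<lambda>(x, y). cons x y)) (Pi\<^sub>E {1..m} B) =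
      (\<Prod>j\<in>{1..m}. emeasure \<mu> (B j))" .
qed

lemma h_integrable: "integrable (\<Pi>\<^sub>M j\<in>{1..m}. \<mu>) h"
proof -
  interpret L: prob_space "\<Pi>\<^sub>M j\<in>{1..m}. \<mu>" by (rule prob_space_laws)
  show ?thesis by (rule L.square_integrable_imp_integrable[OF _ h_square]) measurable
qed

lemma cons_measurable' [measurable]:
  "(\<lambda>(x, y). cons x y) \<in> measurable (\<mu> \<Otimes>\<^sub>M (\<Pi>\<^sub>M j\<in>{1..m-1}. \<mu>)) (\<Pi>\<^sub>M j\<in>{1..m}. S)"
  by measurable

lemma h1_mean: "(\<integral>x. h1 x \<partial>\<mu>) = \<theta>"
proof -
  interpret L: prob_space "\<Pi>\<^sub>M j\<in>{1..m-1}. \<mu>" by (rule prob_space_laws)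
  interpret P: pair_prob_space \<mu> "\<Pi>\<^sub>M j\<in>{1..m-1}. \<mu>" by unfold_locales
  have "integrable (\<mu> \<Otimes>\<^sub>M (\<Pi>\<^sub>M j\<in>{1..m-1}. \<mu>)) (\<lambda>(x, y). h (cons x y))"
    using h_integrable unfolding law_cons[symmetric] by (subst (asm) integrable_distr_eq) (simp_all add: case_prod_unfold cons_measurable'[unfolded case_prod_unfold])
  from P.integral_fst[OF this] have "(\<integral>x. h1 x \<partial>\<mu>) = (\<integral>z. h ((\<lambda>(x, y). cons x y) z) \<partial>(\<mu> \<Otimes>\<^sub>M (\<Pi>\<^sub>M j\<in>{1..m-1}. \<mu>)))"
    unfolding h1_eq case_prod_beta .
  also have "\<dots> = \<theta>"
    unfolding \<theta>_def using integral_distr[OF cons_measurable' h_meas] unfolding law_cons by simp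
  finally show ?thesis .
qed

text \<open>Jensen's inequality in the variables integrated out, obtained from the non-negativity of
  a variance on each section. Sections are square integrable only almost everywhere, hence
  \<open>AE\<close>.\<close>

lemma h1_square: "integrable \<mu> (\<lambda>x. (h1 x)\<^sup>2)"
  and h1_square_le: "(\<integral>x. (h1 x)\<^sup>2 \<partial>\<mu>) \<le> (\<integral>x. (h x)\<^sup>2 \<partial>(\<Pi>\<^sub>M j\<in>{1..m}. \<mu>))"
proof -
  interpret L: prob_space "\<Pi>\<^sub>M j\<in>{1..m-1}. \<mu>" by (rule prob_space_laws)
  interpret P: pair_prob_space \<mu> "\<Pi>\<^sub>M j\<in>{1..m-1}. \<mu>" by unfold_locales
  have int: "integrable (\<mu> \<Otimes>\<^sub>M (\<Pi>\<^sub>M j\<in>{1..m-1}. \<mu>)) (\<lambda>(x, y). (h (cons x y))\<^sup>2)"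
    using h_square unfolding law_cons[symmetric] by (subst (asm) integrable_distr_eq) (simp_all add: case_prod_unfold cons_measurable'[unfolded case_prod_unfold])
  have i2: "integrable \<mu> (\<lambda>x. \<integral>y. (h (cons x y))\<^sup>2 \<partial>(\<Pi>\<^sub>M j\<in>{1..m-1}. \<mu>))"
    using P.integrable_fst[OF int] by simp
  have "AE x in \<mu>. integrable (\<Pi>\<^sub>M j\<in>{1..m-1}. \<mu>) (\<lambda>y. (h (cons x y))\<^sup>2)"
    using P.AE_integrable_fst[OF int] by simp
  then have ae: "AE x in \<mu>. norm ((h1 x)\<^sup>2) \<le> norm (\<integral>y. (h (cons x y))\<^sup>2 \<partial>(\<Pi>\<^sub>M j\<in>{1..m-1}. \<mu>))"
  proof (rule AE_mp, intro AE_I2 impI)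
    fix x assume x: "x \<in> space \<mu>" and i: "integrable (\<Pi>\<^sub>M j\<in>{1..m-1}. \<mu>) (\<lambda>y. (h (cons x y))\<^sup>2)"
    have [measurable]: "(\<lambda>y. h (cons x y)) \<in> borel_measurable (\<Pi>\<^sub>M j\<in>{1..m-1}. \<mu>)"
      using measurable_compose[OF measurable_Pair1'[of x \<mu> "\<Pi>\<^sub>M j\<in>{1..m-1}. \<mu>"] measurable_compose[OF cons_measurable' h_meas]] x
      by simp
    have i1: "integrable (\<Pi>\<^sub>M j\<in>{1..m-1}. \<mu>) (\<lambda>y. h (cons x y))"
      by (rule L.square_integrable_imp_integrable[OF _ i]) measurable
    have "0 \<le> L.variance (\<lambda>y. h (cons x y))" by (rule L.variance_positive)
    then have "(h1 x)\<^sup>2 \<le> (\<integral>y. (h (cons x y))\<^sup>2 \<partial>(\<Pi>\<^sub>M j\<in>{1..m-1}. \<mu>))"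
      using L.variance_eq[OF i1 i] by (simp add: h1_eq)
    then show "norm ((h1 x)\<^sup>2) \<le> norm (\<integral>y. (h (cons x y))\<^sup>2 \<partial>(\<Pi>\<^sub>M j\<in>{1..m-1}. \<mu>))"
      by simp
  qed
  show int1: "integrable \<mu> (\<lambda>x. (h1 x)\<^sup>2)"
    by (rule Bochner_Integration.integrable_bound[OF i2 _ ae]) measurable
  have "(\<integral>x. (h1 x)\<^sup>2 \<partial>\<mu>) \<le> (\<integral>x. (\<integral>y. (h (cons x y))\<^sup>2 \<partial>(\<Pi>\<^sub>M j\<in>{1..m-1}. \<mu>)) \<partial>\<mu>)"
    using ae by (intro integral_mono_AE int1 i2) auto
  also have "\<dots> = (\<integral>z. (h ((\<lambda>(x, y). cons x y) z))\<^sup>2 \<partial>(\<mu> \<Otimes>\<^sub>M (\<Pi>\<^sub>M j\<in>{1..m-1}. \<mu>)))"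
    using P.integral_fst[OF int] unfolding case_prod_beta .
  also have "\<dots> = (\<integral>x. (h x)\<^sup>2 \<partial>(\<Pi>\<^sub>M j\<in>{1..m}. \<mu>))"
    using integral_distr[OF cons_measurable' borel_measurable_power[OF h_meas]] unfolding law_cons by simp
  finally show "(\<integral>x. (h1 x)\<^sup>2 \<partial>\<mu>) \<le> (\<integral>x. (h x)\<^sup>2 \<partial>(\<Pi>\<^sub>M j\<in>{1..m}. \<mu>))" .
qed

lemma h1_integrable: "integrable \<mu> h1"
  by (rule law.square_integrable_imp_integrable[OF _ h1_square]) measurable

lemma law_component: "finite A \<Longrightarrow> l \<in> A \<Longrightarrow> distr (\<Pi>\<^sub>M j\<in>A. \<mu>) \<mu> (\<lambda>x. x l) = \<mu>" for A :: "nat set"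
  using prob_space_law by (intro distr_PiM_component) auto

lemma h1_component_integrable:
  "finite A \<Longrightarrow> l \<in> A \<Longrightarrow> integrable (\<Pi>\<^sub>M j\<in>A. \<mu>) (\<lambda>x. h1 (x l))" for A :: "nat set"
  using h1_integrable integrable_distr_eq[of "\<lambda>x. x l" "\<Pi>\<^sub>M j\<in>A. \<mu>" \<mu> h1] law_component[of A l] by auto

lemma h1_component_integral:
  "finite A \<Longrightarrow> l \<in> A \<Longrightarrow> (\<integral>x. h1 (x l) \<partial>(\<Pi>\<^sub>M j\<in>A. \<mu>)) = \<theta>" for A :: "nat set"
  using integral_distr[of "\<lambda>x. x l" "\<Pi>\<^sub>M j\<in>A. \<mu>" \<mu> h1] law_component[of A l] h1_mean by auto

lemma remainder_measurable [measurable]: "remainder \<in> borel_measurable (\<Pi>\<^sub>M j\<in>{1..m}. S)"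
  unfolding remainder_def by measurable

lemma h_insert_coordinate:
  assumes l0: "l0 \<in> {1..m}" and x0: "x0 \<in> space S"
  defines "A \<equiv> {1..m} - {l0}"
  defines "\<xi> \<equiv> \<lambda>z. \<lambda>l\<in>{1..m}. if l = l0 then x0 else z l"
  shows "(\<integral>z. h (\<xi> z) \<partial>(\<Pi>\<^sub>M j\<in>A. \<mu>)) = h1 x0"
proof -
  define \<tau> where "\<tau> = Transposition.transpose 1 l0"
  have 1: "1 \<in> {1..m}" using m_ge_2 by simp
  have \<tau>: "\<tau> permutes {1..m}" unfolding \<tau>_def using 1 l0 by (rule permutes_swap_id)
  have \<tau>1: "\<tau> 1 = l0" by (simp add: \<tau>_def)
  have \<tau>m: "\<tau> j \<in> {1..m}" if "j \<in> {1..m}" for j using \<tau> that permutes_in_image by metis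
  have \<tau>inj: "\<tau> i = \<tau> j \<longleftrightarrow> i = j" for i j using permutes_inj[OF \<tau>] by (auto dest: injD)
  define \<rho> where "\<rho> z = (\<lambda>j\<in>{1..m-1}. z (\<tau> (Suc j)))" for z :: "nat \<Rightarrow> 's"
  have \<rho>A: "\<tau> (Suc j) \<in> A" if "j \<in> {1..m-1}" for j
  proof -
    have "Suc j \<in> {1..m}" "Suc j \<noteq> 1" using that by auto
    then show ?thesis using \<tau>m[of "Suc j"] \<tau>inj[of "Suc j" 1] \<tau>1 unfolding A_def by auto
  qed
  have dist: "distr (\<Pi>\<^sub>M j\<in>A. \<mu>) (\<Pi>\<^sub>M j\<in>{1..m-1}. \<mu>) \<rho> = (\<Pi>\<^sub>M j\<in>{1..m-1}. \<mu>)"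
    unfolding \<rho>_def using prob_space_law \<rho>A
    by (intro distr_PiM_reindex) (auto simp: inj_on_def \<tau>inj)
  have \<rho>m [measurable]: "\<rho> \<in> measurable (\<Pi>\<^sub>M j\<in>A. \<mu>) (\<Pi>\<^sub>M j\<in>{1..m-1}. \<mu>)"
    unfolding \<rho>_def by (intro measurable_restrict measurable_component_singleton \<rho>A)
  have hc [measurable]: "(\<lambda>y. h (cons x0 y)) \<in> borel_measurable (\<Pi>\<^sub>M j\<in>{1..m-1}. \<mu>)"
    using measurable_compose[OF measurable_Pair1'[of x0 \<mu> "\<Pi>\<^sub>M j\<in>{1..m-1}. \<mu>"] measurable_compose[OF cons_measurable' h_meas]] x0
    by simp
  have eq: "h (\<xi> z) = h (cons x0 (\<rho> z))" if z: "z \<in> space (\<Pi>\<^sub>M j\<in>A. \<mu>)" for z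
  proof -
    have "\<xi> z \<in> space (\<Pi>\<^sub>M j\<in>{1..m}. S)"
      using z x0 unfolding \<xi>_def A_def by (auto simp: space_PiM PiE_iff)
    then have "h (\<xi> z) = h (\<lambda>j\<in>{1..m}. \<xi> z (\<tau> j))"
      using h_sym \<tau> unfolding symmetric_kernel_def by metis
    also have "(\<lambda>j\<in>{1..m}. \<xi> z (\<tau> j)) = cons x0 (\<rho> z)"
    proof
      fix j
      show "(\<lambda>j\<in>{1..m}. \<xi> z (\<tau> j)) j = cons x0 (\<rho> z) j"
      proof (cases "j \<in> {1..m}")
        case True
        show ?thesis
        proof (cases "j = 1")
          case True
          then show ?thesis using 1 l0 by (simp add: cons_def \<xi>_def \<tau>1)
        next
          case False
          then have "j - 1 \<in> {1..m-1}" "Suc (j - 1) = j" using True by auto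
          moreover have "\<tau> j \<noteq> l0" using \<tau>inj[of j 1] False \<tau>1 by auto
          ultimately show ?thesis using True False \<tau>m[OF True] by (simp add: cons_def \<xi>_def \<rho>_def)
        qed
      next
        case False
        then show ?thesis unfolding cons_def by (simp only: restrict_def if_False)
      qed
    qed
    finally show ?thesis .
  qed
  have "(\<integral>z. h (\<xi> z) \<partial>(\<Pi>\<^sub>M j\<in>A. \<mu>)) = (\<integral>z. h (cons x0 (\<rho> z)) \<partial>(\<Pi>\<^sub>M j\<in>A. \<mu>))"
    using eq by (intro Bochner_Integration.integral_cong) auto
  also have "\<dots> = (\<integral>y. h (cons x0 y) \<partial>(\<Pi>\<^sub>M j\<in>{1..m-1}. \<mu>))"
    using integral_distr[OF \<rho>m hc] unfolding dist by simp
  finally show ?thesis unfolding h1_eq .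
qed

text \<open>
  No exceptional null set is needed here: where \<open>h\<close> is not integrable in the remaining
  coordinates, neither is \<open>remainder\<close>, and both Bochner integrals are 0.
\<close>

lemma remainder_degenerate:
  assumes l0: "l0 \<in> {1..m}" and x0: "x0 \<in> space S"
  shows "(\<integral>z. remainder (\<lambda>l\<in>{1..m}. if l = l0 then x0 else z l) \<partial>(\<Pi>\<^sub>M j\<in>{1..m} - {l0}. \<mu>)) = 0"
proof -
  define A where "A = {1..m} - {l0}"
  define \<xi> where "\<xi> z = (\<lambda>l\<in>{1..m}. if l = l0 then x0 else z l)" for z
  interpret L: prob_space "\<Pi>\<^sub>M j\<in>A. \<mu>" by (rule prob_space_laws)
  have A: "finite A" "{1..m} = insert l0 A" "l0 \<notin> A" using l0 by (auto simp: A_def)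
  define G where "G z = h1 x0 + (\<Sum>l\<in>A. h1 (z l) - \<theta>)" for z
  have remainder: "remainder (\<xi> z) = h (\<xi> z) - G z" for z
  proof -
    have "(\<Sum>l\<in>{1..m}. h1 (\<xi> z l) - \<theta>) = (h1 x0 - \<theta>) + (\<Sum>l\<in>A. h1 (\<xi> z l) - \<theta>)"
      unfolding A(2) using A l0 by (subst sum.insert) (auto simp: \<xi>_def)
    also have "(\<Sum>l\<in>A. h1 (\<xi> z l) - \<theta>) = (\<Sum>l\<in>A. h1 (z l) - \<theta>)"
      by (intro sum.cong refl) (auto simp: \<xi>_def A_def)
    finally show ?thesis unfolding remainder_def G_def by simp
  qed
  have Gi: "integrable (\<Pi>\<^sub>M j\<in>A. \<mu>) G"
    unfolding G_def using A(1)
    by (intro Bochner_Integration.integrable_add Bochner_Integration.integrable_sum Bochner_Integration.integrable_diff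
        h1_component_integrable) auto
  have Gint: "(\<integral>z. G z \<partial>(\<Pi>\<^sub>M j\<in>A. \<mu>)) = h1 x0"
    unfolding G_def using A(1)
    by (simp add: h1_component_integrable h1_component_integral L.prob_space)
  show ?thesis
  proof (cases "integrable (\<Pi>\<^sub>M j\<in>A. \<mu>) (\<lambda>z. h (\<xi> z))")
    case True
    then have "(\<integral>z. remainder (\<xi> z) \<partial>(\<Pi>\<^sub>M j\<in>A. \<mu>)) = (\<integral>z. h (\<xi> z) \<partial>(\<Pi>\<^sub>M j\<in>A. \<mu>)) - h1 x0"
      using Gi Gint unfolding remainder by simp
    also have "\<dots> = 0" using h_insert_coordinate[OF l0 x0] unfolding \<xi>_def A_def by simp
    finally show ?thesis unfolding \<xi>_def A_def .
  next
    case False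
    have "\<not> integrable (\<Pi>\<^sub>M j\<in>A. \<mu>) (\<lambda>z. remainder (\<xi> z))"
    proof
      assume "integrable (\<Pi>\<^sub>M j\<in>A. \<mu>) (\<lambda>z. remainder (\<xi> z))"
      then have "integrable (\<Pi>\<^sub>M j\<in>A. \<mu>) (\<lambda>z. remainder (\<xi> z) + G z)" using Gi by simp
      then show False using False unfolding remainder by simp
    qed
    then show ?thesis unfolding \<xi>_def A_def by (rule not_integrable_integral_eq)
  qed
qed

text \<open>The label belongs to the time index rather than to the argument position, so equal
  indices in two tuples always read the same copy.\<close>

definition remainder_at :: "(int \<Rightarrow> nat) \<Rightarrow> (nat \<Rightarrow> int) \<Rightarrow> (nat \<Rightarrow> 'a) \<Rightarrow> real" where
  "remainder_at g i w = remainder (\<lambda>l\<in>{1..m}. X (i l) (w (g (i l))))"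

lemma remainder_at_measurable:
  assumes "(g \<circ> i) ` {1..m} \<subseteq> K"
  shows "remainder_at g i \<in> borel_measurable (\<Pi>\<^sub>M k\<in>K. M)"
  unfolding remainder_at_def
  using measurable_compose[OF decoupled_tuple_measurable[OF assms, of i] remainder_measurable] by (simp add: comp_def)

text \<open>All arguments of the first remainder except number \<open>l0\<close> read copies that
  occur nowhere else. Integrating over those copies with the rest frozen leaves the second remainder
  times an integral of \<open>remainder\<close> over all coordinates but one, which is 0.\<close>

lemma remainder_at_orthogonal:
  assumes K: "finite K" and i: "inj_on (g \<circ> i) {1..m}" "(g \<circ> i) ` {1..m} \<subseteq> K"
    and j: "(g \<circ> j) ` {1..m} \<subseteq> K"
    and int: "integrable (\<Pi>\<^sub>M k\<in>K. M) (\<lambda>w. remainder_at g i w * remainder_at g j w)"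
    and l0: "l0 \<in> {1..m}" and sep: "\<And>l. l \<in> {1..m} - {l0} \<Longrightarrow> g (i l) \<notin> (g \<circ> j) ` {1..m}"
  shows "(\<integral>w. remainder_at g i w * remainder_at g j w \<partial>(\<Pi>\<^sub>M k\<in>K. M)) = 0"
proof -
  define A where "A = {1..m} - {l0}"
  \<comment> \<open>\<open>J0\<close> holds the labels that are integrated first; position
    \<open>l0\<close> and everything the second tuple reads have their labels in
    \<open>I0\<close>.\<close>
  define J0 where "J0 = (g \<circ> i) ` A"
  define I0 where "I0 = K - J0"
  have AJ: "I0 \<inter> J0 = {}" "finite I0" "finite J0" "I0 \<union> J0 = K"
    using K i(2) unfolding I0_def J0_def A_def by auto
  have l0I: "g (i l0) \<in> I0"
  proof -
    have "g (i l0) \<noteq> g (i x)" if "x \<in> A" for x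
      using inj_onD[OF i(1), of l0 x] that l0 by (auto simp: A_def)
    then show ?thesis using i(2) l0 unfolding I0_def J0_def by auto
  qed
  have jI: "g (j l) \<in> I0" if "l \<in> {1..m}" for l
  proof -
    have "g (j l) \<noteq> g (i x)" if "x \<in> A" for x
      using sep[of x] that \<open>l \<in> {1..m}\<close> unfolding A_def by force
    then show ?thesis using j that unfolding I0_def J0_def by auto
  qed
  have lJ: "g (i l) \<in> J0" if "l \<in> A" for l using that unfolding J0_def by auto
  have injA: "inj_on (g \<circ> i) A" using i(1) by (rule inj_on_subset) (auto simp: A_def)
  have law: "distr (\<Pi>\<^sub>M k\<in>J0. M) (\<Pi>\<^sub>M l\<in>A. S) (\<lambda>w. \<lambda>l\<in>A. X (i l) (w ((g \<circ> i) l))) = (\<Pi>\<^sub>M l\<in>A. \<mu>)"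
    using AJ by (intro law_decoupled_tuple injA) (auto simp: J0_def A_def)
  have mA: "(\<lambda>w. \<lambda>l\<in>A. X (i l) (w ((g \<circ> i) l))) \<in> measurable (\<Pi>\<^sub>M k\<in>J0. M) (\<Pi>\<^sub>M l\<in>A. S)"
    by (rule decoupled_tuple_measurable) (auto simp: J0_def)
  have "(\<integral>w. remainder_at g i w * remainder_at g j w \<partial>(\<Pi>\<^sub>M k\<in>K. M)) =
     (\<integral>x. (\<integral>y. remainder_at g i (merge I0 J0 (x, y)) * remainder_at g j (merge I0 J0 (x, y)) \<partial>(\<Pi>\<^sub>M k\<in>J0. M)) \<partial>(\<Pi>\<^sub>M k\<in>I0. M))"
    using copies.product_integral_fold[OF AJ(1-3), of "\<lambda>w. remainder_at g i w * remainder_at g j w"] int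
    unfolding AJ(4) by simp
  also have "\<dots> = (\<integral>x. 0 \<partial>(\<Pi>\<^sub>M k\<in>I0. M))"
  proof (rule Bochner_Integration.integral_cong[OF refl])
    fix x assume x: "x \<in> space (\<Pi>\<^sub>M k\<in>I0. M)"
    define x0 where "x0 = X (i l0) (x (g (i l0)))"
    have x0: "x0 \<in> space S"
      using x l0I measurable_space[OF X_meas] unfolding x0_def by (auto simp: space_PiM PiE_iff)
    define \<xi> where "\<xi> z = (\<lambda>l\<in>{1..m}. if l = l0 then x0 else z l)" for z
    have rj: "remainder_at g j (merge I0 J0 (x, y)) = remainder_at g j x" for y
      unfolding remainder_at_def using jI by (intro arg_cong[where f=remainder] restrict_ext) (simp add: merge_def)
    have ri: "remainder_at g i (merge I0 J0 (x, y)) = remainder (\<xi> (\<lambda>l\<in>A. X (i l) (y ((g \<circ> i) l))))" for y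
      unfolding remainder_at_def \<xi>_def
    proof (intro arg_cong[where f=remainder] restrict_ext)
      fix l assume l: "l \<in> {1..m}"
      show "X (i l) (merge I0 J0 (x, y) (g (i l))) = (if l = l0 then x0 else (\<lambda>l\<in>A. X (i l) (y ((g \<circ> i) l))) l)"
      proof (cases "l = l0")
        case True
        then show ?thesis using l0I by (simp add: x0_def merge_def)
      next
        case False
        then have "l \<in> A" using l by (auto simp: A_def)
        then have "g (i l) \<in> J0" "g (i l) \<notin> I0" using lJ AJ(1) by auto
        then show ?thesis using False \<open>l \<in> A\<close> by (simp add: merge_def)
      qed
    qed
    have \<xi>m: "\<xi> \<in> measurable (\<Pi>\<^sub>M l\<in>A. S) (\<Pi>\<^sub>M l\<in>{1..m}. S)"
      unfolding \<xi>_def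
    proof (rule measurable_restrict)
      fix l assume "l \<in> {1..m}"
      then show "(\<lambda>z. if l = l0 then x0 else z l) \<in> measurable (\<Pi>\<^sub>M l\<in>A. S) S"
        using x0 by (cases "l = l0") (auto simp: A_def intro!: measurable_component_singleton)
    qed
    have "(\<integral>y. remainder_at g i (merge I0 J0 (x, y)) * remainder_at g j (merge I0 J0 (x, y)) \<partial>(\<Pi>\<^sub>M k\<in>J0. M)) =
       (\<integral>y. remainder (\<xi> (\<lambda>l\<in>A. X (i l) (y ((g \<circ> i) l)))) \<partial>(\<Pi>\<^sub>M k\<in>J0. M)) * remainder_at g j x"
      unfolding ri rj by simp
    also have "(\<integral>y. remainder (\<xi> (\<lambda>l\<in>A. X (i l) (y ((g \<circ> i) l)))) \<partial>(\<Pi>\<^sub>M k\<in>J0. M)) = (\<integral>z. remainder (\<xi> z) \<partial>(\<Pi>\<^sub>M l\<in>A. \<mu>))"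
      using integral_distr[OF mA measurable_compose[OF \<xi>m remainder_measurable]] unfolding law by simp
    also have "\<dots> = 0" unfolding \<xi>_def A_def by (rule remainder_degenerate[OF l0 x0])
    finally show "(\<integral>y. remainder_at g i (merge I0 J0 (x, y)) * remainder_at g j (merge I0 J0 (x, y)) \<partial>(\<Pi>\<^sub>M k\<in>J0. M)) = 0" by simp
  qed
  finally show ?thesis by simp
qed

end

section \<open>Second moments of degenerate sums\<close>

text \<open>The coordinate \<open>v\<close> is chosen last: \<open>Q\<close> and \<open>A\<close>
  see only the other coordinates, and these leave at most \<open>a\<close> values for
  \<open>f v\<close>.\<close>

lemma card_PiE_extend_le:
  assumes "finite Z" "finite T" "v \<in> Z" and A: "\<And>x. finite (A x) \<and> card (A x) \<le> a"
  shows "card {f \<in> Z \<rightarrow>\<^sub>E T. Q (restrict f (Z - {v})) \<and> f v \<in> A (restrict f (Z - {v}))}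
     \<le> card {x \<in> (Z - {v}) \<rightarrow>\<^sub>E T. Q x} * a"
proof -
  let ?L = "{f \<in> Z \<rightarrow>\<^sub>E T. Q (restrict f (Z - {v})) \<and> f v \<in> A (restrict f (Z - {v}))}"
  let ?R = "{x \<in> (Z - {v}) \<rightarrow>\<^sub>E T. Q x}"
  have fR: "finite ?R" using assms(1,2) by (auto intro!: finite_subset[OF _ finite_PiE[of "Z - {v}" "\<lambda>_. T"]])
  have "inj_on (\<lambda>f. (restrict f (Z - {v}), f v)) ?L"
  proof (rule inj_onI)
    fix f g assume f: "f \<in> ?L" and g: "g \<in> ?L" and eq: "(restrict f (Z - {v}), f v) = (restrict g (Z - {v}), g v)"
    show "f = g"
    proof (rule PiE_ext)
      show "f \<in> Z \<rightarrow>\<^sub>E T" "g \<in> Z \<rightarrow>\<^sub>E T" using f g by auto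
      show "f x = g x" if "x \<in> Z" for x
        using eq that by (cases "x = v") (auto simp: restrict_def fun_eq_iff split: if_splits)
    qed
  qed
  moreover have "(\<lambda>f. (restrict f (Z - {v}), f v)) ` ?L \<subseteq> (SIGMA x : ?R. A x)"
  proof (rule image_subsetI)
    fix f assume f: "f \<in> ?L"
    then have "restrict f (Z - {v}) \<in> (Z - {v}) \<rightarrow>\<^sub>E T" by auto
    then show "(restrict f (Z - {v}), f v) \<in> (SIGMA x : ?R. A x)" using f by simp
  qed
  ultimately have "card ?L \<le> card (SIGMA x : ?R. A x)"
    using fR A by (intro card_inj_on_le) auto
  also have "\<dots> = (\<Sum>x\<in>?R. card (A x))" using fR A by (intro card_SigmaI) auto
  also have "\<dots> \<le> (\<Sum>x\<in>?R. a)" using A by (intro sum_mono) auto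
  finally show ?thesis by simp
qed

text \<open>Each constraint confines one coordinate in terms of another and so removes one factor
  \<open>card T\<close>. The coordinate \<open>v'\<close> can be removed before \<open>v\<close>,
  because the constraint on \<open>v\<close> involves only \<open>u\<close> and \<open>v\<close>,
  both different from \<open>v'\<close>.\<close>

lemma card_PiE_two_constraints_le:
  assumes Z: "finite Z" and T: "finite T" and v: "v \<in> Z" "v' \<in> Z" "v \<noteq> v'"
    and u: "u \<in> Z" "u \<noteq> v" "u \<noteq> v'" and u': "u' \<in> Z" "u' \<noteq> v'"
    and A: "\<And>t. finite (A t) \<and> card (A t) \<le> a" and B: "\<And>t. finite (B t) \<and> card (B t) \<le> b"
  shows "card {f \<in> Z \<rightarrow>\<^sub>E T. f v \<in> A (f u) \<and> f v' \<in> B (f u')} \<le> card T ^ (card Z - 2) * a * b"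
proof -
  have "{f \<in> Z \<rightarrow>\<^sub>E T. f v \<in> A (f u) \<and> f v' \<in> B (f u')} =
    {f \<in> Z \<rightarrow>\<^sub>E T. (\<lambda>x. x v \<in> A (x u)) (restrict f (Z - {v'})) \<and> f v' \<in> (\<lambda>x. B (x u')) (restrict f (Z - {v'}))}"
    using v u u' by auto
  then have "card {f \<in> Z \<rightarrow>\<^sub>E T. f v \<in> A (f u) \<and> f v' \<in> B (f u')} \<le> card {x \<in> (Z - {v'}) \<rightarrow>\<^sub>E T. x v \<in> A (x u)} * b"
    using card_PiE_extend_le[OF Z T v(2), of "\<lambda>x. B (x u')" b "\<lambda>x. x v \<in> A (x u)"] B by simp
  also have "card {x \<in> (Z - {v'}) \<rightarrow>\<^sub>E T. x v \<in> A (x u)} \<le> card ((Z - {v'} - {v}) \<rightarrow>\<^sub>E T) * a"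
  proof -
    have "{x \<in> (Z - {v'}) \<rightarrow>\<^sub>E T. x v \<in> A (x u)} =
      {x \<in> (Z - {v'}) \<rightarrow>\<^sub>E T. True \<and> x v \<in> (\<lambda>x. A (x u)) (restrict x (Z - {v'} - {v}))}"
      using v u by auto
    then show ?thesis
      using card_PiE_extend_le[of "Z - {v'}" T v "\<lambda>x. A (x u)" a "\<lambda>_. True"] A Z T v by simp
  qed
  also have "card ((Z - {v'} - {v}) \<rightarrow>\<^sub>E T) = card T ^ (card Z - 2)"
    using Z v by (simp add: card_PiE card_Diff_singleton diff_diff_add)
  finally show ?thesis by (simp add: mult_right_mono)
qed

section \<open>Tuples classified by their second smallest index distance\<close>

definition index_pairs :: "nat \<Rightarrow> (nat \<times> nat) set" where
  "index_pairs N = {(a, b). a \<in> {1..N} \<and> b \<in> {1..N} \<and> a < b}"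

definition pair_dist :: "(nat \<Rightarrow> int) \<Rightarrow> nat \<times> nat \<Rightarrow> nat" where
  "pair_dist f e = nat \<bar>f (fst e) - f (snd e)\<bar>"

lemma finite_index_pairs [simp]: "finite (index_pairs N)"
  unfolding index_pairs_def by (rule finite_subset[of _ "{1..N} \<times> {1..N}"]) auto

lemma card_index_pairs_le: "card (index_pairs N) \<le> N ^ 2"
proof -
  have "index_pairs N \<subseteq> {1..N} \<times> {1..N}" by (auto simp: index_pairs_def)
  from card_mono[OF _ this] show ?thesis by (simp add: power2_eq_square)
qed

text \<open>\<open>pair_dist f e2 = k\<close> leaves at most 2 values for one endpoint of
  \<open>e2\<close> given the other, and \<open>pair_dist f e1 \<le> k\<close> at most
  \<open>2 * k + 1\<close> values for an endpoint of \<open>e1\<close>. The two restrictions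
  together cost two powers of \<open>n\<close>.\<close>

lemma card_close_pairs_le:
  assumes e1: "e1 \<in> index_pairs N" and e2: "e2 \<in> index_pairs N" and ne: "e1 \<noteq> e2"
  shows "card {f \<in> {1..N} \<rightarrow>\<^sub>E {1..int n}. pair_dist f e2 = k \<and> pair_dist f e1 \<le> k} \<le> n ^ (N - 2) * (2 * k + 1) * 2"
proof -
  obtain u v where 1: "e1 = (u, v)" using prod.exhaust by blast
  obtain a b where 2: "e2 = (a, b)" using prod.exhaust by blast
  have uv: "u \<in> {1..N}" "v \<in> {1..N}" "u < v" "a \<in> {1..N}" "b \<in> {1..N}" "a < b"
    using e1 e2 unfolding 1 2 index_pairs_def by auto
  \<comment> \<open>Two distinct pairs share at most one position, so \<open>e2\<close> has an
    endpoint \<open>v'\<close> outside \<open>e1\<close>. It is the coordinate to be chosen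
    last.\<close>
  have "\<exists>v' u'. {v', u'} = {a, b} \<and> v' \<noteq> u \<and> v' \<noteq> v \<and> v' \<noteq> u' \<and> v' \<in> {1..N} \<and> u' \<in> {1..N}"
  proof (cases "b \<noteq> u \<and> b \<noteq> v")
    case True
    then show ?thesis using uv by (intro exI[of _ b] exI[of _ a]) auto
  next
    case False
    then have "a \<noteq> u \<and> a \<noteq> v" using uv ne 1 2 by auto
    then show ?thesis using uv by (intro exI[of _ a] exI[of _ b]) auto
  qed
  then obtain v' u' where w: "{v', u'} = {a, b}" "v' \<noteq> u" "v' \<noteq> v" "v' \<noteq> u'" "v' \<in> {1..N}" "u' \<in> {1..N}"
    by blast
  have d2: "pair_dist f e2 = nat \<bar>f u' - f v'\<bar>" for f
    using w(1) unfolding 2 pair_dist_def by (auto simp: doubleton_eq_iff abs_minus_commute)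
  have "{f \<in> {1..N} \<rightarrow>\<^sub>E {1..int n}. pair_dist f e2 = k \<and> pair_dist f e1 \<le> k} \<subseteq>
    {f \<in> {1..N} \<rightarrow>\<^sub>E {1..int n}. f v \<in> {f u - int k..f u + int k} \<and> f v' \<in> {f u' - int k, f u' + int k}}"
    unfolding d2 by (auto simp: 1 pair_dist_def nat_le_iff abs_if split: if_splits)
  then have "card {f \<in> {1..N} \<rightarrow>\<^sub>E {1..int n}. pair_dist f e2 = k \<and> pair_dist f e1 \<le> k} \<le>
    card {f \<in> {1..N} \<rightarrow>\<^sub>E {1..int n}. f v \<in> {f u - int k..f u + int k} \<and> f v' \<in> {f u' - int k, f u' + int k}}"
    by (intro card_mono) (auto intro!: finite_subset[OF _ finite_PiE[of "{1..N}" "\<lambda>_. {1..int n}"]])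
  also have "\<dots> \<le> card {1..int n} ^ (card {1..N} - 2) * (2 * k + 1) * 2"
    using uv w by (intro card_PiE_two_constraints_le[where A="\<lambda>t. {t - int k..t + int k}" and B="\<lambda>t. {t - int k, t + int k}"])
      (auto simp: card_insert_if)
  finally show ?thesis by simp
qed

lemma smallest_pairs_exist:
  assumes "N \<ge> 3"
  shows "\<exists>e1\<in>index_pairs N. \<exists>e2\<in>index_pairs N - {e1}. pair_dist f e1 \<le> pair_dist f e2 \<and>
     (\<forall>e\<in>index_pairs N - {e1}. pair_dist f e2 \<le> pair_dist f e)"
proof -
  have ne: "(1, 2) \<in> index_pairs N" "(1, 3) \<in> index_pairs N" using assms by (auto simp: index_pairs_def)
  obtain e1 where e1: "e1 \<in> index_pairs N" "\<forall>e\<in>index_pairs N. pair_dist f e1 \<le> pair_dist f e"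
    using ex_min_if_finite[of "pair_dist f ` index_pairs N"] ne by (force simp: not_less)
  have "(1::nat, 2::nat) \<noteq> (1, 3)" by simp
  then have "index_pairs N - {e1} \<noteq> {}" using ne by blast
  then obtain e2 where "e2 \<in> index_pairs N - {e1}" "\<forall>e\<in>index_pairs N - {e1}. pair_dist f e2 \<le> pair_dist f e"
    using ex_min_if_finite[of "pair_dist f ` (index_pairs N - {e1})"] by (force simp: not_less)
  then show ?thesis using e1 by blast
qed

text \<open>A union bound: there are at most \<open>N ^ 4\<close> candidates for the two closest
  pairs, and for each candidate the tuples are grouped by the second distance \<open>k\<close>,
  which is at most \<open>n\<close> for indices between 1 and \<open>n\<close>.\<close>

lemma sum_smallest_pairs_le:
  fixes \<phi> :: "(nat \<Rightarrow> int) \<Rightarrow> real" and W :: "nat \<Rightarrow> real"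
  assumes N: "N \<ge> 3" and W: "\<And>k. 0 \<le> W k"
    and \<phi>: "\<And>f e1 e2. \<lbrakk>f \<in> F; e1 \<in> index_pairs N; e2 \<in> index_pairs N - {e1};
        pair_dist f e1 \<le> pair_dist f e2; \<forall>e\<in>index_pairs N - {e1}. pair_dist f e2 \<le> pair_dist f e\<rbrakk>
        \<Longrightarrow> \<phi> f \<le> W (pair_dist f e2)"
    and F: "F \<subseteq> {1..N} \<rightarrow>\<^sub>E {1..int n}"
  shows "(\<Sum>f\<in>F. \<phi> f) \<le> real N ^ 4 * real n ^ (N - 2) * (\<Sum>k\<le>n. W k * (2 * (2 * real k + 1)))"
proof -
  let ?P = "{1..N} \<rightarrow>\<^sub>E {1..int n}"
  let ?E = "{(e1, e2). e1 \<in> index_pairs N \<and> e2 \<in> index_pairs N \<and> e1 \<noteq> e2}"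
  have fin: "finite ?P" by (intro finite_PiE) auto
  have finE: "finite ?E" by (rule finite_subset[of _ "index_pairs N \<times> index_pairs N"]) auto
  \<comment> \<open>The majorant forgets minimality and keeps only
    \<open>pair_dist f e1 \<le> pair_dist f e2\<close>, a condition that can be counted. The extra
    terms are non-negative.\<close>
  define G where "G f e = (if pair_dist f (fst e) \<le> pair_dist f (snd e) then W (pair_dist f (snd e)) else 0)" for f e
  have G0: "0 \<le> G f e" for f e using W by (simp add: G_def)
  have le: "\<phi> f \<le> (\<Sum>e\<in>?E. G f e)" if f: "f \<in> F" for f
  proof -
    obtain e1 e2 where e: "e1 \<in> index_pairs N" "e2 \<in> index_pairs N - {e1}" "pair_dist f e1 \<le> pair_dist f e2"
      "\<forall>e\<in>index_pairs N - {e1}. pair_dist f e2 \<le> pair_dist f e"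
      using smallest_pairs_exist[OF N] by blast
    have "\<phi> f \<le> G f (e1, e2)" using \<phi>[OF f e] e(3) by (simp add: G_def)
    also have "\<dots> \<le> (\<Sum>e\<in>?E. G f e)"
      using e G0 finE by (intro member_le_sum) auto
    finally show ?thesis .
  qed
  have one: "(\<Sum>f\<in>?P. G f e) \<le> real n ^ (N - 2) * (\<Sum>k\<le>n. W k * (2 * (2 * real k + 1)))" if e: "e \<in> ?E" for e
  proof -
    have d: "pair_dist f (snd e) \<le> n" if "f \<in> ?P" for f
    proof -
      have "snd e \<in> index_pairs N" using e by auto
      then have "f (fst (snd e)) \<in> {1..int n}" "f (snd (snd e)) \<in> {1..int n}"
        using that unfolding index_pairs_def by (auto simp: PiE_iff split: prod.splits)
      then show ?thesis unfolding pair_dist_def by auto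
    qed
    have "(\<Sum>f\<in>?P. G f e) = (\<Sum>f\<in>?P. \<Sum>k\<le>n. if pair_dist f (snd e) = k \<and> pair_dist f (fst e) \<le> k then W k else 0)"
    proof (intro sum.cong refl)
      fix f assume "f \<in> ?P"
      have "(\<Sum>k\<le>n. if pair_dist f (snd e) = k \<and> pair_dist f (fst e) \<le> k then W k else 0) =
        (\<Sum>k\<in>{..n}. if k = pair_dist f (snd e) then G f e else 0)"
        by (intro sum.cong refl) (auto simp: G_def)
      also have "\<dots> = G f e" using d[OF \<open>f \<in> ?P\<close>] by simp
      finally show "G f e = (\<Sum>k\<le>n. if pair_dist f (snd e) = k \<and> pair_dist f (fst e) \<le> k then W k else 0)" by simp
    qed
    also have "\<dots> = (\<Sum>k\<le>n. \<Sum>f\<in>?P. if pair_dist f (snd e) = k \<and> pair_dist f (fst e) \<le> k then W k else 0)"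
      by (rule sum.swap)
    also have "\<dots> = (\<Sum>k\<le>n. W k * real (card {f\<in>?P. pair_dist f (snd e) = k \<and> pair_dist f (fst e) \<le> k}))"
    proof (intro sum.cong refl)
      fix k
      have "(\<Sum>f\<in>?P. if pair_dist f (snd e) = k \<and> pair_dist f (fst e) \<le> k then W k else 0) =
        (\<Sum>f\<in>{f\<in>?P. pair_dist f (snd e) = k \<and> pair_dist f (fst e) \<le> k}. W k)"
        by (rule sum.inter_filter[symmetric, OF fin])
      then show "(\<Sum>f\<in>?P. if pair_dist f (snd e) = k \<and> pair_dist f (fst e) \<le> k then W k else 0) =
        W k * real (card {f\<in>?P. pair_dist f (snd e) = k \<and> pair_dist f (fst e) \<le> k})" by simp
    qed
    also have "\<dots> \<le> (\<Sum>k\<le>n. W k * real (n ^ (N - 2) * (2 * k + 1) * 2))"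
      using W e by (intro sum_mono mult_left_mono of_nat_mono card_close_pairs_le) auto
    also have "\<dots> = real n ^ (N - 2) * (\<Sum>k\<le>n. W k * (2 * (2 * real k + 1)))"
      by (simp add: sum_distrib_left algebra_simps)
    finally show ?thesis .
  qed
  define R where "R = real n ^ (N - 2) * (\<Sum>k\<le>n. W k * (2 * (2 * real k + 1)))"
  have R0: "0 \<le> R" unfolding R_def using W by (intro mult_nonneg_nonneg sum_nonneg) auto
  have "(\<Sum>f\<in>F. \<phi> f) \<le> (\<Sum>f\<in>F. \<Sum>e\<in>?E. G f e)" using le by (intro sum_mono) auto
  also have "\<dots> \<le> (\<Sum>f\<in>?P. \<Sum>e\<in>?E. G f e)" using fin F G0 by (intro sum_mono2 sum_nonneg) auto
  also have "\<dots> = (\<Sum>e\<in>?E. \<Sum>f\<in>?P. G f e)" by (rule sum.swap)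
  also have "\<dots> \<le> (\<Sum>e\<in>?E. R)" using one unfolding R_def by (intro sum_mono) blast
  also have "\<dots> = real (card ?E) * R" by simp
  also have "\<dots> \<le> real (N ^ 4) * R"
  proof (intro mult_right_mono of_nat_mono R0)
    have "card ?E \<le> card (index_pairs N \<times> index_pairs N)" by (intro card_mono) auto
    also have "\<dots> \<le> N ^ 2 * N ^ 2" using mult_le_mono[OF card_index_pairs_le[of N] card_index_pairs_le[of N]] by (simp add: card_cartesian_product)
    finally show "card ?E \<le> N ^ 4" by (simp flip: power_add)
  qed
  finally show ?thesis by (simp add: R_def mult.assoc)
qed

text \<open>
  The label of \<open>x\<close> counts the points up to \<open>x\<close>, where the larger of the two close points is not counted,
  so that it inherits the label of the smaller one.
\<close>

lemma merged_pair_labels_exist: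
  fixes f :: "nat \<Rightarrow> int"
  assumes Z: "finite Z" "u \<in> Z" "v \<in> Z" "u \<noteq> v" and k: "k \<ge> 1"
    and sep: "\<And>a b. \<lbrakk>a \<in> Z; b \<in> Z; a \<noteq> b; {a, b} \<noteq> {u, v}\<rbrakk> \<Longrightarrow> int k \<le> \<bar>f a - f b\<bar>"
    and uv: "\<bar>f u - f v\<bar> < 2 * int k"
  shows "\<exists>g::int \<Rightarrow> nat. (\<forall>a\<in>Z. \<forall>b\<in>Z. a \<noteq> b \<longrightarrow> g (f a) = g (f b) \<longrightarrow> {a, b} = {u, v}) \<and>
     (\<forall>a\<in>Z. \<forall>b\<in>Z. g (f a) < g (f b) \<longrightarrow> f a + int k \<le> f b) \<and> (\<forall>x. g x \<le> card Z)"
  using Z(2-4) sep uv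
\<comment> \<open>The claim is symmetric in \<open>u\<close> and \<open>v\<close>, so
  \<open>f u \<le> f v\<close> may be assumed.\<close>
proof (induction "f u" "f v" arbitrary: u v rule: linorder_wlog)
  case (sym u v)
  have "{v, u} = {u, v}" by auto
  then show ?case using sym(1)[of v u] sym(2-) by (simp add: abs_minus_commute)
next
  case (le u v)
  note Zuv = le(2-4) and sep = le(5) and uv = le(6)
  \<comment> \<open>If the two close points coincide they share a label anyway, and removing their
    common value would merge them with the preceding point.\<close>
  define Y where "Y = (if f u = f v then f ` Z else f ` Z - {f v})"
  have fY: "finite Y" using Z(1) by (auto simp: Y_def)
  define g where "g x = card {y\<in>Y. y \<le> x}" for x
  have g_less: "g x < g x'" if "y \<in> Y" "x < y" "y \<le> x'" for x x' y
  proof -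
    have "{y\<in>Y. y \<le> x} \<subset> {y\<in>Y. y \<le> x'}" using that by force
    then show ?thesis unfolding g_def using fY by (intro psubset_card_mono) auto
  qed
  have lab: "{a, b} = {u, v}" if ab: "a \<in> Z" "b \<in> Z" "a \<noteq> b" "g (f a) = g (f b)" "f a \<le> f b" for a b
  proof (rule ccontr)
    assume ne: "{a, b} \<noteq> {u, v}"
    then have gap: "int k \<le> f b - f a" using sep[OF ab(1-3)] ab(5) by simp
    show False
    proof (cases "f b \<in> Y")
      case True
      then show False using g_less[of "f b" "f a" "f b"] gap k ab(4) by simp
    next
      case False
      then have fb: "f u \<noteq> f v" "f b = f v" using ab(2) by (auto simp: Y_def split: if_splits)
      have "b = v"
      proof (rule ccontr)
        assume "b \<noteq> v"
        then have "{b, v} = {u, v}" using sep[of b v] ab(2) Zuv fb(2) k by fastforce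
        then show False using \<open>b \<noteq> v\<close> fb by (auto simp: doubleton_eq_iff)
      qed
      then have au: "a \<noteq> u" using ne by auto
      have uY: "f u \<in> Y" using fb(1) Zuv by (auto simp: Y_def)
      have auv: "{a, u} \<noteq> {u, v}" using au ab(3) \<open>b = v\<close> by (auto simp: doubleton_eq_iff)
      have far: "int k \<le> \<bar>f a - f u\<bar>" using sep[OF ab(1) Zuv(1) au auv] .
      show False
      proof (cases "f a < f u")
        case True
        then show False using g_less[OF uY, of "f a" "f b"] ab(4) fb(2) le(1) by simp
      next
        case False
        \<comment> \<open>Here \<open>a\<close> lies at least \<open>k\<close> above
          \<open>u\<close>, and \<open>v\<close> at least \<open>k\<close> above \<open>a\<close>,
          against \<open>f v - f u < 2 * k\<close>.\<close>
        then show False using far gap uv fb(2) le(1) by linarith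
      qed
    qed
  qed
  have gap: "f a + int k \<le> f b" if ab: "a \<in> Z" "b \<in> Z" "g (f a) < g (f b)" for a b
  proof (rule ccontr)
    assume c: "\<not> f a + int k \<le> f b"
    have "\<not> {y\<in>Y. y \<le> f b} \<subseteq> {y\<in>Y. y \<le> f a}"
      using card_mono[of "{y\<in>Y. y \<le> f a}" "{y\<in>Y. y \<le> f b}"] fY ab(3) unfolding g_def by force
    then obtain y where "y \<in> Y" "y \<le> f b" "\<not> y \<le> f a" by blast
    then have y: "y \<in> Y" "y \<le> f b" "f a < y" by auto
    have "a \<noteq> b" "\<bar>f a - f b\<bar> < int k" using y c by auto
    then have "{a, b} = {u, v}" using sep[OF ab(1,2)] by fastforce
    \<comment> \<open>Points closer than \<open>k\<close> can only be \<open>u\<close> and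
      \<open>v\<close>, in this order. A counted point \<open>y\<close> above \<open>u\<close> and
      not above \<open>v\<close>, coming from a third position, would be closer than
      \<open>k\<close> to \<open>u\<close>.\<close>
    then have "a = u" "b = v" using y le(1) by (auto simp: doubleton_eq_iff)
    then have "f u \<noteq> f v" using y by auto
    then obtain x where x: "x \<in> Z" "y = f x" "y \<noteq> f v" using y(1) by (auto simp: Y_def)
    have "x \<noteq> u" "x \<noteq> v" using x y \<open>a = u\<close> by auto
    then have "int k \<le> \<bar>f u - f x\<bar>" using sep[of u x] x(1) Zuv by (auto simp: doubleton_eq_iff)
    moreover have "f u < f x" "f x \<le> f b" "f b < f u + int k" using x(2) y c \<open>a = u\<close> by auto
    ultimately show False by linarith
  qed
  have "g x \<le> card Z" for x
  proof -
    have "g x \<le> card Y" unfolding g_def using fY by (intro card_mono) auto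
    also have "\<dots> \<le> card (f ` Z)" using Z(1) by (intro card_mono) (auto simp: Y_def)
    also have "\<dots> \<le> card Z" using Z(1) by (rule card_image_le)
    finally show ?thesis .
  qed
  moreover have "{a, b} = {u, v}" if "a \<in> Z" "b \<in> Z" "a \<noteq> b" "g (f a) = g (f b)" for a b
    using lab[of a b] lab[of b a] that by (cases "f a \<le> f b") (auto simp: insert_commute)
  ultimately show ?case using gap by blast
qed

text \<open>The affine map of \<open>[-B, B]\<close> onto \<open>[0, 1]\<close> has slope
  \<open>1 / (2 * B)\<close>, which turns the factor 2 into \<open>4 * B\<close>.\<close>

lemma (in process) beta_decoupling_bounded:
  fixes \<Phi> :: "(int \<Rightarrow> 's) \<Rightarrow> real"
  assumes I: "finite I" "I \<subseteq> {1..}" "g ` I \<subseteq> {..<J::nat}"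
    and gap: "\<And>i j. i \<in> I \<Longrightarrow> j \<in> I \<Longrightarrow> g i < g j \<Longrightarrow> i + int k \<le> j"
    and \<Phi> [measurable]: "\<Phi> \<in> borel_measurable (\<Pi>\<^sub>M i\<in>I. S)"
    and B: "\<And>z. z \<in> space (\<Pi>\<^sub>M i\<in>I. S) \<Longrightarrow> \<bar>\<Phi> z\<bar> \<le> B"
  shows "\<bar>(\<integral>\<omega>. \<Phi> (\<lambda>i\<in>I. X i \<omega>) \<partial>M) - (\<integral>w. \<Phi> (\<lambda>i\<in>I. X i (w (g i))) \<partial>(\<Pi>\<^sub>M j\<in>{..<J}. M))\<bar>
     \<le> 4 * B * real J * beta_mixing M S X k"
proof -
  interpret P: prob_space "\<Pi>\<^sub>M j\<in>{..<J}. M" by (rule prob_space_PiM) unfold_locales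
  have m1 [measurable]: "(\<lambda>\<omega>. \<lambda>i\<in>I. X i \<omega>) \<in> measurable M (\<Pi>\<^sub>M i\<in>I. S)" by measurable
  have m2 [measurable]: "(\<lambda>w. \<lambda>i\<in>I. X i (w (g i))) \<in> measurable (\<Pi>\<^sub>M j\<in>{..<J}. M) (\<Pi>\<^sub>M i\<in>I. S)"
    by (rule product_decoupled_measurable) fact
  have b1: "\<bar>\<Phi> (\<lambda>i\<in>I. X i \<omega>)\<bar> \<le> B" if "\<omega> \<in> space M" for \<omega>
    using measurable_space[OF m1 that] by (rule B)
  have b2: "\<bar>\<Phi> (\<lambda>i\<in>I. X i (w (g i)))\<bar> \<le> B" if "w \<in> space (\<Pi>\<^sub>M j\<in>{..<J}. M)" for w
    using measurable_space[OF m2 that] by (rule B)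
  have i1: "integrable M (\<lambda>\<omega>. \<Phi> (\<lambda>i\<in>I. X i \<omega>))" using b1 by (intro integrable_const_bound[where B=B]) auto
  have i2: "integrable (\<Pi>\<^sub>M j\<in>{..<J}. M) (\<lambda>w. \<Phi> (\<lambda>i\<in>I. X i (w (g i))))"
    using b2 by (intro P.integrable_const_bound[where B=B]) auto
  obtain \<omega>0 where "\<omega>0 \<in> space M" using not_empty by blast
  then have B0: "0 \<le> B" using b1[of \<omega>0] by linarith
  show ?thesis
  proof (cases "B = 0")
    case True
    have "(\<integral>\<omega>. \<Phi> (\<lambda>i\<in>I. X i \<omega>) \<partial>M) = (\<integral>\<omega>. 0 \<partial>M)"
      using b1 True by (intro Bochner_Integration.integral_cong) auto
    moreover have "(\<integral>w. \<Phi> (\<lambda>i\<in>I. X i (w (g i))) \<partial>(\<Pi>\<^sub>M j\<in>{..<J}. M)) = (\<integral>w. 0 \<partial>(\<Pi>\<^sub>M j\<in>{..<J}. M))"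
      using b2 True by (intro Bochner_Integration.integral_cong) auto
    ultimately show ?thesis using True by simp
  next
    case False
    then have B: "B > 0" using B0 by simp
    define \<Psi> where "\<Psi> z = (\<Phi> z + B) / (2 * B)" for z
    have "\<bar>(\<integral>\<omega>. \<Psi> (\<lambda>i\<in>I. X i \<omega>) \<partial>M) - (\<integral>w. \<Psi> (\<lambda>i\<in>I. X i (w (g i))) \<partial>(\<Pi>\<^sub>M j\<in>{..<J}. M))\<bar>
      \<le> 2 * real J * beta_mixing M S X k"
    proof (rule beta_decoupling[OF I gap])
      show "\<Psi> \<in> borel_measurable (\<Pi>\<^sub>M i\<in>I. S)" unfolding \<Psi>_def by measurable
      show "0 \<le> \<Psi> z \<and> \<Psi> z \<le> 1" if "z \<in> space (\<Pi>\<^sub>M i\<in>I. S)" for z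
        using assms(6)[OF that] B unfolding \<Psi>_def by (auto simp: field_simps abs_le_iff)
    qed
    moreover have "(\<integral>\<omega>. \<Psi> (\<lambda>i\<in>I. X i \<omega>) \<partial>M) = ((\<integral>\<omega>. \<Phi> (\<lambda>i\<in>I. X i \<omega>) \<partial>M) + B) / (2 * B)"
      unfolding \<Psi>_def using i1 by (simp add: prob_space)
    moreover have "(\<integral>w. \<Psi> (\<lambda>i\<in>I. X i (w (g i))) \<partial>(\<Pi>\<^sub>M j\<in>{..<J}. M)) =
      ((\<integral>w. \<Phi> (\<lambda>i\<in>I. X i (w (g i))) \<partial>(\<Pi>\<^sub>M j\<in>{..<J}. M)) + B) / (2 * B)"
      unfolding \<Psi>_def using i2 by (simp add: P.prob_space)
    moreover have "(a + B) / (2 * B) - (b + B) / (2 * B) = (a - b) / (2 * B)" for a b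
      by (simp add: diff_divide_distrib add_divide_distrib)
    ultimately have "\<bar>((\<integral>\<omega>. \<Phi> (\<lambda>i\<in>I. X i \<omega>) \<partial>M) - (\<integral>w. \<Phi> (\<lambda>i\<in>I. X i (w (g i))) \<partial>(\<Pi>\<^sub>M j\<in>{..<J}. M))) / (2 * B)\<bar>
      \<le> 2 * real J * beta_mixing M S X k"
      by (simp only:)
    then show ?thesis using B by (simp add: abs_divide divide_le_eq mult.commute mult.left_commute)
  qed
qed

lemma Inc_upto_subset: "Inc_upto m n \<subseteq> {1..m} \<rightarrow>\<^sub>E {1..int n}"
  unfolding Inc_upto_def by auto

lemma finite_Inc_upto [simp]: "finite (Inc_upto m n)"
  by (rule finite_subset[OF Inc_upto_subset]) (auto intro: finite_PiE)

section \<open>Expectations of products of two remainders\<close>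

context square_integrable_kernel
begin

lemma tuple_measurable [measurable]:
  "(\<lambda>\<omega>. \<lambda>l\<in>{1..m}. X (i l) \<omega>) \<in> measurable M (\<Pi>\<^sub>M l\<in>{1..m}. S)"
  by (intro measurable_restrict) auto

text \<open>All positions other than \<open>u\<close> and \<open>v\<close> receive labels of their
  own. After decoupling, one of the two tuples therefore has at most one position that shares a copy
  with anything, and the expectation vanishes. The bound \<open>2 * int k\<close> leaves room for a
  pair at distance exactly \<open>k\<close>.\<close>

lemma pair_expectation_bound:
  fixes f :: "nat \<Rightarrow> int"
  assumes f: "\<And>l. l \<in> {1..2 * m} \<Longrightarrow> 1 \<le> f l"
    and uv: "u \<in> {1..2 * m}" "v \<in> {1..2 * m}" "u < v" and k: "k \<ge> 1"
    and sep: "\<And>a b. \<lbrakk>a \<in> {1..2 * m}; b \<in> {1..2 * m}; a \<noteq> b; {a, b} \<noteq> {u, v}\<rbrakk> \<Longrightarrow> int k \<le> \<bar>f a - f b\<bar>"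
    and close: "\<bar>f u - f v\<bar> < 2 * int k"
    and B: "\<And>x. x \<in> space (\<Pi>\<^sub>M l\<in>{1..m}. S) \<Longrightarrow> \<bar>remainder x\<bar> \<le> B"
  shows "\<bar>\<integral>\<omega>. remainder (\<lambda>l\<in>{1..m}. X (f l) \<omega>) * remainder (\<lambda>l\<in>{1..m}. X (f (m + l)) \<omega>) \<partial>M\<bar>
     \<le> 4 * B\<^sup>2 * real (2 * m + 1) * beta_mixing M S X k"
proof -
  define Z where "Z = {1..2 * m}"
  have Z: "finite Z" "u \<in> Z" "v \<in> Z" "u \<noteq> v" "card Z = 2 * m" using uv by (auto simp: Z_def)
  have "\<exists>g::int \<Rightarrow> nat. (\<forall>a\<in>Z. \<forall>b\<in>Z. a \<noteq> b \<longrightarrow> g (f a) = g (f b) \<longrightarrow> {a, b} = {u, v}) \<and>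
     (\<forall>a\<in>Z. \<forall>b\<in>Z. g (f a) < g (f b) \<longrightarrow> f a + int k \<le> f b) \<and> (\<forall>x. g x \<le> card Z)"
    by (rule merged_pair_labels_exist[OF Z(1-4) k _ close]) (unfold Z_def, rule sep)
  then obtain g :: "int \<Rightarrow> nat" where
    G: "\<forall>a\<in>Z. \<forall>b\<in>Z. a \<noteq> b \<longrightarrow> g (f a) = g (f b) \<longrightarrow> {a, b} = {u, v}"
      "\<forall>a\<in>Z. \<forall>b\<in>Z. g (f a) < g (f b) \<longrightarrow> f a + int k \<le> f b" "\<forall>x. g x \<le> card Z"
    by (elim exE conjE) (rule that)
  have g1: "{a, b} = {u, v}" if "a \<in> Z" "b \<in> Z" "a \<noteq> b" "g (f a) = g (f b)" for a b
    using G(1) that by blast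
  have g2: "f a + int k \<le> f b" if "a \<in> Z" "b \<in> Z" "g (f a) < g (f b)" for a b
    using G(2) that by blast
  have g3: "g x \<le> card Z" for x using G(3) by blast
  define I where "I = f ` Z"
  \<comment> \<open>Labels run from 0 to \<open>card Z = 2 * m\<close>, hence
    \<open>2 * m + 1\<close> copies.\<close>
  define J where "J = 2 * m + 1"
  define i where "i l = f l" for l
  define j where "j l = f (m + l)" for l
  have lZ: "l \<in> Z" "m + l \<in> Z" if "l \<in> {1..m}" for l using that by (auto simp: Z_def)
  have iI: "i l \<in> I" "j l \<in> I" if "l \<in> {1..m}" for l using lZ[OF that] by (auto simp: I_def i_def j_def)
  have gJ: "g x \<in> {..<J}" for x using g3[of x] Z(5) by (auto simp: J_def)
  define \<Phi> where "\<Phi> z = remainder (\<lambda>l\<in>{1..m}. z (i l)) * remainder (\<lambda>l\<in>{1..m}. z (j l))" for z :: "int \<Rightarrow> 's"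
  have mi: "(\<lambda>z. \<lambda>l\<in>{1..m}. z (i l)) \<in> measurable (\<Pi>\<^sub>M x\<in>I. S) (\<Pi>\<^sub>M l\<in>{1..m}. S)"
    by (intro measurable_restrict measurable_component_singleton iI)
  have mj: "(\<lambda>z. \<lambda>l\<in>{1..m}. z (j l)) \<in> measurable (\<Pi>\<^sub>M x\<in>I. S) (\<Pi>\<^sub>M l\<in>{1..m}. S)"
    by (intro measurable_restrict measurable_component_singleton iI)
  note [measurable] = mi mj
  have m\<Phi>: "\<Phi> \<in> borel_measurable (\<Pi>\<^sub>M x\<in>I. S)"
    unfolding \<Phi>_def
    using measurable_compose[OF mi remainder_measurable] measurable_compose[OF mj remainder_measurable] by simp
  have bb: "\<bar>x * y\<bar> \<le> B\<^sup>2" if "\<bar>x\<bar> \<le> B" "\<bar>y\<bar> \<le> B" for x y :: real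
    using mult_mono[OF that] that by (simp add: abs_mult power2_eq_square)
  have b\<Phi>: "\<bar>\<Phi> z\<bar> \<le> B\<^sup>2" if "z \<in> space (\<Pi>\<^sub>M x\<in>I. S)" for z
    unfolding \<Phi>_def using measurable_space[OF mi that] measurable_space[OF mj that] by (intro bb B)
  have "\<bar>(\<integral>\<omega>. \<Phi> (\<lambda>x\<in>I. X x \<omega>) \<partial>M) - (\<integral>w. \<Phi> (\<lambda>x\<in>I. X x (w (g x))) \<partial>(\<Pi>\<^sub>M j\<in>{..<J}. M))\<bar>
     \<le> 4 * B\<^sup>2 * real J * beta_mixing M S X k"
  proof (rule beta_decoupling_bounded)
    show "finite I" using Z by (simp add: I_def)
    show "I \<subseteq> {1..}" using f by (auto simp: I_def Z_def)
    show "g ` I \<subseteq> {..<J}" using gJ by auto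
    show "x + int k \<le> y" if "x \<in> I" "y \<in> I" "g x < g y" for x y
      using that g2 unfolding I_def by auto
  qed (fact m\<Phi> b\<Phi>)+
  moreover have "\<Phi> (\<lambda>x\<in>I. X x \<omega>) = remainder (\<lambda>l\<in>{1..m}. X (f l) \<omega>) * remainder (\<lambda>l\<in>{1..m}. X (f (m + l)) \<omega>)" for \<omega>
    unfolding \<Phi>_def using iI unfolding i_def j_def
    by (intro arg_cong2[where f="(*)"] arg_cong[where f=remainder] restrict_ext) auto
  moreover have \<Phi>w: "\<Phi> (\<lambda>x\<in>I. X x (w (g x))) = remainder_at g i w * remainder_at g j w" for w
    unfolding \<Phi>_def remainder_at_def using iI
    by (intro arg_cong2[where f="(*)"] arg_cong[where f=remainder] restrict_ext) auto
  moreover have "(\<integral>w. remainder_at g i w * remainder_at g j w \<partial>(\<Pi>\<^sub>M j\<in>{..<J}. M)) = 0"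
  proof -
    interpret P: prob_space "\<Pi>\<^sub>M j\<in>{..<J}. M" by (rule prob_space_copies)
    have K: "(g \<circ> i) ` {1..m} \<subseteq> {..<J}" "(g \<circ> j) ` {1..m} \<subseteq> {..<J}" using gJ by auto
    have int: "integrable (\<Pi>\<^sub>M j\<in>{..<J}. M) (\<lambda>w. remainder_at g i w * remainder_at g j w)"
    proof (rule P.integrable_const_bound[where B="B\<^sup>2"])
      show "(\<lambda>w. remainder_at g i w * remainder_at g j w) \<in> borel_measurable (\<Pi>\<^sub>M j\<in>{..<J}. M)"
        using remainder_at_measurable[OF K(1)] remainder_at_measurable[OF K(2)] by simp
      show "AE w in \<Pi>\<^sub>M j\<in>{..<J}. M. norm (remainder_at g i w * remainder_at g j w) \<le> B\<^sup>2"
      proof (rule AE_I2)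
        fix w assume w: "w \<in> space (\<Pi>\<^sub>M j\<in>{..<J}. M)"
        have "\<bar>remainder_at g i' w\<bar> \<le> B" if "(g \<circ> i') ` {1..m} \<subseteq> {..<J}" for i'
          using measurable_space[OF decoupled_tuple_measurable[OF that, of i'] w] unfolding remainder_at_def by (intro B) simp
        then show "norm (remainder_at g i w * remainder_at g j w) \<le> B\<^sup>2" using K bb by simp
      qed
    qed
    have int': "integrable (\<Pi>\<^sub>M j\<in>{..<J}. M) (\<lambda>w. remainder_at g j w * remainder_at g i w)"
      using int by (simp add: mult.commute)
    have 1: "1 \<in> {1..m}" using m_ge_2 by simp
    \<comment> \<open>The tuple that plays the first role in \<open>remainder_at_orthogonal\<close>
      is the second one if the merged pair lies inside the first, and the first one otherwise. If
      the pair straddles both tuples, \<open>l0\<close> is the merged position \<open>u\<close>; in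
      the other cases any position serves.\<close>
    consider "v \<le> m" | "m < v" "u \<le> m" | "m < u" using uv by linarith
    then show ?thesis
    proof cases
      case 1
      have "inj_on (g \<circ> j) {1..m}"
      proof (rule inj_onI, rule ccontr)
        fix a b assume ab: "a \<in> {1..m}" "b \<in> {1..m}" "(g \<circ> j) a = (g \<circ> j) b" "a \<noteq> b"
        then have "{m + a, m + b} = {u, v}" using lZ by (intro g1) (auto simp: j_def)
        then show False using 1 ab uv by (auto simp: doubleton_eq_iff)
      qed
      moreover have "g (j l) \<notin> (g \<circ> i) ` {1..m}" if "l \<in> {1..m}" for l
      proof
        assume "g (j l) \<in> (g \<circ> i) ` {1..m}"
        then obtain l' where l': "l' \<in> {1..m}" "g (f (m + l)) = g (f l')" by (auto simp: i_def j_def)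
        then have "{m + l, l'} = {u, v}" using that lZ by (intro g1) auto
        then show False using 1 that uv by (auto simp: doubleton_eq_iff)
      qed
      ultimately have "(\<integral>w. remainder_at g j w * remainder_at g i w \<partial>(\<Pi>\<^sub>M j\<in>{..<J}. M)) = 0"
        using K int' \<open>1 \<in> {1..m}\<close> by (intro remainder_at_orthogonal[where ?l0.0 = 1]) auto
      then show ?thesis by (simp add: mult.commute)
    next
      case 2
      have "inj_on (g \<circ> i) {1..m}"
      proof (rule inj_onI, rule ccontr)
        fix a b assume ab: "a \<in> {1..m}" "b \<in> {1..m}" "(g \<circ> i) a = (g \<circ> i) b" "a \<noteq> b"
        then have "{a, b} = {u, v}" using lZ by (intro g1) (auto simp: i_def)
        then show False using 2 ab uv by (auto simp: doubleton_eq_iff)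
      qed
      moreover have "g (i l) \<notin> (g \<circ> j) ` {1..m}" if "l \<in> {1..m} - {u}" for l
      proof
        assume "g (i l) \<in> (g \<circ> j) ` {1..m}"
        then obtain l' where l': "l' \<in> {1..m}" "g (f l) = g (f (m + l'))" by (auto simp: i_def j_def)
        then have "{l, m + l'} = {u, v}" using that lZ by (intro g1) auto
        then show False using 2 that uv l' by (auto simp: doubleton_eq_iff)
      qed
      ultimately show ?thesis
        using K int 2 uv by (intro remainder_at_orthogonal[where ?l0.0 = u]) auto
    next
      case 3
      have "inj_on (g \<circ> i) {1..m}"
      proof (rule inj_onI, rule ccontr)
        fix a b assume ab: "a \<in> {1..m}" "b \<in> {1..m}" "(g \<circ> i) a = (g \<circ> i) b" "a \<noteq> b"
        then have "{a, b} = {u, v}" using lZ by (intro g1) (auto simp: i_def)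
        then show False using 3 ab uv by (auto simp: doubleton_eq_iff)
      qed
      moreover have "g (i l) \<notin> (g \<circ> j) ` {1..m}" if "l \<in> {1..m}" for l
      proof
        assume "g (i l) \<in> (g \<circ> j) ` {1..m}"
        then obtain l' where l': "l' \<in> {1..m}" "g (f l) = g (f (m + l'))" by (auto simp: i_def j_def)
        then have "{l, m + l'} = {u, v}" using that lZ by (intro g1) auto
        then show False using 3 that uv l' by (auto simp: doubleton_eq_iff)
      qed
      ultimately show ?thesis
        using K int \<open>1 \<in> {1..m}\<close> by (intro remainder_at_orthogonal[where ?l0.0 = 1]) auto
    qed
  qed
  ultimately show ?thesis unfolding J_def by simp
qed

text \<open>\<open>K\<close> separates two regimes: below it the second moment bound
  \<open>C2\<close> is used, from \<open>K\<close> on the decoupling bound, which requires a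
  positive distance and hence \<open>K \<ge> 1\<close>.\<close>

lemma sum_square_bound:
  fixes B C2 :: real
  assumes B: "\<And>x. x \<in> space (\<Pi>\<^sub>M l\<in>{1..m}. S) \<Longrightarrow> \<bar>remainder x\<bar> \<le> B"
    and C2: "\<And>i. i \<in> Inc_upto m n \<Longrightarrow> (\<integral>\<omega>. (remainder (\<lambda>l\<in>{1..m}. X (i l) \<omega>))\<^sup>2 \<partial>M) \<le> C2" "0 \<le> C2"
    and K: "K \<ge> 1"
  shows "(\<integral>\<omega>. (\<Sum>i\<in>Inc_upto m n. remainder (\<lambda>l\<in>{1..m}. X (i l) \<omega>))\<^sup>2 \<partial>M) \<le>
    real (2 * m) ^ 4 * real n ^ (2 * m - 2) *
      (\<Sum>k\<le>n. (if k < K then C2 else 4 * B\<^sup>2 * real (2 * m + 1) * beta_mixing M S X k) * (2 * (2 * real k + 1)))"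
proof -
  define R where "R i \<omega> = remainder (\<lambda>l\<in>{1..m}. X (i l) \<omega>)" for i :: "nat \<Rightarrow> int" and \<omega>
  define T where "T = Inc_upto m n"
  have T: "finite T" "T \<subseteq> {1..m} \<rightarrow>\<^sub>E {1..int n}" unfolding T_def using Inc_upto_subset by auto
  have Rm [measurable]: "R i \<in> borel_measurable M" for i unfolding R_def by measurable
  have Rb: "\<bar>R i \<omega>\<bar> \<le> B" if "\<omega> \<in> space M" for i \<omega>
    unfolding R_def using measurable_space[OF tuple_measurable that] by (rule B)
  have bb: "\<bar>x * y\<bar> \<le> B\<^sup>2" if "\<bar>x\<bar> \<le> B" "\<bar>y\<bar> \<le> B" for x y :: real
    using mult_mono[OF that] that by (simp add: abs_mult power2_eq_square)
  have Ri: "integrable M (\<lambda>\<omega>. R i \<omega> * R j \<omega>)" for i j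
    using Rb bb by (intro integrable_const_bound[where B="B\<^sup>2"]) auto
  \<comment> \<open>A pair of tuples becomes a single function on \<open>{1..2 * m}\<close>, so that
    distances within and across the two tuples are treated alike.\<close>
  define glue where "glue = (\<lambda>(i, j). \<lambda>l\<in>{1..2 * m}. if l \<le> m then i l else j (l - m) :: int)"
  define F where "F = glue ` (T \<times> T)"
  define \<phi> where "\<phi> f = (\<integral>\<omega>. R f \<omega> * R (\<lambda>l. f (m + l)) \<omega> \<partial>M)" for f
  have g1: "glue (i, j) l = i l" if "l \<in> {1..m}" for i j l using that by (simp add: glue_def)
  have g2: "glue (i, j) (m + l) = j l" if "l \<in> {1..m}" for i j l using that by (auto simp: glue_def)
  have inj: "inj_on glue (T \<times> T)"
  proof (rule inj_onI)
    fix p q assume p: "p \<in> T \<times> T" and q: "q \<in> T \<times> T" and eq: "glue p = glue q"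
    obtain i j i' j' where pq: "p = (i, j)" "q = (i', j')" by fastforce
    have mem: "i \<in> {1..m} \<rightarrow>\<^sub>E {1..int n}" "j \<in> {1..m} \<rightarrow>\<^sub>E {1..int n}"
      "i' \<in> {1..m} \<rightarrow>\<^sub>E {1..int n}" "j' \<in> {1..m} \<rightarrow>\<^sub>E {1..int n}"
      using p q T(2) unfolding pq by auto
    have "i = i'" using eq by (intro PiE_ext[OF mem(1,3)]) (metis g1 pq)
    moreover have "j = j'" using eq by (intro PiE_ext[OF mem(2,4)]) (metis g2 pq)
    ultimately show "p = q" by (simp add: pq)
  qed
  have R1: "R (glue (i, j)) = R i" for i j
    unfolding R_def by (intro ext arg_cong[where f=remainder] restrict_ext) (simp only: g1)
  have R2: "R (\<lambda>l. glue (i, j) (m + l)) = R j" for i j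
    unfolding R_def by (intro ext arg_cong[where f=remainder] restrict_ext) (simp only: g2)
  have "(\<integral>\<omega>. (\<Sum>i\<in>T. R i \<omega>)\<^sup>2 \<partial>M) = (\<integral>\<omega>. (\<Sum>p\<in>T \<times> T. R (fst p) \<omega> * R (snd p) \<omega>) \<partial>M)"
    by (simp add: power2_eq_square sum_product sum.cartesian_product case_prod_beta)
  also have "\<dots> = (\<Sum>p\<in>T \<times> T. (\<integral>\<omega>. R (fst p) \<omega> * R (snd p) \<omega> \<partial>M))"
    using Ri by (intro Bochner_Integration.integral_sum) auto
  also have "\<dots> = (\<Sum>p\<in>T \<times> T. \<phi> (glue p))"
  proof (intro sum.cong refl)
    fix p :: "(nat \<Rightarrow> int) \<times> (nat \<Rightarrow> int)"
    show "(\<integral>\<omega>. R (fst p) \<omega> * R (snd p) \<omega> \<partial>M) = \<phi> (glue p)"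
      using R1[of "fst p" "snd p"] R2[of "fst p" "snd p"] unfolding \<phi>_def by simp
  qed
  also have "\<dots> = (\<Sum>f\<in>F. \<phi> f)"
    unfolding F_def using inj by (simp add: sum.reindex)
  also have "\<dots> \<le> real (2 * m) ^ 4 * real n ^ (2 * m - 2) *
      (\<Sum>k\<le>n. (if k < K then C2 else 4 * B\<^sup>2 * real (2 * m + 1) * beta_mixing M S X k) * (2 * (2 * real k + 1)))"
  proof (rule sum_smallest_pairs_le)
    show "2 * m \<ge> 3" using m_ge_2 by simp
    show "0 \<le> (if k < K then C2 else 4 * B\<^sup>2 * real (2 * m + 1) * beta_mixing M S X k)" for k
      using C2(2) beta_mixing_nonneg by simp
    have Fmem: "f l \<in> {1..int n}" if "f \<in> F" "l \<in> {1..2 * m}" for f l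
    proof -
      obtain i j where ij: "i \<in> T" "j \<in> T" "f = glue (i, j)" using \<open>f \<in> F\<close> unfolding F_def by auto
      have "i \<in> {1..m} \<rightarrow>\<^sub>E {1..int n}" "j \<in> {1..m} \<rightarrow>\<^sub>E {1..int n}" using ij T(2) by auto
      moreover have "l - m \<in> {1..m}" if "\<not> l \<le> m" using \<open>l \<in> {1..2 * m}\<close> that by auto
      ultimately show ?thesis using that(2) unfolding ij(3) glue_def by (cases "l \<le> m") (auto simp: PiE_iff)
    qed
    have Fext: "f \<in> extensional {1..2 * m}" if "f \<in> F" for f
      using that unfolding F_def glue_def by auto
    show "F \<subseteq> {1..2 * m} \<rightarrow>\<^sub>E {1..int n}"
    proof
      fix f assume f: "f \<in> F"
      show "f \<in> {1..2 * m} \<rightarrow>\<^sub>E {1..int n}"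
        unfolding PiE_iff using Fmem[OF f] Fext[OF f] by blast
    qed
    fix f e1 e2
    assume f: "f \<in> F" and e1: "e1 \<in> index_pairs (2 * m)" and e2: "e2 \<in> index_pairs (2 * m) - {e1}"
      and le: "pair_dist f e1 \<le> pair_dist f e2"
      and min: "\<forall>e\<in>index_pairs (2 * m) - {e1}. pair_dist f e2 \<le> pair_dist f e"
    show "\<phi> f \<le> (if pair_dist f e2 < K then C2 else 4 * B\<^sup>2 * real (2 * m + 1) * beta_mixing M S X (pair_dist f e2))"
    proof (cases "pair_dist f e2 < K")
      case True
      obtain i j where ij: "i \<in> T" "j \<in> T" "f = glue (i, j)" using f unfolding F_def by auto
      have ab: "a * b \<le> a\<^sup>2 / 2 + b\<^sup>2 / 2" for a b :: real
        using sum_squares_bound[of a b] by simp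
      have "\<phi> f = (\<integral>\<omega>. R i \<omega> * R j \<omega> \<partial>M)" unfolding \<phi>_def ij(3) R1 R2 ..
      also have "\<dots> \<le> (\<integral>\<omega>. (R i \<omega>)\<^sup>2 / 2 + (R j \<omega>)\<^sup>2 / 2 \<partial>M)"
        using Ri[of i i] Ri[of j j] ab by (intro integral_mono[OF Ri]) (auto simp: power2_eq_square)
      also have "\<dots> = (\<integral>\<omega>. (R i \<omega>)\<^sup>2 \<partial>M) / 2 + (\<integral>\<omega>. (R j \<omega>)\<^sup>2 \<partial>M) / 2"
        using Ri[of i i] Ri[of j j] by (simp add: power2_eq_square)
      also have "\<dots> \<le> C2" using C2(1)[of i] C2(1)[of j] ij unfolding R_def T_def by simp
      finally show ?thesis using True by simp
    next
      case False
      define k where "k = pair_dist f e2"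
      have k: "k \<ge> 1" using False K unfolding k_def by simp
      obtain u v where uv: "e1 = (u, v)" using prod.exhaust by blast
      have uv': "u \<in> {1..2 * m}" "v \<in> {1..2 * m}" "u < v" using e1 unfolding uv index_pairs_def by auto
      have sep: "int k \<le> \<bar>f a - f b\<bar>" if ab: "a \<in> {1..2 * m}" "b \<in> {1..2 * m}" "a \<noteq> b" "{a, b} \<noteq> {u, v}" for a b
      proof (cases "a < b")
        case True
        then have "(a, b) \<in> index_pairs (2 * m) - {e1}" using ab unfolding index_pairs_def uv by auto
        then have "k \<le> pair_dist f (a, b)" using min unfolding k_def by blast
        then show ?thesis unfolding pair_dist_def by simp
      next
        case False
        then have "(b, a) \<in> index_pairs (2 * m) - {e1}" using ab unfolding index_pairs_def uv by auto
        then have "k \<le> pair_dist f (b, a)" using min unfolding k_def by blast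
        then show ?thesis unfolding pair_dist_def by simp
      qed
      have close: "\<bar>f u - f v\<bar> < 2 * int k"
      proof -
        have "pair_dist f (u, v) \<le> k" using le unfolding k_def uv .
        then show ?thesis using k unfolding pair_dist_def by simp
      qed
      have "\<bar>\<phi> f\<bar> \<le> 4 * B\<^sup>2 * real (2 * m + 1) * beta_mixing M S X k"
        unfolding \<phi>_def R_def
        using Fmem[OF f] by (intro pair_expectation_bound[OF _ uv' k sep close B]) auto
      then show ?thesis using False unfolding k_def by simp
    qed
  qed
  finally show ?thesis unfolding R_def T_def .
qed

end

section \<open>Linearization of the U-statistic\<close>

lemma Inc_upto_inj: "i \<in> Inc_upto m n \<Longrightarrow> inj_on i {1..m}"
  unfolding Inc_upto_def by (auto intro: strict_mono_on_imp_inj_on)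

lemma bij_betw_Inc_upto_subsets:
  "bij_betw (\<lambda>i. i ` {1..m}) (Inc_upto m n) {A. A \<subseteq> {1..int n} \<and> card A = m}"
proof (rule bij_betwI')
  fix i i' assume i: "i \<in> Inc_upto m n" and i': "i' \<in> Inc_upto m n"
  have sorted: "sorted_wrt (<) (map j [1..<Suc m])" if "j \<in> Inc_upto m n" for j
    using that unfolding Inc_upto_def sorted_wrt_map
    by (intro sorted_wrt_mono_rel[OF _ sorted_wrt_upt[of 1 "Suc m"]]) (auto simp: strict_mono_on_def)
  show "i ` {1..m} = i' ` {1..m} \<longleftrightarrow> i = i'"
  proof
    assume "i ` {1..m} = i' ` {1..m}"
    then have "set (map i [1..<Suc m]) = set (map i' [1..<Suc m])"
      by (simp only: set_map set_upt atLeastLessThanSuc_atLeastAtMost)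
    from strict_sorted_equal[OF sorted[OF i'] sorted[OF i] this] have eq: "map i [1..<Suc m] = map i' [1..<Suc m]" .
    then have all: "\<forall>x\<in>set [1..<Suc m]. i x = i' x" by (simp only: map_eq_conv)
    show "i = i'"
    proof (rule PiE_ext[OF subsetD[OF Inc_upto_subset i] subsetD[OF Inc_upto_subset i']])
      fix x assume "x \<in> {1..m}"
      then have "x \<in> set [1..<Suc m]" by auto
      with all show "i x = i' x" by (rule bspec)
    qed
  qed simp
next
  fix i assume i: "i \<in> Inc_upto m n"
  then have "i ` {1..m} \<subseteq> {1..int n}" using Inc_upto_subset[of m n] by auto
  moreover have "card (i ` {1..m}) = m" using Inc_upto_inj[OF i] by (simp add: card_image)
  ultimately show "i ` {1..m} \<in> {A. A \<subseteq> {1..int n} \<and> card A = m}" by simp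
next
  fix A assume A: "A \<in> {A. A \<subseteq> {1..int n} \<and> card A = m}"
  then have fA: "finite A" by (auto intro: finite_subset)
  define xs where "xs = sorted_list_of_set A"
  have xs: "length xs = m" "set xs = A" "sorted_wrt (<) xs"
    using A fA by (auto simp: xs_def)
  define i where "i = (\<lambda>l\<in>{1..m}. xs ! (l - 1))"
  have im: "i ` {1..m} = A"
  proof (intro set_eqI iffI)
    fix y assume "y \<in> i ` {1..m}"
    then obtain l where "l \<in> {1..m}" "y = xs ! (l - 1)" by (auto simp: i_def)
    then show "y \<in> A" using nth_mem[of "l - 1" xs] xs by auto
  next
    fix y assume "y \<in> A"
    then obtain q where q: "q < m" "y = xs ! q" using xs by (metis in_set_conv_nth)
    then have "Suc q \<in> {1..m}" "y = i (Suc q)" by (auto simp: i_def)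
    then show "y \<in> i ` {1..m}" by blast
  qed
  have "strict_mono_on {1..m} i"
  proof (rule strict_mono_onI)
    fix a b assume ab: "a \<in> {1..m}" "b \<in> {1..m}" "a < b"
    then have "xs ! (a - 1) < xs ! (b - 1)" using xs by (intro sorted_wrt_nth_less[OF xs(3)]) auto
    then show "i a < i b" using ab by (simp add: i_def)
  qed
  moreover have "i \<in> {1..m} \<rightarrow>\<^sub>E {1..int n}"
    using im A by (auto simp: i_def)
  ultimately have "i \<in> Inc_upto m n" unfolding Inc_upto_def by auto
  then show "\<exists>i\<in>Inc_upto m n. A = i ` {1..m}" using im by blast
qed

lemma card_subsets_containing:
  assumes "finite Z" "x \<in> Z" "m \<ge> 1"
  shows "card {A. A \<subseteq> Z \<and> card A = m \<and> x \<in> A} = (card Z - 1) choose (m - 1)"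
proof -
  have "bij_betw (insert x) {B. B \<subseteq> Z - {x} \<and> card B = m - 1} {A. A \<subseteq> Z \<and> card A = m \<and> x \<in> A}"
  proof (rule bij_betw_byWitness[where f'="\<lambda>A. A - {x}"])
    show "insert x ` {B. B \<subseteq> Z - {x} \<and> card B = m - 1} \<subseteq> {A. A \<subseteq> Z \<and> card A = m \<and> x \<in> A}"
    proof (rule image_subsetI)
      fix B assume B: "B \<in> {B. B \<subseteq> Z - {x} \<and> card B = m - 1}"
      then have "finite B" "x \<notin> B" using assms(1) by (auto intro: finite_subset)
      then show "insert x B \<in> {A. A \<subseteq> Z \<and> card A = m \<and> x \<in> A}" using B assms by auto
    qed
    show "(\<lambda>A. A - {x}) ` {A. A \<subseteq> Z \<and> card A = m \<and> x \<in> A} \<subseteq> {B. B \<subseteq> Z - {x} \<and> card B = m - 1}"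
      using assms by (auto simp: card_Diff_singleton dest: finite_subset)
  qed auto
  then have "card {A. A \<subseteq> Z \<and> card A = m \<and> x \<in> A} = card {B. B \<subseteq> Z - {x} \<and> card B = m - 1}"
    by (rule bij_betw_same_card[symmetric])
  also have "\<dots> = (card Z - 1) choose (m - 1)"
    using assms by (subst n_subsets) (auto simp: card_Diff_singleton)
  finally show ?thesis .
qed

text \<open>Double counting: increasing tuples correspond to \<open>m\<close>-element subsets, and
  each index lies in \<open>(n - 1) choose (m - 1)\<close> of these.\<close>

lemma sum_over_Inc_upto:
  fixes Y :: "int \<Rightarrow> real"
  assumes "m \<ge> 1"
  shows "(\<Sum>i\<in>Inc_upto m n. \<Sum>l\<in>{1..m}. Y (i l)) = real ((n - 1) choose (m - 1)) * (\<Sum>x\<in>{1..int n}. Y x)"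
proof -
  let ?A = "{A. A \<subseteq> {1..int n} \<and> card A = m}"
  have fA: "finite ?A" by (rule finite_subset[of _ "Pow {1..int n}"]) auto
  have "(\<Sum>i\<in>Inc_upto m n. \<Sum>l\<in>{1..m}. Y (i l)) = (\<Sum>i\<in>Inc_upto m n. \<Sum>x\<in>i ` {1..m}. Y x)"
    by (intro sum.cong refl) (simp add: sum.reindex[OF Inc_upto_inj])
  also have "\<dots> = (\<Sum>A\<in>?A. \<Sum>x\<in>A. Y x)"
    by (rule sum.reindex_bij_betw[OF bij_betw_Inc_upto_subsets])
  also have "\<dots> = (\<Sum>A\<in>?A. \<Sum>x\<in>{1..int n}. if x \<in> A then Y x else 0)"
  proof (rule sum.cong[OF refl])
    fix A assume "A \<in> ?A"
    then have "{x \<in> {1..int n}. x \<in> A} = A" by auto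
    then show "(\<Sum>x\<in>A. Y x) = (\<Sum>x\<in>{1..int n}. if x \<in> A then Y x else 0)"
      by (simp flip: sum.inter_filter)
  qed
  also have "\<dots> = (\<Sum>x\<in>{1..int n}. \<Sum>A\<in>?A. if x \<in> A then Y x else 0)"
    by (rule sum.swap)
  also have "\<dots> = (\<Sum>x\<in>{1..int n}. real ((n - 1) choose (m - 1)) * Y x)"
  proof (rule sum.cong[OF refl])
    fix x assume x: "x \<in> {1..int n}"
    have "(\<Sum>A\<in>?A. if x \<in> A then Y x else 0) = (\<Sum>A\<in>{A\<in>?A. x \<in> A}. Y x)"
      using fA by (simp only: sum.inter_filter)
    also have "{A\<in>?A. x \<in> A} = {A. A \<subseteq> {1..int n} \<and> card A = m \<and> x \<in> A}" by auto
    also have "(\<Sum>A\<in>\<dots>. Y x) = real ((n - 1) choose (m - 1)) * Y x"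
      using card_subsets_containing[OF _ x assms] by simp
    finally show "(\<Sum>A\<in>?A. if x \<in> A then Y x else 0) = real ((n - 1) choose (m - 1)) * Y x" .
  qed
  finally show ?thesis by (simp add: sum_distrib_left)
qed

text \<open>
  The numbers \<open>H2\<close> and \<open>\<delta> n\<close> record what is used of uniform integrability: only the families
  \<open>H\<^bsub>i,m\<^esub>\<close> and a single tuple of independent variables enter, the latter through the law \<open>\<mu>\<^sup>m\<close>.
\<close>

locale ustat_kernel = square_integrable_kernel M S X \<mu> m h
  for M :: "'a measure" and S :: "'s measure" and X :: "int \<Rightarrow> 'a \<Rightarrow> 's" and \<mu> :: "'s measure"
    and m :: nat and h :: "(nat \<Rightarrow> 's) \<Rightarrow> real" +
  fixes \<delta> :: "nat \<Rightarrow> real" and H2 :: real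
  assumes X_square: "\<And>i. i \<in> Inc m \<Longrightarrow> integrable M (\<lambda>\<omega>. (h (\<lambda>l\<in>{1..m}. X (i l) \<omega>))\<^sup>2)"
    and X_square_le: "\<And>i. i \<in> Inc m \<Longrightarrow> (\<integral>\<omega>. (h (\<lambda>l\<in>{1..m}. X (i l) \<omega>))\<^sup>2 \<partial>M) \<le> H2"
    and law_square_le: "(\<integral>x. (h x)\<^sup>2 \<partial>(\<Pi>\<^sub>M j\<in>{1..m}. \<mu>)) \<le> H2"
    and X_tail: "\<And>i n. i \<in> Inc m \<Longrightarrow>
      (\<integral>\<omega>. (if real n < (h (\<lambda>l\<in>{1..m}. X (i l) \<omega>))\<^sup>2 then (h (\<lambda>l\<in>{1..m}. X (i l) \<omega>))\<^sup>2 else 0) \<partial>M) \<le> \<delta> n"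
    and law_tail: "\<And>n. (\<integral>x. (if real n < (h x)\<^sup>2 then (h x)\<^sup>2 else 0) \<partial>(\<Pi>\<^sub>M j\<in>{1..m}. \<mu>)) \<le> \<delta> n"
    and \<delta>_lim: "\<delta> \<longlonglongrightarrow> 0"
    and beta_summable: "summable (\<lambda>k. real (Suc k) * beta_mixing M S X (Suc k))"
begin

text \<open>Values are replaced by 0 according to the size of \<open>h x\<close> alone, so symmetry
  survives. The threshold \<open>n\<close> for the square is \<open>sqrt n\<close> for
  \<open>h\<close>.\<close>

definition h_trunc :: "nat \<Rightarrow> (nat \<Rightarrow> 's) \<Rightarrow> real" where
  "h_trunc n x = (if (h x)\<^sup>2 \<le> real n then h x else 0)"

lemma h_trunc_le: "\<bar>h_trunc n x\<bar> \<le> sqrt (real n)"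
  unfolding h_trunc_def by (auto intro: real_le_rsqrt)

lemma h_trunc_sq_le: "(h_trunc n x)\<^sup>2 \<le> (h x)\<^sup>2"
  unfolding h_trunc_def by auto

lemma Inc_upto_Inc: "i \<in> Inc_upto m n \<Longrightarrow> n \<ge> m \<Longrightarrow> i \<in> Inc m"
  unfolding Inc_def by auto

text \<open>Truncating \<open>remainder\<close> directly would lose degeneracy. Each truncated
  kernel instead gets its own mean, projection and remainder, and the latter is degenerate by
  construction.\<close>

sublocale trunc: square_integrable_kernel M S X \<mu> m "h_trunc n" for n
proof unfold_locales
  show "m \<ge> 2" by (rule m_ge_2)
  show meas: "h_trunc n \<in> borel_measurable (\<Pi>\<^sub>M j\<in>{1..m}. S)" unfolding h_trunc_def by measurable
  show "symmetric_kernel S m (h_trunc n)"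
    using h_sym unfolding symmetric_kernel_def h_trunc_def by auto
  show "integrable (\<Pi>\<^sub>M j\<in>{1..m}. \<mu>) (\<lambda>x. (h_trunc n x)\<^sup>2)"
    using meas h_trunc_sq_le by (intro Bochner_Integration.integrable_bound[OF h_square]) (auto cong: measurable_cong_sets)
qed

end

context square_integrable_kernel
begin

text \<open>Integrating out variables contracts L^1 norms. The pointwise inequality holds where both
  sections are integrable, that is, almost everywhere.\<close>

lemma h1_diff_le:
  assumes K: "square_integrable_kernel M S X \<mu> m h'"
  shows "(\<integral>x. \<bar>h1 x - square_integrable_kernel.h1 \<mu> m h' x\<bar> \<partial>\<mu>) \<le> (\<integral>x. \<bar>h x - h' x\<bar> \<partial>(\<Pi>\<^sub>M j\<in>{1..m}. \<mu>))"
proof -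
  interpret K: square_integrable_kernel M S X \<mu> m h' by fact
  interpret L: prob_space "\<Pi>\<^sub>M j\<in>{1..m-1}. \<mu>" by (rule prob_space_laws)
  interpret P: pair_prob_space \<mu> "\<Pi>\<^sub>M j\<in>{1..m-1}. \<mu>" by unfold_locales
  have hi: "integrable (\<mu> \<Otimes>\<^sub>M (\<Pi>\<^sub>M j\<in>{1..m-1}. \<mu>)) (\<lambda>z. g ((\<lambda>(x, y). cons x y) z))"
    if "integrable (\<Pi>\<^sub>M j\<in>{1..m}. \<mu>) g" for g :: "_ \<Rightarrow> real"
    using integrable_distr[OF cons_measurable', of g] that unfolding law_cons by simp
  have i1: "integrable (\<mu> \<Otimes>\<^sub>M (\<Pi>\<^sub>M j\<in>{1..m-1}. \<mu>)) (\<lambda>(x, y). h (cons x y))"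
    using hi[OF h_integrable] by (simp add: case_prod_unfold)
  have i2: "integrable (\<mu> \<Otimes>\<^sub>M (\<Pi>\<^sub>M j\<in>{1..m-1}. \<mu>)) (\<lambda>(x, y). h' (cons x y))"
    using hi[OF K.h_integrable] by (simp add: case_prod_unfold)
  have i3: "integrable (\<mu> \<Otimes>\<^sub>M (\<Pi>\<^sub>M j\<in>{1..m-1}. \<mu>)) (\<lambda>(x, y). \<bar>h (cons x y) - h' (cons x y)\<bar>)"
    using hi[of "\<lambda>x. \<bar>h x - h' x\<bar>"] h_integrable K.h_integrable by (simp add: case_prod_unfold)
  have c: "K.h1 x = (\<integral>y. h' (cons x y) \<partial>(\<Pi>\<^sub>M j\<in>{1..m-1}. \<mu>))" for x
    unfolding K.h1_eq by (simp add: cons_def[abs_def] K.cons_def[abs_def])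
  have "AE x in \<mu>. \<bar>h1 x - K.h1 x\<bar> \<le> (\<integral>y. \<bar>h (cons x y) - h' (cons x y)\<bar> \<partial>(\<Pi>\<^sub>M j\<in>{1..m-1}. \<mu>))"
    using P.AE_integrable_fst[OF i1] P.AE_integrable_fst[OF i2]
  proof eventually_elim
    case (elim x)
    then have "h1 x - K.h1 x = (\<integral>y. h (cons x y) - h' (cons x y) \<partial>(\<Pi>\<^sub>M j\<in>{1..m-1}. \<mu>))"
      unfolding h1_eq c by simp
    then show ?case using integral_abs_bound[of "\<Pi>\<^sub>M j\<in>{1..m-1}. \<mu>" "\<lambda>y. h (cons x y) - h' (cons x y)"] by simp
  qed
  moreover have "integrable \<mu> (\<lambda>x. \<integral>y. \<bar>h (cons x y) - h' (cons x y)\<bar> \<partial>(\<Pi>\<^sub>M j\<in>{1..m-1}. \<mu>))"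
    using P.integrable_fst[OF i3] by simp
  ultimately have "(\<integral>x. \<bar>h1 x - K.h1 x\<bar> \<partial>\<mu>) \<le> (\<integral>x. (\<integral>y. \<bar>h (cons x y) - h' (cons x y)\<bar> \<partial>(\<Pi>\<^sub>M j\<in>{1..m-1}. \<mu>)) \<partial>\<mu>)"
    using h1_integrable K.h1_integrable by (intro integral_mono_AE) auto
  also have "\<dots> = (\<integral>z. \<bar>h ((\<lambda>(x, y). cons x y) z) - h' ((\<lambda>(x, y). cons x y) z)\<bar> \<partial>(\<mu> \<Otimes>\<^sub>M (\<Pi>\<^sub>M j\<in>{1..m-1}. \<mu>)))"
    using P.integral_fst[OF i3] by (simp add: case_prod_unfold)
  also have "\<dots> = (\<integral>x. \<bar>h x - h' x\<bar> \<partial>(\<Pi>\<^sub>M j\<in>{1..m}. \<mu>))"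
    using integral_distr[OF cons_measurable', of "\<lambda>x. \<bar>h x - h' x\<bar>"] h_meas K.h_meas unfolding law_cons by simp
  finally show ?thesis .
qed

lemma \<theta>_diff_le:
  assumes K: "square_integrable_kernel M S X \<mu> m h'"
  shows "\<bar>\<theta> - square_integrable_kernel.\<theta> \<mu> m h'\<bar> \<le> (\<integral>x. \<bar>h x - h' x\<bar> \<partial>(\<Pi>\<^sub>M j\<in>{1..m}. \<mu>))"
proof -
  interpret K: square_integrable_kernel M S X \<mu> m h' by fact
  have "\<theta> - K.\<theta> = (\<integral>x. h x - h' x \<partial>(\<Pi>\<^sub>M j\<in>{1..m}. \<mu>))"
    unfolding \<theta>_def K.\<theta>_def using h_integrable K.h_integrable by simp
  then show ?thesis using integral_abs_bound[of "\<Pi>\<^sub>M j\<in>{1..m}. \<mu>" "\<lambda>x. h x - h' x"] by simp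
qed

lemma integral_law_X:
  fixes f :: "'s \<Rightarrow> real"
  assumes "f \<in> borel_measurable S"
  shows "(\<integral>\<omega>. f (X i \<omega>) \<partial>M) = (\<integral>x. f x \<partial>\<mu>)"
  using integral_distr[OF X_meas assms, of i] unfolding law_X by simp

lemma integrable_law_X:
  fixes f :: "'s \<Rightarrow> real"
  assumes "integrable \<mu> f"
  shows "integrable M (\<lambda>\<omega>. f (X i \<omega>))"
  using integrable_distr[OF X_meas, of i f] assms unfolding law_X by simp

lemma remainder_tuple: "remainder (\<lambda>l\<in>{1..m}. X (i l) \<omega>) = h (\<lambda>l\<in>{1..m}. X (i l) \<omega>) - \<theta> - (\<Sum>l\<in>{1..m}. h1 (X (i l) \<omega>) - \<theta>)"
  unfolding remainder_def by simp

lemma bounded_kernel: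
  assumes b: "\<And>x. \<bar>h x\<bar> \<le> b"
  shows "\<bar>h1 x\<bar> \<le> b" and "\<bar>\<theta>\<bar> \<le> b" and "\<bar>remainder z\<bar> \<le> (2 * real m + 2) * b"
proof -
  have b0: "0 \<le> b" using b[of undefined] by linarith
  have le: "\<bar>\<integral>y. f y \<partial>N\<bar> \<le> b" if N: "prob_space N" and f: "\<And>y. \<bar>f y\<bar> \<le> b" for N :: "'z measure" and f :: "'z \<Rightarrow> real"
  \<comment> \<open>\<open>f\<close> is bounded but may fail to be measurable. Its Bochner integral
    is then 0, which obeys the bound as well.\<close>
  proof (cases "integrable N f")
    case True
    interpret N: prob_space N by fact
    have "\<bar>\<integral>y. f y \<partial>N\<bar> \<le> (\<integral>y. \<bar>f y\<bar> \<partial>N)" by (rule integral_abs_bound)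
    also have "\<dots> \<le> (\<integral>y. b \<partial>N)" using True f by (intro integral_mono) auto
    finally show ?thesis by (simp add: N.prob_space)
  qed (simp add: not_integrable_integral_eq b0)
  show 1: "\<bar>h1 x\<bar> \<le> b" for x unfolding h1_eq using prob_space_laws b by (rule le)
  show 2: "\<bar>\<theta>\<bar> \<le> b" unfolding \<theta>_def using prob_space_laws b by (rule le)
  have "\<bar>\<Sum>l\<in>{1..m}. h1 (z l) - \<theta>\<bar> \<le> (\<Sum>l\<in>{1..m}. \<bar>h1 (z l) - \<theta>\<bar>)" by (rule sum_abs)
  also have "\<dots> \<le> (\<Sum>l\<in>{1..m}. 2 * b)"
  proof (intro sum_mono)
    fix l show "\<bar>h1 (z l) - \<theta>\<bar> \<le> 2 * b" using 1[of "z l"] 2 by linarith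
  qed
  finally have "\<bar>\<Sum>l\<in>{1..m}. h1 (z l) - \<theta>\<bar> \<le> 2 * real m * b" by simp
  then have "\<bar>remainder z\<bar> \<le> 2 * real m * b + 2 * b" unfolding remainder_def using b[of z] 2 by linarith
  then show "\<bar>remainder z\<bar> \<le> (2 * real m + 2) * b" by (simp add: algebra_simps)
qed

lemma remainder_second_moment:
  assumes i: "integrable M (\<lambda>\<omega>. (h (\<lambda>l\<in>{1..m}. X (i l) \<omega>))\<^sup>2)"
    and C: "(\<integral>\<omega>. (h (\<lambda>l\<in>{1..m}. X (i l) \<omega>))\<^sup>2 \<partial>M) \<le> C" "(\<integral>x. (h x)\<^sup>2 \<partial>(\<Pi>\<^sub>M j\<in>{1..m}. \<mu>)) \<le> C"
  shows "(\<integral>\<omega>. (remainder (\<lambda>l\<in>{1..m}. X (i l) \<omega>))\<^sup>2 \<partial>M) \<le> 3 * (1 + 2 * (real m)\<^sup>2) * C"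
proof -
  interpret L: prob_space "\<Pi>\<^sub>M j\<in>{1..m}. \<mu>" by (rule prob_space_laws)
  let ?h = "\<lambda>\<omega>. h (\<lambda>l\<in>{1..m}. X (i l) \<omega>)"
  have \<theta>2: "\<theta>\<^sup>2 \<le> C"
  proof -
    have "0 \<le> L.variance h" by (rule L.variance_positive)
    then show ?thesis using L.variance_eq[OF h_integrable h_square] C(2) by (simp add: \<theta>_def)
  qed
  have h1i: "integrable M (\<lambda>\<omega>. (h1 (X k \<omega>))\<^sup>2)" for k by (rule integrable_law_X[OF h1_square])
  have h1C: "(\<integral>\<omega>. (h1 (X k \<omega>))\<^sup>2 \<partial>M) \<le> C" for k
    using h1_square_le C(2) by (subst integral_law_X[where f="\<lambda>x. (h1 x)\<^sup>2"]) auto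
  \<comment> \<open>\<open>remainder\<close> equals \<open>h + (m - 1) * \<theta>\<close> minus the
    sum of the \<open>m\<close> projections. Squaring three terms costs a factor 3,
    \<open>(m - 1)\<^sup>2\<close> is at most \<open>m\<^sup>2\<close>, and Cauchy-Schwarz for the
    projections gives the factor \<open>m\<close>.\<close>
  define G where "G \<omega> = 3 * (?h \<omega>)\<^sup>2 + 3 * ((real m)\<^sup>2 * \<theta>\<^sup>2) + 3 * (real m * (\<Sum>l\<in>{1..m}. (h1 (X (i l) \<omega>))\<^sup>2))" for \<omega>
  have G: "integrable M G"
    unfolding G_def using i h1i
    by (intro Bochner_Integration.integrable_add integrable_mult_right Bochner_Integration.integrable_sum) auto
  have sq: "(a + b - c)\<^sup>2 \<le> 3 * a\<^sup>2 + 3 * b\<^sup>2 + 3 * c\<^sup>2" for a b c :: real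
  proof -
    have "3 * a\<^sup>2 + 3 * b\<^sup>2 + 3 * c\<^sup>2 - (a + b - c)\<^sup>2 = (a - b)\<^sup>2 + (a + c)\<^sup>2 + (b + c)\<^sup>2"
      by (simp add: power2_eq_square algebra_simps)
    then show ?thesis using zero_le_power2[of "a - b"] zero_le_power2[of "a + c"] zero_le_power2[of "b + c"] by linarith
  qed
  have le: "(remainder (\<lambda>l\<in>{1..m}. X (i l) \<omega>))\<^sup>2 \<le> G \<omega>" for \<omega>
  proof -
    let ?s = "\<Sum>l\<in>{1..m}. h1 (X (i l) \<omega>)"
    have "remainder (\<lambda>l\<in>{1..m}. X (i l) \<omega>) = ?h \<omega> + (real m - 1) * \<theta> - ?s"
      unfolding remainder_tuple by (simp add: sum_subtractf algebra_simps)
    then have "(remainder (\<lambda>l\<in>{1..m}. X (i l) \<omega>))\<^sup>2 \<le> 3 * (?h \<omega>)\<^sup>2 + 3 * ((real m - 1) * \<theta>)\<^sup>2 + 3 * ?s\<^sup>2"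
      using sq by simp
    moreover have "((real m - 1) * \<theta>)\<^sup>2 \<le> (real m)\<^sup>2 * \<theta>\<^sup>2"
      using m_ge_2 by (simp add: power_mult_distrib mult_right_mono power_mono)
    moreover have "?s\<^sup>2 \<le> real m * (\<Sum>l\<in>{1..m}. (h1 (X (i l) \<omega>))\<^sup>2)"
      using Cauchy_Schwarz_ineq_sum[of "\<lambda>_. 1" "\<lambda>l. h1 (X (i l) \<omega>)" "{1..m}"] by simp
    ultimately show ?thesis unfolding G_def by linarith
  qed
  have "(\<integral>\<omega>. (remainder (\<lambda>l\<in>{1..m}. X (i l) \<omega>))\<^sup>2 \<partial>M) \<le> (\<integral>\<omega>. G \<omega> \<partial>M)"
  proof (rule integral_mono[OF _ G le])
    show "integrable M (\<lambda>\<omega>. (remainder (\<lambda>l\<in>{1..m}. X (i l) \<omega>))\<^sup>2)"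
    proof (rule Bochner_Integration.integrable_bound[OF G])
      show "AE \<omega> in M. norm ((remainder (\<lambda>l\<in>{1..m}. X (i l) \<omega>))\<^sup>2) \<le> norm (G \<omega>)"
        using le by (intro AE_I2) (simp add: order_trans[OF le abs_ge_self])
    qed measurable
  qed
  also have "\<dots> = 3 * (\<integral>\<omega>. (?h \<omega>)\<^sup>2 \<partial>M) + 3 * ((real m)\<^sup>2 * \<theta>\<^sup>2) + 3 * (real m * (\<Sum>l\<in>{1..m}. \<integral>\<omega>. (h1 (X (i l) \<omega>))\<^sup>2 \<partial>M))"
    unfolding G_def using i h1i by (simp add: prob_space)
  also have "\<dots> \<le> 3 * C + 3 * ((real m)\<^sup>2 * C) + 3 * (real m * (\<Sum>l\<in>{1..m}. C))"
    using C(1) \<theta>2 h1C by (intro add_mono mult_left_mono sum_mono) auto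
  also have "\<dots> = 3 * (1 + 2 * (real m)\<^sup>2) * C" by (simp add: power2_eq_square algebra_simps)
  finally show ?thesis .
qed

end

section \<open>Truncation error and normalization\<close>

context ustat_kernel
begin

abbreviation tup :: "(nat \<Rightarrow> int) \<Rightarrow> 'a \<Rightarrow> nat \<Rightarrow> 's" where
  "tup i \<omega> \<equiv> (\<lambda>l\<in>{1..m}. X (i l) \<omega>)"

lemma h_tuple_integrable:
  assumes "i \<in> Inc m"
  shows "integrable M (\<lambda>\<omega>. h (tup i \<omega>))"
  by (rule square_integrable_imp_integrable[OF _ X_square[OF assms]]) measurable

lemma remainder_tuple_integrable: "i \<in> Inc m \<Longrightarrow> integrable M (\<lambda>\<omega>. remainder (tup i \<omega>))"
  unfolding remainder_tuple using h_tuple_integrable integrable_law_X[OF h1_integrable] by auto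

lemma H2_nonneg: "0 \<le> H2"
  using law_square_le by (rule order_trans[rotated]) simp

text \<open>Where \<open>h\<close> is cut off, \<open>\<bar>h x\<bar>\<close> exceeds
  \<open>sqrt n\<close> and is therefore at most \<open>(h x)\<^sup>2 / sqrt n\<close>. In this way
  uniform integrability of the squares becomes an L^1 error of order
  \<open>\<delta> n / sqrt n\<close>.\<close>

lemma h_trunc_diff_le:
  assumes "n \<ge> 1"
  shows "\<bar>h x - h_trunc n x\<bar> \<le> (if real n < (h x)\<^sup>2 then (h x)\<^sup>2 else 0) / sqrt (real n)"
proof (cases "real n < (h x)\<^sup>2")
  case True
  then have "sqrt (real n) \<le> \<bar>h x\<bar>" using real_sqrt_le_mono[of "real n" "(h x)\<^sup>2"] by simp
  then have "\<bar>h x\<bar> * sqrt (real n) \<le> \<bar>h x\<bar> * \<bar>h x\<bar>" by (rule mult_left_mono) simp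
  then have "\<bar>h x\<bar> * sqrt (real n) \<le> (h x)\<^sup>2" by (simp add: power2_eq_square)
  then show ?thesis using True assms by (simp add: h_trunc_def le_divide_eq)
qed (simp add: h_trunc_def)

lemma law_h_trunc_diff_le:
  assumes "n \<ge> 1"
  shows "(\<integral>x. \<bar>h x - h_trunc n x\<bar> \<partial>(\<Pi>\<^sub>M j\<in>{1..m}. \<mu>)) \<le> \<delta> n / sqrt (real n)"
proof -
  have i: "integrable (\<Pi>\<^sub>M j\<in>{1..m}. \<mu>) (\<lambda>x. if real n < (h x)\<^sup>2 then (h x)\<^sup>2 else 0)"
    by (rule Bochner_Integration.integrable_bound[OF h_square]) auto
  have "(\<integral>x. \<bar>h x - h_trunc n x\<bar> \<partial>(\<Pi>\<^sub>M j\<in>{1..m}. \<mu>)) \<le> (\<integral>x. (if real n < (h x)\<^sup>2 then (h x)\<^sup>2 else 0) / sqrt (real n) \<partial>(\<Pi>\<^sub>M j\<in>{1..m}. \<mu>))"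
    using h_trunc_diff_le[OF assms] h_integrable trunc.h_integrable i by (intro integral_mono) auto
  also have "\<dots> \<le> \<delta> n / sqrt (real n)" using law_tail[of n] by (simp add: divide_right_mono)
  finally show ?thesis .
qed

lemma X_h_trunc_diff_le:
  assumes n: "n \<ge> 1" and i: "i \<in> Inc m"
  shows "(\<integral>\<omega>. \<bar>h (tup i \<omega>) - h_trunc n (tup i \<omega>)\<bar> \<partial>M) \<le> \<delta> n / sqrt (real n)"
    and "integrable M (\<lambda>\<omega>. h_trunc n (tup i \<omega>))"
proof -
  show h_trunci: "integrable M (\<lambda>\<omega>. h_trunc n (tup i \<omega>))"
    using h_trunc_le by (intro integrable_const_bound[where B="sqrt (real n)"]) auto
  have it: "integrable M (\<lambda>\<omega>. if real n < (h (tup i \<omega>))\<^sup>2 then (h (tup i \<omega>))\<^sup>2 else 0)"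
    by (rule Bochner_Integration.integrable_bound[OF X_square[OF i]]) auto
  have "(\<integral>\<omega>. \<bar>h (tup i \<omega>) - h_trunc n (tup i \<omega>)\<bar> \<partial>M) \<le> (\<integral>\<omega>. (if real n < (h (tup i \<omega>))\<^sup>2 then (h (tup i \<omega>))\<^sup>2 else 0) / sqrt (real n) \<partial>M)"
    using h_trunc_diff_le[OF n] h_tuple_integrable[OF i] h_trunci it by (intro integral_mono) auto
  also have "\<dots> \<le> \<delta> n / sqrt (real n)" using X_tail[OF i, of n] by (simp add: divide_right_mono)
  finally show "(\<integral>\<omega>. \<bar>h (tup i \<omega>) - h_trunc n (tup i \<omega>)\<bar> \<partial>M) \<le> \<delta> n / sqrt (real n)" .
qed

text \<open>One error \<open>\<delta> n / sqrt n\<close> comes from \<open>h\<close>, one from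
  \<open>\<theta>\<close>, and two from each of the \<open>m\<close> centred projections.\<close>

lemma remainder_diff_le:
  assumes n: "n \<ge> 1" and i: "i \<in> Inc m"
  shows "(\<integral>\<omega>. \<bar>remainder (tup i \<omega>) - trunc.remainder n (tup i \<omega>)\<bar> \<partial>M) \<le> (2 * real m + 2) * (\<delta> n / sqrt (real n))"
    and "integrable M (\<lambda>\<omega>. trunc.remainder n (tup i \<omega>))"
proof -
  let ?d = "\<delta> n / sqrt (real n)"
  define D where "D x = \<bar>h1 x - trunc.h1 n x\<bar>" for x
  have K: "square_integrable_kernel M S X \<mu> m (h_trunc n)" by unfold_locales
  have th: "\<bar>\<theta> - trunc.\<theta> n\<bar> \<le> ?d" using \<theta>_diff_le[OF K] law_h_trunc_diff_le[OF n] by simp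
  have Di: "integrable \<mu> D" unfolding D_def using h1_integrable trunc.h1_integrable by auto
  have D: "integrable M (\<lambda>\<omega>. D (X k \<omega>))" for k by (rule integrable_law_X[OF Di])
  have DE: "(\<integral>\<omega>. D (X k \<omega>) \<partial>M) \<le> ?d" for k
  proof -
    have [measurable]: "D \<in> borel_measurable S" unfolding D_def by measurable
    have "(\<integral>x. D x \<partial>\<mu>) \<le> ?d"
      unfolding D_def using h1_diff_le[OF K] law_h_trunc_diff_le[OF n] by linarith
    then show ?thesis by (simp add: integral_law_X)
  qed
  show ri: "integrable M (\<lambda>\<omega>. trunc.remainder n (tup i \<omega>))"
    unfolding trunc.remainder_tuple using X_h_trunc_diff_le(2)[OF n i] integrable_law_X[OF trunc.h1_integrable] by auto
  define G where "G \<omega> = \<bar>h (tup i \<omega>) - h_trunc n (tup i \<omega>)\<bar> + \<bar>\<theta> - trunc.\<theta> n\<bar> + (\<Sum>l\<in>{1..m}. D (X (i l) \<omega>) + \<bar>\<theta> - trunc.\<theta> n\<bar>)" for \<omega>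
  have Gi: "integrable M G" unfolding G_def
    using X_h_trunc_diff_le(2)[OF n i] h_tuple_integrable[OF i] D by auto
  have le: "\<bar>remainder (tup i \<omega>) - trunc.remainder n (tup i \<omega>)\<bar> \<le> G \<omega>" for \<omega>
  proof -
    have "remainder (tup i \<omega>) - trunc.remainder n (tup i \<omega>) = (h (tup i \<omega>) - h_trunc n (tup i \<omega>)) - (\<theta> - trunc.\<theta> n)
        - (\<Sum>l\<in>{1..m}. (h1 (X (i l) \<omega>) - trunc.h1 n (X (i l) \<omega>)) - (\<theta> - trunc.\<theta> n))"
      unfolding remainder_tuple trunc.remainder_tuple by (simp add: sum_subtractf sum.distrib algebra_simps)
    moreover have "\<bar>\<Sum>l\<in>{1..m}. (h1 (X (i l) \<omega>) - trunc.h1 n (X (i l) \<omega>)) - (\<theta> - trunc.\<theta> n)\<bar> \<le> (\<Sum>l\<in>{1..m}. D (X (i l) \<omega>) + \<bar>\<theta> - trunc.\<theta> n\<bar>)"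
      unfolding D_def by (rule order_trans[OF sum_abs]) (intro sum_mono abs_triangle_ineq4)
    ultimately show ?thesis unfolding G_def by linarith
  qed
  have "(\<integral>\<omega>. \<bar>remainder (tup i \<omega>) - trunc.remainder n (tup i \<omega>)\<bar> \<partial>M) \<le> (\<integral>\<omega>. G \<omega> \<partial>M)"
    using le remainder_tuple_integrable[OF i] ri Gi by (intro integral_mono) auto
  also have "\<dots> = (\<integral>\<omega>. \<bar>h (tup i \<omega>) - h_trunc n (tup i \<omega>)\<bar> \<partial>M) + \<bar>\<theta> - trunc.\<theta> n\<bar> + (\<Sum>l\<in>{1..m}. (\<integral>\<omega>. D (X (i l) \<omega>) \<partial>M) + \<bar>\<theta> - trunc.\<theta> n\<bar>)"
    unfolding G_def using X_h_trunc_diff_le(2)[OF n i] h_tuple_integrable[OF i] D by (simp add: prob_space)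
  also have "\<dots> \<le> ?d + ?d + (\<Sum>l\<in>{1..m}. ?d + ?d)"
    using X_h_trunc_diff_le(1)[OF n i] th DE by (intro add_mono sum_mono) auto
  also have "\<dots> = (2 * real m + 2) * ?d" by (simp add: algebra_simps)
  finally show "(\<integral>\<omega>. \<bar>remainder (tup i \<omega>) - trunc.remainder n (tup i \<omega>)\<bar> \<partial>M) \<le> (2 * real m + 2) * ?d" .
qed

lemma card_Inc_upto_le: "card (Inc_upto m n) \<le> n ^ m"
proof -
  have "card (Inc_upto m n) \<le> card ({1..m} \<rightarrow>\<^sub>E {1..int n})"
    by (intro card_mono Inc_upto_subset finite_PiE) auto
  then show ?thesis by (simp add: card_PiE)
qed

definition beta_tail :: "nat \<Rightarrow> real" where
  "beta_tail K = (\<Sum>k. real (Suc (k + K)) * beta_mixing M S X (Suc (k + K)))"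

lemma beta_tail_tendsto: "beta_tail \<longlonglongrightarrow> 0"
proof -
  let ?f = "\<lambda>k. real (Suc k) * beta_mixing M S X (Suc k)"
  have eq: "beta_tail = (\<lambda>K. suminf ?f - (\<Sum>k<K. ?f k))"
    by (rule ext) (unfold beta_tail_def, rule suminf_minus_initial_segment[OF beta_summable])
  have "(\<lambda>K. suminf ?f - (\<Sum>k<K. ?f k)) \<longlonglongrightarrow> suminf ?f - suminf ?f"
    using summable_LIMSEQ[OF beta_summable] by (intro tendsto_intros)
  then show ?thesis unfolding eq by (simp only: diff_self)
qed

lemma sum_le_beta_tail: "(\<Sum>k\<in>{Suc K..n}. real k * beta_mixing M S X k) \<le> beta_tail K"
proof -
  let ?f = "\<lambda>k. real (Suc (k + K)) * beta_mixing M S X (Suc (k + K))"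
  have s: "summable ?f" using summable_ignore_initial_segment[OF beta_summable, of K] by simp
  have "(\<Sum>k\<in>{Suc K..n}. real k * beta_mixing M S X k) \<le> (\<Sum>k\<in>{Suc K..<Suc K + n}. real k * beta_mixing M S X k)"
    using beta_mixing_nonneg by (intro sum_mono2) auto
  also have "\<dots> = (\<Sum>k<n. ?f k)"
    using sum.shift_bounds_nat_ivl[of "\<lambda>k. real k * beta_mixing M S X k" 0 "Suc K" n]
    by (simp add: atLeast0LessThan add.commute)
  also have "\<dots> \<le> beta_tail K"
    unfolding beta_tail_def using beta_mixing_nonneg by (intro sum_le_suminf[OF s]) auto
  finally show ?thesis .
qed

text \<open>
  Pairs of tuples whose second smallest index distance is at most \<open>K\<close> are bounded by second
  moments, which gives \<open>near_const\<close>; the others by decoupling, with \<open>B\<^sup>2 = (2m+2)\<^sup>2 n\<close>, which gives \<open>far_const\<close>.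
\<close>

definition near_const :: real where "near_const = real (2 * m) ^ 4 * (3 * (1 + 2 * (real m)\<^sup>2) * H2) * 6"
definition far_const :: real where "far_const = real (2 * m) ^ 4 * (4 * (2 * real m + 2)\<^sup>2 * real (2 * m + 1)) * 6"

text \<open>\<open>n / n ^ (2 * m)\<close> is the square of the normalization
  \<open>sqrt n / n ^ m\<close>. Against \<open>n ^ (2 * m - 2)\<close> it leaves
  \<open>1 / n\<close>, which cancels the factor \<open>n\<close> of \<open>B\<^sup>2\<close> in the
  distant terms and survives in the near ones.\<close>

lemma truncated_sum_square:
  assumes n: "n \<ge> m"
  shows "real n / real n ^ (2 * m) * (\<integral>\<omega>. (\<Sum>i\<in>Inc_upto m n. trunc.remainder n (tup i \<omega>))\<^sup>2 \<partial>M) \<le>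
    near_const * (real (Suc K))\<^sup>2 / real n + far_const * beta_tail K"
proof -
  define C2 where "C2 = 3 * (1 + 2 * (real m)\<^sup>2) * H2"
  define B where "B = (2 * real m + 2) * sqrt (real n)"
  have n0: "n > 0" using n m_ge_2 by simp
  have C20: "0 \<le> C2" using H2_nonneg by (simp add: C2_def)
  define W where "W k = (if k < Suc K then C2 else 4 * B\<^sup>2 * real (2 * m + 1) * beta_mixing M S X k)" for k
  have "(\<integral>\<omega>. (\<Sum>i\<in>Inc_upto m n. trunc.remainder n (tup i \<omega>))\<^sup>2 \<partial>M) \<le>
    real (2 * m) ^ 4 * real n ^ (2 * m - 2) * (\<Sum>k\<le>n. W k * (2 * (2 * real k + 1)))"
    unfolding W_def
  proof (rule trunc.sum_square_bound)
    show "\<bar>trunc.remainder n x\<bar> \<le> B" for x unfolding B_def using h_trunc_le by (rule trunc.bounded_kernel)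
    show "0 \<le> C2" by fact
    fix i assume "i \<in> Inc_upto m n"
    then have i: "i \<in> Inc m" using n by (rule Inc_upto_Inc)
    have ih: "integrable M (\<lambda>\<omega>. (h_trunc n (tup i \<omega>))\<^sup>2)"
      by (rule Bochner_Integration.integrable_bound[OF X_square[OF i]]) (auto simp: h_trunc_sq_le)
    show "(\<integral>\<omega>. (trunc.remainder n (tup i \<omega>))\<^sup>2 \<partial>M) \<le> C2"
      unfolding C2_def
    proof (rule trunc.remainder_second_moment[OF ih])
      show "(\<integral>\<omega>. (h_trunc n (tup i \<omega>))\<^sup>2 \<partial>M) \<le> H2"
        using X_square_le[OF i] integral_mono[OF ih X_square[OF i]] h_trunc_sq_le by (meson order_trans)
      show "(\<integral>x. (h_trunc n x)\<^sup>2 \<partial>(\<Pi>\<^sub>M j\<in>{1..m}. \<mu>)) \<le> H2"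
        using law_square_le integral_mono[OF trunc.h_square h_square] h_trunc_sq_le by (meson order_trans)
    qed
  qed simp
  then have "real n / real n ^ (2 * m) * (\<integral>\<omega>. (\<Sum>i\<in>Inc_upto m n. trunc.remainder n (tup i \<omega>))\<^sup>2 \<partial>M) \<le>
    real n / real n ^ (2 * m) * (real (2 * m) ^ 4 * real n ^ (2 * m - 2) * (\<Sum>k\<le>n. W k * (2 * (2 * real k + 1))))"
    by (rule mult_left_mono) simp
  also have "\<dots> = real (2 * m) ^ 4 * ((\<Sum>k\<le>n. W k * (2 * (2 * real k + 1))) / real n)"
  proof -
    have "2 * m = (2 * m - 2) + 2" using m_ge_2 by simp
    then have "real n ^ (2 * m) = real n ^ (2 * m - 2) * real n ^ 2" by (metis power_add)
    then have "real n ^ (2 * m) = real n ^ (2 * m - 2) * (real n * real n)" by (simp only: power2_eq_square)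
    then show ?thesis using n0 by (simp add: field_simps)
  qed
  also have "\<dots> \<le> real (2 * m) ^ 4 * ((C2 * 6 * (real (Suc K))\<^sup>2 + 4 * B\<^sup>2 * real (2 * m + 1) * 6 * beta_tail K) / real n)"
  proof (intro mult_left_mono divide_right_mono)
    show "(\<Sum>k\<le>n. W k * (2 * (2 * real k + 1))) \<le> C2 * 6 * (real (Suc K))\<^sup>2 + 4 * B\<^sup>2 * real (2 * m + 1) * 6 * beta_tail K"
    proof -
    \<comment> \<open>For \<open>K > n\<close> the first range goes beyond \<open>n\<close>; the
      additional terms are non-negative.\<close>
    have "(\<Sum>k\<le>n. W k * (2 * (2 * real k + 1))) \<le> (\<Sum>k\<in>{..<Suc K} \<union> {Suc K..n}. W k * (2 * (2 * real k + 1)))"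
      using C20 beta_mixing_nonneg by (intro sum_mono2) (auto simp: W_def)
    also have "\<dots> = (\<Sum>k<Suc K. W k * (2 * (2 * real k + 1))) + (\<Sum>k\<in>{Suc K..n}. W k * (2 * (2 * real k + 1)))"
      by (rule sum.union_disjoint) auto
    also have "\<dots> \<le> (\<Sum>k<Suc K. C2 * (6 * real (Suc K))) + (\<Sum>k\<in>{Suc K..n}. 4 * B\<^sup>2 * real (2 * m + 1) * 6 * (real k * beta_mixing M S X k))"
    proof (intro add_mono sum_mono)
      show "W k * (2 * (2 * real k + 1)) \<le> C2 * (6 * real (Suc K))" if "k \<in> {..<Suc K}" for k
        using that C20 by (auto simp: W_def intro!: mult_left_mono)
      show "W k * (2 * (2 * real k + 1)) \<le> 4 * B\<^sup>2 * real (2 * m + 1) * 6 * (real k * beta_mixing M S X k)" if "k \<in> {Suc K..n}" for k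
      proof -
        \<comment> \<open>This needs \<open>k \<ge> 1\<close>, which holds in the far range. In the
          near range the same factor 6 bounds \<open>2 * (2 * k + 1)\<close> by
          \<open>6 * Suc K\<close>.\<close>
        have "2 * (2 * real k + 1) \<le> 6 * real k" using that by simp
        then have "(4 * B\<^sup>2 * real (2 * m + 1) * beta_mixing M S X k) * (2 * (2 * real k + 1)) \<le> (4 * B\<^sup>2 * real (2 * m + 1) * beta_mixing M S X k) * (6 * real k)"
          using beta_mixing_nonneg by (intro mult_left_mono) auto
        moreover have "W k = 4 * B\<^sup>2 * real (2 * m + 1) * beta_mixing M S X k" using that by (simp add: W_def)
        ultimately show ?thesis by (simp only: mult_ac)
      qed
    qed
    also have "\<dots> = C2 * 6 * (real (Suc K))\<^sup>2 + 4 * B\<^sup>2 * real (2 * m + 1) * 6 * (\<Sum>k\<in>{Suc K..n}. real k * beta_mixing M S X k)"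
    proof -
      have "(\<Sum>k\<in>{Suc K..n}. 4 * B\<^sup>2 * real (2 * m + 1) * 6 * (real k * beta_mixing M S X k)) =
        4 * B\<^sup>2 * real (2 * m + 1) * 6 * (\<Sum>k\<in>{Suc K..n}. real k * beta_mixing M S X k)"
        by (rule sum_distrib_left[symmetric])
      moreover have "(\<Sum>k<Suc K. C2 * (6 * real (Suc K))) = C2 * 6 * (real (Suc K))\<^sup>2"
        by (simp only: sum_constant card_lessThan power2_eq_square mult_ac)
      ultimately show ?thesis by simp
    qed
    also have "\<dots> \<le> C2 * 6 * (real (Suc K))\<^sup>2 + 4 * B\<^sup>2 * real (2 * m + 1) * 6 * beta_tail K"
      using sum_le_beta_tail[of K n] by (intro add_left_mono mult_left_mono) auto
    finally show ?thesis .
    qed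
  qed auto
  also have "\<dots> =
      near_const * (real (Suc K))\<^sup>2 / real n + far_const * beta_tail K"
  proof -
    have "B\<^sup>2 = (2 * real m + 2)\<^sup>2 * real n" by (simp add: B_def power_mult_distrib)
    moreover have "a * ((c * 6 * s + 4 * (w * real n) * l * 6 * t) / real n) = a * c * 6 * s / real n + a * (4 * w * l) * 6 * t" for a c s w l t :: real
      using n0 by (simp add: field_simps)
    ultimately show ?thesis unfolding near_const_def far_const_def C2_def by simp
  qed
  finally show ?thesis .
qed

lemma truncated_remainder_sum_bounded: "\<bar>\<Sum>i\<in>Inc_upto m n. trunc.remainder n (tup i \<omega>)\<bar> \<le> real (card (Inc_upto m n)) * ((2 * real m + 2) * sqrt (real n))"
proof -
  have "\<bar>\<Sum>i\<in>Inc_upto m n. trunc.remainder n (tup i \<omega>)\<bar> \<le> (\<Sum>i\<in>Inc_upto m n. \<bar>trunc.remainder n (tup i \<omega>)\<bar>)" by (rule sum_abs)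
  also have "\<dots> \<le> (\<Sum>i\<in>Inc_upto m n. (2 * real m + 2) * sqrt (real n))"
    by (intro sum_mono trunc.bounded_kernel(3) h_trunc_le)
  finally show ?thesis by simp
qed

text \<open>The truncated part is controlled in L^2 and enters through Jensen's inequality, the
  truncation error only in L^1. For the latter, at most \<open>n ^ m\<close> tuples, each with an
  error of order \<open>\<delta> n / sqrt n\<close>, and the normalization leave a multiple of
  \<open>\<delta> n\<close>.\<close>

lemma remainder_sum_abs_le:
  assumes n: "n \<ge> m"
  shows "sqrt (real n) / real n ^ m * (\<integral>\<omega>. \<bar>\<Sum>i\<in>Inc_upto m n. remainder (tup i \<omega>)\<bar> \<partial>M) \<le>
    sqrt (near_const * (real (Suc K))\<^sup>2 / real n + far_const * beta_tail K) + (2 * real m + 2) * \<delta> n"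
proof -
  have n1: "n \<ge> 1" using n m_ge_2 by simp
  define F where "F \<omega> = (\<Sum>i\<in>Inc_upto m n. trunc.remainder n (tup i \<omega>))" for \<omega>
  define G where "G \<omega> = (\<Sum>i\<in>Inc_upto m n. \<bar>remainder (tup i \<omega>) - trunc.remainder n (tup i \<omega>)\<bar>)" for \<omega>
  define c where "c = sqrt (real n) / real n ^ m"
  have c0: "0 \<le> c" by (simp add: c_def)
  have Inc: "i \<in> Inc m" if "i \<in> Inc_upto m n" for i using that n by (rule Inc_upto_Inc)
  have Fi: "integrable M F" unfolding F_def using remainder_diff_le(2)[OF n1] Inc by auto
  have Gi: "integrable M G" unfolding G_def using remainder_diff_le(2)[OF n1] remainder_tuple_integrable Inc by auto
  have F2: "integrable M (\<lambda>\<omega>. (F \<omega>)\<^sup>2)"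
  proof (rule integrable_const_bound)
    show "AE \<omega> in M. norm ((F \<omega>)\<^sup>2) \<le> (real (card (Inc_upto m n)) * ((2 * real m + 2) * sqrt (real n)))\<^sup>2"
    proof (rule AE_I2)
      fix \<omega>
      have "\<bar>F \<omega>\<bar> \<le> real (card (Inc_upto m n)) * ((2 * real m + 2) * sqrt (real n))"
        unfolding F_def by (rule truncated_remainder_sum_bounded)
      from power_mono[OF this, of 2] show "norm ((F \<omega>)\<^sup>2) \<le> (real (card (Inc_upto m n)) * ((2 * real m + 2) * sqrt (real n)))\<^sup>2"
        by simp
    qed
  qed (use Fi in measurable)
  have "(\<integral>\<omega>. \<bar>\<Sum>i\<in>Inc_upto m n. remainder (tup i \<omega>)\<bar> \<partial>M) \<le> (\<integral>\<omega>. \<bar>F \<omega>\<bar> + G \<omega> \<partial>M)"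
  proof (rule integral_mono)
    show "integrable M (\<lambda>\<omega>. \<bar>\<Sum>i\<in>Inc_upto m n. remainder (tup i \<omega>)\<bar>)" using remainder_tuple_integrable Inc by auto
    show "integrable M (\<lambda>\<omega>. \<bar>F \<omega>\<bar> + G \<omega>)" using Fi Gi by auto
    fix \<omega>
    have "(\<Sum>i\<in>Inc_upto m n. remainder (tup i \<omega>)) = F \<omega> + (\<Sum>i\<in>Inc_upto m n. remainder (tup i \<omega>) - trunc.remainder n (tup i \<omega>))"
      unfolding F_def by (simp add: sum_subtractf)
    moreover have "\<bar>\<Sum>i\<in>Inc_upto m n. remainder (tup i \<omega>) - trunc.remainder n (tup i \<omega>)\<bar> \<le> G \<omega>"
      unfolding G_def by (rule sum_abs)
    ultimately show "\<bar>\<Sum>i\<in>Inc_upto m n. remainder (tup i \<omega>)\<bar> \<le> \<bar>F \<omega>\<bar> + G \<omega>" by linarith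
  qed
  also have "\<dots> = (\<integral>\<omega>. \<bar>F \<omega>\<bar> \<partial>M) + (\<integral>\<omega>. G \<omega> \<partial>M)" using Fi Gi by simp
  finally have "(\<integral>\<omega>. \<bar>\<Sum>i\<in>Inc_upto m n. remainder (tup i \<omega>)\<bar> \<partial>M) \<le> (\<integral>\<omega>. \<bar>F \<omega>\<bar> \<partial>M) + (\<integral>\<omega>. G \<omega> \<partial>M)" .
  from mult_left_mono[OF this c0]
  have "c * (\<integral>\<omega>. \<bar>\<Sum>i\<in>Inc_upto m n. remainder (tup i \<omega>)\<bar> \<partial>M) \<le> c * (\<integral>\<omega>. \<bar>F \<omega>\<bar> \<partial>M) + c * (\<integral>\<omega>. G \<omega> \<partial>M)"
    by (simp only: distrib_left)
  also have "c * (\<integral>\<omega>. \<bar>F \<omega>\<bar> \<partial>M) \<le> sqrt (near_const * (real (Suc K))\<^sup>2 / real n + far_const * beta_tail K)"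
  proof (rule real_le_rsqrt)
    have "0 \<le> variance (\<lambda>\<omega>. \<bar>F \<omega>\<bar>)" by (rule variance_positive)
    then have "(\<integral>\<omega>. \<bar>F \<omega>\<bar> \<partial>M)\<^sup>2 \<le> (\<integral>\<omega>. (F \<omega>)\<^sup>2 \<partial>M)"
      using variance_eq[of "\<lambda>\<omega>. \<bar>F \<omega>\<bar>"] Fi F2 by simp
    then have "(c * (\<integral>\<omega>. \<bar>F \<omega>\<bar> \<partial>M))\<^sup>2 \<le> c\<^sup>2 * (\<integral>\<omega>. (F \<omega>)\<^sup>2 \<partial>M)"
      by (simp add: power_mult_distrib mult_left_mono)
    also have "c\<^sup>2 = real n / real n ^ (2 * m)"
      by (simp add: c_def power_divide mult.commute flip: power_mult)
    also have "\<dots> * (\<integral>\<omega>. (F \<omega>)\<^sup>2 \<partial>M) \<le> near_const * (real (Suc K))\<^sup>2 / real n + far_const * beta_tail K"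
      unfolding F_def by (rule truncated_sum_square[OF n])
    finally show "(c * (\<integral>\<omega>. \<bar>F \<omega>\<bar> \<partial>M))\<^sup>2 \<le> near_const * (real (Suc K))\<^sup>2 / real n + far_const * beta_tail K" .
  qed
  also have "c * (\<integral>\<omega>. G \<omega> \<partial>M) \<le> (2 * real m + 2) * \<delta> n"
  proof -
    have \<delta>0: "0 \<le> \<delta> n" using law_tail[of n] by (rule order_trans[rotated]) simp
    have "(\<integral>\<omega>. G \<omega> \<partial>M) = (\<Sum>i\<in>Inc_upto m n. \<integral>\<omega>. \<bar>remainder (tup i \<omega>) - trunc.remainder n (tup i \<omega>)\<bar> \<partial>M)"
      unfolding G_def using remainder_diff_le(2)[OF n1] remainder_tuple_integrable Inc by (intro Bochner_Integration.integral_sum) auto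
    also have "\<dots> \<le> (\<Sum>i\<in>Inc_upto m n. (2 * real m + 2) * (\<delta> n / sqrt (real n)))"
      using remainder_diff_le(1)[OF n1] Inc by (intro sum_mono) auto
    also have "\<dots> = real (card (Inc_upto m n)) * ((2 * real m + 2) * (\<delta> n / sqrt (real n)))" by simp
    also have "\<dots> \<le> real n ^ m * ((2 * real m + 2) * (\<delta> n / sqrt (real n)))"
    proof (rule mult_right_mono)
      show "real (card (Inc_upto m n)) \<le> real n ^ m" using card_Inc_upto_le[of n] by (simp flip: of_nat_power)
    qed (use \<delta>0 in simp)
    finally have "c * (\<integral>\<omega>. G \<omega> \<partial>M) \<le> c * (real n ^ m * ((2 * real m + 2) * (\<delta> n / sqrt (real n))))"
      using c0 by (rule mult_left_mono)
    also have "\<dots> = (2 * real m + 2) * \<delta> n" using n1 by (simp add: c_def field_simps)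
    finally show ?thesis .
  qed
  finally show ?thesis unfolding c_def by linarith
qed

lemma remainder_sum_tendsto: "(\<lambda>n. sqrt (real n) / real n ^ m * (\<integral>\<omega>. \<bar>\<Sum>i\<in>Inc_upto m n. remainder (tup i \<omega>)\<bar> \<partial>M)) \<longlonglongrightarrow> 0"
proof (rule order_tendstoI)
  fix a :: real assume a: "a < 0"
  have nn: "0 \<le> sqrt (real n) / real n ^ m * (\<integral>\<omega>. \<bar>\<Sum>i\<in>Inc_upto m n. remainder (tup i \<omega>)\<bar> \<partial>M)" for n
    by (intro mult_nonneg_nonneg Bochner_Integration.integral_nonneg) auto
  then show "\<forall>\<^sub>F n in sequentially. a < sqrt (real n) / real n ^ m * (\<integral>\<omega>. \<bar>\<Sum>i\<in>Inc_upto m n. remainder (tup i \<omega>)\<bar> \<partial>M)"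
    by (intro always_eventually allI less_le_trans[OF a nn])
next
  fix e :: real assume e: "0 < e"
  \<comment> \<open>\<open>K\<close> is fixed before \<open>n\<close>: it makes the distant part
    small for all \<open>n\<close> at once, and for this \<open>K\<close> the near part is
    \<open>O(1 / n)\<close>.\<close>
  have "(\<lambda>K. sqrt (far_const * beta_tail K)) \<longlonglongrightarrow> sqrt (far_const * 0)" by (intro tendsto_intros beta_tail_tendsto)
  then have "\<forall>\<^sub>F K in sequentially. sqrt (far_const * beta_tail K) < e" using e by (intro order_tendstoD(2)) auto
  then obtain K where K: "sqrt (far_const * beta_tail K) < e" by (auto simp: eventually_sequentially)
  have "(\<lambda>n. sqrt (near_const * (real (Suc K))\<^sup>2 * (1 / real n) + far_const * beta_tail K) + (2 * real m + 2) * \<delta> n) \<longlonglongrightarrow>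
     sqrt (near_const * (real (Suc K))\<^sup>2 * 0 + far_const * beta_tail K) + (2 * real m + 2) * 0"
    by (intro tendsto_intros \<delta>_lim lim_1_over_n)
  then have "\<forall>\<^sub>F n in sequentially. sqrt (near_const * (real (Suc K))\<^sup>2 * (1 / real n) + far_const * beta_tail K) + (2 * real m + 2) * \<delta> n < e"
    using K by (intro order_tendstoD(2)) auto
  then show "\<forall>\<^sub>F n in sequentially. sqrt (real n) / real n ^ m * (\<integral>\<omega>. \<bar>\<Sum>i\<in>Inc_upto m n. remainder (tup i \<omega>)\<bar> \<partial>M) < e"
    using eventually_ge_at_top[of m]
  proof eventually_elim
    case (elim n)
    then show ?case using remainder_sum_abs_le[OF elim(2), of K] by simp
  qed
qed

lemma U_stat_decomposition:
  assumes n: "n \<ge> m"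
  shows "U_stat m n h X \<omega> = (\<Sum>i\<in>Inc_upto m n. remainder (tup i \<omega>)) + real (card (Inc_upto m n)) * \<theta> +
    real ((n - 1) choose (m - 1)) * (\<Sum>x\<in>{1..int n}. h1 (X x \<omega>) - \<theta>)"
proof -
  have "U_stat m n h X \<omega> = (\<Sum>i\<in>Inc_upto m n. remainder (tup i \<omega>) + \<theta> + (\<Sum>l\<in>{1..m}. h1 (X (i l) \<omega>) - \<theta>))"
    unfolding U_stat_def remainder_tuple by (intro sum.cong refl) simp
  also have "\<dots> = (\<Sum>i\<in>Inc_upto m n. remainder (tup i \<omega>)) + real (card (Inc_upto m n)) * \<theta> +
    (\<Sum>i\<in>Inc_upto m n. \<Sum>l\<in>{1..m}. h1 (X (i l) \<omega>) - \<theta>)"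
    by (simp add: sum.distrib)
  also have "(\<Sum>i\<in>Inc_upto m n. \<Sum>l\<in>{1..m}. h1 (X (i l) \<omega>) - \<theta>) = real ((n - 1) choose (m - 1)) * (\<Sum>x\<in>{1..int n}. h1 (X x \<omega>) - \<theta>)"
    using m_ge_2 by (intro sum_over_Inc_upto) simp
  finally show ?thesis .
qed

definition V_stat :: "nat \<Rightarrow> 'a \<Rightarrow> real" where
  "V_stat n \<omega> = sqrt (real n) / real (n choose m) * (U_stat m n h X \<omega> - (\<integral>\<omega>'. U_stat m n h X \<omega>' \<partial>M))"

definition L_stat :: "nat \<Rightarrow> 'a \<Rightarrow> real" where
  "L_stat n \<omega> = real m * ((\<Sum>x\<in>{1..int n}. h1 (X x \<omega>) - \<theta>) / sqrt (real n))"

lemma V_stat_measurable [measurable]: "V_stat n \<in> borel_measurable M"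
  unfolding V_stat_def U_stat_def by measurable

lemma L_stat_measurable [measurable]: "L_stat n \<in> borel_measurable M"
  unfolding L_stat_def by measurable

lemma V_stat_minus_L_stat:
  assumes n: "n \<ge> m"
  shows "V_stat n \<omega> - L_stat n \<omega> = sqrt (real n) / real (n choose m) *
    ((\<Sum>i\<in>Inc_upto m n. remainder (tup i \<omega>)) - (\<integral>\<omega>. (\<Sum>i\<in>Inc_upto m n. remainder (tup i \<omega>)) \<partial>M))"
proof -
  define R where "R \<omega> = (\<Sum>i\<in>Inc_upto m n. remainder (tup i \<omega>))" for \<omega>
  define L where "L \<omega> = (\<Sum>x\<in>{1..int n}. h1 (X x \<omega>) - \<theta>)" for \<omega>
  define b where "b = real ((n - 1) choose (m - 1))"
  have Ri: "integrable M R" unfolding R_def using remainder_tuple_integrable Inc_upto_Inc[OF _ n] by auto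
  have Li: "integrable M L" unfolding L_def using integrable_law_X[OF h1_integrable] by auto
  have "(\<integral>\<omega>. L \<omega> \<partial>M) = 0"
    unfolding L_def using integrable_law_X[OF h1_integrable] integral_law_X[OF h1_measurable] h1_mean
    by (simp add: prob_space)
  moreover have U: "U_stat m n h X \<omega> = R \<omega> + real (card (Inc_upto m n)) * \<theta> + b * L \<omega>" for \<omega>
    unfolding R_def L_def b_def by (rule U_stat_decomposition[OF n])
  ultimately have EU: "(\<integral>\<omega>. U_stat m n h X \<omega> \<partial>M) = (\<integral>\<omega>. R \<omega> \<partial>M) + real (card (Inc_upto m n)) * \<theta>"
    using Ri Li by (simp add: prob_space)
  have n0: "n > 0" using n m_ge_2 by simp
  \<comment> \<open>This identity turns the weight of the linear part into
    \<open>m / sqrt n\<close>. The linear part has mean 0, so centring affects the remainder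
    alone.\<close>
  have "real m * real (n choose m) = real n * b"
    unfolding b_def using times_binomial_minus1_eq[of m n] m_ge_2 by (simp flip: of_nat_mult)
  moreover have "real (n choose m) > 0" using n by (simp add: zero_less_binomial)
  ultimately have "b / real (n choose m) = real m / real n" using n0 by (simp add: field_simps)
  then have "sqrt (real n) / real (n choose m) * (b * L \<omega>) = sqrt (real n) * (real m / real n) * L \<omega>"
    by (metis (no_types, opaque_lifting) mult.assoc mult.commute times_divide_eq_left)
  also have "\<dots> = L_stat n \<omega>"
    unfolding L_stat_def L_def using n0 by (simp add: field_simps)
  finally have "sqrt (real n) / real (n choose m) * (b * L \<omega>) = L_stat n \<omega>" .
  moreover have "q * (R \<omega> + x + y - (e + x)) - q * y = q * (R \<omega> - e)" for q x y e :: real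
    by (simp add: algebra_simps)
  ultimately show ?thesis unfolding V_stat_def EU U R_def[symmetric] by metis
qed

theorem V_stat_L_stat_tendsto: "(\<lambda>n. \<integral>\<omega>. \<bar>V_stat n \<omega> - L_stat n \<omega>\<bar> \<partial>M) \<longlonglongrightarrow> 0"
proof (rule tendsto_sandwich[OF _ _ tendsto_const])
  let ?a = "\<lambda>n. sqrt (real n) / real n ^ m * (\<integral>\<omega>. \<bar>\<Sum>i\<in>Inc_upto m n. remainder (tup i \<omega>)\<bar> \<partial>M)"
  show "(\<lambda>n. 2 * real m ^ m * ?a n) \<longlonglongrightarrow> 0"
    using tendsto_mult_left[OF remainder_sum_tendsto, of "2 * real m ^ m"] by simp
  show "\<forall>\<^sub>F n in sequentially. 0 \<le> (\<integral>\<omega>. \<bar>V_stat n \<omega> - L_stat n \<omega>\<bar> \<partial>M)" by simp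
  show "\<forall>\<^sub>F n in sequentially. (\<integral>\<omega>. \<bar>V_stat n \<omega> - L_stat n \<omega>\<bar> \<partial>M) \<le> 2 * real m ^ m * ?a n"
    using eventually_ge_at_top[of m]
  proof eventually_elim
    case (elim n)
    define R where "R \<omega> = (\<Sum>i\<in>Inc_upto m n. remainder (tup i \<omega>))" for \<omega>
    define q where "q = sqrt (real n) / real (n choose m)"
    have n0: "n > 0" using elim m_ge_2 by simp
    have q0: "0 \<le> q" by (simp add: q_def)
    have Ri: "integrable M R" unfolding R_def using remainder_tuple_integrable Inc_upto_Inc[OF _ elim] by auto
    have "(\<integral>\<omega>. \<bar>V_stat n \<omega> - L_stat n \<omega>\<bar> \<partial>M) = (\<integral>\<omega>. q * \<bar>R \<omega> - expectation R\<bar> \<partial>M)"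
      unfolding V_stat_minus_L_stat[OF elim] R_def q_def by (simp add: abs_mult)
    also have "\<dots> \<le> (\<integral>\<omega>. q * (\<bar>R \<omega>\<bar> + expectation (\<lambda>\<omega>. \<bar>R \<omega>\<bar>)) \<partial>M)"
    proof (intro integral_mono)
      show "integrable M (\<lambda>\<omega>. q * \<bar>R \<omega> - expectation R\<bar>)" using Ri by auto
      show "integrable M (\<lambda>\<omega>. q * (\<bar>R \<omega>\<bar> + expectation (\<lambda>\<omega>. \<bar>R \<omega>\<bar>)))" using Ri by auto
      fix \<omega>
      have "\<bar>expectation R\<bar> \<le> expectation (\<lambda>\<omega>. \<bar>R \<omega>\<bar>)" by (rule integral_abs_bound)
      then show "q * \<bar>R \<omega> - expectation R\<bar> \<le> q * (\<bar>R \<omega>\<bar> + expectation (\<lambda>\<omega>. \<bar>R \<omega>\<bar>))"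
        using q0 by (intro mult_left_mono) linarith+
    qed
    also have "\<dots> = 2 * q * expectation (\<lambda>\<omega>. \<bar>R \<omega>\<bar>)" using Ri by (simp add: prob_space)
    also have "\<dots> \<le> 2 * (real m ^ m * (sqrt (real n) / real n ^ m)) * expectation (\<lambda>\<omega>. \<bar>R \<omega>\<bar>)"
    proof (intro mult_right_mono mult_left_mono)
      \<comment> \<open>This lower bound for the binomial coefficient is the origin of
        \<open>m ^ m\<close>; the factor 2 comes from centring \<open>R\<close>.\<close>
      have "(real n / real m) ^ m \<le> real (n choose m)" by (rule binomial_ge_n_over_k_pow_k[OF elim])
      moreover have "(real n / real m) ^ m > 0" using n0 m_ge_2 by simp
      ultimately have "q \<le> sqrt (real n) / (real n / real m) ^ m"
        unfolding q_def using elim by (intro divide_left_mono mult_pos_pos) auto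
      then show "q \<le> real m ^ m * (sqrt (real n) / real n ^ m)" by (simp add: power_divide mult.commute)
    qed (auto intro!: Bochner_Integration.integral_nonneg)
    finally show ?case by (simp add: R_def)
  qed
qed

end

section \<open>The central limit theorem for bounded functions\<close>

lemma cesaro_mean_tendsto:
  fixes a :: "nat \<Rightarrow> real"
  assumes "a \<longlonglongrightarrow> s"
  shows "(\<lambda>p. (\<Sum>k<p. a k) / real p) \<longlonglongrightarrow> s"
proof (rule LIMSEQ_I)
  fix e :: real assume e: "0 < e"
  then have "0 < e / 2" by simp
  from LIMSEQ_D[OF assms this] obtain N where N: "\<And>k. k \<ge> N \<Longrightarrow> \<bar>a k - s\<bar> < e / 2" by auto
  define C where "C = (\<Sum>k<N. \<bar>a k - s\<bar>)"
  have "(\<lambda>p. C * (1 / real p)) \<longlonglongrightarrow> C * 0" by (intro tendsto_intros lim_1_over_n)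
  then have "\<forall>\<^sub>F p in sequentially. C * (1 / real p) < e / 2" using e by (intro order_tendstoD(2)) auto
  then obtain N' where N': "\<And>p. p \<ge> N' \<Longrightarrow> C / real p < e / 2" by (auto simp: eventually_sequentially)
  show "\<exists>n0. \<forall>p\<ge>n0. norm ((\<Sum>k<p. a k) / real p - s) < e"
  proof (intro exI[of _ "max 1 (max N N')"] allI impI)
    fix p assume p: "max 1 (max N N') \<le> p"
    have "(\<Sum>k<p. a k) / real p - s = (\<Sum>k<p. a k - s) / real p"
      using p by (simp add: sum_subtractf field_simps)
    also have "\<bar>\<dots>\<bar> \<le> (\<Sum>k<p. \<bar>a k - s\<bar>) / real p"
      using p by (simp add: abs_divide divide_right_mono)
    also have "(\<Sum>k<p. \<bar>a k - s\<bar>) = C + (\<Sum>k\<in>{N..<p}. \<bar>a k - s\<bar>)"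
    proof -
      have "{..<p} = {..<N} \<union> {N..<p}" using p by auto
      then show ?thesis unfolding C_def by (simp add: sum.union_disjoint ivl_disj_int)
    qed
    also have "(C + (\<Sum>k\<in>{N..<p}. \<bar>a k - s\<bar>)) / real p \<le> (C + real p * (e / 2)) / real p"
    proof (intro divide_right_mono add_left_mono)
      have "(\<Sum>k\<in>{N..<p}. \<bar>a k - s\<bar>) \<le> (\<Sum>k\<in>{N..<p}. e / 2)" using N by (intro sum_mono) (auto intro: less_imp_le)
      also have "\<dots> = real (p - N) * (e / 2)" by simp
      also have "\<dots> \<le> real p * (e / 2)" using e by (intro mult_right_mono) auto
      finally show "(\<Sum>k\<in>{N..<p}. \<bar>a k - s\<bar>) \<le> real p * (e / 2)" .
    qed simp
    also have "\<dots> = C / real p + e / 2" using p by (simp add: field_simps)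
    also have "\<dots> < e"
    proof -
      have "C / real p < e / 2" using p by (intro N') simp
      then show ?thesis by linarith
    qed
    finally show "norm ((\<Sum>k<p. a k) / real p - s) < e" by simp
  qed
qed

locale stationary_process = process M S X
  for M :: "'a measure" and S :: "'s measure" and X :: "int \<Rightarrow> 'a \<Rightarrow> 's" +
  assumes shift: "\<And>t. distr M (\<Pi>\<^sub>M i\<in>(UNIV :: int set). S) (\<lambda>\<omega> i. X (i + t) \<omega>) =
      distr M (\<Pi>\<^sub>M i\<in>(UNIV :: int set). S) (\<lambda>\<omega> i. X i \<omega>)"
begin

lemma path_measurable [measurable]: "(\<lambda>\<omega> i. X (i + t) \<omega>) \<in> measurable M (\<Pi>\<^sub>M i\<in>(UNIV :: int set). S)"
  using measurable_space[OF X_meas] by (intro measurable_PiM_single') auto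

lemma path_measurable0 [measurable]: "(\<lambda>\<omega> i. X i \<omega>) \<in> measurable M (\<Pi>\<^sub>M i\<in>(UNIV :: int set). S)"
  using path_measurable[of 0] by simp

lemma stationary_integral:
  fixes \<Phi> :: "(int \<Rightarrow> 's) \<Rightarrow> 'b::{banach, second_countable_topology}"
  assumes "\<Phi> \<in> borel_measurable (\<Pi>\<^sub>M i\<in>(UNIV :: int set). S)"
  shows "(\<integral>\<omega>. \<Phi> (\<lambda>i. X (i + t) \<omega>) \<partial>M) = (\<integral>\<omega>. \<Phi> (\<lambda>i. X i \<omega>) \<partial>M)"
  using integral_distr[OF path_measurable[of t] assms] integral_distr[OF path_measurable0 assms] shift[of t] by simp

lemma stationary_integral_pair:
  fixes F :: "'s \<Rightarrow> 's \<Rightarrow> real"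
  assumes [measurable]: "(\<lambda>z. F (fst z) (snd z)) \<in> borel_measurable (S \<Otimes>\<^sub>M S)"
  shows "(\<integral>\<omega>. F (X (i + t) \<omega>) (X (j + t) \<omega>) \<partial>M) = (\<integral>\<omega>. F (X i \<omega>) (X j \<omega>) \<partial>M)"
proof -
  have "(\<lambda>x. F (x i) (x j)) \<in> borel_measurable (\<Pi>\<^sub>M i\<in>(UNIV :: int set). S)"
    using measurable_compose[OF _ assms, of "\<lambda>x. (x i, x j)" "\<Pi>\<^sub>M i\<in>(UNIV :: int set). S"] by simp
  from stationary_integral[OF this] show ?thesis .
qed

lemma law_eq: "distr M S (X i) = distr M S (X 0)"
proof -
  have c: "(\<lambda>x. x 0) \<in> measurable (\<Pi>\<^sub>M i\<in>(UNIV :: int set). S) S" by measurable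
  have "distr M S (X i) = distr (distr M (\<Pi>\<^sub>M i\<in>(UNIV :: int set). S) (\<lambda>\<omega> j. X (j + i) \<omega>)) S (\<lambda>x. x 0)"
    by (subst distr_distr[OF c path_measurable]) (simp add: comp_def)
  also have "\<dots> = distr M S (X 0)"
    unfolding shift by (subst distr_distr[OF c path_measurable0]) (simp add: comp_def)
  finally show ?thesis .
qed

section \<open>Covariances and variances of partial sums\<close>

definition mean :: "('s \<Rightarrow> real) \<Rightarrow> real" where
  "mean f = (\<integral>\<omega>. f (X 0 \<omega>) \<partial>M)"

definition centered :: "('s \<Rightarrow> real) \<Rightarrow> int \<Rightarrow> 'a \<Rightarrow> real" where
  "centered f i \<omega> = f (X i \<omega>) - mean f"

definition cov :: "('s \<Rightarrow> real) \<Rightarrow> nat \<Rightarrow> real" where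
  "cov f k = (\<integral>\<omega>. centered f 0 \<omega> * centered f (int k) \<omega> \<partial>M)"

lemma integral_X_eq:
  assumes [measurable]: "f \<in> borel_measurable S"
  shows "(\<integral>\<omega>. f (X i \<omega>) \<partial>M) = (\<integral>\<omega>. f (X 0 \<omega>) \<partial>M :: real)"
  using integral_distr[of "X i" M S f] integral_distr[of "X 0" M S f] law_eq[of i] by simp

lemma integrable_X_iff:
  assumes [measurable]: "f \<in> borel_measurable S"
  shows "integrable M (\<lambda>\<omega>. f (X i \<omega>) :: real) \<longleftrightarrow> integrable M (\<lambda>\<omega>. f (X 0 \<omega>))"
  using integrable_distr_eq[of "X i" M S f] integrable_distr_eq[of "X 0" M S f] law_eq[of i] by simp

lemma centered_measurable [measurable]:
  assumes [measurable]: "f \<in> borel_measurable S"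
  shows "centered f i \<in> borel_measurable M"
  unfolding centered_def[abs_def] by measurable

context
  fixes f :: "'s \<Rightarrow> real"
  assumes f [measurable]: "f \<in> borel_measurable S"
    and f2: "integrable M (\<lambda>\<omega>. (f (X 0 \<omega>))\<^sup>2)"
begin

lemma integrable_f: "integrable M (\<lambda>\<omega>. f (X i \<omega>))"
proof -
  have "integrable M (\<lambda>\<omega>. f (X 0 \<omega>))" by (rule square_integrable_imp_integrable[OF _ f2]) measurable
  then show ?thesis using integrable_X_iff[OF f] by simp
qed

lemma centered_integrable: "integrable M (centered f i)"
  unfolding centered_def[abs_def] using integrable_f by simp

lemma centered_mean: "(\<integral>\<omega>. centered f i \<omega> \<partial>M) = 0"
  unfolding centered_def using integrable_f[of i] integral_X_eq[OF f, of i] by (simp add: mean_def prob_space)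

lemma centered_square_integrable: "integrable M (\<lambda>\<omega>. (centered f i \<omega>)\<^sup>2)"
proof -
  have "integrable M (\<lambda>\<omega>. (f (X i \<omega>))\<^sup>2)"
    using f2 integrable_X_iff[of "\<lambda>x. (f x)\<^sup>2" i] by simp
  then show ?thesis unfolding centered_def using integrable_f[of i] by (simp add: power2_diff)
qed

lemma centered_product_integrable: "integrable M (\<lambda>\<omega>. centered f i \<omega> * centered f j \<omega>)"
proof (rule Bochner_Integration.integrable_bound)
  show "integrable M (\<lambda>\<omega>. (centered f i \<omega>)\<^sup>2 + (centered f j \<omega>)\<^sup>2)"
    using centered_square_integrable by simp
  have "\<bar>x * y\<bar> \<le> x\<^sup>2 + y\<^sup>2" for x y :: real
  proof -
    have "2 * (\<bar>x\<bar> * \<bar>y\<bar>) \<le> x\<^sup>2 + y\<^sup>2" using sum_squares_bound[of "\<bar>x\<bar>" "\<bar>y\<bar>"] by simp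
    moreover have "0 \<le> \<bar>x\<bar> * \<bar>y\<bar>" by simp
    ultimately show ?thesis unfolding abs_mult by linarith
  qed
  then show "AE \<omega> in M. norm (centered f i \<omega> * centered f j \<omega>) \<le> norm ((centered f i \<omega>)\<^sup>2 + (centered f j \<omega>)\<^sup>2)"
    by (intro AE_I2) (simp add: abs_of_nonneg)
qed measurable

lemma integral_centered_product: "(\<integral>\<omega>. centered f i \<omega> * centered f j \<omega> \<partial>M) = cov f (nat \<bar>i - j\<bar>)"
proof -
  have st: "(\<integral>\<omega>. centered f (i + t) \<omega> * centered f (j + t) \<omega> \<partial>M) = (\<integral>\<omega>. centered f i \<omega> * centered f j \<omega> \<partial>M)" for i j t
    unfolding centered_def by (rule stationary_integral_pair) measurable
  show ?thesis
  proof (cases "i \<le> j")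
    case True
    then show ?thesis using st[of 0 i "j - i"] unfolding cov_def by simp
  next
    case False
    then show ?thesis using st[of "i - j" j 0] unfolding cov_def by (simp add: mult.commute)
  qed
qed

lemma sum_centered_square_integrable: "integrable M (\<lambda>\<omega>. (\<Sum>i\<in>A. centered f i \<omega>)\<^sup>2)"
  unfolding power2_eq_square sum_product by (intro Bochner_Integration.integrable_sum centered_product_integrable)

lemma integral_sum_centered_square:
  "(\<integral>\<omega>. (\<Sum>i\<in>A. centered f i \<omega>)\<^sup>2 \<partial>M) = (\<Sum>i\<in>A. \<Sum>j\<in>A. cov f (nat \<bar>i - j\<bar>))"
proof -
  have "(\<integral>\<omega>. (\<Sum>i\<in>A. centered f i \<omega>)\<^sup>2 \<partial>M) = (\<integral>\<omega>. (\<Sum>i\<in>A. \<Sum>j\<in>A. centered f i \<omega> * centered f j \<omega>) \<partial>M)"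
    unfolding power2_eq_square sum_product ..
  also have "\<dots> = (\<Sum>i\<in>A. \<integral>\<omega>. (\<Sum>j\<in>A. centered f i \<omega> * centered f j \<omega>) \<partial>M)"
    by (rule Bochner_Integration.integral_sum) (rule Bochner_Integration.integrable_sum, rule centered_product_integrable)
  also have "\<dots> = (\<Sum>i\<in>A. \<Sum>j\<in>A. \<integral>\<omega>. centered f i \<omega> * centered f j \<omega> \<partial>M)"
    by (rule sum.cong[OF refl]) (rule Bochner_Integration.integral_sum, rule centered_product_integrable)
  finally show ?thesis unfolding integral_centered_product .
qed

lemma integral_sum_centered_square_le:
  assumes b: "\<And>k. \<bar>cov f k\<bar> \<le> b k" "summable b" and A: "finite A"
  shows "(\<integral>\<omega>. (\<Sum>i\<in>A. centered f i \<omega>)\<^sup>2 \<partial>M) \<le> real (card A) * (2 * suminf b)"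
proof -
  have b0: "0 \<le> b k" for k using b(1)[of k] by linarith
  have le: "sum b (g ` B) \<le> suminf b" if "finite B" for g :: "int \<Rightarrow> nat" and B
    using that b0 by (intro sum_le_suminf[OF b(2)]) auto
  have "(\<Sum>j\<in>A. cov f (nat \<bar>i - j\<bar>)) \<le> 2 * suminf b" for i
  proof -
    have "(\<Sum>j\<in>A. cov f (nat \<bar>i - j\<bar>)) \<le> (\<Sum>j\<in>A. b (nat \<bar>i - j\<bar>))"
      using b(1) by (intro sum_mono) (smt (verit))
    \<comment> \<open>On either side of \<open>i\<close> the lag determines \<open>j\<close>, so
      each half becomes a sum over distinct lags.\<close>
    also have "\<dots> = (\<Sum>j\<in>{j\<in>A. i \<le> j}. b (nat \<bar>i - j\<bar>)) + (\<Sum>j\<in>{j\<in>A. \<not> i \<le> j}. b (nat \<bar>i - j\<bar>))"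
      using A by (subst sum.union_disjoint[symmetric]) (auto intro!: sum.cong)
    also have "(\<Sum>j\<in>{j\<in>A. i \<le> j}. b (nat \<bar>i - j\<bar>)) = sum b ((\<lambda>j. nat \<bar>i - j\<bar>) ` {j\<in>A. i \<le> j})"
      by (subst sum.reindex) (auto simp: inj_on_def)
    also have "(\<Sum>j\<in>{j\<in>A. \<not> i \<le> j}. b (nat \<bar>i - j\<bar>)) = sum b ((\<lambda>j. nat \<bar>i - j\<bar>) ` {j\<in>A. \<not> i \<le> j})"
      by (subst sum.reindex) (auto simp: inj_on_def)
    also have "sum b ((\<lambda>j. nat \<bar>i - j\<bar>) ` {j\<in>A. i \<le> j}) + sum b ((\<lambda>j. nat \<bar>i - j\<bar>) ` {j\<in>A. \<not> i \<le> j}) \<le> suminf b + suminf b"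
      using A by (intro add_mono le) auto
    finally show ?thesis by simp
  qed
  then have "(\<Sum>i\<in>A. \<Sum>j\<in>A. cov f (nat \<bar>i - j\<bar>)) \<le> (\<Sum>i\<in>A. 2 * suminf b)"
    by (rule sum_mono)
  then show ?thesis unfolding integral_sum_centered_square by simp
qed

definition block_var :: "nat \<Rightarrow> real" where
  "block_var p = (\<integral>\<omega>. (\<Sum>i\<in>{1..int p}. centered f i \<omega>)\<^sup>2 \<partial>M)"

lemma block_var_nonneg: "0 \<le> block_var p"
  unfolding block_var_def by simp

text \<open>The increment is a partial sum of the series in \<open>long_run_var\<close>, so the
  variance per point is a Cesaro mean of these partial sums.\<close>

lemma block_var_Suc: "block_var (Suc p) = block_var p + (cov f 0 + 2 * (\<Sum>k<p. cov f (Suc k)))"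
proof -
  let ?A = "{1..int p}"
  have A: "{1..int (Suc p)} = insert (int (Suc p)) ?A" "int (Suc p) \<notin> ?A" by auto
  have row: "(\<Sum>j\<in>?A. cov f (nat \<bar>int (Suc p) - j\<bar>)) = (\<Sum>k<p. cov f (Suc k))"
  proof (rule sum.reindex_bij_witness[where i="\<lambda>k. int (p - k)" and j="\<lambda>j. p - nat j"])
    fix j assume j: "j \<in> ?A"
    then have "nat \<bar>int (Suc p) - j\<bar> = Suc (p - nat j)" by auto
    then show "cov f (Suc (p - nat j)) = cov f (nat \<bar>int (Suc p) - j\<bar>)" by simp
  qed auto
  have col: "(\<Sum>j\<in>?A. cov f (nat \<bar>j - int (Suc p)\<bar>)) = (\<Sum>k<p. cov f (Suc k))"
    unfolding row[symmetric] by (simp add: abs_minus_commute)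
  have "block_var (Suc p) = (\<Sum>i\<in>insert (int (Suc p)) ?A. \<Sum>j\<in>insert (int (Suc p)) ?A. cov f (nat \<bar>i - j\<bar>))"
    unfolding block_var_def integral_sum_centered_square A(1) ..
  also have "\<dots> = cov f 0 + (\<Sum>j\<in>?A. cov f (nat \<bar>int (Suc p) - j\<bar>)) +
      ((\<Sum>i\<in>?A. cov f (nat \<bar>i - int (Suc p)\<bar>)) + (\<Sum>i\<in>?A. \<Sum>j\<in>?A. cov f (nat \<bar>i - j\<bar>)))"
    using A(2) by (simp add: sum.distrib del: of_nat_Suc)
  also have "\<dots> = block_var p + (cov f 0 + 2 * (\<Sum>k<p. cov f (Suc k)))"
    unfolding row col block_var_def integral_sum_centered_square by simp
  finally show ?thesis .
qed

definition long_run_var :: real where "long_run_var = cov f 0 + 2 * (\<Sum>k. cov f (Suc k))"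

lemma block_var_tendsto:
  assumes "\<And>k. \<bar>cov f k\<bar> \<le> b k" "summable b"
  shows "(\<lambda>p. block_var p / real p) \<longlonglongrightarrow> long_run_var"
proof -
  have "summable (\<lambda>k. cov f (Suc k))"
    using assms summable_Suc_iff[of b] by (intro summable_comparison_test[of "\<lambda>k. cov f (Suc k)" "\<lambda>k. b (Suc k)"]) auto
  then have "(\<lambda>p. cov f 0 + 2 * (\<Sum>k<p. cov f (Suc k))) \<longlonglongrightarrow> long_run_var"
    unfolding long_run_var_def by (intro tendsto_intros summable_LIMSEQ)
  from cesaro_mean_tendsto[OF this]
  have "(\<lambda>p. (\<Sum>q<p. cov f 0 + 2 * (\<Sum>k<q. cov f (Suc k))) / real p) \<longlonglongrightarrow> long_run_var" .
  moreover have "(\<Sum>q<p. cov f 0 + 2 * (\<Sum>k<q. cov f (Suc k))) = block_var p" for p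
    by (induction p) (simp_all add: block_var_Suc, simp add: block_var_def)
  ultimately show ?thesis by simp
qed

lemma long_run_var_nonneg:
  assumes "\<And>k. \<bar>cov f k\<bar> \<le> b k" "summable b"
  shows "0 \<le> long_run_var"
  using block_var_tendsto[OF assms] block_var_nonneg by (intro LIMSEQ_le_const[OF block_var_tendsto[OF assms]]) auto

end

end

section \<open>Characteristic functions and decoupled blocks\<close>

lemma norm_iexp_diff_le: "cmod (iexp x - iexp y) \<le> \<bar>x - y\<bar>"
proof -
  have "iexp x - iexp y = iexp y * (iexp (x - y) - 1)"
    by (simp add: algebra_simps flip: exp_add)
  then have "cmod (iexp x - iexp y) = cmod (iexp (x - y) - 1)" by (simp add: norm_mult)
  also have "\<dots> \<le> \<bar>x - y\<bar>" using iexp_approx1[of "x - y" 0] by simp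
  finally show ?thesis .
qed

lemma (in prob_space) iexp_integrable:
  assumes [measurable]: "A \<in> borel_measurable M"
  shows "integrable M (\<lambda>\<omega>. iexp (A \<omega>))"
  by (rule integrable_const_bound[where B=1]) auto

lemma (in prob_space) iexp_integral_diff_le:
  assumes [measurable]: "A \<in> borel_measurable M" "B \<in> borel_measurable M"
    and i: "integrable M (\<lambda>\<omega>. A \<omega> - B \<omega>)"
  shows "cmod ((\<integral>\<omega>. iexp (A \<omega>) \<partial>M) - (\<integral>\<omega>. iexp (B \<omega>) \<partial>M)) \<le> (\<integral>\<omega>. \<bar>A \<omega> - B \<omega>\<bar> \<partial>M)"
proof -
  have "(\<integral>\<omega>. iexp (A \<omega>) \<partial>M) - (\<integral>\<omega>. iexp (B \<omega>) \<partial>M) = (\<integral>\<omega>. iexp (A \<omega>) - iexp (B \<omega>) \<partial>M)"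
    by (rule Bochner_Integration.integral_diff[symmetric]) (rule iexp_integrable, measurable)+
  also have "cmod \<dots> \<le> (\<integral>\<omega>. cmod (iexp (A \<omega>) - iexp (B \<omega>)) \<partial>M)" by (rule integral_norm_bound)
  also have "\<dots> \<le> (\<integral>\<omega>. \<bar>A \<omega> - B \<omega>\<bar> \<partial>M)"
  proof (rule integral_mono)
    show "integrable M (\<lambda>\<omega>. cmod (iexp (A \<omega>) - iexp (B \<omega>)))"
      by (intro integrable_norm Bochner_Integration.integrable_diff iexp_integrable) measurable
    show "integrable M (\<lambda>\<omega>. \<bar>A \<omega> - B \<omega>\<bar>)" using i by simp
  qed (rule norm_iexp_diff_le)
  finally show ?thesis .
qed

lemma (in prob_space) expectation_abs_le_sqrt:
  assumes [measurable]: "A \<in> borel_measurable M" and i: "integrable M (\<lambda>\<omega>. (A \<omega>)\<^sup>2)"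
  shows "(\<integral>\<omega>. \<bar>A \<omega>\<bar> \<partial>M) \<le> sqrt (\<integral>\<omega>. (A \<omega>)\<^sup>2 \<partial>M)"
proof (rule real_le_rsqrt)
  have "integrable M A" by (rule square_integrable_imp_integrable[OF _ i]) measurable
  then have "variance (\<lambda>\<omega>. \<bar>A \<omega>\<bar>) = expectation (\<lambda>\<omega>. \<bar>A \<omega>\<bar>\<^sup>2) - (expectation (\<lambda>\<omega>. \<bar>A \<omega>\<bar>))\<^sup>2"
    using i by (intro variance_eq) auto
  then show "(expectation (\<lambda>\<omega>. \<bar>A \<omega>\<bar>))\<^sup>2 \<le> (\<integral>\<omega>. (A \<omega>)\<^sup>2 \<partial>M)"
    using variance_positive[of "\<lambda>\<omega>. \<bar>A \<omega>\<bar>"] by simp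
qed

text \<open>Real and imaginary parts contribute a factor 4 each.\<close>

lemma (in process) beta_decoupling_complex:
  fixes \<Phi> :: "(int \<Rightarrow> 's) \<Rightarrow> complex"
  assumes I: "finite I" "I \<subseteq> {1..}" "g ` I \<subseteq> {..<J::nat}"
    and gap: "\<And>i j. i \<in> I \<Longrightarrow> j \<in> I \<Longrightarrow> g i < g j \<Longrightarrow> i + int k \<le> j"
    and \<Phi> [measurable]: "\<Phi> \<in> borel_measurable (\<Pi>\<^sub>M i\<in>I. S)"
    and B: "\<And>z. cmod (\<Phi> z) \<le> 1"
  shows "cmod ((\<integral>\<omega>. \<Phi> (\<lambda>i\<in>I. X i \<omega>) \<partial>M) - (\<integral>w. \<Phi> (\<lambda>i\<in>I. X i (w (g i))) \<partial>(\<Pi>\<^sub>M j\<in>{..<J}. M)))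
     \<le> 8 * real J * beta_mixing M S X k"
proof -
  interpret P: prob_space "\<Pi>\<^sub>M j\<in>{..<J}. M" by (rule prob_space_PiM) unfold_locales
  have m1: "(\<lambda>\<omega>. \<lambda>i\<in>I. X i \<omega>) \<in> measurable M (\<Pi>\<^sub>M i\<in>I. S)" by measurable
  have m2: "(\<lambda>w. \<lambda>i\<in>I. X i (w (g i))) \<in> measurable (\<Pi>\<^sub>M j\<in>{..<J}. M) (\<Pi>\<^sub>M i\<in>I. S)"
    by (rule product_decoupled_measurable) fact
  define a where "a = (\<integral>\<omega>. \<Phi> (\<lambda>i\<in>I. X i \<omega>) \<partial>M)"
  define b where "b = (\<integral>w. \<Phi> (\<lambda>i\<in>I. X i (w (g i))) \<partial>(\<Pi>\<^sub>M j\<in>{..<J}. M))"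
  have i1: "integrable M (\<lambda>\<omega>. \<Phi> (\<lambda>i\<in>I. X i \<omega>))"
    using B measurable_compose[OF m1 \<Phi>] by (intro integrable_const_bound[where B=1]) auto
  have i2: "integrable (\<Pi>\<^sub>M j\<in>{..<J}. M) (\<lambda>w. \<Phi> (\<lambda>i\<in>I. X i (w (g i))))"
    using B measurable_compose[OF m2 \<Phi>] by (intro P.integrable_const_bound[where B=1]) auto
  have "\<bar>(\<integral>\<omega>. Re (\<Phi> (\<lambda>i\<in>I. X i \<omega>)) \<partial>M) - (\<integral>w. Re (\<Phi> (\<lambda>i\<in>I. X i (w (g i)))) \<partial>(\<Pi>\<^sub>M j\<in>{..<J}. M))\<bar>
     \<le> 4 * 1 * real J * beta_mixing M S X k"
  proof (rule beta_decoupling_bounded[OF I gap])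
    show "\<bar>Re (\<Phi> z)\<bar> \<le> 1" for z using abs_Re_le_cmod[of "\<Phi> z"] B[of z] by linarith
  qed measurable
  moreover have "\<bar>(\<integral>\<omega>. Im (\<Phi> (\<lambda>i\<in>I. X i \<omega>)) \<partial>M) - (\<integral>w. Im (\<Phi> (\<lambda>i\<in>I. X i (w (g i)))) \<partial>(\<Pi>\<^sub>M j\<in>{..<J}. M))\<bar>
     \<le> 4 * 1 * real J * beta_mixing M S X k"
  proof (rule beta_decoupling_bounded[OF I gap])
    show "\<bar>Im (\<Phi> z)\<bar> \<le> 1" for z using abs_Im_le_cmod[of "\<Phi> z"] B[of z] by linarith
  qed measurable
  ultimately have "\<bar>Re (a - b)\<bar> + \<bar>Im (a - b)\<bar> \<le> 8 * real J * beta_mixing M S X k"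
    unfolding a_def b_def using integral_Re[OF i1] integral_Re[OF i2] integral_Im[OF i1] integral_Im[OF i2] by simp
  then show ?thesis using cmod_le[of "a - b"] unfolding a_def b_def by linarith
qed

lemma exp_minus_quadratic_bound:
  fixes y :: real
  assumes "0 \<le> y"
  shows "\<bar>(1 - y) - exp (- y)\<bar> \<le> y\<^sup>2"
proof -
  have "exp (- y) \<ge> 1 - y" using exp_ge_add_one_self[of "- y"] by simp
  moreover have "exp (- y) \<le> 1 - y + y\<^sup>2"
  proof -
    \<comment> \<open>The product equals \<open>1 + y ^ 3\<close>.\<close>
    have "1 \<le> (1 - y + y\<^sup>2) * (1 + y)"
      using assms by (simp add: algebra_simps power2_eq_square)
    also have "\<dots> \<le> (1 - y + y\<^sup>2) * exp y"
    proof (rule mult_left_mono)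
      have "0 \<le> (1 - y / 2)\<^sup>2 + 3 / 4 * y\<^sup>2" by simp
      then show "0 \<le> 1 - y + y\<^sup>2" by (simp add: power2_eq_square algebra_simps)
    qed (use exp_ge_add_one_self[of y] in simp)
    finally have "1 / exp y \<le> 1 - y + y\<^sup>2" by (simp add: divide_le_eq)
    then show ?thesis by (simp add: exp_minus inverse_eq_divide)
  qed
  ultimately show ?thesis by linarith
qed

context stationary_process
begin

text \<open>Characteristic function of the unnormalized centred sum. The scaling by
  \<open>sqrt n\<close> is put into the argument, so the same function describes the whole sample
  and a single block.\<close>

definition phi :: "('s \<Rightarrow> real) \<Rightarrow> nat \<Rightarrow> real \<Rightarrow> complex" where
  "phi f n t = (\<integral>\<omega>. iexp (t * (\<Sum>i\<in>{1..int n}. centered f i \<omega>)) \<partial>M)"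

lemma phi_norm_le: "f \<in> borel_measurable S \<Longrightarrow> cmod (phi f n t) \<le> 1"
proof -
  assume f [measurable]: "f \<in> borel_measurable S"
  have "cmod (phi f n t) \<le> (\<integral>\<omega>. cmod (iexp (t * (\<Sum>i\<in>{1..int n}. centered f i \<omega>))) \<partial>M)"
    unfolding phi_def by (rule integral_norm_bound)
  then show ?thesis by (simp add: prob_space)
qed

text \<open>\<open>N\<close> blocks of length \<open>p\<close> are kept, separated by
  \<open>q\<close> points. Dropping the other \<open>n - N * p\<close> points costs at most a bound
  on their standard deviation, decoupling the blocks costs the \<beta> term. Under the product
  measure the expectation factorizes, and stationarity makes all factors equal.\<close>

lemma phi_blocks:
  assumes f [measurable]: "f \<in> borel_measurable S" and f2: "integrable M (\<lambda>\<omega>. (f (X 0 \<omega>))\<^sup>2)"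
    and b: "\<And>k. \<bar>cov f k\<bar> \<le> b k" "summable b"
    and pq: "p \<ge> 1" "q \<ge> 1" and N: "N * (p + q) \<le> n"
  shows "cmod (phi f n t - phi f p t ^ N) \<le> \<bar>t\<bar> * sqrt (real (n - N * p) * (2 * suminf b)) + 8 * real N * beta_mixing M S X q"
proof -
  define L where "L = p + q"
  have L: "L > 0" using pq by (simp add: L_def)
  define Blk where "Blk c = {int (c * L) + 1..int (c * L) + int p}" for c
  \<comment> \<open>Time is divided into periods of length \<open>L\<close>, each a block followed
    by its gap. Times start at 1, which explains \<open>x - 1\<close>.\<close>
  define g where "g x = nat ((x - 1) div int L)" for x :: int
  define I where "I = (\<Union>c<N. Blk c)"
  have Blk: "finite (Blk c)" "card (Blk c) = p" for c by (auto simp: Blk_def)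
  have gB: "g x = c" if "x \<in> Blk c" for x c
  proof -
    have "(x - 1) div int L = int c"
      by (rule int_div_pos_eq[where r="x - 1 - int (c * L)"]) (use that pq in \<open>auto simp: Blk_def L_def algebra_simps\<close>)
    then show ?thesis by (simp add: g_def)
  qed
  have gap: "x + int q \<le> y" if "x \<in> Blk c" "y \<in> Blk c'" "c < c'" for x y c c'
  proof -
    have "(c + 1) * L \<le> c' * L" using that by (intro mult_le_mono1) auto
    then have "c * L + L \<le> c' * L" by (simp only: add_mult_distrib mult_1)
    then have "int (c * L) + int L \<le> int (c' * L)" by (simp only: of_nat_add[symmetric] of_nat_le_iff)
    moreover have "x \<le> int (c * L) + int p" "int (c' * L) + 1 \<le> y" using that by (simp_all only: Blk_def atLeastAtMost_iff)
    moreover have "int L = int p + int q" by (simp add: L_def)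
    ultimately show ?thesis by linarith
  qed
  have disj: "Blk c \<inter> Blk c' = {}" if "c \<noteq> c'" for c c' using gB that by blast
  have I: "finite I" "I \<subseteq> {1..int n}"
  proof -
    show "finite I" using Blk by (simp add: I_def)
    show "I \<subseteq> {1..int n}"
    proof
      fix x assume "x \<in> I"
      then obtain c where c: "c < N" "x \<in> Blk c" by (auto simp: I_def)
      have "(c + 1) * L \<le> N * L" using c by (intro mult_le_mono1) auto
      then have "c * L + L \<le> N * L" by (simp only: add_mult_distrib mult_1)
      then have "c * L + L \<le> n" using N unfolding L_def by linarith
      then have "int (c * L) + int L \<le> int n" by (simp only: of_nat_add[symmetric] of_nat_le_iff)
      moreover have "0 \<le> int (c * L)" by (rule of_nat_0_le_iff)
      moreover have "int (c * L) + 1 \<le> x" "x \<le> int (c * L) + int p" using c(2) by (simp_all only: Blk_def atLeastAtMost_iff)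
      moreover have "int p \<le> int L" by (simp add: L_def)
      ultimately show "x \<in> {1..int n}" unfolding atLeastAtMost_iff by linarith
    qed
  qed
  have cardI: "card I = N * p"
    unfolding I_def using Blk disj by (subst card_UN_disjoint) auto
  have sumI: "(\<Sum>x\<in>I. F x) = (\<Sum>c<N. \<Sum>x\<in>Blk c. F x)" for F :: "int \<Rightarrow> real"
    unfolding I_def using Blk disj by (subst sum.UNION_disjoint) auto
  define R where "R = {1..int n} - I"
  have R: "finite R" "card R = n - N * p"
    using I cardI by (auto simp: R_def card_Diff_subset)
  define A where "A \<omega> = t * (\<Sum>i\<in>{1..int n}. centered f i \<omega>)" for \<omega>
  define B where "B \<omega> = t * (\<Sum>i\<in>I. centered f i \<omega>)" for \<omega>
  have [measurable]: "A \<in> borel_measurable M" "B \<in> borel_measurable M"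
    unfolding A_def B_def by measurable
  have AB: "A \<omega> - B \<omega> = t * (\<Sum>i\<in>R. centered f i \<omega>)" for \<omega>
  proof -
    have "(\<Sum>i\<in>{1..int n}. centered f i \<omega>) = (\<Sum>i\<in>R. centered f i \<omega>) + (\<Sum>i\<in>I. centered f i \<omega>)"
      unfolding R_def using I by (intro sum.subset_diff) auto
    then show ?thesis unfolding A_def B_def by (simp add: algebra_simps)
  qed
  have "cmod ((\<integral>\<omega>. iexp (A \<omega>) \<partial>M) - (\<integral>\<omega>. iexp (B \<omega>) \<partial>M)) \<le> (\<integral>\<omega>. \<bar>A \<omega> - B \<omega>\<bar> \<partial>M)"
  proof (rule iexp_integral_diff_le)
    show "integrable M (\<lambda>\<omega>. A \<omega> - B \<omega>)"
      unfolding AB by (intro integrable_mult_right Bochner_Integration.integrable_sum centered_integrable f f2)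
  qed measurable
  also have "\<dots> = \<bar>t\<bar> * (\<integral>\<omega>. \<bar>\<Sum>i\<in>R. centered f i \<omega>\<bar> \<partial>M)"
    unfolding AB by (simp add: abs_mult)
  also have "\<dots> \<le> \<bar>t\<bar> * sqrt (real (n - N * p) * (2 * suminf b))"
  proof (intro mult_left_mono)
    have "(\<integral>\<omega>. \<bar>\<Sum>i\<in>R. centered f i \<omega>\<bar> \<partial>M) \<le> sqrt (\<integral>\<omega>. (\<Sum>i\<in>R. centered f i \<omega>)\<^sup>2 \<partial>M)"
      by (rule expectation_abs_le_sqrt) (measurable, rule sum_centered_square_integrable[OF f f2])
    also have "\<dots> \<le> sqrt (real (n - N * p) * (2 * suminf b))"
      using integral_sum_centered_square_le[OF f f2 b R(1)] unfolding R(2) by simp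
    finally show "(\<integral>\<omega>. \<bar>\<Sum>i\<in>R. centered f i \<omega>\<bar> \<partial>M) \<le> sqrt (real (n - N * p) * (2 * suminf b))" .
  qed simp
  finally have 1: "cmod (phi f n t - (\<integral>\<omega>. iexp (B \<omega>) \<partial>M)) \<le> \<bar>t\<bar> * sqrt (real (n - N * p) * (2 * suminf b))"
    unfolding phi_def A_def .
  define \<Phi> where "\<Phi> z = iexp (t * (\<Sum>x\<in>I. f (z x) - mean f))" for z :: "int \<Rightarrow> 's"
  have "cmod ((\<integral>\<omega>. \<Phi> (\<lambda>x\<in>I. X x \<omega>) \<partial>M) - (\<integral>w. \<Phi> (\<lambda>x\<in>I. X x (w (g x))) \<partial>(\<Pi>\<^sub>M j\<in>{..<N}. M))) \<le> 8 * real N * beta_mixing M S X q"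
  proof (rule beta_decoupling_complex[OF I(1)])
    show "I \<subseteq> {1..}" using I by auto
    show "g ` I \<subseteq> {..<N}" using gB by (auto simp: I_def)
    show "x + int q \<le> y" if xy: "x \<in> I" "y \<in> I" "g x < g y" for x y
    proof -
      obtain c c' where "x \<in> Blk c" "y \<in> Blk c'" using xy unfolding I_def by blast
      then show ?thesis using gap[of x c y c'] gB xy(3) by auto
    qed
    have [measurable]: "(\<lambda>z. f (z x)) \<in> borel_measurable (\<Pi>\<^sub>M x\<in>I. S)" if "x \<in> I" for x
      using that by measurable
    show "\<Phi> \<in> borel_measurable (\<Pi>\<^sub>M x\<in>I. S)" unfolding \<Phi>_def by measurable
    show "cmod (\<Phi> z) \<le> 1" for z by (simp add: \<Phi>_def)
  qed
  moreover have "\<Phi> (\<lambda>x\<in>I. X x \<omega>) = iexp (B \<omega>)" for \<omega>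
    unfolding \<Phi>_def B_def centered_def by simp
  moreover have "(\<integral>w. \<Phi> (\<lambda>x\<in>I. X x (w (g x))) \<partial>(\<Pi>\<^sub>M j\<in>{..<N}. M)) = phi f p t ^ N"
  proof -
    interpret PS: product_sigma_finite "\<lambda>_::nat. M" by unfold_locales
    define E where "E c \<omega> = iexp (t * (\<Sum>x\<in>Blk c. centered f x \<omega>))" for c \<omega>
    have Ei: "integrable M (E c)" for c
      unfolding E_def by (rule iexp_integrable) measurable
    have "\<Phi> (\<lambda>x\<in>I. X x (w (g x))) = (\<Prod>c<N. E c (w c))" for w
    proof -
      have "(\<Sum>x\<in>I. f ((\<lambda>x\<in>I. X x (w (g x))) x) - mean f) = (\<Sum>x\<in>I. centered f x (w (g x)))"
        by (intro sum.cong refl) (simp add: centered_def)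
      also have "\<dots> = (\<Sum>c<N. \<Sum>x\<in>Blk c. centered f x (w c))"
        unfolding sumI using gB by (intro sum.cong refl) auto
      finally show ?thesis unfolding \<Phi>_def E_def
        by (simp add: sum_distrib_left flip: exp_sum)
    qed
    then have "(\<integral>w. \<Phi> (\<lambda>x\<in>I. X x (w (g x))) \<partial>(\<Pi>\<^sub>M j\<in>{..<N}. M)) = (\<Prod>c<N. \<integral>\<omega>. E c \<omega> \<partial>M)"
      using PS.product_integral_prod[of "{..<N}" E] Ei by simp
    also have "\<dots> = (\<Prod>c<N. phi f p t)"
    proof (rule prod.cong[OF refl])
      fix c
      define \<Psi> where "\<Psi> y = iexp (t * (\<Sum>i\<in>{1..int p}. f (y i) - mean f))" for y :: "int \<Rightarrow> 's"
      have "\<Psi> \<in> borel_measurable (\<Pi>\<^sub>M i\<in>(UNIV :: int set). S)" unfolding \<Psi>_def by measurable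
      from stationary_integral[OF this, of "int (c * L)"]
      have "(\<integral>\<omega>. \<Psi> (\<lambda>i. X (i + int (c * L)) \<omega>) \<partial>M) = phi f p t"
        unfolding \<Psi>_def phi_def centered_def .
      moreover have "E c \<omega> = \<Psi> (\<lambda>i. X (i + int (c * L)) \<omega>)" for \<omega>
      proof -
        have "(\<Sum>x\<in>Blk c. centered f x \<omega>) = (\<Sum>i\<in>{1..int p}. f (X (i + int (c * L)) \<omega>) - mean f)"
          by (rule sum.reindex_bij_witness[where i="\<lambda>i. i + int (c * L)" and j="\<lambda>x. x - int (c * L)"])
             (auto simp: Blk_def centered_def)
        then show ?thesis unfolding E_def \<Psi>_def by simp
      qed
      ultimately show "(\<integral>\<omega>. E c \<omega> \<partial>M) = phi f p t" by simp
    qed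
    finally show ?thesis by simp
  qed
  ultimately have 2: "cmod ((\<integral>\<omega>. iexp (B \<omega>) \<partial>M) - phi f p t ^ N) \<le> 8 * real N * beta_mixing M S X q"
    by simp
  have "phi f n t - phi f p t ^ N = (phi f n t - (\<integral>\<omega>. iexp (B \<omega>) \<partial>M)) + ((\<integral>\<omega>. iexp (B \<omega>) \<partial>M) - phi f p t ^ N)"
    by simp
  also have "cmod \<dots> \<le> \<bar>t\<bar> * sqrt (real (n - N * p) * (2 * suminf b)) + 8 * real N * beta_mixing M S X q"
    using 1 2 by (rule norm_triangle_mono)
  finally show ?thesis .
qed

text \<open>The third moment is bounded by the supremum \<open>2 * p * R\<close> times the variance,
  and the variance by a multiple of \<open>p\<close>. This gives \<open>p\<^sup>2\<close> where the
  supremum alone would give \<open>p ^ 3\<close>. With \<open>t\<close> of order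
  \<open>1 / sqrt n\<close> and about \<open>n / p\<close> blocks, the total error is of order
  \<open>p / sqrt n\<close>.\<close>

lemma phi_block_expansion:
  assumes f [measurable]: "f \<in> borel_measurable S" and R: "\<And>x. \<bar>f x\<bar> \<le> R"
    and b: "\<And>k. \<bar>cov f k\<bar> \<le> b k" "summable b"
  shows "cmod (phi f p t - exp (- (t\<^sup>2 * block_var f p / 2))) \<le>
    t\<^sup>2 * \<bar>t\<bar> / 3 * R * (2 * suminf b) * (real p)\<^sup>2 + t ^ 4 * (suminf b)\<^sup>2 * (real p)\<^sup>2"
proof -
  have f2: "integrable M (\<lambda>\<omega>. (f (X 0 \<omega>))\<^sup>2)"
  proof (rule integrable_const_bound[where B="R\<^sup>2"])
    show "AE \<omega> in M. norm ((f (X 0 \<omega>))\<^sup>2) \<le> R\<^sup>2"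
    proof (rule AE_I2)
      fix \<omega>
      show "norm ((f (X 0 \<omega>))\<^sup>2) \<le> R\<^sup>2" using power_mono[OF R[of "X 0 \<omega>"], of 2] by simp
    qed
  qed measurable
  have R0: "0 \<le> R" using R[of undefined] by linarith
  define v where "v = block_var f p"
  define Z where "Z \<omega> = (\<Sum>i\<in>{1..int p}. centered f i \<omega>)" for \<omega>
  have [measurable]: "Z \<in> borel_measurable M" unfolding Z_def by measurable
  have Zi: "integrable M Z" unfolding Z_def by (intro Bochner_Integration.integrable_sum centered_integrable f f2)
  have Z2: "integrable M (\<lambda>\<omega>. (Z \<omega>)\<^sup>2)" unfolding Z_def by (rule sum_centered_square_integrable[OF f f2])
  have Z0: "expectation Z = 0"
    unfolding Z_def using centered_mean[OF f f2] centered_integrable[OF f f2] by simp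
  have var: "variance Z = v" unfolding Z0 v_def block_var_def[OF f f2] Z_def by simp
  have v: "0 \<le> v" "v \<le> real p * (2 * suminf b)"
    using block_var_nonneg[OF f f2] integral_sum_centered_square_le[OF f f2 b, of "{1..int p}"]
    unfolding v_def block_var_def[OF f f2] by auto
  have "\<bar>mean f\<bar> \<le> R"
  proof -
    have "\<bar>mean f\<bar> \<le> (\<integral>\<omega>. \<bar>f (X 0 \<omega>)\<bar> \<partial>M)" unfolding mean_def by (rule integral_abs_bound)
    also have "\<dots> \<le> (\<integral>\<omega>. R \<partial>M)" using R integrable_f[OF f f2, of 0] by (intro integral_mono) auto
    finally show ?thesis by (simp add: prob_space)
  qed
  then have cb: "\<bar>centered f i \<omega>\<bar> \<le> 2 * R" for i \<omega>
    unfolding centered_def using R[of "X i \<omega>"] by linarith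
  have Zb: "\<bar>Z \<omega>\<bar> \<le> real p * (2 * R)" for \<omega>
  proof -
    have "\<bar>Z \<omega>\<bar> \<le> (\<Sum>i\<in>{1..int p}. \<bar>centered f i \<omega>\<bar>)" unfolding Z_def by (rule sum_abs)
    also have "\<dots> \<le> (\<Sum>i\<in>{1..int p}. 2 * R)" by (intro sum_mono cb)
    finally show ?thesis by simp
  qed
  have "cmod (char (distr M borel Z) t - (1 - t\<^sup>2 * v / 2)) \<le> (t\<^sup>2 / 6) * expectation (\<lambda>x. min (6 * (Z x)\<^sup>2) (\<bar>t\<bar> * \<bar>Z x\<bar> ^ 3))"
    using Zi Z2 Z0 var by (intro char_approx3') auto
  also have "expectation (\<lambda>x. min (6 * (Z x)\<^sup>2) (\<bar>t\<bar> * \<bar>Z x\<bar> ^ 3)) \<le> expectation (\<lambda>x. \<bar>t\<bar> * (real p * (2 * R)) * (Z x)\<^sup>2)"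
  proof (rule integral_mono)
    show "integrable M (\<lambda>x. min (6 * (Z x)\<^sup>2) (\<bar>t\<bar> * \<bar>Z x\<bar> ^ 3))"
      by (rule Bochner_Integration.integrable_bound[of M "\<lambda>x. 6 * (Z x)\<^sup>2"]) (use Z2 in auto)
    show "integrable M (\<lambda>x. \<bar>t\<bar> * (real p * (2 * R)) * (Z x)\<^sup>2)" using Z2 by simp
    fix x
    have "\<bar>Z x\<bar> ^ 3 = \<bar>Z x\<bar> * (Z x)\<^sup>2" by (simp add: power3_eq_cube power2_eq_square)
    also have "\<dots> \<le> (real p * (2 * R)) * (Z x)\<^sup>2" using Zb by (intro mult_right_mono) auto
    finally have "\<bar>t\<bar> * \<bar>Z x\<bar> ^ 3 \<le> \<bar>t\<bar> * ((real p * (2 * R)) * (Z x)\<^sup>2)" by (rule mult_left_mono) simp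
    then show "min (6 * (Z x)\<^sup>2) (\<bar>t\<bar> * \<bar>Z x\<bar> ^ 3) \<le> \<bar>t\<bar> * (real p * (2 * R)) * (Z x)\<^sup>2"
      by (simp add: mult.assoc)
  qed
  also have "expectation (\<lambda>x. \<bar>t\<bar> * (real p * (2 * R)) * (Z x)\<^sup>2) = \<bar>t\<bar> * (real p * (2 * R)) * v"
    using var Z0 by simp
  also have "\<bar>t\<bar> * (real p * (2 * R)) * v \<le> \<bar>t\<bar> * (real p * (2 * R)) * (real p * (2 * suminf b))"
    using v R0 by (intro mult_left_mono) auto
  finally have 1: "cmod (char (distr M borel Z) t - (1 - t\<^sup>2 * v / 2)) \<le>
      (t\<^sup>2 / 6) * (\<bar>t\<bar> * (real p * (2 * R)) * (real p * (2 * suminf b)))"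
    by (simp add: mult_left_mono)
  have ch: "char (distr M borel Z) t = phi f p t"
    unfolding char_def phi_def Z_def[symmetric] by (subst integral_distr) auto
  define y where "y = t\<^sup>2 * v / 2"
  have y: "0 \<le> y" "y \<le> t\<^sup>2 * (real p * suminf b)"
    using v mult_left_mono[OF v(2), of "t\<^sup>2 / 2"] by (auto simp: y_def)
  have "cmod (of_real (1 - y) - of_real (exp (- y))) \<le> y\<^sup>2"
    using exp_minus_quadratic_bound[OF y(1)] by (simp del: of_real_diff of_real_exp flip: of_real_diff)
  also have "\<dots> \<le> (t\<^sup>2 * (real p * suminf b))\<^sup>2" using y by (intro power_mono)
  finally have 2: "cmod (of_real (1 - y) - of_real (exp (- y))) \<le> (t\<^sup>2 * (real p * suminf b))\<^sup>2" .
  have "phi f p t - of_real (exp (- y)) = (phi f p t - of_real (1 - y)) + (of_real (1 - y) - of_real (exp (- y)))" by simp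
  also have "cmod \<dots> \<le> (t\<^sup>2 / 6) * (\<bar>t\<bar> * (real p * (2 * R)) * (real p * (2 * suminf b))) + (t\<^sup>2 * (real p * suminf b))\<^sup>2"
    using 1 2 unfolding ch y_def by (intro norm_triangle_mono) simp_all
  also have "\<dots> = t\<^sup>2 * \<bar>t\<bar> / 3 * R * (2 * suminf b) * (real p)\<^sup>2 + t ^ 4 * (suminf b)\<^sup>2 * (real p)\<^sup>2"
    by (simp add: power2_eq_square power4_eq_xxxx algebra_simps)
  finally show ?thesis unfolding y_def v_def by (simp add: exp_of_real)
qed

text \<open>For numbers of modulus at most 1 the \<open>N\<close>-th powers differ by at most
  \<open>N\<close> times the difference of the numbers. Since \<open>N * p \<le> n\<close>, the
  \<open>N\<close> block errors of order \<open>p\<^sup>2\<close> add up to order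
  \<open>n * p\<close> before scaling.\<close>

lemma bernstein_bound:
  assumes f [measurable]: "f \<in> borel_measurable S" and R: "\<And>x. \<bar>f x\<bar> \<le> R"
    and b: "\<And>k. \<bar>cov f k\<bar> \<le> b k" "summable b"
    and pq: "p \<ge> 1" "q \<ge> 1" and N: "N * (p + q) \<le> n" and n: "n \<ge> 1"
  shows "cmod (phi f n (t / sqrt (real n)) - exp (- (t\<^sup>2 / 2 * (real (N * p) / real n) * (block_var f p / real p)))) \<le>
    \<bar>t\<bar> * sqrt ((1 - real (N * p) / real n) * (2 * suminf b)) + 8 * (real N * beta_mixing M S X q) +
    (t\<^sup>2 * \<bar>t\<bar> / 3 * R * (2 * suminf b) * (real p / sqrt (real n)) + t ^ 4 * (suminf b)\<^sup>2 * (real p / real n))"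
proof -
  have f2: "integrable M (\<lambda>\<omega>. (f (X 0 \<omega>))\<^sup>2)"
  proof (rule integrable_const_bound[where B="R\<^sup>2"])
    show "AE \<omega> in M. norm ((f (X 0 \<omega>))\<^sup>2) \<le> R\<^sup>2"
    proof (rule AE_I2)
      fix \<omega>
      show "norm ((f (X 0 \<omega>))\<^sup>2) \<le> R\<^sup>2" using power_mono[OF R[of "X 0 \<omega>"], of 2] by simp
    qed
  qed measurable
  have R0: "0 \<le> R" using R[of undefined] by linarith
  define t' where "t' = t / sqrt (real n)"
  have b0: "0 \<le> b k" for k using b(1)[of k] by linarith
  have sb: "0 \<le> suminf b" by (rule suminf_nonneg[OF b(2) b0])
  have Np: "N * p \<le> n" using N by (simp add: algebra_simps)
  have t2: "t'\<^sup>2 = t\<^sup>2 / real n" by (simp add: t'_def power_divide)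
  have ta: "\<bar>t'\<bar> = \<bar>t\<bar> / sqrt (real n)" by (simp add: t'_def abs_divide)
  have t4: "t' ^ 4 = t ^ 4 / (real n)\<^sup>2"
  proof -
    have "t' ^ 4 = (t'\<^sup>2)\<^sup>2" by (simp flip: power_mult)
    then show ?thesis unfolding t2 by (simp add: power_divide flip: power_mult)
  qed
  define y where "y = t'\<^sup>2 * block_var f p / 2"
  have y: "0 \<le> y" using block_var_nonneg[OF f f2] by (simp add: y_def)
  define D where "D = t'\<^sup>2 * \<bar>t'\<bar> / 3 * R * (2 * suminf b) * (real p)\<^sup>2 + t' ^ 4 * (suminf b)\<^sup>2 * (real p)\<^sup>2"
  have 1: "cmod (phi f n t' - phi f p t' ^ N) \<le> \<bar>t'\<bar> * sqrt (real (n - N * p) * (2 * suminf b)) + 8 * real N * beta_mixing M S X q"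
    by (rule phi_blocks[OF f f2 b pq N])
  have "cmod (phi f p t' ^ N - exp (- y) ^ N) \<le> real N * cmod (phi f p t' - exp (- y))"
    using norm_power_diff[of "phi f p t'" "complex_of_real (exp (- y))" N] phi_norm_le[OF f, of p t'] y
    by (simp add: of_real_power)
  also have "\<dots> \<le> real N * D"
    using phi_block_expansion[OF f R b, of p t'] unfolding y_def D_def by (intro mult_left_mono) auto
  finally have 2: "cmod (phi f p t' ^ N - exp (- y) ^ N) \<le> real N * D" .
  have "phi f n t' - exp (- y) ^ N = (phi f n t' - phi f p t' ^ N) + (phi f p t' ^ N - exp (- y) ^ N)" by simp
  also have "cmod \<dots> \<le> (\<bar>t'\<bar> * sqrt (real (n - N * p) * (2 * suminf b)) + 8 * real N * beta_mixing M S X q) + real N * D"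
    using 1 2 by (rule norm_triangle_mono)
  also have "\<bar>t'\<bar> * sqrt (real (n - N * p) * (2 * suminf b)) = \<bar>t\<bar> * sqrt ((1 - real (N * p) / real n) * (2 * suminf b))"
  proof -
    have "real (n - N * p) / real n = 1 - real (N * p) / real n" using Np n by (simp add: of_nat_diff field_simps)
    then have "(1 - real (N * p) / real n) * (2 * suminf b) = (real (n - N * p) * (2 * suminf b)) / real n"
      by (simp only: times_divide_eq_left[symmetric])
    then show ?thesis unfolding ta by (simp add: real_sqrt_divide)
  qed
  also have "real N * D \<le> t\<^sup>2 * \<bar>t\<bar> / 3 * R * (2 * suminf b) * (real p / sqrt (real n)) + t ^ 4 * (suminf b)\<^sup>2 * (real p / real n)"
  proof -
    define c1 where "c1 = t\<^sup>2 * \<bar>t\<bar> / 3 * R * (2 * suminf b)"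
    define c2 where "c2 = t ^ 4 * (suminf b)\<^sup>2"
    have c: "0 \<le> c1" "0 \<le> c2" using R0 sb by (auto simp: c1_def c2_def)
    have "real N * D = c1 * (real p / sqrt (real n)) * (real N * real p / real n) + c2 * (real p / real n) * (real N * real p / real n)"
      unfolding D_def t2 ta t4 c1_def c2_def using n by (simp add: field_simps power2_eq_square)
    also have "\<dots> \<le> c1 * (real p / sqrt (real n)) * 1 + c2 * (real p / real n) * 1"
    proof (intro add_mono mult_left_mono)
      have "real N * real p \<le> real n" using Np by (simp flip: of_nat_mult)
      then show "real N * real p / real n \<le> 1" "real N * real p / real n \<le> 1" using n by simp_all
    qed (use c in auto)
    finally show ?thesis by (simp add: c1_def c2_def)
  qed
  finally have "cmod (phi f n t' - exp (- y) ^ N) \<le> \<bar>t\<bar> * sqrt ((1 - real (N * p) / real n) * (2 * suminf b)) + 8 * real N * beta_mixing M S X q +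
    (t\<^sup>2 * \<bar>t\<bar> / 3 * R * (2 * suminf b) * (real p / sqrt (real n)) + t ^ 4 * (suminf b)\<^sup>2 * (real p / real n))"
    by simp
  moreover have "exp (- y) ^ N = exp (- (t\<^sup>2 / 2 * (real (N * p) / real n) * (block_var f p / real p)))"
  proof -
    have "exp (- y) ^ N = exp (real N * (- y))" by (rule exp_of_nat_mult[symmetric])
    also have "real N * (- y) = - (t\<^sup>2 / 2 * (real (N * p) / real n) * (block_var f p / real p))"
      unfolding y_def t2 using pq by (simp add: field_simps)
    finally show ?thesis .
  qed
  ultimately show ?thesis unfolding t'_def by (simp add: mult.assoc flip: of_real_power)
qed

text \<open>
  The exponents \<open>a = 2/5\<close> and \<open>b = 7/20\<close> satisfy \<open>b < a < 1/2\<close>, as the characteristic function expansion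
  requires, and \<open>a + 2b > 1\<close>, so that \<open>n\<^sup>1\<^sup>-\<^sup>a \<beta>(n\<^sup>b)\<close> tends to 0 when \<open>\<beta>(k) = O(k\<^sup>-\<^sup>2)\<close>.
\<close>

definition block_len :: "nat \<Rightarrow> nat" where "block_len n = nat \<lceil>real n powr (2/5)\<rceil>"
definition gap_len :: "nat \<Rightarrow> nat" where "gap_len n = nat \<lceil>real n powr (7/20)\<rceil>"
definition block_count :: "nat \<Rightarrow> nat" where "block_count n = n div (block_len n + gap_len n)"

lemma block_len_bounds: "n \<ge> 1 \<Longrightarrow> real n powr (2/5) \<le> real (block_len n)" "n \<ge> 1 \<Longrightarrow> real (block_len n) \<le> real n powr (2/5) + 1" "n \<ge> 1 \<Longrightarrow> block_len n \<ge> 1"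
proof -
  assume n: "n \<ge> 1"
  then have pos: "real n powr (2/5) > 0" by simp
  show 1: "real n powr (2/5) \<le> real (block_len n)" unfolding block_len_def by (rule of_nat_ceiling)
  have "real (block_len n) = of_int \<lceil>real n powr (2/5)\<rceil>" unfolding block_len_def by (rule of_nat_nat) (unfold zero_le_ceiling, use pos in linarith)
  then show "real (block_len n) \<le> real n powr (2/5) + 1" by linarith
  have "real (block_len n) > 0" using pos 1 by linarith
  then show "block_len n \<ge> 1" by (simp add: Suc_le_eq One_nat_def)
qed

lemma gap_len_bounds: "n \<ge> 1 \<Longrightarrow> real n powr (7/20) \<le> real (gap_len n)" "n \<ge> 1 \<Longrightarrow> real (gap_len n) \<le> real n powr (7/20) + 1" "n \<ge> 1 \<Longrightarrow> gap_len n \<ge> 1"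
proof -
  assume n: "n \<ge> 1"
  then have pos: "real n powr (7/20) > 0" by simp
  show 1: "real n powr (7/20) \<le> real (gap_len n)" unfolding gap_len_def by (rule of_nat_ceiling)
  have "real (gap_len n) = of_int \<lceil>real n powr (7/20)\<rceil>" unfolding gap_len_def by (rule of_nat_nat) (unfold zero_le_ceiling, use pos in linarith)
  then show "real (gap_len n) \<le> real n powr (7/20) + 1" by linarith
  have "real (gap_len n) > 0" using pos 1 by linarith
  then show "gap_len n \<ge> 1" by (simp add: Suc_le_eq One_nat_def)
qed

lemma block_len_over_sqrt: "(\<lambda>n. real (block_len n) / sqrt (real n)) \<longlonglongrightarrow> 0"
proof (rule tendsto_sandwich[OF _ _ tendsto_const])
  show "(\<lambda>n. (real n powr (2/5) + 1) / sqrt (real n)) \<longlonglongrightarrow> 0" by real_asymp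
  show "\<forall>\<^sub>F n in sequentially. real (block_len n) / sqrt (real n) \<le> (real n powr (2/5) + 1) / sqrt (real n)"
    using eventually_ge_at_top[of 1] by eventually_elim (intro divide_right_mono block_len_bounds, auto)
qed auto

lemma block_len_over_n: "(\<lambda>n. real (block_len n) / real n) \<longlonglongrightarrow> 0"
proof (rule tendsto_sandwich[OF _ _ tendsto_const])
  show "(\<lambda>n. (real n powr (2/5) + 1) / real n) \<longlonglongrightarrow> 0" by real_asymp
  show "\<forall>\<^sub>F n in sequentially. real (block_len n) / real n \<le> (real n powr (2/5) + 1) / real n"
    using eventually_ge_at_top[of 1] by eventually_elim (intro divide_right_mono block_len_bounds, auto)
qed auto

lemma gap_over_block: "(\<lambda>n. real (gap_len n) / real (block_len n)) \<longlonglongrightarrow> 0"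
proof (rule tendsto_sandwich[OF _ _ tendsto_const])
  show "(\<lambda>n. (real n powr (7/20) + 1) / real n powr (2/5)) \<longlonglongrightarrow> 0" by real_asymp
  show "\<forall>\<^sub>F n in sequentially. real (gap_len n) / real (block_len n) \<le> (real n powr (7/20) + 1) / real n powr (2/5)"
    using eventually_ge_at_top[of 1]
  proof eventually_elim
    case (elim n)
    then show ?case using block_len_bounds[of n] gap_len_bounds[of n] by (intro frac_le) auto
  qed
qed auto

lemma block_len_at_top: "filterlim block_len at_top sequentially"
proof -
  have "filterlim (\<lambda>n. real (block_len n)) at_top sequentially"
  proof (rule filterlim_at_top_mono)
    show "filterlim (\<lambda>n. real n powr (2/5)) at_top sequentially" by real_asymp
    show "\<forall>\<^sub>F n in sequentially. real n powr (2/5) \<le> real (block_len n)"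
      using eventually_ge_at_top[of 1] by eventually_elim (rule block_len_bounds)
  qed
  then show ?thesis by (simp add: filterlim_sequentially_iff_filterlim_real)
qed

lemma block_count_le: "block_count n * (block_len n + gap_len n) \<le> n"
  unfolding block_count_def by (rule div_times_less_eq_dividend)

text \<open>At most one period at the end is incomplete, so \<open>n < N * L + L\<close>. This gives
  the lower bound \<open>p / L - p / n\<close>, and \<open>p / L\<close> tends to 1 because gaps are
  short compared with blocks.\<close>

lemma blocks_times_len_over_n: "(\<lambda>n. real (block_count n * block_len n) / real n) \<longlonglongrightarrow> 1"
proof (rule tendsto_sandwich)
  show "(\<lambda>n. 1 / (1 + real (gap_len n) / real (block_len n)) - real (block_len n) / real n) \<longlonglongrightarrow> 1"
  proof -
    have "(\<lambda>n. 1 / (1 + real (gap_len n) / real (block_len n)) - real (block_len n) / real n) \<longlonglongrightarrow> 1 / (1 + 0) - 0"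
      by (intro tendsto_intros gap_over_block block_len_over_n) simp
    then show ?thesis by simp
  qed
  show "(\<lambda>n. 1) \<longlonglongrightarrow> (1::real)" by simp
  show "\<forall>\<^sub>F n in sequentially. real (block_count n * block_len n) / real n \<le> 1"
    using eventually_ge_at_top[of 1]
  proof eventually_elim
    case (elim n)
    have "block_count n * block_len n \<le> n" using block_count_le[of n] by (simp add: algebra_simps)
    then have "real (block_count n * block_len n) \<le> real n" by (simp only: of_nat_le_iff)
    then show ?case using elim by (simp add: divide_le_eq)
  qed
  show "\<forall>\<^sub>F n in sequentially. 1 / (1 + real (gap_len n) / real (block_len n)) - real (block_len n) / real n \<le> real (block_count n * block_len n) / real n"
    using eventually_ge_at_top[of 1]
  proof eventually_elim
    case (elim n)
    define L where "L = block_len n + gap_len n"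
    have L: "L > 0" using block_len_bounds(3)[OF elim] by (simp add: L_def)
    have "n < block_count n * L + L" unfolding block_count_def L_def[symmetric] using dividend_less_div_times[OF L, of n] by (simp only: add.commute)
    then have "real n \<le> real (block_count n) * real L + real L" by (simp flip: of_nat_mult of_nat_add)
    then have "real n * real (block_len n) \<le> (real (block_count n) * real L + real L) * real (block_len n)" by (rule mult_right_mono) simp
    then have "real (block_len n) / real L \<le> (real (block_count n) * real (block_len n) + real (block_len n)) / real n"
      using L elim by (simp add: field_simps)
    then have "real (block_len n) / real L - real (block_len n) / real n \<le> real (block_count n * block_len n) / real n"
      by (simp add: add_divide_distrib)
    moreover have "1 / (1 + real (gap_len n) / real (block_len n)) = real (block_len n) / real L"
      using block_len_bounds(3)[OF elim] by (simp add: L_def field_simps)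
    ultimately show ?case by simp
  qed
qed

lemma block_count_beta_tendsto:
  assumes C: "\<And>k. k \<ge> 1 \<Longrightarrow> beta_mixing M S X k \<le> C / (real k)\<^sup>2"
  shows "(\<lambda>n. real (block_count n) * beta_mixing M S X (gap_len n)) \<longlonglongrightarrow> 0"
proof (rule tendsto_sandwich[OF _ _ tendsto_const])
  have C0: "0 \<le> C" using C[of 1] beta_mixing_nonneg[of 1] by simp
  show "(\<lambda>n. C * (real n / (real n powr (2/5) * (real n powr (7/20))\<^sup>2))) \<longlonglongrightarrow> 0" by real_asymp
  show "\<forall>\<^sub>F n in sequentially. 0 \<le> real (block_count n) * beta_mixing M S X (gap_len n)"
    using beta_mixing_nonneg by simp
  show "\<forall>\<^sub>F n in sequentially. real (block_count n) * beta_mixing M S X (gap_len n) \<le> C * (real n / (real n powr (2/5) * (real n powr (7/20))\<^sup>2))"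
    using eventually_ge_at_top[of 1]
  proof eventually_elim
    case (elim n)
    have pos: "real n powr (2/5) > 0" "real n powr (7/20) > 0" using elim by simp_all
    have "block_count n * block_len n \<le> n" using block_count_le[of n] by (simp add: algebra_simps)
    then have "real (block_count n) * real (block_len n) \<le> real n" by (simp flip: of_nat_mult)
    then have "real (block_count n) * real n powr (2/5) \<le> real n"
      using mult_left_mono[OF block_len_bounds(1)[OF elim], of "real (block_count n)"] by simp
    then have 1: "real (block_count n) \<le> real n / real n powr (2/5)" using pos by (simp add: le_divide_eq)
    have "beta_mixing M S X (gap_len n) \<le> C / (real (gap_len n))\<^sup>2" using C gap_len_bounds(3)[OF elim] .
    also have "\<dots> \<le> C / (real n powr (7/20))\<^sup>2"
    proof (rule divide_left_mono)
      show "(real n powr (7/20))\<^sup>2 \<le> (real (gap_len n))\<^sup>2" using gap_len_bounds(1)[OF elim] by (intro power_mono) auto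
      show "0 < (real (gap_len n))\<^sup>2 * (real n powr (7/20))\<^sup>2" using pos gap_len_bounds(3)[OF elim] by simp
    qed (rule C0)
    finally have "real (block_count n) * beta_mixing M S X (gap_len n) \<le> real n / real n powr (2/5) * (C / (real n powr (7/20))\<^sup>2)"
      using 1 beta_mixing_nonneg by (intro mult_mono) auto
    then show ?case by (simp add: field_simps)
  qed
qed

theorem bounded_clt:
  assumes f [measurable]: "f \<in> borel_measurable S" and R: "\<And>x. \<bar>f x\<bar> \<le> R"
    and b: "\<And>k. \<bar>cov f k\<bar> \<le> b k" "summable b"
    and C: "\<And>k. k \<ge> 1 \<Longrightarrow> beta_mixing M S X k \<le> C / (real k)\<^sup>2"
  shows "(\<lambda>n. phi f n (t / sqrt (real n))) \<longlonglongrightarrow> exp (- (t\<^sup>2 / 2 * long_run_var f))"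
proof -
  have f2: "integrable M (\<lambda>\<omega>. (f (X 0 \<omega>))\<^sup>2)"
  proof (rule integrable_const_bound[where B="R\<^sup>2"])
    show "AE \<omega> in M. norm ((f (X 0 \<omega>))\<^sup>2) \<le> R\<^sup>2"
    proof (rule AE_I2)
      fix \<omega>
      show "norm ((f (X 0 \<omega>))\<^sup>2) \<le> R\<^sup>2" using power_mono[OF R[of "X 0 \<omega>"], of 2] by simp
    qed
  qed measurable
  define E where "E n = exp (- (t\<^sup>2 / 2 * (real (block_count n * block_len n) / real n) * (block_var f (block_len n) / real (block_len n))))" for n
  have "(\<lambda>n. block_var f (block_len n) / real (block_len n)) \<longlonglongrightarrow> long_run_var f"
    using filterlim_compose[OF block_var_tendsto[OF f f2 b] block_len_at_top] .
  then have "E \<longlonglongrightarrow> exp (- (t\<^sup>2 / 2 * 1 * long_run_var f))"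
    unfolding E_def[abs_def] by (intro tendsto_intros blocks_times_len_over_n)
  then have lim: "(\<lambda>n. complex_of_real (E n)) \<longlonglongrightarrow> exp (- (t\<^sup>2 / 2 * long_run_var f))"
    by (metis tendsto_of_real mult.right_neutral)
  define G where "G n = \<bar>t\<bar> * sqrt ((1 - real (block_count n * block_len n) / real n) * (2 * suminf b)) + 8 * (real (block_count n) * beta_mixing M S X (gap_len n)) +
    (t\<^sup>2 * \<bar>t\<bar> / 3 * R * (2 * suminf b) * (real (block_len n) / sqrt (real n)) + t ^ 4 * (suminf b)\<^sup>2 * (real (block_len n) / real n))" for n
  have "G \<longlonglongrightarrow> \<bar>t\<bar> * sqrt ((1 - 1) * (2 * suminf b)) + 8 * 0 + (t\<^sup>2 * \<bar>t\<bar> / 3 * R * (2 * suminf b) * 0 + t ^ 4 * (suminf b)\<^sup>2 * 0)"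
    unfolding G_def[abs_def]
    by (intro tendsto_intros blocks_times_len_over_n block_count_beta_tendsto[OF C] block_len_over_sqrt block_len_over_n)
  then have G: "G \<longlonglongrightarrow> 0" by simp
  have "(\<lambda>n. phi f n (t / sqrt (real n)) - complex_of_real (E n)) \<longlonglongrightarrow> 0"
  proof (rule Lim_null_comparison[OF _ G])
    show "\<forall>\<^sub>F n in sequentially. cmod (phi f n (t / sqrt (real n)) - complex_of_real (E n)) \<le> G n"
      using eventually_ge_at_top[of 1]
    proof eventually_elim
      case (elim n)
      then show ?case
        using bernstein_bound[OF f R b block_len_bounds(3)[OF elim] gap_len_bounds(3)[OF elim] block_count_le elim, of t]
        unfolding E_def G_def by simp
    qed
  qed
  from tendsto_add[OF this lim] show ?thesis by simp
qed

end

section \<open>Covariance bounds and truncation\<close>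

text \<open>
  The generalized inverse of the distribution function represents \<open>\<bar>Y\<bar>\<close> on \<open>(0,1)\<close>; reflected by \<open>u \<mapsto> 1 - u\<close>, it is
  the upper quantile function.
\<close>

lemma (in prob_space) quantile_dominates_tail:
  fixes Y :: "'a \<Rightarrow> real"
  assumes [measurable]: "Y \<in> borel_measurable M" and T: "T \<ge> 0"
    and PT: "prob {\<omega>\<in>space M. \<bar>Y \<omega>\<bar> > T} \<le> \<alpha>"
  shows "(\<integral>\<^sup>+\<omega>. ennreal (if T < \<bar>Y \<omega>\<bar> then (Y \<omega>)\<^sup>2 else 0) \<partial>M) \<le>
    (\<integral>\<^sup>+u\<in>{0..\<alpha>}. (upper_quantile M Y u)\<^sup>2 \<partial>lborel)"
proof -
  define D where "D = distr M borel (\<lambda>\<omega>. \<bar>Y \<omega>\<bar>)"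
  interpret D: real_distribution D unfolding D_def by (rule real_distribution_distr) simp
  interpret Q: cdf_distribution D by unfold_locales
  define \<phi> where "\<phi> y = ennreal (if T < y then y\<^sup>2 else 0)" for y :: real
  have [measurable]: "\<phi> \<in> borel_measurable borel" unfolding \<phi>_def by measurable
  have cdf: "cdf D t = 1 - prob {\<omega>\<in>space M. \<bar>Y \<omega>\<bar> > t}" for t
  proof -
    have "cdf D t = prob {\<omega>\<in>space M. \<bar>Y \<omega>\<bar> \<le> t}"
      unfolding cdf_def D_def by (subst measure_distr) (auto intro!: arg_cong[where f=prob])
    also have "\<dots> = prob (space M - {\<omega>\<in>space M. \<bar>Y \<omega>\<bar> > t})"
      by (intro arg_cong[where f=prob]) auto
    also have "\<dots> = 1 - prob {\<omega>\<in>space M. \<bar>Y \<omega>\<bar> > t}" by (rule prob_compl) measurable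
    finally show ?thesis .
  qed
  \<comment> \<open>The generalized inverse represents the law on the open unit interval, so the
    integrand is set to 0 elsewhere.\<close>
  define F where "F \<omega> = \<phi> (Q.I \<omega>) * indicator {0<..<1} \<omega>" for \<omega>
  have F [measurable]: "F \<in> borel_measurable borel"
  proof -
    have "(\<lambda>\<omega>. \<phi> (Q.I \<omega>)) \<in> borel_measurable (restrict_space borel {0<..<1})"
      by (rule measurable_compose[OF Q.measurable_CI]) measurable
    then show ?thesis unfolding F_def by (subst (asm) borel_measurable_restrict_space_iff_ennreal) auto
  qed
  have "(\<integral>\<^sup>+\<omega>. ennreal (if T < \<bar>Y \<omega>\<bar> then (Y \<omega>)\<^sup>2 else 0) \<partial>M) = (\<integral>\<^sup>+y. \<phi> y \<partial>D)"
    unfolding D_def by (subst nn_integral_distr) (auto simp: \<phi>_def intro!: nn_integral_cong)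
  also have "\<dots> = (\<integral>\<^sup>+y. \<phi> y \<partial>distr (restrict_space lborel {0<..<1}) borel Q.I)"
    unfolding Q.distr_I_eq_M ..
  also have "\<dots> = (\<integral>\<^sup>+\<omega>. \<phi> (Q.I \<omega>) \<partial>restrict_space lborel {0<..<1})"
  proof (rule nn_integral_distr)
    show "Q.I \<in> measurable (restrict_space lborel {0<..<1}) borel"
      using Q.measurable_CI by (simp cong: measurable_cong_sets add: sets_restrict_space)
  qed measurable
  also have "\<dots> = (\<integral>\<^sup>+\<omega>. F \<omega> \<partial>lborel)"
    unfolding F_def by (rule nn_integral_restrict_space) simp
  also have "\<dots> = (\<integral>\<^sup>+u. F (1 + (- 1) * u) \<partial>lborel)"
    using nn_integral_real_affine[of F "- 1" 1] by simp
  also have "\<dots> \<le> (\<integral>\<^sup>+u\<in>{0..\<alpha>}. (upper_quantile M Y u)\<^sup>2 \<partial>lborel)"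
  proof (rule nn_integral_mono)
    fix u :: real
    show "F (1 + (- 1) * u) \<le> (upper_quantile M Y u)\<^sup>2 * indicator {0..\<alpha>} u"
    proof (cases "0 < u \<and> u < 1 \<and> T < Q.I (1 - u)")
      case True
      have pinv: "1 - u \<le> cdf D x \<longleftrightarrow> Q.I (1 - u) \<le> x" for x
        by (rule Q.pseudoinverse) (use True in auto)
      \<comment> \<open>\<open>T < Q.I (1 - u)\<close> means \<open>cdf D T < 1 - u\<close>: the
        probability that \<open>\<bar>Y\<bar>\<close> exceeds \<open>T\<close> is larger than
        \<open>u\<close>, and it is at most \<open>\<alpha>\<close>.\<close>
      have "u \<le> \<alpha>" using pinv[of T] True cdf[of T] PT by linarith
      moreover have "ennreal (Q.I (1 - u)) \<le> upper_quantile M Y u"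
        unfolding upper_quantile_def
      proof (rule INF_greatest)
        fix t assume "t \<in> {t. 0 < t \<and> prob {\<omega>\<in>space M. \<bar>Y \<omega>\<bar> > t} \<le> u}"
        then show "ennreal (Q.I (1 - u)) \<le> ennreal t" using pinv[of t] cdf[of t] by (intro ennreal_leI) auto
      qed
      then have "(ennreal (Q.I (1 - u)))\<^sup>2 \<le> (upper_quantile M Y u)\<^sup>2" by (rule power_mono) simp
      ultimately show ?thesis using True T by (simp add: F_def \<phi>_def ennreal_power)
    next
      case False
      then show ?thesis by (auto simp: F_def \<phi>_def indicator_def)
    qed
  qed
  finally show ?thesis .
qed

text \<open>\<open>T\<close> is the upper quantile at \<open>\<alpha>\<close>. On
  \<open>[0, \<alpha>]\<close> the quantile function is at least \<open>T\<close>, which gives the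
  first inequality; by right continuity of the tail the probability beyond \<open>T\<close> is at
  most \<open>\<alpha>\<close>, which gives the second. Both parts of the covariance bound at level
  \<open>T\<close> are thus controlled by one integral.\<close>

lemma (in prob_space) quantile_level_exists:
  fixes Y :: "'a \<Rightarrow> real"
  assumes [measurable]: "Y \<in> borel_measurable M" and \<alpha>: "\<alpha> > 0"
  shows "\<exists>T\<ge>0. ennreal (\<alpha> * T\<^sup>2) \<le> (\<integral>\<^sup>+u\<in>{0..\<alpha>}. (upper_quantile M Y u)\<^sup>2 \<partial>lborel) \<and>
    (\<integral>\<^sup>+\<omega>. ennreal (if T < \<bar>Y \<omega>\<bar> then (Y \<omega>)\<^sup>2 else 0) \<partial>M) \<le>
    (\<integral>\<^sup>+u\<in>{0..\<alpha>}. (upper_quantile M Y u)\<^sup>2 \<partial>lborel)"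
proof -
  define G where "G t = prob {\<omega>\<in>space M. \<bar>Y \<omega>\<bar> > t}" for t
  have Gmono: "G t \<le> G s" if "s \<le> t" for s t
    unfolding G_def using that by (intro finite_measure_mono) auto
  define A where "A = {t. 0 < t \<and> G t \<le> \<alpha>}"
  have ne: "A \<noteq> {}"
  proof -
    have "(\<lambda>n. prob {\<omega>\<in>space M. \<bar>Y \<omega>\<bar> > real n}) \<longlonglongrightarrow> prob (\<Inter>n. {\<omega>\<in>space M. \<bar>Y \<omega>\<bar> > real n})"
      by (rule finite_Lim_measure_decseq) (auto simp: decseq_def)
    also have "(\<Inter>n. {\<omega>\<in>space M. \<bar>Y \<omega>\<bar> > real n}) = {}"
    proof -
      have False if "\<forall>n. \<bar>Y \<omega>\<bar> > real n" for \<omega>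
        using that reals_Archimedean2[of "\<bar>Y \<omega>\<bar>"] by (meson less_asym)
      then show ?thesis by auto
    qed
    finally have "(\<lambda>n. G (real n)) \<longlonglongrightarrow> 0" by (simp add: G_def)
    then have "\<forall>\<^sub>F n in sequentially. G (real n) < \<alpha>" using \<alpha> by (rule order_tendstoD)
    then obtain n where "\<And>k. k \<ge> n \<Longrightarrow> G (real k) < \<alpha>" by (auto simp: eventually_sequentially)
    from this[of "Suc n"] have "real (Suc n) \<in> A" by (simp add: A_def)
    then show ?thesis by auto
  qed
  have bdd: "bdd_below A" unfolding A_def by (intro bdd_belowI[of _ 0]) auto
  define T where "T = Inf A"
  have T0: "0 \<le> T" unfolding T_def using ne by (intro cInf_greatest) (auto simp: A_def)
  have above: "G t \<le> \<alpha>" if "t > T" for t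
  proof -
    obtain s where "s \<in> A" "s < t" using cInf_lessD[OF ne, of t] \<open>t > T\<close> unfolding T_def by auto
    then show ?thesis using Gmono[of s t] by (auto simp: A_def)
  qed
  \<comment> \<open>The infimum over positive \<open>t\<close> may be 0 and so lie outside
    \<open>A\<close>; continuity of the measure along increasing events still gives the bound at
    \<open>T\<close>.\<close>
  have GT: "G T \<le> \<alpha>"
  proof -
    have "(\<lambda>n. prob {\<omega>\<in>space M. \<bar>Y \<omega>\<bar> > T + 1 / real (Suc n)}) \<longlonglongrightarrow> prob (\<Union>n. {\<omega>\<in>space M. \<bar>Y \<omega>\<bar> > T + 1 / real (Suc n)})"
    proof (rule finite_Lim_measure_incseq)
      show "incseq (\<lambda>n. {\<omega>\<in>space M. \<bar>Y \<omega>\<bar> > T + 1 / real (Suc n)})"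
      proof (rule incseq_SucI, safe)
        fix n \<omega> assume "T + 1 / real (Suc n) < \<bar>Y \<omega>\<bar>"
        moreover have "1 / real (Suc (Suc n)) \<le> 1 / real (Suc n)" by (intro divide_left_mono) auto
        ultimately show "T + 1 / real (Suc (Suc n)) < \<bar>Y \<omega>\<bar>" by linarith
      qed
    qed auto
    also have "(\<Union>n. {\<omega>\<in>space M. \<bar>Y \<omega>\<bar> > T + 1 / real (Suc n)}) = {\<omega>\<in>space M. \<bar>Y \<omega>\<bar> > T}"
    proof (intro set_eqI iffI)
      fix \<omega> assume "\<omega> \<in> (\<Union>n. {\<omega>\<in>space M. \<bar>Y \<omega>\<bar> > T + 1 / real (Suc n)})"
      then obtain n where n: "\<omega> \<in> space M" "\<bar>Y \<omega>\<bar> > T + 1 / real (Suc n)" by auto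
      have "0 < 1 / real (Suc n)" by simp
      then have "T < \<bar>Y \<omega>\<bar>" using n(2) by linarith
      then show "\<omega> \<in> {\<omega>\<in>space M. \<bar>Y \<omega>\<bar> > T}" using n(1) by simp
    next
      fix \<omega> assume w: "\<omega> \<in> {\<omega>\<in>space M. \<bar>Y \<omega>\<bar> > T}"
      then have "0 < \<bar>Y \<omega>\<bar> - T" by simp
      then obtain n where "inverse (real (Suc n)) < \<bar>Y \<omega>\<bar> - T" using reals_Archimedean by blast
      then have "1 / real (Suc n) < \<bar>Y \<omega>\<bar> - T" by (simp only: inverse_eq_divide)
      then have "\<bar>Y \<omega>\<bar> > T + 1 / real (Suc n)" by linarith
      then show "\<omega> \<in> (\<Union>n. {\<omega>\<in>space M. \<bar>Y \<omega>\<bar> > T + 1 / real (Suc n)})" using w by blast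
    qed
    finally have "(\<lambda>n. G (T + 1 / real (Suc n))) \<longlonglongrightarrow> G T" unfolding G_def .
    then show ?thesis by (rule LIMSEQ_le_const2) (use above in auto)
  qed
  have "ennreal (\<alpha> * T\<^sup>2) = (\<integral>\<^sup>+u. ennreal (T\<^sup>2) * indicator {0..\<alpha>} u \<partial>lborel)"
    using \<alpha> by (subst nn_integral_cmult_indicator) (auto simp: ennreal_mult mult.commute)
  also have "\<dots> \<le> (\<integral>\<^sup>+u\<in>{0..\<alpha>}. (upper_quantile M Y u)\<^sup>2 \<partial>lborel)"
  proof (rule nn_integral_mono)
    fix u :: real
    show "ennreal (T\<^sup>2) * indicator {0..\<alpha>} u \<le> (upper_quantile M Y u)\<^sup>2 * indicator {0..\<alpha>} u"
    proof (cases "u \<in> {0..\<alpha>}")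
      case True
      have "ennreal T \<le> upper_quantile M Y u"
        unfolding upper_quantile_def
      proof (rule INF_greatest)
        fix t assume "t \<in> {t. 0 < t \<and> prob {\<omega>\<in>space M. \<bar>Y \<omega>\<bar> > t} \<le> u}"
        then have "t \<in> A" using True by (auto simp: A_def G_def)
        then show "ennreal T \<le> ennreal t" unfolding T_def using bdd by (intro ennreal_leI cInf_lower)
      qed
      then have "(ennreal T)\<^sup>2 \<le> (upper_quantile M Y u)\<^sup>2" by (rule power_mono) simp
      then show ?thesis using True T0 by (simp add: ennreal_power)
    qed simp
  qed
  finally have 1: "ennreal (\<alpha> * T\<^sup>2) \<le> (\<integral>\<^sup>+u\<in>{0..\<alpha>}. (upper_quantile M Y u)\<^sup>2 \<partial>lborel)" .
  have 2: "(\<integral>\<^sup>+\<omega>. ennreal (if T < \<bar>Y \<omega>\<bar> then (Y \<omega>)\<^sup>2 else 0) \<partial>M) \<le>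
    (\<integral>\<^sup>+u\<in>{0..\<alpha>}. (upper_quantile M Y u)\<^sup>2 \<partial>lborel)"
    using GT unfolding G_def by (intro quantile_dominates_tail T0) auto
  show ?thesis using T0 1 2 by blast
qed

section \<open>Covariance inequality under strong mixing\<close>

context stationary_process
begin

definition past_alpha :: "nat \<Rightarrow> real" where
  "past_alpha k = alpha_coeff M (generated_algebra M S X {..0}) (generated_algebra M S X {int k})"

lemma vimage_X_in_generated_algebra:
  assumes "i \<in> I" "A \<in> sets S"
  shows "X i -` A \<inter> space M \<in> generated_algebra M S X I"
  unfolding generated_algebra_def using assms by (intro sigma_sets.Basic) auto

lemma alpha_bound:
  assumes "A \<in> generated_algebra M S X I" "B \<in> generated_algebra M S X J"
  shows "\<bar>prob (A \<inter> B) - prob A * prob B\<bar> \<le> alpha_coeff M (generated_algebra M S X I) (generated_algebra M S X J)"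
proof -
  have "\<bar>prob (A \<inter> B) - prob A * prob B\<bar> \<le> 1" for A B
  proof -
    have "0 \<le> prob A * prob B" "prob A * prob B \<le> 1" by (auto intro: mult_le_one)
    then show ?thesis using prob_le_1[of "A \<inter> B"] measure_nonneg[of M "A \<inter> B"] by linarith
  qed
  then have "bdd_above ((\<lambda>(A, B). \<bar>prob (A \<inter> B) - prob A * prob B\<bar>) ` (generated_algebra M S X I \<times> generated_algebra M S X J))"
    by (intro bdd_aboveI[where M=1]) auto
  from cSUP_upper[OF _ this, of "(A, B)"] assms show ?thesis unfolding alpha_coeff_def by simp
qed

lemma past_alpha_sets:
  assumes "A \<in> sets S" "B \<in> sets S"
  shows "\<bar>prob {\<omega>\<in>space M. X 0 \<omega> \<in> A \<and> X (int k) \<omega> \<in> B} - prob {\<omega>\<in>space M. X 0 \<omega> \<in> A} * prob {\<omega>\<in>space M. X (int k) \<omega> \<in> B}\<bar> \<le> past_alpha k"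
proof -
  have "\<bar>prob ((X 0 -` A \<inter> space M) \<inter> (X (int k) -` B \<inter> space M)) - prob (X 0 -` A \<inter> space M) * prob (X (int k) -` B \<inter> space M)\<bar> \<le> past_alpha k"
    unfolding past_alpha_def using assms by (intro alpha_bound vimage_X_in_generated_algebra) auto
  moreover have "(X 0 -` A \<inter> space M) \<inter> (X (int k) -` B \<inter> space M) = {\<omega>\<in>space M. X 0 \<omega> \<in> A \<and> X (int k) \<omega> \<in> B}"
    "X 0 -` A \<inter> space M = {\<omega>\<in>space M. X 0 \<omega> \<in> A}" "X (int k) -` B \<inter> space M = {\<omega>\<in>space M. X (int k) \<omega> \<in> B}"
    by auto
  ultimately show ?thesis by simp
qed

lemma past_alpha_nonneg: "0 \<le> past_alpha k"
  using past_alpha_sets[of "{}" "{}" k] by simp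

definition cross_cov :: "nat \<Rightarrow> ('s \<Rightarrow> real) \<Rightarrow> ('s \<Rightarrow> real) \<Rightarrow> real" where
  "cross_cov k f g = (\<integral>\<omega>. f (X 0 \<omega>) * g (X (int k) \<omega>) \<partial>M) - (\<integral>\<omega>. f (X 0 \<omega>) \<partial>M) * (\<integral>\<omega>. g (X (int k) \<omega>) \<partial>M)"

lemma bounded_integrable:
  assumes "F \<in> borel_measurable M" "\<And>\<omega>. \<omega> \<in> space M \<Longrightarrow> \<bar>F \<omega>\<bar> \<le> (b::real)"
  shows "integrable M F" and "\<bar>\<integral>\<omega>. F \<omega> \<partial>M\<bar> \<le> b"
proof -
  show i: "integrable M F" using assms by (intro integrable_const_bound[where B=b]) auto
  have "\<bar>\<integral>\<omega>. F \<omega> \<partial>M\<bar> \<le> (\<integral>\<omega>. \<bar>F \<omega>\<bar> \<partial>M)" by (rule integral_abs_bound)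
  also have "\<dots> \<le> (\<integral>\<omega>. b \<partial>M)" using assms i by (intro integral_mono) auto
  finally show "\<bar>\<integral>\<omega>. F \<omega> \<partial>M\<bar> \<le> b" by (simp add: prob_space)
qed

text \<open>One argument of a bilinear form is handled at a time: \<open>G\<close> is frozen, and
  the other factor runs through functions of a single variable of the process.\<close>

lemma unit_functional_bound:
  fixes G :: "'a \<Rightarrow> real"
  assumes [measurable]: "G \<in> borel_measurable M" and G: "\<And>\<omega>. \<omega> \<in> space M \<Longrightarrow> \<bar>G \<omega>\<bar> \<le> c"
    and sets: "\<And>A. A \<in> sets S \<Longrightarrow> \<bar>\<integral>\<omega>. indicator A (X i \<omega>) * G \<omega> \<partial>M\<bar> \<le> a"
    and u [measurable]: "u \<in> borel_measurable S" and u01: "\<And>x. x \<in> space S \<Longrightarrow> 0 \<le> u x \<and> u x \<le> (1::real)"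
  shows "\<bar>\<integral>\<omega>. u (X i \<omega>) * G \<omega> \<partial>M\<bar> \<le> a"
proof (rule functional_le_on_unit_functions[where L="\<lambda>u. \<integral>\<omega>. u (X i \<omega>) * G \<omega> \<partial>M" and N=S and K=c])
  have XS: "X i \<omega> \<in> space S" if "\<omega> \<in> space M" for \<omega> using measurable_space[OF X_meas that] .
  have b: "\<bar>f (X i \<omega>) * G \<omega>\<bar> \<le> b * c" if "\<forall>x\<in>space S. \<bar>f x\<bar> \<le> b" "\<omega> \<in> space M" for f b \<omega>
    unfolding abs_mult using that XS G by (intro mult_mono) (auto intro: order_trans[OF abs_ge_zero])
  have i: "integrable M (\<lambda>\<omega>. f (X i \<omega>) * G \<omega>)" if "f \<in> borel_measurable S" "\<forall>x\<in>space S. \<bar>f x\<bar> \<le> b" for f b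
    by (rule bounded_integrable(1)[OF _ b[OF that(2)]]) (use that(1) in measurable)
  show "(\<integral>\<omega>. (f (X i \<omega>) + g (X i \<omega>)) * G \<omega> \<partial>M) = (\<integral>\<omega>. f (X i \<omega>) * G \<omega> \<partial>M) + (\<integral>\<omega>. g (X i \<omega>) * G \<omega> \<partial>M)"
    if "f \<in> borel_measurable S" "g \<in> borel_measurable S" "\<forall>x\<in>space S. \<bar>f x\<bar> \<le> b" "\<forall>x\<in>space S. \<bar>g x\<bar> \<le> c'" for f g b c'
    using i[OF that(1,3)] i[OF that(2,4)] by (simp add: distrib_right)
  show "(\<integral>\<omega>. c' * f (X i \<omega>) * G \<omega> \<partial>M) = c' * (\<integral>\<omega>. f (X i \<omega>) * G \<omega> \<partial>M)" for f c'
    by (simp add: mult.assoc)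
  show "\<bar>\<integral>\<omega>. f (X i \<omega>) * G \<omega> \<partial>M\<bar> \<le> c * b" if "f \<in> borel_measurable S" "\<forall>x\<in>space S. \<bar>f x\<bar> \<le> b" for f b
    unfolding mult.commute[of c] by (rule bounded_integrable(2)[OF _ b[OF that(2)]]) (use that(1) in measurable)
qed (use sets u u01 in auto)

text \<open>The level set argument is applied to each argument in turn, passing from two events to a
  function and an event, and from there to two functions. Centring one factor beforehand turns the
  covariance into a linear functional of the other. The constants \<open>c = 1\<close> and
  \<open>c = 2\<close> are crude sup bounds that do not reach the result.\<close>

lemma cross_cov_unit_bound:
  assumes f [measurable]: "f \<in> borel_measurable S" and g [measurable]: "g \<in> borel_measurable S"
    and f01: "\<And>x. 0 \<le> f x \<and> f x \<le> 1" and g01: "\<And>x. 0 \<le> g x \<and> g x \<le> 1"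
  shows "\<bar>cross_cov k f g\<bar> \<le> past_alpha k"
proof -
  have if_: "integrable M (\<lambda>\<omega>. f (X i \<omega>))" for i
    by (rule bounded_integrable(1)[where b=1]) (use f01 in auto)
  have ig: "integrable M (\<lambda>\<omega>. g (X i \<omega>))" for i
    by (rule bounded_integrable(1)[where b=1]) (use g01 in auto)
  define Ef where "Ef = (\<integral>\<omega>. f (X 0 \<omega>) \<partial>M)"
  have Ef: "\<bar>Ef\<bar> \<le> 1" unfolding Ef_def by (rule bounded_integrable(2)) (use f01 in auto)
  have step1: "\<bar>\<integral>\<omega>. f (X 0 \<omega>) * (indicator B (X (int k) \<omega>) - prob {\<omega>\<in>space M. X (int k) \<omega> \<in> B}) \<partial>M\<bar> \<le> past_alpha k" if B [measurable]: "B \<in> sets S" for B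
  proof (rule unit_functional_bound[where c=1])
    let ?p = "prob {\<omega>\<in>space M. X (int k) \<omega> \<in> B}"
    show "\<bar>indicator B (X (int k) \<omega>) - ?p\<bar> \<le> 1" for \<omega>
      using prob_le_1[of "{\<omega>\<in>space M. X (int k) \<omega> \<in> B}"] measure_nonneg[of M "{\<omega>\<in>space M. X (int k) \<omega> \<in> B}"] by (auto simp: indicator_def)
    fix A assume A [measurable]: "A \<in> sets S"
    have "(\<integral>\<omega>. indicator A (X 0 \<omega>) * (indicator B (X (int k) \<omega>) - ?p) \<partial>M) =
      (\<integral>\<omega>. indicator {\<omega>\<in>space M. X 0 \<omega> \<in> A \<and> X (int k) \<omega> \<in> B} \<omega> - ?p * indicator {\<omega>\<in>space M. X 0 \<omega> \<in> A} \<omega> \<partial>M)"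
      by (rule Bochner_Integration.integral_cong) (auto simp: indicator_def)
    also have "\<dots> = prob {\<omega>\<in>space M. X 0 \<omega> \<in> A \<and> X (int k) \<omega> \<in> B} - ?p * prob {\<omega>\<in>space M. X 0 \<omega> \<in> A}"
    proof (subst Bochner_Integration.integral_diff)
      show "integrable M (indicator {\<omega>\<in>space M. X 0 \<omega> \<in> A \<and> X (int k) \<omega> \<in> B} :: _ \<Rightarrow> real)"
        by (rule bounded_integrable(1)[where b=1]) (auto simp: indicator_def)
      show "integrable M (\<lambda>\<omega>. ?p * indicator {\<omega>\<in>space M. X 0 \<omega> \<in> A} \<omega> :: real)"
        by (intro integrable_mult_right bounded_integrable(1)[where b=1]) (auto simp: indicator_def)
      have [simp]: "{\<omega>\<in>space M. X 0 \<omega> \<in> A \<and> X (int k) \<omega> \<in> B} \<inter> space M = {\<omega>\<in>space M. X 0 \<omega> \<in> A \<and> X (int k) \<omega> \<in> B}"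
        "{\<omega>\<in>space M. X 0 \<omega> \<in> A} \<inter> space M = {\<omega>\<in>space M. X 0 \<omega> \<in> A}" by auto
      show "expectation (indicator {\<omega>\<in>space M. X 0 \<omega> \<in> A \<and> X (int k) \<omega> \<in> B}) - (\<integral>\<omega>. ?p * indicator {\<omega>\<in>space M. X 0 \<omega> \<in> A} \<omega> \<partial>M) =
        prob {\<omega>\<in>space M. X 0 \<omega> \<in> A \<and> X (int k) \<omega> \<in> B} - ?p * prob {\<omega>\<in>space M. X 0 \<omega> \<in> A}" by simp
    qed
    finally show "\<bar>\<integral>\<omega>. indicator A (X 0 \<omega>) * (indicator B (X (int k) \<omega>) - ?p) \<partial>M\<bar> \<le> past_alpha k"
      using past_alpha_sets[OF A B, of k] by (simp add: mult.commute)
  qed (use f01 in auto)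
  have "\<bar>\<integral>\<omega>. g (X (int k) \<omega>) * (f (X 0 \<omega>) - Ef) \<partial>M\<bar> \<le> past_alpha k"
  proof (rule unit_functional_bound[where c=2])
    show "\<bar>f (X 0 \<omega>) - Ef\<bar> \<le> 2" for \<omega> using f01[of "X 0 \<omega>"] Ef by linarith
    fix B assume B [measurable]: "B \<in> sets S"
    let ?p = "prob {\<omega>\<in>space M. X (int k) \<omega> \<in> B}"
    have i1: "integrable M (\<lambda>\<omega>. f (X 0 \<omega>) * indicator B (X (int k) \<omega>))"
      by (rule bounded_integrable(1)[where b=1]) (use f01 in \<open>auto simp: indicator_def\<close>)
    have i2: "integrable M (\<lambda>\<omega>. indicator B (X (int k) \<omega>) :: real)"
      by (rule bounded_integrable(1)[where b=1]) (auto simp: indicator_def)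
    have p: "(\<integral>\<omega>. indicator B (X (int k) \<omega>) \<partial>M) = ?p"
    proof -
      have "(\<integral>\<omega>. indicator B (X (int k) \<omega>) \<partial>M :: real) = (\<integral>\<omega>. indicator {\<omega>\<in>space M. X (int k) \<omega> \<in> B} \<omega> \<partial>M)"
        by (rule Bochner_Integration.integral_cong) (auto simp: indicator_def)
      moreover have "{\<omega>\<in>space M. X (int k) \<omega> \<in> B} \<inter> space M = {\<omega>\<in>space M. X (int k) \<omega> \<in> B}" by auto
      ultimately show ?thesis by simp
    qed
    have "(\<integral>\<omega>. indicator B (X (int k) \<omega>) * (f (X 0 \<omega>) - Ef) \<partial>M) = (\<integral>\<omega>. f (X 0 \<omega>) * indicator B (X (int k) \<omega>) \<partial>M) - Ef * ?p"
    proof -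
      have "(\<integral>\<omega>. indicator B (X (int k) \<omega>) * (f (X 0 \<omega>) - Ef) \<partial>M) =
        (\<integral>\<omega>. f (X 0 \<omega>) * indicator B (X (int k) \<omega>) - Ef * indicator B (X (int k) \<omega>) \<partial>M)"
        by (intro Bochner_Integration.integral_cong refl) (simp add: algebra_simps)
      then show ?thesis using i1 i2 p by simp
    qed
    also have "\<dots> = (\<integral>\<omega>. f (X 0 \<omega>) * (indicator B (X (int k) \<omega>) - ?p) \<partial>M)"
      using i1 if_[of 0] by (simp add: right_diff_distrib Ef_def)
    finally show "\<bar>\<integral>\<omega>. indicator B (X (int k) \<omega>) * (f (X 0 \<omega>) - Ef) \<partial>M\<bar> \<le> past_alpha k"
      using step1[OF B] by simp
  qed (use g01 in auto)
  moreover have "(\<integral>\<omega>. g (X (int k) \<omega>) * (f (X 0 \<omega>) - Ef) \<partial>M) = cross_cov k f g"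
  proof -
    have "integrable M (\<lambda>\<omega>. f (X 0 \<omega>) * g (X (int k) \<omega>))"
      by (rule bounded_integrable(1)[where b=1]) (use f01 g01 in \<open>auto simp: abs_mult intro: mult_le_one\<close>)
    then show ?thesis unfolding cross_cov_def Ef_def[symmetric] using ig[of "int k"]
      by (simp add: right_diff_distrib mult.commute)
  qed
  ultimately show ?thesis by simp
qed

text \<open>\<open>4 * T\<^sup>2\<close> is the product of the two slopes \<open>2 * T\<close> of
  the affine map of \<open>[0, 1]\<close> onto \<open>[-T, T]\<close>.\<close>

lemma cross_cov_bounded:
  assumes f [measurable]: "f \<in> borel_measurable S" and g [measurable]: "g \<in> borel_measurable S"
    and fT: "\<And>x. \<bar>f x\<bar> \<le> T" and gT: "\<And>x. \<bar>g x\<bar> \<le> T"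
  shows "\<bar>cross_cov k f g\<bar> \<le> 4 * past_alpha k * T\<^sup>2"
proof (cases "T = 0")
  case True
  then have "f = (\<lambda>_. 0)" "g = (\<lambda>_. 0)" using fT gT by (auto simp: fun_eq_iff)
  then show ?thesis using True by (simp add: cross_cov_def)
next
  case False
  then have T: "T > 0" using fT[of undefined] by linarith
  define u where "u x = (f x + T) / (2 * T)" for x
  define v where "v x = (g x + T) / (2 * T)" for x
  have [measurable]: "u \<in> borel_measurable S" "v \<in> borel_measurable S" unfolding u_def v_def by measurable
  have u01: "0 \<le> u x \<and> u x \<le> 1" and v01: "0 \<le> v x \<and> v x \<le> 1" for x
    using fT[of x] gT[of x] T by (auto simp: u_def v_def field_simps)
  have iu: "integrable M (\<lambda>\<omega>. u (X i \<omega>))" and iv: "integrable M (\<lambda>\<omega>. v (X i \<omega>))" for i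
    by (rule bounded_integrable(1)[where b=1], use u01 v01 in auto)+
  have iuv: "integrable M (\<lambda>\<omega>. u (X 0 \<omega>) * v (X (int k) \<omega>))"
    by (rule bounded_integrable(1)[where b=1]) (use u01 v01 in \<open>auto simp: abs_mult intro: mult_le_one\<close>)
  have fu: "f x = 2 * T * u x - T" and gv: "g x = 2 * T * v x - T" for x
    using T by (auto simp: u_def v_def)
  define a where "a = (\<integral>\<omega>. u (X 0 \<omega>) * v (X (int k) \<omega>) \<partial>M)"
  define p where "p = (\<integral>\<omega>. u (X 0 \<omega>) \<partial>M)"
  define q where "q = (\<integral>\<omega>. v (X (int k) \<omega>) \<partial>M)"
  have 1: "(\<integral>\<omega>. f (X 0 \<omega>) \<partial>M) = 2 * T * p - T" unfolding fu p_def using iu by (simp add: prob_space)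
  have 2: "(\<integral>\<omega>. g (X (int k) \<omega>) \<partial>M) = 2 * T * q - T" unfolding gv q_def using iv by (simp add: prob_space)
  have "(\<integral>\<omega>. f (X 0 \<omega>) * g (X (int k) \<omega>) \<partial>M) =
    (\<integral>\<omega>. 4 * T\<^sup>2 * (u (X 0 \<omega>) * v (X (int k) \<omega>)) - 2 * T\<^sup>2 * u (X 0 \<omega>) - 2 * T\<^sup>2 * v (X (int k) \<omega>) + T\<^sup>2 \<partial>M)"
    unfolding fu gv by (intro Bochner_Integration.integral_cong refl) (simp add: power2_eq_square algebra_simps)
  also have "\<dots> = 4 * T\<^sup>2 * a - 2 * T\<^sup>2 * p - 2 * T\<^sup>2 * q + T\<^sup>2"
    unfolding a_def p_def q_def using iu iv iuv by (simp add: prob_space)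
  finally have "cross_cov k f g = 4 * T\<^sup>2 * (a - p * q)"
    unfolding cross_cov_def 1 2 by (simp add: power2_eq_square algebra_simps)
  also have "a - p * q = cross_cov k u v" unfolding cross_cov_def a_def p_def q_def ..
  finally have "\<bar>cross_cov k f g\<bar> = 4 * T\<^sup>2 * \<bar>cross_cov k u v\<bar>" by (simp add: abs_mult)
  also have "\<dots> \<le> 4 * T\<^sup>2 * past_alpha k"
    using u01 v01 by (intro mult_left_mono cross_cov_unit_bound) auto
  finally show ?thesis by (simp add: mult_ac)
qed

section \<open>Functions under a common envelope\<close>

context
  fixes H :: "'s \<Rightarrow> real"
  assumes H [measurable]: "H \<in> borel_measurable S"
    and H2: "integrable M (\<lambda>\<omega>. (H (X 0 \<omega>))\<^sup>2)"
begin

definition tail_square :: "real \<Rightarrow> real" where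
  "tail_square T = (\<integral>\<omega>. (if T < \<bar>H (X 0 \<omega>)\<bar> then (H (X 0 \<omega>))\<^sup>2 else 0) \<partial>M)"

lemma tail_square_integrable: "integrable M (\<lambda>\<omega>. if T < \<bar>H (X i \<omega>)\<bar> then (H (X i \<omega>))\<^sup>2 else 0)"
proof -
  have "integrable M (\<lambda>\<omega>. (H (X i \<omega>))\<^sup>2)" using H2 integrable_X_iff[of "\<lambda>x. (H x)\<^sup>2" i] by simp
  then show ?thesis by (rule Bochner_Integration.integrable_bound) auto
qed

lemma tail_square_eq: "(\<integral>\<omega>. (if T < \<bar>H (X i \<omega>)\<bar> then (H (X i \<omega>))\<^sup>2 else 0) \<partial>M) = tail_square T"
  unfolding tail_square_def by (rule integral_X_eq[of "\<lambda>x. if T < \<bar>H x\<bar> then (H x)\<^sup>2 else 0"]) measurable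

lemma tail_square_tendsto: "(\<lambda>n. tail_square (real n)) \<longlonglongrightarrow> 0"
proof -
  have "(\<lambda>n. tail_square (real n)) \<longlonglongrightarrow> (\<integral>\<omega>. 0 \<partial>M)"
    unfolding tail_square_def
  proof (rule integral_dominated_convergence)
    show "integrable M (\<lambda>\<omega>. (H (X 0 \<omega>))\<^sup>2)" by (rule H2)
    show "AE \<omega> in M. (\<lambda>n. if real n < \<bar>H (X 0 \<omega>)\<bar> then (H (X 0 \<omega>))\<^sup>2 else 0) \<longlonglongrightarrow> 0"
    proof (rule AE_I2)
      fix \<omega>
      obtain N where N: "\<bar>H (X 0 \<omega>)\<bar> \<le> real N" using real_arch_simple by blast
      have "(if real n < \<bar>H (X 0 \<omega>)\<bar> then (H (X 0 \<omega>))\<^sup>2 else 0) = 0" if "N \<le> n" for n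
        using N that by auto
      then have "\<forall>\<^sub>F n in sequentially. (if real n < \<bar>H (X 0 \<omega>)\<bar> then (H (X 0 \<omega>))\<^sup>2 else 0) = 0"
        using eventually_ge_at_top[of N] by (rule eventually_mono[rotated])
      then show "(\<lambda>n. if real n < \<bar>H (X 0 \<omega>)\<bar> then (H (X 0 \<omega>))\<^sup>2 else 0) \<longlonglongrightarrow> 0"
        by (rule tendsto_eventually)
    qed
  qed auto
  then show ?thesis by simp
qed

lemma dominated_square_integrable:
  assumes [measurable]: "f \<in> borel_measurable S" and le: "\<And>x. \<bar>f x\<bar> \<le> \<bar>H x\<bar>"
  shows "integrable M (\<lambda>\<omega>. (f (X i \<omega>))\<^sup>2)"
proof -
  have "integrable M (\<lambda>\<omega>. (H (X i \<omega>))\<^sup>2)" using H2 integrable_X_iff[of "\<lambda>x. (H x)\<^sup>2" i] by simp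
  then show ?thesis
  proof (rule Bochner_Integration.integrable_bound)
    show "AE \<omega> in M. norm ((f (X i \<omega>))\<^sup>2) \<le> norm ((H (X i \<omega>))\<^sup>2)"
      using le by (intro AE_I2) (simp add: abs_le_square_iff)
  qed measurable
qed

lemma product_integrable:
  fixes f g :: "'s \<Rightarrow> real"
  assumes [measurable]: "f \<in> borel_measurable S" "g \<in> borel_measurable S"
    and f2: "integrable M (\<lambda>\<omega>. (f (X i \<omega>))\<^sup>2)" and g2: "integrable M (\<lambda>\<omega>. (g (X j \<omega>))\<^sup>2)"
  shows "integrable M (\<lambda>\<omega>. f (X i \<omega>) * g (X j \<omega>))"
    and "\<bar>\<integral>\<omega>. f (X i \<omega>) * g (X j \<omega>) \<partial>M\<bar> \<le> (\<integral>\<omega>. (f (X i \<omega>))\<^sup>2 \<partial>M) / 2 + (\<integral>\<omega>. (g (X j \<omega>))\<^sup>2 \<partial>M) / 2"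
proof -
  have i2: "integrable M (\<lambda>\<omega>. (f (X i \<omega>))\<^sup>2 / 2 + (g (X j \<omega>))\<^sup>2 / 2)" using f2 g2 by simp
  have le: "\<bar>x * y\<bar> \<le> x\<^sup>2 / 2 + y\<^sup>2 / 2" for x y :: real
    using sum_squares_bound[of "\<bar>x\<bar>" "\<bar>y\<bar>"] by (simp add: abs_mult)
  show i: "integrable M (\<lambda>\<omega>. f (X i \<omega>) * g (X j \<omega>))"
  proof (rule Bochner_Integration.integrable_bound[OF i2])
    show "AE \<omega> in M. norm (f (X i \<omega>) * g (X j \<omega>)) \<le> norm ((f (X i \<omega>))\<^sup>2 / 2 + (g (X j \<omega>))\<^sup>2 / 2)"
      using order_trans[OF le abs_ge_self] by (intro AE_I2) (simp only: real_norm_def)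
  qed measurable
  have "\<bar>\<integral>\<omega>. f (X i \<omega>) * g (X j \<omega>) \<partial>M\<bar> \<le> (\<integral>\<omega>. \<bar>f (X i \<omega>) * g (X j \<omega>)\<bar> \<partial>M)" by (rule integral_abs_bound)
  also have "\<dots> \<le> (\<integral>\<omega>. (f (X i \<omega>))\<^sup>2 / 2 + (g (X j \<omega>))\<^sup>2 / 2 \<partial>M)"
    using i i2 le by (intro integral_mono) auto
  also have "\<dots> = (\<integral>\<omega>. (f (X i \<omega>))\<^sup>2 \<partial>M) / 2 + (\<integral>\<omega>. (g (X j \<omega>))\<^sup>2 \<partial>M) / 2" using f2 g2 by simp
  finally show "\<bar>\<integral>\<omega>. f (X i \<omega>) * g (X j \<omega>) \<partial>M\<bar> \<le> (\<integral>\<omega>. (f (X i \<omega>))\<^sup>2 \<partial>M) / 2 + (\<integral>\<omega>. (g (X j \<omega>))\<^sup>2 \<partial>M) / 2" .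
qed

lemma square_of_mean_le:
  fixes f :: "'s \<Rightarrow> real"
  assumes [measurable]: "f \<in> borel_measurable S" and f2: "integrable M (\<lambda>\<omega>. (f (X i \<omega>))\<^sup>2)"
  shows "(\<integral>\<omega>. f (X i \<omega>) \<partial>M)\<^sup>2 \<le> (\<integral>\<omega>. (f (X i \<omega>))\<^sup>2 \<partial>M)"
proof -
  have i: "integrable M (\<lambda>\<omega>. f (X i \<omega>))" by (rule square_integrable_imp_integrable[OF _ f2]) measurable
  show ?thesis using variance_positive[of "\<lambda>\<omega>. f (X i \<omega>)"] variance_eq[OF i f2] by simp
qed

text \<open>
  Both functions are split at level \<open>T\<close>. The low parts give \<open>4 \<alpha> T\<^sup>2\<close>; each of the three other
  combinations contributes an expectation of a product and a product of expectations, both at most the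
  tail.
\<close>

lemma cross_cov_truncation_bound:
  assumes f [measurable]: "f \<in> borel_measurable S" and g [measurable]: "g \<in> borel_measurable S"
    and fH: "\<And>x. \<bar>f x\<bar> \<le> \<bar>H x\<bar>" and gH: "\<And>x. \<bar>g x\<bar> \<le> \<bar>H x\<bar>" and T: "T \<ge> 0"
  shows "\<bar>cross_cov k f g\<bar> \<le> 4 * past_alpha k * T\<^sup>2 + 6 * tail_square T"
proof -
  define lo where "lo f x = (if \<bar>f x\<bar> \<le> T then f x else 0)" for f :: "'s \<Rightarrow> real" and x
  define hi where "hi f x = (if \<bar>f x\<bar> \<le> T then 0 else f x)" for f :: "'s \<Rightarrow> real" and x
  have lom: "lo u \<in> borel_measurable S" and him: "hi u \<in> borel_measurable S" if [measurable]: "u \<in> borel_measurable S" for u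
    unfolding lo_def[abs_def] hi_def[abs_def] by measurable
  note [measurable] = lom[OF f] lom[OF g] him[OF f] him[OF g]
  have loT: "\<bar>lo u x\<bar> \<le> T" for u x using T by (simp add: lo_def)
  have loH: "\<bar>lo u x\<bar> \<le> \<bar>H x\<bar>" and hiH: "\<bar>hi u x\<bar> \<le> \<bar>H x\<bar>" if "\<And>x. \<bar>u x\<bar> \<le> \<bar>H x\<bar>" for u x
    using that[of x] by (auto simp: lo_def hi_def)
  \<comment> \<open>Where the high part is non-zero,
    \<open>T < \<bar>u x\<bar> \<le> \<bar>H x\<bar>\<close>. Hence its square and its product with
    \<open>T\<close> are both below the tail of \<open>H\<^sup>2\<close>.\<close>
  have hi2: "(hi u x)\<^sup>2 \<le> (if T < \<bar>H x\<bar> then (H x)\<^sup>2 else 0)" "T * \<bar>hi u x\<bar> \<le> (if T < \<bar>H x\<bar> then (H x)\<^sup>2 else 0)"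
    if "\<And>x. \<bar>u x\<bar> \<le> \<bar>H x\<bar>" for u x
  proof -
    show "(hi u x)\<^sup>2 \<le> (if T < \<bar>H x\<bar> then (H x)\<^sup>2 else 0)"
      using that[of x] abs_le_square_iff[of "u x" "H x"] by (auto simp: hi_def)
    have "T * \<bar>u x\<bar> \<le> \<bar>H x\<bar> * \<bar>H x\<bar>" if "T < \<bar>u x\<bar>"
      using that \<open>\<And>x. \<bar>u x\<bar> \<le> \<bar>H x\<bar>\<close>[of x] T by (intro mult_mono) auto
    then show "T * \<bar>hi u x\<bar> \<le> (if T < \<bar>H x\<bar> then (H x)\<^sup>2 else 0)"
      using that[of x] by (auto simp: hi_def power2_eq_square)
  qed
  have sq: "integrable M (\<lambda>\<omega>. (lo u (X i \<omega>))\<^sup>2)" "integrable M (\<lambda>\<omega>. (hi u (X i \<omega>))\<^sup>2)"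
    if "u \<in> borel_measurable S" "\<And>x. \<bar>u x\<bar> \<le> \<bar>H x\<bar>" for u i
    by (rule dominated_square_integrable[OF lom[OF that(1)] loH[OF that(2)]], rule dominated_square_integrable[OF him[OF that(1)] hiH[OF that(2)]])
  have in1: "integrable M (\<lambda>\<omega>. lo u (X i \<omega>))" "integrable M (\<lambda>\<omega>. hi u (X i \<omega>))"
    if "u \<in> borel_measurable S" "\<And>x. \<bar>u x\<bar> \<le> \<bar>H x\<bar>" for u i
    using sq[OF that, of i] lom[OF that(1)] him[OF that(1)] by (auto intro!: square_integrable_imp_integrable)
  have Ehi2: "(\<integral>\<omega>. (hi u (X i \<omega>))\<^sup>2 \<partial>M) \<le> tail_square T" if u: "u \<in> borel_measurable S" "\<And>x. \<bar>u x\<bar> \<le> \<bar>H x\<bar>" for u i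
    unfolding tail_square_eq[of T i, symmetric] using sq(2)[OF u] tail_square_integrable hi2(1)[OF u(2)] by (intro integral_mono) auto
  have TEhi: "T * (\<integral>\<omega>. \<bar>hi u (X i \<omega>)\<bar> \<partial>M) \<le> tail_square T" if u: "u \<in> borel_measurable S" "\<And>x. \<bar>u x\<bar> \<le> \<bar>H x\<bar>" for u i
  proof -
    have "T * (\<integral>\<omega>. \<bar>hi u (X i \<omega>)\<bar> \<partial>M) = (\<integral>\<omega>. T * \<bar>hi u (X i \<omega>)\<bar> \<partial>M)" by simp
    also have "\<dots> \<le> tail_square T"
      unfolding tail_square_eq[of T i, symmetric] using in1(2)[OF u] tail_square_integrable hi2(2)[OF u(2)] by (intro integral_mono) auto
    finally show ?thesis .
  qed
  have lh: "\<bar>\<integral>\<omega>. lo u (X i \<omega>) * hi v (X j \<omega>) \<partial>M\<bar> \<le> tail_square T"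
      "\<bar>(\<integral>\<omega>. lo u (X i \<omega>) \<partial>M) * (\<integral>\<omega>. hi v (X j \<omega>) \<partial>M)\<bar> \<le> tail_square T"
    if u: "u \<in> borel_measurable S" "\<And>x. \<bar>u x\<bar> \<le> \<bar>H x\<bar>" and v: "v \<in> borel_measurable S" "\<And>x. \<bar>v x\<bar> \<le> \<bar>H x\<bar>" for u v i j
  proof -
    have p: "integrable M (\<lambda>\<omega>. lo u (X i \<omega>) * hi v (X j \<omega>))"
      by (rule product_integrable(1)[OF lom[OF u(1)] him[OF v(1)] sq(1)[OF u] sq(2)[OF v]])
    have "\<bar>\<integral>\<omega>. lo u (X i \<omega>) * hi v (X j \<omega>) \<partial>M\<bar> \<le> (\<integral>\<omega>. \<bar>lo u (X i \<omega>) * hi v (X j \<omega>)\<bar> \<partial>M)" by (rule integral_abs_bound)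
    also have "\<dots> \<le> (\<integral>\<omega>. T * \<bar>hi v (X j \<omega>)\<bar> \<partial>M)"
    proof (rule integral_mono)
      show "integrable M (\<lambda>\<omega>. \<bar>lo u (X i \<omega>) * hi v (X j \<omega>)\<bar>)" using p by (rule integrable_abs)
      show "integrable M (\<lambda>\<omega>. T * \<bar>hi v (X j \<omega>)\<bar>)" using in1(2)[OF v, of j] by simp
      show "\<bar>lo u (X i \<omega>) * hi v (X j \<omega>)\<bar> \<le> T * \<bar>hi v (X j \<omega>)\<bar>" for \<omega>
        unfolding abs_mult by (rule mult_right_mono[OF loT]) simp
    qed
    also have "\<dots> \<le> tail_square T" using TEhi[OF v, of j] by simp
    finally show "\<bar>\<integral>\<omega>. lo u (X i \<omega>) * hi v (X j \<omega>) \<partial>M\<bar> \<le> tail_square T" .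
    have "\<bar>\<integral>\<omega>. lo u (X i \<omega>) \<partial>M\<bar> \<le> T" 
      by (rule bounded_integrable(2)[OF measurable_compose[OF X_meas lom[OF u(1)]] loT])
    then have "\<bar>(\<integral>\<omega>. lo u (X i \<omega>) \<partial>M) * (\<integral>\<omega>. hi v (X j \<omega>) \<partial>M)\<bar> \<le> T * (\<integral>\<omega>. \<bar>hi v (X j \<omega>)\<bar> \<partial>M)"
      unfolding abs_mult using T by (intro mult_mono integral_abs_bound) auto
    then show "\<bar>(\<integral>\<omega>. lo u (X i \<omega>) \<partial>M) * (\<integral>\<omega>. hi v (X j \<omega>) \<partial>M)\<bar> \<le> tail_square T" using TEhi[OF v, of j] by linarith
  qed
  have hh1: "\<bar>\<integral>\<omega>. hi f (X 0 \<omega>) * hi g (X (int k) \<omega>) \<partial>M\<bar> \<le> tail_square T"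
    using product_integrable(2)[OF him[OF f] him[OF g] sq(2)[OF f fH, of 0] sq(2)[OF g gH, of "int k"]]
      Ehi2[OF f fH, of 0] Ehi2[OF g gH, of "int k"] by linarith
  have hh2: "\<bar>(\<integral>\<omega>. hi f (X 0 \<omega>) \<partial>M) * (\<integral>\<omega>. hi g (X (int k) \<omega>) \<partial>M)\<bar> \<le> tail_square T"
  proof -
    have le: "\<bar>x * y\<bar> \<le> x\<^sup>2 / 2 + y\<^sup>2 / 2" for x y :: real
      using sum_squares_bound[of "\<bar>x\<bar>" "\<bar>y\<bar>"] by (simp add: abs_mult)
    have "(\<integral>\<omega>. hi f (X 0 \<omega>) \<partial>M)\<^sup>2 \<le> tail_square T" "(\<integral>\<omega>. hi g (X (int k) \<omega>) \<partial>M)\<^sup>2 \<le> tail_square T"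
      using square_of_mean_le[OF him[OF f] sq(2)[OF f fH, of 0]] square_of_mean_le[OF him[OF g] sq(2)[OF g gH, of "int k"]]
        Ehi2[OF f fH, of 0] Ehi2[OF g gH, of "int k"] by linarith+
    then show ?thesis using le[of "\<integral>\<omega>. hi f (X 0 \<omega>) \<partial>M" "\<integral>\<omega>. hi g (X (int k) \<omega>) \<partial>M"] by linarith
  qed
  have fs: "f x = lo f x + hi f x" and gs: "g x = lo g x + hi g x" for x by (auto simp: lo_def hi_def)
  define a b c d where "a = (\<integral>\<omega>. lo f (X 0 \<omega>) * lo g (X (int k) \<omega>) \<partial>M)" and "b = (\<integral>\<omega>. lo f (X 0 \<omega>) * hi g (X (int k) \<omega>) \<partial>M)"
    and "c = (\<integral>\<omega>. hi f (X 0 \<omega>) * lo g (X (int k) \<omega>) \<partial>M)" and "d = (\<integral>\<omega>. hi f (X 0 \<omega>) * hi g (X (int k) \<omega>) \<partial>M)"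
  define p q p' q' where "p = (\<integral>\<omega>. lo f (X 0 \<omega>) \<partial>M)" and "q = (\<integral>\<omega>. hi f (X 0 \<omega>) \<partial>M)"
    and "p' = (\<integral>\<omega>. lo g (X (int k) \<omega>) \<partial>M)" and "q' = (\<integral>\<omega>. hi g (X (int k) \<omega>) \<partial>M)"
  note pi = product_integrable(1)[OF lom[OF f] lom[OF g] sq(1)[OF f fH] sq(1)[OF g gH]]
    product_integrable(1)[OF lom[OF f] him[OF g] sq(1)[OF f fH] sq(2)[OF g gH]]
    product_integrable(1)[OF him[OF f] lom[OF g] sq(2)[OF f fH] sq(1)[OF g gH]]
    product_integrable(1)[OF him[OF f] him[OF g] sq(2)[OF f fH] sq(2)[OF g gH]]
  have "(\<integral>\<omega>. f (X 0 \<omega>) * g (X (int k) \<omega>) \<partial>M) = a + b + c + d"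
  proof -
    have "(\<integral>\<omega>. f (X 0 \<omega>) * g (X (int k) \<omega>) \<partial>M) = (\<integral>\<omega>. lo f (X 0 \<omega>) * lo g (X (int k) \<omega>) + lo f (X 0 \<omega>) * hi g (X (int k) \<omega>)
      + hi f (X 0 \<omega>) * lo g (X (int k) \<omega>) + hi f (X 0 \<omega>) * hi g (X (int k) \<omega>) \<partial>M)"
    proof (rule Bochner_Integration.integral_cong[OF refl])
      fix \<omega>
      show "f (X 0 \<omega>) * g (X (int k) \<omega>) = lo f (X 0 \<omega>) * lo g (X (int k) \<omega>) + lo f (X 0 \<omega>) * hi g (X (int k) \<omega>)
        + hi f (X 0 \<omega>) * lo g (X (int k) \<omega>) + hi f (X 0 \<omega>) * hi g (X (int k) \<omega>)"
        by (subst fs, subst gs) (simp add: algebra_simps)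
    qed
    also have "\<dots> = a + b + c + d" unfolding a_def b_def c_def d_def using pi by simp
    finally show ?thesis .
  qed
  moreover have "(\<integral>\<omega>. f (X 0 \<omega>) \<partial>M) = p + q"
    unfolding p_def q_def using in1[OF f fH, of 0] by (subst fs) simp
  moreover have "(\<integral>\<omega>. g (X (int k) \<omega>) \<partial>M) = p' + q'"
    unfolding p'_def q'_def using in1[OF g gH, of "int k"] by (subst gs) simp
  ultimately have "cross_cov k f g = (a - p * p') + (b - p * q') + (c - q * p') + (d - q * q')"
    unfolding cross_cov_def by (simp add: algebra_simps)
  moreover have "\<bar>a - p * p'\<bar> \<le> 4 * past_alpha k * T\<^sup>2"
    using cross_cov_bounded[OF lom[OF f] lom[OF g] loT loT, of k] unfolding cross_cov_def a_def p_def p'_def .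
  moreover have "\<bar>b\<bar> \<le> tail_square T" "\<bar>p * q'\<bar> \<le> tail_square T"
    using lh[OF f fH g gH, of 0 "int k"] unfolding b_def p_def q'_def by auto
  moreover have "\<bar>c\<bar> \<le> tail_square T" "\<bar>q * p'\<bar> \<le> tail_square T"
    using lh[OF g gH f fH, of "int k" 0] unfolding c_def q_def p'_def by (auto simp: mult.commute)
  moreover have "\<bar>d\<bar> \<le> tail_square T" "\<bar>q * q'\<bar> \<le> tail_square T"
    using hh1 hh2 unfolding d_def q_def q'_def by auto
  ultimately show ?thesis by linarith
qed

definition quantile_integral :: "nat \<Rightarrow> ennreal" where
  "quantile_integral k = (\<integral>\<^sup>+u\<in>{0..past_alpha k}. (upper_quantile M (\<lambda>\<omega>. H (X 0 \<omega>)) u)\<^sup>2 \<partial>lborel)"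

text \<open>With the quantile at \<open>\<alpha>\<close> as level, both
  \<open>\<alpha> * T\<^sup>2\<close> and the tail are bounded by the quantile integral, hence
  \<open>10 = 4 + 6\<close>. For \<open>\<alpha> = 0\<close> there may be no finite such level, and
  the truncation level tends to infinity instead.\<close>

lemma cross_cov_quantile_bound:
  assumes f: "f \<in> borel_measurable S" and g: "g \<in> borel_measurable S"
    and fH: "\<And>x. \<bar>f x\<bar> \<le> \<bar>H x\<bar>" and gH: "\<And>x. \<bar>g x\<bar> \<le> \<bar>H x\<bar>" and fin: "quantile_integral k < \<infinity>"
  shows "\<bar>cross_cov k f g\<bar> \<le> 10 * enn2real (quantile_integral k)"
proof (cases "past_alpha k = 0")
  case True
  have "\<bar>cross_cov k f g\<bar> \<le> 6 * tail_square (real n)" for n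
    using cross_cov_truncation_bound[OF f g fH gH, of "real n" k] True by simp
  moreover have "(\<lambda>n. 6 * tail_square (real n)) \<longlonglongrightarrow> 6 * 0" by (intro tendsto_intros tail_square_tendsto)
  ultimately have "\<bar>cross_cov k f g\<bar> \<le> 6 * 0" by (metis LIMSEQ_le_const)
  then show ?thesis by simp
next
  case False
  then have "past_alpha k > 0" using past_alpha_nonneg[of k] by simp
  then obtain T where T: "T \<ge> 0" "ennreal (past_alpha k * T\<^sup>2) \<le> quantile_integral k"
    "(\<integral>\<^sup>+\<omega>. ennreal (if T < \<bar>H (X 0 \<omega>)\<bar> then (H (X 0 \<omega>))\<^sup>2 else 0) \<partial>M) \<le> quantile_integral k"
    using quantile_level_exists[of "\<lambda>\<omega>. H (X 0 \<omega>)" "past_alpha k"] unfolding quantile_integral_def by auto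
  have r: "x \<le> enn2real (quantile_integral k)" if "ennreal x \<le> quantile_integral k" "0 \<le> x" for x
    using enn2real_mono[OF that(1)] fin that(2) by simp
  have "past_alpha k * T\<^sup>2 \<le> enn2real (quantile_integral k)"
    using T(2) past_alpha_nonneg by (intro r) auto
  moreover have "tail_square T \<le> enn2real (quantile_integral k)"
  proof (rule r)
    have "ennreal (tail_square T) = (\<integral>\<^sup>+\<omega>. ennreal (if T < \<bar>H (X 0 \<omega>)\<bar> then (H (X 0 \<omega>))\<^sup>2 else 0) \<partial>M)"
      unfolding tail_square_def by (rule nn_integral_eq_integral[symmetric, OF tail_square_integrable]) auto
    then show "ennreal (tail_square T) \<le> quantile_integral k" using T(3) by simp
    show "0 \<le> tail_square T" unfolding tail_square_def by (rule Bochner_Integration.integral_nonneg) auto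
  qed
  ultimately show ?thesis using cross_cov_truncation_bound[OF f g fH gH T(1), of k] by linarith
qed

lemma cov_eq_cross:
  assumes f [measurable]: "f \<in> borel_measurable S" and fH: "\<And>x. \<bar>f x\<bar> \<le> \<bar>H x\<bar>"
  shows "cov f k = cross_cov k f f"
proof -
  have f2: "integrable M (\<lambda>\<omega>. (f (X i \<omega>))\<^sup>2)" for i by (rule dominated_square_integrable[OF f fH])
  have i: "integrable M (\<lambda>\<omega>. f (X i \<omega>))" for i by (rule integrable_f[OF f f2])
  have p: "integrable M (\<lambda>\<omega>. f (X 0 \<omega>) * f (X (int k) \<omega>))" by (rule product_integrable(1)[OF f f f2 f2])
  have m: "(\<integral>\<omega>. f (X i \<omega>) \<partial>M) = mean f" for i using integral_X_eq[OF f, of i] by (simp add: mean_def)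
  have "cov f k = (\<integral>\<omega>. f (X 0 \<omega>) * f (X (int k) \<omega>) - mean f * f (X 0 \<omega>) - mean f * f (X (int k) \<omega>) + mean f * mean f \<partial>M)"
    unfolding cov_def centered_def by (intro Bochner_Integration.integral_cong refl) (simp add: algebra_simps)
  also have "\<dots> = (\<integral>\<omega>. f (X 0 \<omega>) * f (X (int k) \<omega>) \<partial>M) - mean f * mean f"
    using p i m by (simp add: prob_space)
  finally show ?thesis unfolding cross_cov_def m .
qed

text \<open>A majorant that depends on the envelope alone and is therefore common to all
  truncations. At lag 0 the truncation level is 0, and \<open>tail_square 0\<close> is the second
  moment of \<open>H (X 0)\<close>.\<close>

definition cov_bound :: "nat \<Rightarrow> real" where
  "cov_bound k = (if k = 0 then 6 * tail_square 0 else 10 * enn2real (quantile_integral k))"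

context
  assumes Q: "(\<Sum>k. quantile_integral (Suc k)) < \<infinity>"
begin

lemma quantile_integral_finite: "quantile_integral (Suc k) < \<infinity>"
proof -
  have "quantile_integral (Suc k) \<le> (\<Sum>k. quantile_integral (Suc k))"
    using sum_le_suminf[of "\<lambda>k. quantile_integral (Suc k)" "{k}"] by simp
  then show ?thesis using Q by (rule le_less_trans)
qed

lemma cov_bound_summable: "summable cov_bound"
proof -
  have "summable (\<lambda>k. enn2real (quantile_integral (Suc k)))"
  proof (rule summable_suminf_not_top)
    have "ennreal (enn2real (quantile_integral (Suc k))) = quantile_integral (Suc k)" for k using quantile_integral_finite[of k] by simp
    then show "(\<Sum>k. ennreal (enn2real (quantile_integral (Suc k)))) \<noteq> top" using Q by simp
  qed simp
  then have "summable (\<lambda>k. cov_bound (Suc k))" unfolding cov_bound_def by (simp add: summable_mult)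
  then show ?thesis by (simp only: summable_Suc_iff)
qed

lemma cov_le_bound:
  assumes f: "f \<in> borel_measurable S" and fH: "\<And>x. \<bar>f x\<bar> \<le> \<bar>H x\<bar>"
  shows "\<bar>cov f k\<bar> \<le> cov_bound k"
proof (cases k)
  case 0
  then show ?thesis using cross_cov_truncation_bound[OF f f fH fH, of 0 0] cov_eq_cross[OF f fH, of 0] by (simp add: cov_bound_def)
next
  case (Suc j)
  then show ?thesis using cross_cov_quantile_bound[OF f f fH fH quantile_integral_finite[of j]] cov_eq_cross[OF f fH, of k] by (simp add: cov_bound_def)
qed

lemma cov_tendsto:
  assumes F [measurable]: "\<And>n. F n \<in> borel_measurable S" and FH: "\<And>n x. \<bar>F n x\<bar> \<le> \<bar>H x\<bar>"
    and G [measurable]: "G \<in> borel_measurable S" and GH: "\<And>x. \<bar>G x\<bar> \<le> \<bar>H x\<bar>"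
    and lim: "\<And>x. (\<lambda>n. F n x) \<longlonglongrightarrow> G x"
  shows "(\<lambda>n. cov (F n) k) \<longlonglongrightarrow> cov G k"
proof -
  have Hi: "integrable M (\<lambda>\<omega>. \<bar>H (X i \<omega>)\<bar>)" for i
    using integrable_f[OF H H2] by simp
  have HH: "integrable M (\<lambda>\<omega>. \<bar>H (X 0 \<omega>) * H (X (int k) \<omega>)\<bar>)"
    using product_integrable(1)[OF H H] dominated_square_integrable[OF H] by simp
  have 1: "(\<lambda>n. \<integral>\<omega>. F n (X i \<omega>) \<partial>M) \<longlonglongrightarrow> (\<integral>\<omega>. G (X i \<omega>) \<partial>M)" for i
    by (rule integral_dominated_convergence[OF _ _ Hi[of i]]) (use FH lim in auto)
  have 2: "(\<lambda>n. \<integral>\<omega>. F n (X 0 \<omega>) * F n (X (int k) \<omega>) \<partial>M) \<longlonglongrightarrow> (\<integral>\<omega>. G (X 0 \<omega>) * G (X (int k) \<omega>) \<partial>M)"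
    by (rule integral_dominated_convergence[OF _ _ HH]) (use FH lim in \<open>auto simp: abs_mult intro!: tendsto_mult mult_mono\<close>)
  show ?thesis
    unfolding cov_eq_cross[OF F FH] cov_eq_cross[OF G GH] cross_cov_def
    by (intro tendsto_intros 1 2)
qed

text \<open>Both limits come from Tannery's theorem with \<open>cov_bound\<close> as majorant. The
  second one, applied to functions tending to 0, makes the variances of the discarded parts
  uniformly small.\<close>

lemma long_run_var_tendsto:
  assumes F: "\<And>n. F n \<in> borel_measurable S" and FH: "\<And>n x. \<bar>F n x\<bar> \<le> \<bar>H x\<bar>"
    and G: "G \<in> borel_measurable S" and GH: "\<And>x. \<bar>G x\<bar> \<le> \<bar>H x\<bar>"
    and lim: "\<And>x. (\<lambda>n. F n x) \<longlonglongrightarrow> G x"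
  shows "(\<lambda>n. long_run_var (F n)) \<longlonglongrightarrow> long_run_var G" and "(\<lambda>n. \<Sum>k. \<bar>cov (F n) k\<bar>) \<longlonglongrightarrow> (\<Sum>k. \<bar>cov G k\<bar>)"
proof -
  have F2: "integrable M (\<lambda>\<omega>. (F n (X 0 \<omega>))\<^sup>2)" for n by (rule dominated_square_integrable[OF F FH])
  have G2: "integrable M (\<lambda>\<omega>. (G (X 0 \<omega>))\<^sup>2)" by (rule dominated_square_integrable[OF G GH])
  have s: "summable (\<lambda>k. cov_bound (Suc k))" using cov_bound_summable by (simp only: summable_Suc_iff)
  have c: "(\<lambda>n. cov (F n) k) \<longlonglongrightarrow> cov G k" for k by (rule cov_tendsto[OF F FH G GH lim])
  have "(\<lambda>n. \<Sum>k. cov (F n) (Suc k)) \<longlonglongrightarrow> (\<Sum>k. cov G (Suc k))"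
    using tannerys_theorem[OF c always_eventually s sequentially_bot, of Suc] cov_le_bound[OF F FH] by auto
  then show "(\<lambda>n. long_run_var (F n)) \<longlonglongrightarrow> long_run_var G"
    unfolding long_run_var_def[OF F F2] long_run_var_def[OF G G2] by (intro tendsto_intros c)
  have "(\<lambda>n. \<bar>cov (F n) k\<bar>) \<longlonglongrightarrow> \<bar>cov G k\<bar>" for k by (intro tendsto_intros c)
  from tannerys_theorem[OF this always_eventually cov_bound_summable sequentially_bot] cov_le_bound[OF F FH]
  show "(\<lambda>n. \<Sum>k. \<bar>cov (F n) k\<bar>) \<longlonglongrightarrow> (\<Sum>k. \<bar>cov G k\<bar>)" by auto
qed

end

end

end

text \<open>As the coefficients decrease, \<beta>(k) times \<open>1 + ... + k\<close> is at most the
  partial sum of j \<beta>(j) up to k; so twice the full sum serves as \<open>C\<close>.\<close>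

lemma (in process) beta_mixing_le_inverse_square:
  assumes s: "summable (\<lambda>k. real (Suc k) * beta_mixing M S X (Suc k))"
  shows "\<exists>C. \<forall>k\<ge>1. beta_mixing M S X k \<le> C / (real k)\<^sup>2"
proof (intro exI allI impI)
  fix k :: nat assume k: "k \<ge> 1"
  define B where "B = (\<Sum>k. real (Suc k) * beta_mixing M S X (Suc k))"
  have gauss: "(\<Sum>j<k. real (Suc j)) \<ge> (real k)\<^sup>2 / 2"
    by (induction k) (auto simp: power2_eq_square algebra_simps add_divide_distrib)
  have "(real k)\<^sup>2 / 2 * beta_mixing M S X k \<le> (\<Sum>j<k. real (Suc j)) * beta_mixing M S X k"
    using gauss beta_mixing_nonneg by (rule mult_right_mono)
  also have "\<dots> = (\<Sum>j<k. real (Suc j) * beta_mixing M S X k)" by (rule sum_distrib_right)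
  also have "\<dots> \<le> (\<Sum>j<k. real (Suc j) * beta_mixing M S X (Suc j))"
    by (intro sum_mono mult_left_mono beta_mixing_antimono) auto
  also have "\<dots> \<le> B"
    unfolding B_def using beta_mixing_nonneg by (intro sum_le_suminf[OF s]) auto
  finally have "beta_mixing M S X k * (real k)\<^sup>2 \<le> 2 * B" by (simp add: mult.commute)
  moreover have "(real k)\<^sup>2 > 0" using k by simp
  ultimately show "beta_mixing M S X k \<le> 2 * (\<Sum>k. real (Suc k) * beta_mixing M S X (Suc k)) / (real k)\<^sup>2"
    unfolding B_def[symmetric] by (subst pos_le_divide_eq) auto
qed

section \<open>Square integrable functions by approximation\<close>

context stationary_process
begin

text \<open>The bound is uniform in \<open>n\<close>: the variance of a sum grows at most linearly,
  which the scaling cancels. This uniformity permits the limits in \<open>n\<close> and in the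
  truncation level to be exchanged.\<close>

lemma phi_diff_le:
  assumes f [measurable]: "f \<in> borel_measurable S" and f2: "integrable M (\<lambda>\<omega>. (f (X 0 \<omega>))\<^sup>2)"
    and g [measurable]: "g \<in> borel_measurable S" and g2: "integrable M (\<lambda>\<omega>. (g (X 0 \<omega>))\<^sup>2)"
    and d2: "integrable M (\<lambda>\<omega>. (f (X 0 \<omega>) - g (X 0 \<omega>))\<^sup>2)"
    and s: "summable (\<lambda>k. \<bar>cov (\<lambda>x. f x - g x) k\<bar>)" and n: "n \<ge> 1"
  shows "cmod (phi f n (t / sqrt (real n)) - phi g n (t / sqrt (real n))) \<le>
    \<bar>t\<bar> * sqrt (2 * (\<Sum>k. \<bar>cov (\<lambda>x. f x - g x) k\<bar>))"
proof -
  define d where "d x = f x - g x" for x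
  define c where "c = t / sqrt (real n)"
  have d [measurable]: "d \<in> borel_measurable S" unfolding d_def[abs_def] by measurable
  have d2': "integrable M (\<lambda>\<omega>. (d (X 0 \<omega>))\<^sup>2)" using d2 by (simp add: d_def)
  have s': "summable (\<lambda>k. \<bar>cov d k\<bar>)" using s by (simp add: d_def[abs_def])
  have m: "mean d = mean f - mean g"
    unfolding mean_def d_def using integrable_f[OF f f2] integrable_f[OF g g2] by simp
  have diff: "c * (\<Sum>i\<in>A. centered f i \<omega>) - c * (\<Sum>i\<in>A. centered g i \<omega>) = c * (\<Sum>i\<in>A. centered d i \<omega>)" for A \<omega>
    unfolding right_diff_distrib[symmetric] sum_subtractf[symmetric]
    by (simp add: centered_def m d_def algebra_simps)
  have i: "integrable M (\<lambda>\<omega>. c * (\<Sum>i\<in>{1..int n}. centered d i \<omega>))"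
    by (intro integrable_mult_right Bochner_Integration.integrable_sum centered_integrable[OF d d2'])
  have "cmod (phi f n c - phi g n c) \<le> (\<integral>\<omega>. \<bar>c * (\<Sum>i\<in>{1..int n}. centered f i \<omega>) - c * (\<Sum>i\<in>{1..int n}. centered g i \<omega>)\<bar> \<partial>M)"
    unfolding phi_def
  proof (rule iexp_integral_diff_le)
    show "integrable M (\<lambda>\<omega>. c * (\<Sum>i\<in>{1..int n}. centered f i \<omega>) - c * (\<Sum>i\<in>{1..int n}. centered g i \<omega>))"
      unfolding diff by (rule i)
  qed measurable
  also have "\<dots> = \<bar>c\<bar> * (\<integral>\<omega>. \<bar>\<Sum>i\<in>{1..int n}. centered d i \<omega>\<bar> \<partial>M)"
    unfolding diff by (simp add: abs_mult)
  also have "\<dots> \<le> \<bar>c\<bar> * sqrt (real n * (2 * (\<Sum>k. \<bar>cov d k\<bar>)))"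
  proof (rule mult_left_mono)
    have "(\<integral>\<omega>. \<bar>\<Sum>i\<in>{1..int n}. centered d i \<omega>\<bar> \<partial>M) \<le> sqrt (\<integral>\<omega>. (\<Sum>i\<in>{1..int n}. centered d i \<omega>)\<^sup>2 \<partial>M)"
      using sum_centered_square_integrable[OF d d2'] by (intro expectation_abs_le_sqrt) auto
    also have "\<dots> \<le> sqrt (real n * (2 * (\<Sum>k. \<bar>cov d k\<bar>)))"
      using integral_sum_centered_square_le[OF d d2' _ s', of "{1..int n}"] by simp
    finally show "(\<integral>\<omega>. \<bar>\<Sum>i\<in>{1..int n}. centered d i \<omega>\<bar> \<partial>M) \<le> sqrt (real n * (2 * (\<Sum>k. \<bar>cov d k\<bar>)))" .
  qed simp
  also have "\<dots> = \<bar>t\<bar> * sqrt (2 * (\<Sum>k. \<bar>cov d k\<bar>))"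
    using n by (simp add: c_def real_sqrt_mult abs_divide)
  finally show ?thesis unfolding c_def d_def[abs_def] .
qed

theorem stationary_clt:
  assumes H [measurable]: "H \<in> borel_measurable S" and H2: "integrable M (\<lambda>\<omega>. (H (X 0 \<omega>))\<^sup>2)"
    and Q: "(\<Sum>k. quantile_integral H (Suc k)) < \<infinity>"
    and C: "\<And>k. k \<ge> 1 \<Longrightarrow> beta_mixing M S X k \<le> C / (real k)\<^sup>2"
  shows "(\<lambda>n. phi H n (t / sqrt (real n))) \<longlonglongrightarrow> exp (- (t\<^sup>2 / 2 * long_run_var H))"
proof -
  define F where "F N x = (if \<bar>H x\<bar> \<le> real N then H x else 0)" for N :: nat and x
  define D where "D N x = H x - F N x" for N x
  have F [measurable]: "F N \<in> borel_measurable S" for N unfolding F_def[abs_def] by measurable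
  have D [measurable]: "D N \<in> borel_measurable S" for N unfolding D_def[abs_def] by measurable
  have FH: "\<bar>F N x\<bar> \<le> \<bar>H x\<bar>" and DH: "\<bar>D N x\<bar> \<le> \<bar>H x\<bar>" and FN: "\<bar>F N x\<bar> \<le> real N" for N x
    by (auto simp: F_def D_def)
  have F_lim: "(\<lambda>N. F N x) \<longlonglongrightarrow> H x" for x
  proof (rule tendsto_eventually)
    obtain N where "\<bar>H x\<bar> \<le> real N" using real_arch_simple by blast
    then have "F n x = H x" if "N \<le> n" for n using that by (auto simp: F_def)
    then show "\<forall>\<^sub>F n in sequentially. F n x = H x" using eventually_ge_at_top[of N] by (rule eventually_mono[rotated])
  qed
  have D_lim: "(\<lambda>N. D N x) \<longlonglongrightarrow> 0" for x
    unfolding D_def using tendsto_diff[OF tendsto_const F_lim, of "H x" x] by simp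
  have zero: "(\<lambda>_. 0) \<in> borel_measurable S" "\<And>x. \<bar>0::real\<bar> \<le> \<bar>H x\<bar>" by auto
  note sq = dominated_square_integrable[OF H H2]
  note cb = cov_bound_summable[OF H H2 Q]
  have sF: "summable (\<lambda>k. \<bar>cov (F N) k\<bar>)" and sD: "summable (\<lambda>k. \<bar>cov (D N) k\<bar>)" for N
    by (rule summable_comparison_test'[OF cb, of 0], use cov_le_bound[OF H H2 Q F FH] cov_le_bound[OF H H2 Q D DH] in simp)+
  define d where "d N = \<bar>t\<bar> * sqrt (2 * (\<Sum>k. \<bar>cov (D N) k\<bar>))" for N
  \<comment> \<open>The discarded parts are dominated by \<open>H\<close> and tend to 0 pointwise,
    so the limit is the sum belonging to the zero function.\<close>
  have "(\<lambda>N. \<Sum>k. \<bar>cov (D N) k\<bar>) \<longlonglongrightarrow> (\<Sum>k. \<bar>cov (\<lambda>_. 0) k\<bar>)"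
    by (rule long_run_var_tendsto(2)[OF H H2 Q D DH zero D_lim])
  then have "(\<lambda>N. \<Sum>k. \<bar>cov (D N) k\<bar>) \<longlonglongrightarrow> 0"
    by (simp add: cov_def centered_def mean_def)
  then have "d \<longlonglongrightarrow> \<bar>t\<bar> * sqrt (2 * 0)" unfolding d_def by (intro tendsto_intros)
  then have d0: "d \<longlonglongrightarrow> 0" by simp
  define G where "G N = complex_of_real (exp (- (t\<^sup>2 / 2 * long_run_var (F N))))" for N
  define L where "L = complex_of_real (exp (- (t\<^sup>2 / 2 * long_run_var H)))"
  have G: "G \<longlonglongrightarrow> L"
    unfolding G_def L_def by (intro tendsto_intros long_run_var_tendsto(1)[OF H H2 Q F FH H _ F_lim]) auto
  have "(\<lambda>n. phi H n (t / sqrt (real n))) \<longlonglongrightarrow> L"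
  proof (rule LIMSEQ_I)
    fix e :: real assume e: "e > 0"
    have "\<forall>\<^sub>F N in sequentially. d N < e / 3" using order_tendstoD(2)[OF d0, of "e / 3"] e by simp
    moreover have "\<forall>\<^sub>F N in sequentially. cmod (G N - L) < e / 3" using tendstoD[OF G, of "e / 3"] e by (simp add: dist_norm)
    ultimately have "\<forall>\<^sub>F N in sequentially. d N < e / 3 \<and> cmod (G N - L) < e / 3" by (rule eventually_conj)
    then obtain N where N: "d N < e / 3" "cmod (G N - L) < e / 3"
      using eventually_happens sequentially_bot by blast
    have FG: "(\<lambda>n. phi (F N) n (t / sqrt (real n))) \<longlonglongrightarrow> G N"
      using bounded_clt[where b="\<lambda>k. \<bar>cov (F N) k\<bar>" and t=t, OF F FN order_refl sF C] unfolding G_def by simp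
    obtain n0 where n0: "\<And>n. n \<ge> n0 \<Longrightarrow> cmod (phi (F N) n (t / sqrt (real n)) - G N) < e / 3"
      using LIMSEQ_D[OF FG, of "e / 3"] e by auto
    show "\<exists>no. \<forall>n\<ge>no. cmod (phi H n (t / sqrt (real n)) - L) < e"
    proof (intro exI allI impI)
      fix n assume n: "n \<ge> max n0 1"
      define a b where "a = phi H n (t / sqrt (real n))" and "b = phi (F N) n (t / sqrt (real n))"
      have "cmod (a - b) \<le> d N"
        unfolding a_def b_def d_def D_def[abs_def]
      proof (rule phi_diff_le[OF H H2 F sq[OF F FH]])
        show "integrable M (\<lambda>\<omega>. (H (X 0 \<omega>) - F N (X 0 \<omega>))\<^sup>2)" using sq[OF D DH, of N 0] by (simp add: D_def)
        show "summable (\<lambda>k. \<bar>cov (\<lambda>x. H x - F N x) k\<bar>)" using sD[of N] by (simp add: D_def[abs_def])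
      qed (use n in simp)
      moreover have "cmod (b - G N) < e / 3" using n0[of n] n by (simp add: b_def)
      moreover have "cmod (a - L) \<le> cmod (a - b) + cmod (b - G N) + cmod (G N - L)"
        using norm_triangle_ineq[of "a - b" "b - L"] norm_triangle_ineq[of "b - G N" "G N - L"] by simp
      ultimately show "cmod (phi H n (t / sqrt (real n)) - L) < e" using N unfolding a_def by linarith
    qed
  qed
  then show ?thesis unfolding L_def by simp
qed

text \<open>The covariance at lag \<open>i\<close> depends on \<open>\<bar>i\<bar>\<close> only.
  Splitting the integers into \<open>i \<ge> 0\<close> and \<open>i < 0\<close> gives two series, of
  which the first contains lag 0.\<close>

lemma covariance_has_sum:
  assumes f: "f \<in> borel_measurable S" and f2: "integrable M (\<lambda>\<omega>. (f (X 0 \<omega>))\<^sup>2)"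
    and s: "summable (\<lambda>k. \<bar>cov f k\<bar>)"
  shows "((\<lambda>i. covariance M (\<lambda>\<omega>. f (X 0 \<omega>)) (\<lambda>\<omega>. f (X i \<omega>))) has_sum long_run_var f) UNIV"
proof -
  define g where "g i = cov f (nat \<bar>i\<bar>)" for i :: int
  have eq: "covariance M (\<lambda>\<omega>. f (X 0 \<omega>)) (\<lambda>\<omega>. f (X i \<omega>)) = g i" for i
    using integral_centered_product[OF f f2, of 0 i] integral_X_eq[OF f, of i]
    unfolding covariance_def centered_def mean_def g_def by simp
  have s1: "summable (\<lambda>k. \<bar>cov f (Suc k)\<bar>)" using s by (subst summable_Suc_iff)
  have c: "summable (cov f)" using s by (rule summable_rabs_cancel)
  then have c1: "summable (\<lambda>k. cov f (Suc k))" by (subst summable_Suc_iff)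
  have "((g \<circ> int) has_sum (\<Sum>k. cov f k)) UNIV"
    by (rule norm_summable_imp_has_sum) (use s c in \<open>simp_all add: g_def o_def summable_sums\<close>)
  then have 1: "(g has_sum (\<Sum>k. cov f k)) (range int)"
    by (subst has_sum_reindex) auto
  have n: "nat \<bar>- int (Suc k)\<bar> = Suc k" for k by simp
  have "((g \<circ> (\<lambda>k. - int (Suc k))) has_sum (\<Sum>k. cov f (Suc k))) UNIV"
    unfolding g_def o_def n by (rule norm_summable_imp_has_sum) (use s1 c1 in \<open>simp_all add: summable_sums\<close>)
  then have 2: "(g has_sum (\<Sum>k. cov f (Suc k))) (range (\<lambda>k. - int (Suc k)))"
    by (subst has_sum_reindex) (auto simp: inj_on_def)
  have U: "range int \<union> range (\<lambda>k. - int (Suc k)) = UNIV"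
  proof (intro set_eqI iffI UNIV_I)
    fix i :: int
    show "i \<in> range int \<union> range (\<lambda>k. - int (Suc k))"
    proof (cases "i \<ge> 0")
      case True
      then have "i = int (nat i)" by simp
      then show ?thesis by blast
    next
      case False
      then have "i = - int (Suc (nat (- i - 1)))" by simp
      then show ?thesis by blast
    qed
  qed
  have "range int \<inter> range (\<lambda>k. - int (Suc k)) = {}" by auto
  from has_sum_Un_disjoint[OF 1 2 this] have "(g has_sum (\<Sum>k. cov f k) + (\<Sum>k. cov f (Suc k))) UNIV"
    unfolding U .
  moreover have "(\<Sum>k. cov f k) + (\<Sum>k. cov f (Suc k)) = long_run_var f"
    unfolding long_run_var_def[OF f f2] using suminf_split_head[OF c] by simp
  ultimately show ?thesis unfolding eq by simp
qed

end

text \<open>Finiteness is established for non-negative integrals before passing to real ones: a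
  Bochner integral is 0 for a non-integrable function, so a bound on it would say nothing.\<close>

lemma (in prob_space) uniformly_integrable_bounds:
  fixes Y :: "'i \<Rightarrow> 'a \<Rightarrow> real"
  assumes UI: "uniformly_integrable M I Y" and Y0: "\<And>i \<omega>. i \<in> I \<Longrightarrow> 0 \<le> Y i \<omega>"
  shows "\<exists>B \<delta>. (\<forall>i\<in>I. integrable M (Y i) \<and> (\<integral>\<omega>. Y i \<omega> \<partial>M) \<le> B) \<and>
    (\<forall>i\<in>I. \<forall>n. (\<integral>\<omega>. (if real n < Y i \<omega> then Y i \<omega> else 0) \<partial>M) \<le> \<delta> n) \<and> \<delta> \<longlonglongrightarrow> 0"
proof -
  have Ym [measurable]: "Y i \<in> borel_measurable M" if "i \<in> I" for i
    using UI that by (auto simp: uniformly_integrable_def)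
  define T where "T R = (SUP i\<in>I. \<integral>\<^sup>+\<omega>\<in>{\<omega>. \<bar>Y i \<omega>\<bar> > R}. ennreal \<bar>Y i \<omega>\<bar> \<partial>M)" for R
  have T0: "(T \<longlongrightarrow> 0) at_top" using UI unfolding uniformly_integrable_def T_def by simp
  have T_le: "(\<integral>\<^sup>+\<omega>. ennreal (if R < Y i \<omega> then Y i \<omega> else 0) \<partial>M) \<le> T R" if "i \<in> I" for i R
  proof -
    have "(\<integral>\<^sup>+\<omega>. ennreal (if R < Y i \<omega> then Y i \<omega> else 0) \<partial>M) = (\<integral>\<^sup>+\<omega>\<in>{\<omega>. \<bar>Y i \<omega>\<bar> > R}. ennreal \<bar>Y i \<omega>\<bar> \<partial>M)"
      using Y0[OF that] by (intro nn_integral_cong) (auto simp: indicator_def)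
    also have "\<dots> \<le> T R" unfolding T_def using that by (rule SUP_upper)
    finally show ?thesis .
  qed
  have "\<forall>\<^sub>F R in at_top. T R < 1" using order_tendstoD(2)[OF T0, of 1] by simp
  then have "\<forall>\<^sub>F R in at_top. T R < 1 \<and> 0 \<le> R" using eventually_ge_at_top[of 0] by eventually_elim simp
  \<comment> \<open>Any level with tail below 1 will do: values up to \<open>R\<close> contribute at
    most \<open>R\<close> and larger ones at most 1, whence the bound \<open>R + 1\<close>.\<close>
  then obtain R where R: "T R < 1" "0 \<le> R" using eventually_happens trivial_limit_at_top_linorder by blast
  have nn_le: "(\<integral>\<^sup>+\<omega>. ennreal (Y i \<omega>) \<partial>M) \<le> ennreal (R + 1)" if i: "i \<in> I" for i
  proof -
    have "(\<integral>\<^sup>+\<omega>. ennreal (Y i \<omega>) \<partial>M) \<le> (\<integral>\<^sup>+\<omega>. ennreal R + ennreal (if R < Y i \<omega> then Y i \<omega> else 0) \<partial>M)"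
      using R(2) by (intro nn_integral_mono) (auto simp flip: ennreal_plus intro!: ennreal_leI)
    also have "\<dots> = ennreal R + (\<integral>\<^sup>+\<omega>. ennreal (if R < Y i \<omega> then Y i \<omega> else 0) \<partial>M)"
      using i by (subst nn_integral_add) (auto simp: emeasure_space_1)
    also have "\<dots> \<le> ennreal R + 1" using T_le[OF i, of R] R(1) by (intro add_left_mono) auto
    finally show ?thesis using R(2) by (simp add: ennreal_plus)
  qed
  have Yi: "integrable M (Y i)" if i: "i \<in> I" for i
    using nn_le[OF i] Y0[OF i] i by (intro integrableI_nonneg) (auto simp: less_top[symmetric] top_unique)
  have YB: "(\<integral>\<omega>. Y i \<omega> \<partial>M) \<le> R + 1" if i: "i \<in> I" for i
  proof -
    have "(\<integral>\<^sup>+\<omega>. ennreal (Y i \<omega>) \<partial>M) = ennreal (\<integral>\<omega>. Y i \<omega> \<partial>M)"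
      using Y0[OF i] by (intro nn_integral_eq_integral Yi i) auto
    then have "ennreal (\<integral>\<omega>. Y i \<omega> \<partial>M) \<le> ennreal (R + 1)" using nn_le[OF i] by simp
    then show ?thesis using R(2) by (subst (asm) ennreal_le_iff) auto
  qed
  have fin: "T (real n) < \<infinity>" for n
  proof -
    have "T (real n) \<le> ennreal (R + 1)"
      unfolding T_def
    proof (rule SUP_least)
      fix i assume i: "i \<in> I"
      have "(\<integral>\<^sup>+\<omega>\<in>{\<omega>. \<bar>Y i \<omega>\<bar> > real n}. ennreal \<bar>Y i \<omega>\<bar> \<partial>M) \<le> (\<integral>\<^sup>+\<omega>. ennreal (Y i \<omega>) \<partial>M)"
        using Y0[OF i] by (intro nn_integral_mono) (auto simp: indicator_def)
      also have "\<dots> \<le> ennreal (R + 1)" by (rule nn_le[OF i])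
      finally show "(\<integral>\<^sup>+\<omega>\<in>{\<omega>. \<bar>Y i \<omega>\<bar> > real n}. ennreal \<bar>Y i \<omega>\<bar> \<partial>M) \<le> ennreal (R + 1)" .
    qed
    then show ?thesis by (rule le_less_trans) simp
  qed
  define \<delta> where "\<delta> n = enn2real (T (real n))" for n :: nat
  have "(\<lambda>n. T (real n)) \<longlonglongrightarrow> ennreal 0"
    using filterlim_compose[OF T0 filterlim_real_sequentially] by simp
  then have \<delta>0: "\<delta> \<longlonglongrightarrow> 0" unfolding \<delta>_def by (rule tendsto_enn2real) simp
  have Y\<delta>: "(\<integral>\<omega>. (if real n < Y i \<omega> then Y i \<omega> else 0) \<partial>M) \<le> \<delta> n" if i: "i \<in> I" for i n
  proof -
    have "(\<integral>\<omega>. (if real n < Y i \<omega> then Y i \<omega> else 0) \<partial>M) = enn2real (\<integral>\<^sup>+\<omega>. ennreal (if real n < Y i \<omega> then Y i \<omega> else 0) \<partial>M)"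
      using i Y0[OF i] by (intro integral_eq_nn_integral) auto
    also have "\<dots> \<le> \<delta> n" unfolding \<delta>_def using T_le[OF i] fin by (intro enn2real_mono) auto
    finally show ?thesis .
  qed
  show ?thesis using Yi YB Y\<delta> \<delta>0 by blast
qed

lemma (in prob_space) char_distr_eq:
  assumes [measurable]: "V \<in> borel_measurable M"
  shows "char (distr M borel V) t = (\<integral>\<omega>. iexp (t * V \<omega>) \<partial>M)"
  unfolding char_def by (subst integral_distr) auto

section \<open>Conclusion\<close>

context ustat_kernel
begin

lemma V_stat_char_tendsto:
  assumes L: "(\<lambda>n. \<integral>\<omega>. iexp (t * L_stat n \<omega>) \<partial>M) \<longlonglongrightarrow> l"
  shows "(\<lambda>n. \<integral>\<omega>. iexp (t * V_stat n \<omega>) \<partial>M) \<longlonglongrightarrow> l"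
proof -
  define d where "d n = (\<integral>\<omega>. iexp (t * V_stat n \<omega>) \<partial>M) - (\<integral>\<omega>. iexp (t * L_stat n \<omega>) \<partial>M)" for n
  have "d \<longlonglongrightarrow> 0"
  proof (rule Lim_null_comparison)
    show "(\<lambda>n. \<bar>t\<bar> * (\<integral>\<omega>. \<bar>V_stat n \<omega> - L_stat n \<omega>\<bar> \<partial>M)) \<longlonglongrightarrow> 0"
      using tendsto_mult_left[OF V_stat_L_stat_tendsto, of "\<bar>t\<bar>"] by simp
    show "\<forall>\<^sub>F n in sequentially. norm (d n) \<le> \<bar>t\<bar> * (\<integral>\<omega>. \<bar>V_stat n \<omega> - L_stat n \<omega>\<bar> \<partial>M)"
      using eventually_ge_at_top[of m]
    proof eventually_elim
      case (elim n)
      have "integrable M (\<lambda>\<omega>. \<Sum>i\<in>Inc_upto m n. remainder (tup i \<omega>))"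
        using remainder_tuple_integrable Inc_upto_Inc[OF _ elim] by (intro Bochner_Integration.integrable_sum) auto
      then have i: "integrable M (\<lambda>\<omega>. t * (V_stat n \<omega> - L_stat n \<omega>))"
        unfolding V_stat_minus_L_stat[OF elim]
        by (intro integrable_mult_right Bochner_Integration.integrable_diff integrable_const)
      have "cmod (d n) \<le> (\<integral>\<omega>. \<bar>t * V_stat n \<omega> - t * L_stat n \<omega>\<bar> \<partial>M)"
        unfolding d_def
      proof (rule iexp_integral_diff_le)
        show "integrable M (\<lambda>\<omega>. t * V_stat n \<omega> - t * L_stat n \<omega>)"
          using i by (simp only: right_diff_distrib)
      qed measurable
      also have "\<dots> = \<bar>t\<bar> * (\<integral>\<omega>. \<bar>V_stat n \<omega> - L_stat n \<omega>\<bar> \<partial>M)"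
        unfolding right_diff_distrib[symmetric] abs_mult by simp
      finally show ?case .
    qed
  qed
  from tendsto_add[OF this L] show ?thesis by (simp add: d_def)
qed

end

text \<open>The vector is the argument of \<open>h\<close> in \<open>H_var\<close> for
  \<open>k = 1\<close>. Its law is the product law, so bounds for this member of the uniformly
  integrable family become bounds for integrals over independent arguments.\<close>

lemma (in prob_space) law_of_decoupled_vector:
  fixes X :: "int \<Rightarrow> 'a \<Rightarrow> 's" and Xs :: "nat \<Rightarrow> 'a \<Rightarrow> 's"
  assumes m: "m \<ge> 2"
    and X_meas [measurable]: "\<And>i. X i \<in> measurable M S" and law: "distr M S (X i) = \<mu>"
    and Xs_iid: "indep_vars (\<lambda>_. S) Xs {1..m-1}"
    and Xs_law: "\<And>j. j \<in> {1..m-1} \<Longrightarrow> distr M S (Xs j) = \<mu>"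
    and Xs_indep: "indep_set
          {(\<lambda>\<omega>. \<lambda>j\<in>{1..m-1}. Xs j \<omega>) -` A \<inter> space M |A. A \<in> sets (\<Pi>\<^sub>M j\<in>{1..m-1}. S)}
          {(\<lambda>\<omega> i. X i \<omega>) -` B \<inter> space M |B. B \<in> sets (\<Pi>\<^sub>M i\<in>(UNIV :: int set). S)}"
  shows "(\<lambda>\<omega>. \<lambda>j\<in>{1..m}. if j \<le> 1 then X i \<omega> else Xs (j - 1) \<omega>) \<in> measurable M (\<Pi>\<^sub>M j\<in>{1..m}. S)"
    and "distr M (\<Pi>\<^sub>M j\<in>{1..m}. S) (\<lambda>\<omega>. \<lambda>j\<in>{1..m}. if j \<le> 1 then X i \<omega> else Xs (j - 1) \<omega>) = (\<Pi>\<^sub>M j\<in>{1..m}. \<mu>)"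
proof -
  have Xs_meas: "Xs j \<in> measurable M S" if "j \<in> {1..m-1}" for j
    using Xs_iid that by (auto simp: indep_vars_def)
  have sets_\<mu>: "sets \<mu> = sets S" and "prob_space \<mu>"
    using law[symmetric] by (auto intro: prob_space_distr)
  interpret \<mu>: prob_space \<mu> by fact
  interpret P: product_sigma_finite "\<lambda>_::nat. \<mu>" by unfold_locales
  define Z where "Z \<omega> = (\<lambda>j\<in>{1..m}. if j \<le> 1 then X i \<omega> else Xs (j - 1) \<omega>)" for \<omega>
  have Z: "Z \<in> measurable M (\<Pi>\<^sub>M j\<in>{1..m}. S)"
    unfolding Z_def
  proof (rule measurable_restrict)
    fix j assume j: "j \<in> {1..m}"
    show "(\<lambda>\<omega>. if j \<le> 1 then X i \<omega> else Xs (j - 1) \<omega>) \<in> measurable M S"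
    proof (cases "j \<le> 1")
      case False
      then have "j - 1 \<in> {1..m-1}" using j by auto
      from Xs_meas[OF this] False show ?thesis by simp
    qed simp
  qed
  then show "(\<lambda>\<omega>. \<lambda>j\<in>{1..m}. if j \<le> 1 then X i \<omega> else Xs (j - 1) \<omega>) \<in> measurable M (\<Pi>\<^sub>M j\<in>{1..m}. S)"
    unfolding Z_def .
  have prob_law: "prob (V -` A \<inter> space M) = measure \<mu> A" if "V \<in> measurable M S" "distr M S V = \<mu>" "A \<in> sets S" for V A
    using that by (metis measure_distr)
  have "distr M (\<Pi>\<^sub>M j\<in>{1..m}. S) Z = (\<Pi>\<^sub>M j\<in>{1..m}. \<mu>)"
  proof (rule P.PiM_eqI)
    show "sets (distr M (\<Pi>\<^sub>M j\<in>{1..m}. S) Z) = sets (\<Pi>\<^sub>M j\<in>{1..m}. \<mu>)"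
      using sets_\<mu> by (simp cong: sets_PiM_cong)
    fix A assume "\<And>j. j \<in> {1..m} \<Longrightarrow> A j \<in> sets \<mu>"
    then have A: "A j \<in> sets S" if "j \<in> {1..m}" for j using that sets_\<mu> by simp
    define E where "E = (\<lambda>\<omega>. \<lambda>j\<in>{1..m-1}. Xs j \<omega>) -` (\<Pi>\<^sub>E j\<in>{1..m-1}. A (Suc j)) \<inter> space M"
    \<comment> \<open>The event on \<open>X i\<close> is written as an event of the whole path, the
      form in which independence is assumed.\<close>
    define F where "F = (\<lambda>\<omega> i. X i \<omega>) -` {z \<in> space (\<Pi>\<^sub>M i\<in>(UNIV :: int set). S). z i \<in> A 1} \<inter> space M"
    have m1: "{1..m-1} \<noteq> {}" "1 \<in> {1..m}" using m by auto
    have XS: "X i \<omega> \<in> space S" if "\<omega> \<in> space M" for i \<omega> using measurable_space[OF X_meas that] .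
    have F_eq: "F = X i -` A 1 \<inter> space M"
      unfolding F_def using XS by (auto simp: space_PiM PiE_def)
    have E_eq: "E = (\<Inter>j\<in>{1..m-1}. Xs j -` A (Suc j) \<inter> space M)"
      unfolding E_def using m1(1) by (auto simp: PiE_iff)
    have "(\<Pi>\<^sub>E j\<in>{1..m-1}. A (Suc j)) \<in> sets (\<Pi>\<^sub>M j\<in>{1..m-1}. S)"
      using A by (intro sets_PiM_I_finite) auto
    moreover have "{z \<in> space (\<Pi>\<^sub>M i\<in>(UNIV :: int set). S). z i \<in> A 1} \<in> sets (\<Pi>\<^sub>M i\<in>(UNIV :: int set). S)"
      using A[OF m1(2)] by measurable
    ultimately have "prob (E \<inter> F) = prob E * prob F"
      unfolding E_def F_def by (intro indep_setD[OF Xs_indep]) blast+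
    also have "prob F = measure \<mu> (A 1)" unfolding F_eq using A[OF m1(2)] by (intro prob_law law X_meas)
    also have "prob E = (\<Prod>j\<in>{1..m-1}. prob (Xs j -` A (Suc j) \<inter> space M))"
      unfolding E_eq using m1(1) A by (intro indep_varsD[OF Xs_iid]) auto
    also have "\<dots> = (\<Prod>j\<in>{1..m-1}. measure \<mu> (A (Suc j)))"
      using A by (intro prod.cong refl prob_law Xs_meas Xs_law) auto
    also have "\<dots> * measure \<mu> (A 1) = (\<Prod>j\<in>{1..m}. measure \<mu> (A j))"
    proof -
      have "(\<Prod>j\<in>{1..m}. measure \<mu> (A j)) = measure \<mu> (A 1) * (\<Prod>j\<in>{Suc 1..Suc (m-1)}. measure \<mu> (A j))"
        using m by (subst prod.atLeast_Suc_atMost) auto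
      also have "(\<Prod>j\<in>{Suc 1..Suc (m-1)}. measure \<mu> (A j)) = (\<Prod>j\<in>{1..m-1}. measure \<mu> (A (Suc j)))"
        by (rule prod.shift_bounds_cl_Suc_ivl)
      finally show ?thesis by (simp add: mult.commute)
    qed
    also have "E \<inter> F = Z -` (\<Pi>\<^sub>E j\<in>{1..m}. A j) \<inter> space M"
    proof (intro set_eqI iffI)
      fix \<omega> assume w: "\<omega> \<in> E \<inter> F"
      have "(if j \<le> 1 then X i \<omega> else Xs (j - 1) \<omega>) \<in> A j" if j: "j \<in> {1..m}" for j
      proof (cases "j \<le> 1")
        case True
        then have "j = 1" using j by simp
        then show ?thesis using w by (simp add: F_eq)
      next
        case False
        then have "j - 1 \<in> {1..m-1}" "Suc (j - 1) = j" using j by auto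
        then have "Xs (j - 1) \<omega> \<in> A j" using w unfolding E_eq by force
        then show ?thesis using False by simp
      qed
      then show "\<omega> \<in> Z -` (\<Pi>\<^sub>E j\<in>{1..m}. A j) \<inter> space M" using w by (auto simp: Z_def F_def)
    next
      fix \<omega> assume w: "\<omega> \<in> Z -` (\<Pi>\<^sub>E j\<in>{1..m}. A j) \<inter> space M"
      then have Zj: "Z \<omega> j \<in> A j" if "j \<in> {1..m}" for j using that by (auto simp: PiE_iff)
      have "X i \<omega> \<in> A 1" using Zj[OF m1(2)] m by (simp add: Z_def)
      moreover have "Xs j \<omega> \<in> A (Suc j)" if "j \<in> {1..m-1}" for j
        using Zj[of "Suc j"] that by (auto simp: Z_def)
      ultimately show "\<omega> \<in> E \<inter> F" using w m1(1) unfolding E_eq F_eq by auto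
    qed
    finally have "prob (Z -` (\<Pi>\<^sub>E j\<in>{1..m}. A j) \<inter> space M) = (\<Prod>j\<in>{1..m}. measure \<mu> (A j))" .
    moreover have "emeasure (distr M (\<Pi>\<^sub>M j\<in>{1..m}. S) Z) (\<Pi>\<^sub>E j\<in>{1..m}. A j) = emeasure M (Z -` (\<Pi>\<^sub>E j\<in>{1..m}. A j) \<inter> space M)"
      using A by (intro emeasure_distr Z sets_PiM_I_finite) auto
    ultimately show "emeasure (distr M (\<Pi>\<^sub>M j\<in>{1..m}. S) Z) (\<Pi>\<^sub>E j\<in>{1..m}. A j) = (\<Prod>j\<in>{1..m}. emeasure \<mu> (A j))"
      by (simp add: emeasure_eq_measure \<mu>.emeasure_eq_measure prod_ennreal)
  qed simp
  then show "distr M (\<Pi>\<^sub>M j\<in>{1..m}. S) (\<lambda>\<omega>. \<lambda>j\<in>{1..m}. if j \<le> 1 then X i \<omega> else Xs (j - 1) \<omega>) = (\<Pi>\<^sub>M j\<in>{1..m}. \<mu>)"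
    unfolding Z_def .
qed

theorem theorem2p1:
  fixes M :: "'a measure" and S :: "'s measure"
    and X :: "int \<Rightarrow> 'a \<Rightarrow> 's" and Xs :: "nat \<Rightarrow> 'a \<Rightarrow> 's"
    and m :: nat and h :: "(nat \<Rightarrow> 's) \<Rightarrow> real" and h1 :: "'s \<Rightarrow> real"
  assumes prob: "prob_space M"
    and m: "m \<ge> 2"
    and h_meas: "h \<in> borel_measurable (\<Pi>\<^sub>M j\<in>{1..m}. S)"
    and h_sym: "symmetric_kernel S m h"
    and stat: "strictly_stationary M S X"
    and Xs_iid: "prob_space.indep_vars M (\<lambda>_. S) Xs {1..m-1}"
    and Xs_law: "\<And>j. j \<in> {1..m-1} \<Longrightarrow> distr M S (Xs j) = distr M S (X 0)"
    and Xs_indep: "prob_space.indep_set M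
          {(\<lambda>\<omega>. \<lambda>j\<in>{1..m-1}. Xs j \<omega>) -` A \<inter> space M |A. A \<in> sets (\<Pi>\<^sub>M j\<in>{1..m-1}. S)}
          {(\<lambda>\<omega> i. X i \<omega>) -` B \<inter> space M |B. B \<in> sets (\<Pi>\<^sub>M i\<in>(UNIV :: int set). S)}"
    and h1: "h1 = first_projection (distr M S (X 0)) m h"
    and alpha: "(\<Sum>k. \<integral>\<^sup>+u\<in>{0..alpha_coeff M (generated_algebra M S X {..0})
                                            (generated_algebra M S X {int (Suc k)})}.
                    (upper_quantile M (\<lambda>\<omega>. h1 (X 0 \<omega>)) u)\<^sup>2 \<partial>lborel) < \<infinity>"
    and UI: "uniformly_integrable M (SIGMA k:{1..m}. Inc k) (\<lambda>(k, i) \<omega>. (H_var m h X Xs k i \<omega>)\<^sup>2)"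
    and beta: "summable (\<lambda>k. real (Suc k) * beta_mixing M S X (Suc k))"
  shows "\<exists>\<sigma>\<ge>0.
     ((\<lambda>i::int. covariance M (\<lambda>\<omega>. h1 (X 0 \<omega>)) (\<lambda>\<omega>. h1 (X i \<omega>))) has_sum \<sigma>\<^sup>2) UNIV \<and>
     weak_conv_m
       (\<lambda>n. distr M borel (\<lambda>\<omega>. sqrt (real n) / real (n choose m) *
                (U_stat m n h X \<omega> - (\<integral>\<omega>'. U_stat m n h X \<omega>' \<partial>M))))
       (distr std_normal_distribution borel (\<lambda>x. real m * \<sigma> * x))"
proof -
  interpret prob_space M by fact
  interpret stationary_process M S X
    using stat unfolding strictly_stationary_def by unfold_locales auto
  define \<mu> where "\<mu> = distr M S (X 0)"
  define Y where "Y = (\<lambda>(k, i) \<omega>. (H_var m h X Xs k i \<omega>)\<^sup>2)"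
  have Y0: "0 \<le> Y p \<omega>" for p \<omega> by (simp add: Y_def split: prod.split)
  obtain B \<delta> where
    B: "\<And>p. p \<in> (SIGMA k:{1..m}. Inc k) \<Longrightarrow> integrable M (Y p) \<and> (\<integral>\<omega>. Y p \<omega> \<partial>M) \<le> B" and
    \<delta>: "\<And>p n. p \<in> (SIGMA k:{1..m}. Inc k) \<Longrightarrow> (\<integral>\<omega>. (if real n < Y p \<omega> then Y p \<omega> else 0) \<partial>M) \<le> \<delta> n" and
    \<delta>0: "\<delta> \<longlonglongrightarrow> 0"
    using uniformly_integrable_bounds[OF UI[folded Y_def] Y0] by blast
  have tuple: "Y (m, i) \<omega> = (h (\<lambda>l\<in>{1..m}. X (i l) \<omega>))\<^sup>2" for i \<omega>
  proof -
    have "(\<lambda>j\<in>{1..m}. if j \<le> m then X (i j) \<omega> else Xs (j - m) \<omega>) = (\<lambda>l\<in>{1..m}. X (i l) \<omega>)"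
      by (rule restrict_ext) simp
    then show ?thesis unfolding Y_def H_var_def by simp
  qed
  have tuple_index: "(m, i) \<in> (SIGMA k:{1..m}. Inc k)" if "i \<in> Inc m" for i using that m by simp
  define Z where "Z \<omega> = (\<lambda>j\<in>{1..m}. if j \<le> 1 then X 1 \<omega> else Xs (j - 1) \<omega>)" for \<omega>
  have Z: "Z \<in> measurable M (\<Pi>\<^sub>M j\<in>{1..m}. S)" and Z_law: "distr M (\<Pi>\<^sub>M j\<in>{1..m}. S) Z = (\<Pi>\<^sub>M j\<in>{1..m}. \<mu>)"
    unfolding Z_def \<mu>_def
    by (rule law_of_decoupled_vector[OF m X_meas law_eq Xs_iid Xs_law Xs_indep]; assumption)+
  \<comment> \<open>The one-element tuple with index 1 selects a member of the family with
    \<open>k = 1\<close>, in which the other \<open>m - 1\<close> arguments are the independent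
    variables \<open>Xs\<close>.\<close>
  define i1 :: "nat \<Rightarrow> int" where "i1 = (\<lambda>j\<in>{1..1}. 1)"
  have "i1 \<in> Inc_upto 1 1" unfolding Inc_upto_def i1_def by (auto simp: strict_mono_on_def)
  then have "i1 \<in> Inc 1" unfolding Inc_def by auto
  then have first_index: "(1, i1) \<in> (SIGMA k:{1..m}. Inc k)" using m by simp
  have first: "Y (1, i1) \<omega> = (h (Z \<omega>))\<^sup>2" for \<omega>
  proof -
    have "(\<lambda>j\<in>{1..m}. if j \<le> 1 then X (i1 j) \<omega> else Xs (j - 1) \<omega>) = Z \<omega>"
      unfolding Z_def i1_def by (rule restrict_ext) auto
    then show ?thesis unfolding Y_def H_var_def by simp
  qed
  have law_integral: "(\<integral>x. g x \<partial>(\<Pi>\<^sub>M j\<in>{1..m}. \<mu>)) = (\<integral>\<omega>. g (Z \<omega>) \<partial>M)" if "g \<in> borel_measurable (\<Pi>\<^sub>M j\<in>{1..m}. S)" for g :: "_ \<Rightarrow> real"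
    unfolding Z_law[symmetric] using Z that by (rule integral_distr)
  note [measurable] = h_meas
  \<comment> \<open>\<open>B\<close> and \<open>\<delta>\<close> bound means and tails of the
    squares, through the members with \<open>k = m\<close> for tuples of the process and through the
    one with \<open>k = 1\<close> for the product law.\<close>
  interpret U: ustat_kernel M S X \<mu> m h \<delta> B
  proof unfold_locales
    show "distr M S (X i) = \<mu>" for i unfolding \<mu>_def by (rule law_eq)
    show "integrable (\<Pi>\<^sub>M j\<in>{1..m}. \<mu>) (\<lambda>x. (h x)\<^sup>2)"
      unfolding Z_law[symmetric] using B[OF first_index] Z by (subst integrable_distr_eq) (auto simp: first[abs_def])
    show "integrable M (\<lambda>\<omega>. (h (\<lambda>l\<in>{1..m}. X (i l) \<omega>))\<^sup>2)" if "i \<in> Inc m" for i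
      using B[OF tuple_index[OF that]] by (simp add: tuple[abs_def])
    show "(\<integral>\<omega>. (h (\<lambda>l\<in>{1..m}. X (i l) \<omega>))\<^sup>2 \<partial>M) \<le> B" if "i \<in> Inc m" for i
      using B[OF tuple_index[OF that]] by (simp add: tuple[abs_def])
    show "(\<integral>x. (h x)\<^sup>2 \<partial>(\<Pi>\<^sub>M j\<in>{1..m}. \<mu>)) \<le> B"
      using B[OF first_index] by (subst law_integral) (auto simp: first[abs_def])
    show "(\<integral>\<omega>. (if real n < (h (\<lambda>l\<in>{1..m}. X (i l) \<omega>))\<^sup>2 then (h (\<lambda>l\<in>{1..m}. X (i l) \<omega>))\<^sup>2 else 0) \<partial>M) \<le> \<delta> n" if "i \<in> Inc m" for i n
      using \<delta>[OF tuple_index[OF that], of n] unfolding tuple .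
    show "(\<integral>x. (if real n < (h x)\<^sup>2 then (h x)\<^sup>2 else 0) \<partial>(\<Pi>\<^sub>M j\<in>{1..m}. \<mu>)) \<le> \<delta> n" for n
      using \<delta>[OF first_index, of n] unfolding first by (subst law_integral) auto
  qed (use m h_meas h_sym \<delta>0 beta in auto)
  have h1_eq: "h1 = U.h1" unfolding h1 U.h1_def by (simp add: \<mu>_def)
  have h1_meas [measurable]: "h1 \<in> borel_measurable S" unfolding h1_eq by (rule U.h1_measurable)
  have h1_sq: "integrable M (\<lambda>\<omega>. (h1 (X 0 \<omega>))\<^sup>2)"
    using U.integrable_law_X[OF U.h1_square, of 0] unfolding h1_eq .
  have \<theta>: "U.\<theta> = mean h1"
    using U.integral_law_X[OF U.h1_measurable, of 0] U.h1_mean unfolding mean_def h1_eq by simp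
  have Q: "(\<Sum>k. quantile_integral h1 (Suc k)) < \<infinity>"
    using alpha unfolding quantile_integral_def[OF h1_meas h1_sq] past_alpha_def .
  have le: "\<bar>h1 x\<bar> \<le> \<bar>h1 x\<bar>" for x ..
  note cov_le = cov_le_bound[OF h1_meas h1_sq Q h1_meas le] and summ = cov_bound_summable[OF h1_meas h1_sq Q]
  have abs_summ: "summable (\<lambda>k. \<bar>cov h1 k\<bar>)"
    by (rule summable_comparison_test'[OF summ, of 0]) (use cov_le in simp)
  define \<sigma> where "\<sigma> = sqrt (long_run_var h1)"
  have lrv0: "0 \<le> long_run_var h1" by (rule long_run_var_nonneg[OF h1_meas h1_sq cov_le summ])
  then have \<sigma>: "\<sigma> \<ge> 0" "\<sigma>\<^sup>2 = long_run_var h1" by (simp_all add: \<sigma>_def)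
  obtain C where C: "\<And>k. k \<ge> 1 \<Longrightarrow> beta_mixing M S X k \<le> C / (real k)\<^sup>2"
    using beta_mixing_le_inverse_square[OF beta] by auto
  interpret N: real_distribution std_normal_distribution by (rule real_dist_normal_dist)
  have "weak_conv_m (\<lambda>n. distr M borel (U.V_stat n)) (distr std_normal_distribution borel (\<lambda>x. real m * \<sigma> * x))"
  proof (rule levy_continuity)
    show "real_distribution (distr M borel (U.V_stat n))" for n
      by (rule real_distribution_distr) (rule U.V_stat_measurable)
    show "real_distribution (distr std_normal_distribution borel (\<lambda>x. real m * \<sigma> * x))"
      by (rule N.real_distribution_distr) simp
    fix t
    \<comment> \<open>The factor \<open>m\<close> of the linear part is absorbed into the argument,
      which produces the variance \<open>m\<^sup>2 * \<sigma>\<^sup>2\<close>.\<close>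
    have "(\<lambda>n. phi h1 n (t * real m / sqrt (real n))) \<longlonglongrightarrow> exp (- ((t * real m)\<^sup>2 / 2 * long_run_var h1))"
      by (rule stationary_clt[OF h1_meas h1_sq Q C])
    moreover have "phi h1 n (t * real m / sqrt (real n)) = (\<integral>\<omega>. iexp (t * U.L_stat n \<omega>) \<partial>M)" for n
      unfolding phi_def U.L_stat_def centered_def h1_eq[symmetric] \<theta>
      by (simp add: algebra_simps)
    moreover have "char (distr std_normal_distribution borel (\<lambda>x. real m * \<sigma> * x)) t = exp (- ((t * real m)\<^sup>2 / 2 * long_run_var h1))"
    proof -
      have "char (distr std_normal_distribution borel (\<lambda>x. real m * \<sigma> * x)) t = char std_normal_distribution (t * (real m * \<sigma>))"
        by (subst N.char_distr_eq) (simp_all add: char_def mult.assoc)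
      then show ?thesis
        by (simp add: char_std_normal_distribution power_mult_distrib \<sigma>(2)[symmetric] mult_ac)
    qed
    ultimately show "(\<lambda>n. char (distr M borel (U.V_stat n)) t) \<longlonglongrightarrow> char (distr std_normal_distribution borel (\<lambda>x. real m * \<sigma> * x)) t"
      using U.V_stat_char_tendsto[of t] by (simp add: char_distr_eq)
  qed
  moreover have "U.V_stat n = (\<lambda>\<omega>. sqrt (real n) / real (n choose m) * (U_stat m n h X \<omega> - (\<integral>\<omega>'. U_stat m n h X \<omega>' \<partial>M)))" for n
    by (rule ext) (rule U.V_stat_def)
  ultimately show ?thesis
    using \<sigma> covariance_has_sum[OF h1_meas h1_sq abs_summ] by (intro exI[of _ \<sigma>]) simp
qed

end
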